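(* Let $X$ be a $T$-variety satisfying the assumptions listed in the context, $\Gamma$ its moment graph with maximal vertex $x_0$, and $\mathcal{M}$ the canonical $\Gamma$-sheaf. Then $\mathcal{M}$ is (up to isomorphism) the unique indecomposable pure sheaf with $\mathcal{M}(x_0)=A$. Any pure $\mathcal{A}$-module on $\Gamma$ is a direct sum of sheaves obtained by applying the same construction to the subgraphs $\Gamma_{\le x}$ consisting of all vertices $y\le x$ and all edges joining them, or by applying shifts to these sheaves.
   Context: **The variety.** $T\cong(\mathbb{C}^* )^d$ is an algebraic torus and $X$ is an irreducible complex algebraic variety with an algebraic $T$-action such that: (1a) for every fixed point $x\in X^T$ there are a homomorphism $i\colon\mathbb{C}^*\to T$ and a Zariski open neighborhood $U$ of $x$ with $\lim_{\alpha\to 0}i(\alpha)y=x$ for all $y\in U$ (so $X^T$ is finite); (1b) $X$ has finitely many one-dimensional $T$-orbits; (2) $X$ has a $T$-invariant Whitney stratification by affine spaces. Each stratum contains exactly one fixed point; $C_x$ denotes the stratum containing $x\in X^T$. Every one-dimensional orbit $L$ has exactly two distinct limit points: the fixed point $x$ in the stratum $C_x$ containing $L$, and another fixed point lying in some stratum in the closure of $C_x$. **The moment graph.** $\mathfrak{t}$ is the Lie algebra of $T$. The graph $\Gamma$ has vertex set $\mathcal{V}=X^T$ and edge set $\mathcal{E}$ the set of one-dimensional orbits; $L\in\mathcal{E}$ joins its two limit points. The direction $V_L\subset\mathfrak{t}^*$ of $L$ is the one-dimensional annihilator of the Lie algebra of the common stabilizer in $T$ of the points of $L$. The vertices are partially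 ordered by $x\le y$ iff $C_x\subset\overline{C_y}$. $U_x$ is the set of edges joining $x$ to a vertex $y$ with $x\le y$; $D_x$ is the set of edges joining $x$ to a vertex $y$ with $y\le x$. There is a unique maximal vertex $x_0$. **$\Gamma$-sheaves.** $A=\mathrm{Sym}(\mathfrak{t}^* )$, graded with $\mathfrak{t}^*$ in degree 2, and $A_L=A/V_LA$. "Module" means finitely generated graded module. For an $A$-module $M$, $\overline{M}=M\otimes_A\mathbb{C}=M/\mathfrak{t}^*M$. A $\Gamma$-sheaf, also called an $\mathcal{A}$-module, is a triple $(\{M_x\},\{M_L\},\{\rho_{x,L}\})$ with $M_x$ an $A$-module for each $x\in\mathcal{V}$, $M_L$ an $A_L$-module for each $L\in\mathcal{E}$, and $\rho_{x,L}\colon M_x\to M_L$ a homomorphism of $A$-modules whenever $x$ lies on $L$; morphisms are families of graded homomorphisms commuting with the $\rho_{x,L}$. For a subset $Z$ of $\mathcal{V}\cup\mathcal{E}$, $\mathcal{M}(Z)$ is the module of tuples $(s_a)_{a\in Z}\in\bigoplus_{a\in Z}M_a$ with $\rho_{x,L}(s_x)=s_L$ whenever $x,L\in Z$ and $x$ lies on $L$; restriction maps forget components. Write $\mathcal{M}(x)=M_x$, $\mathcal{M}(L)=M_L$. A shift means a shift of the grading of all modules. **Canonical sheaf $\mathcal{M}$.** A projective cover of an $A$-module $M$ is a free $A$-module $P$ with a surjection $P\to M$ inducing an isomorphism $\overline{P}\to\overline{M}$. Put $M_{x_0}=A$. Inductively, suppose $\mathcal{M}$ is known on the full subgraph $\Gamma_{>x}$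 of vertices $y>x$ and all edges joining them. For $L\in U_x$ with upper vertex $y$, put $M_L=M_y/V_LM_y$ with $\rho_{y,L}$ the quotient map. Let $\widetilde{\Gamma}_{>x}=\Gamma_{>x}\cup U_x$ and let $M_{\partial x}$ be the image of the restriction $\phi\colon\mathcal{M}(\widetilde{\Gamma}_{>x})\to\mathcal{M}(U_x)=\bigoplus_{L\in U_x}M_L$. Let $M_x$ be a projective cover of $M_{\partial x}$; the components of $M_x\to M_{\partial x}\subset\bigoplus_{L\in U_x}M_L$ are the maps $\rho_{x,L}$. The same construction applied to $\Gamma_{\le x}$ (whose unique maximal vertex is $x$) gives a sheaf on $\Gamma_{\le x}$, regarded as a $\Gamma$-sheaf by placing $0$ on the vertices and edges outside $\Gamma_{\le x}$. **Pure sheaves.** For a vertex $x$, $x^\circ$ is the set consisting of $x$ and all edges adjacent to $x$. An $\mathcal{A}$-module $\mathcal{N}$ is pure if for all $x\in\mathcal{V}$: (1) $\mathcal{N}(x)$ is a free $A$-module; (2) $\mathcal{N}(L)=\mathcal{N}(x)/V_L\mathcal{N}(x)$ (via $\rho_{x,L}$) whenever $L\in D_x$; (3) the restrictions $\mathcal{N}(x^\circ)\to\mathcal{N}(U_x)$ and $\mathcal{N}(\widetilde{\Gamma}_{>x})\to\mathcal{N}(U_x)$ have the same image. *)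

theory Defs
  imports
    "HOL-Analysis.Analysis"
    "HOL-Algebra.Coset"
    "HOL-Algebra.Generated_Groups"
    "HOL-Algebra.Module"
    "HOL-Library.Poly_Mapping"
    "HOL-Library.Disjoint_Sets"
begin

section \<open>Polynomials and affine algebraic geometry over the complex numbers\<close>

text \<open>
  A monomial is a finitely supported exponent function. Affine n-space is realised inside
  \<^typ>\<open>nat \<Rightarrow> complex\<close> as the set of functions vanishing at all indices \<open>\<ge> n\<close>; the topology of
  \<^typ>\<open>nat \<Rightarrow> complex\<close> (the product topology) induces the usual one on it. Variables of index
  \<open>\<ge> n\<close> evaluate to 0 on affine n-space, so the variables of the polynomials below need not be bounded.
\<close>

type_synonym cpoly = "(nat \<Rightarrow>\<^sub>0 nat) \<Rightarrow>\<^sub>0 complex"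

definition peval :: "(nat \<Rightarrow> complex) \<Rightarrow> cpoly \<Rightarrow> complex" where
  "peval z p = (\<Sum>m\<in>Poly_Mapping.keys p. Poly_Mapping.lookup p m *
      (\<Prod>i\<in>Poly_Mapping.keys m. z i ^ Poly_Mapping.lookup m i))"

definition cspace :: "nat \<Rightarrow> (nat \<Rightarrow> complex) set" where
  "cspace n = {z. \<forall>i\<ge>n. z i = 0}"

definition algebraic_set :: "nat \<Rightarrow> (nat \<Rightarrow> complex) set \<Rightarrow> bool" where
  "algebraic_set n Z \<longleftrightarrow> (\<exists>P. Z = {z \<in> cspace n. \<forall>p\<in>P. peval z p = 0})"

text \<open>
  Regular functions are locally quotients of polynomials. The neighbourhood on which \<open>f = p/q\<close>
  can always be taken to be the principal open set where \<open>q\<close> does not vanish (enlarge \<open>p\<close> and \<open>q\<close> by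
  a common factor).
\<close>

definition regular_fun :: "(nat \<Rightarrow> complex) set \<Rightarrow> ((nat \<Rightarrow> complex) \<Rightarrow> complex) \<Rightarrow> bool" where
  "regular_fun W f \<longleftrightarrow> (\<forall>w\<in>W. \<exists>p q. peval w q \<noteq> 0 \<and>
      (\<forall>z\<in>W. peval z q \<noteq> 0 \<longrightarrow> f z = peval z p / peval z q))"

definition regular_map :: "(nat \<Rightarrow> complex) set \<Rightarrow> ((nat \<Rightarrow> complex) \<Rightarrow> (nat \<Rightarrow> complex)) \<Rightarrow> bool" where
  "regular_map W F \<longleftrightarrow> (\<forall>i. regular_fun W (\<lambda>z. F z i))"

definition first_coords :: "nat \<Rightarrow> (nat \<Rightarrow> complex) \<Rightarrow> (nat \<Rightarrow> complex)" where
  "first_coords d z = (\<lambda>i. if i < d then z i else 0)"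

definition drop_coords :: "nat \<Rightarrow> (nat \<Rightarrow> complex) \<Rightarrow> (nat \<Rightarrow> complex)" where
  "drop_coords d z = (\<lambda>i. z (i + d))"

definition join_coords :: "nat \<Rightarrow> (nat \<Rightarrow> complex) \<Rightarrow> (nat \<Rightarrow> complex) \<Rightarrow> (nat \<Rightarrow> complex)" where
  "join_coords n z w = (\<lambda>i. if i < n then z i else w (i - n))"


section \<open>Algebraic varieties\<close>

text \<open>
  Varieties are given by a finite atlas of affine charts: a chart identifies its domain with a
  Zariski closed subset of affine space, and the transition maps are biregular between Zariski
  open subsets. The torus rank, the action and the stratification are recorded in the same structure.
\<close>

record 'x chart =
  cdom :: "'x set"
  cdim :: nat
  cmap :: "'x \<Rightarrow> (nat \<Rightarrow> complex)"

record 'x tvariety =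
  pts :: "'x set"
  charts :: "'x chart set"
  trank :: nat
  tact :: "(nat \<Rightarrow> complex) \<Rightarrow> 'x \<Rightarrow> 'x"
  strata :: "'x set set"

abbreviation cimg :: "'x chart \<Rightarrow> (nat \<Rightarrow> complex) set" where
  "cimg c \<equiv> cmap c ` cdom c"

abbreviation cinv :: "'x chart \<Rightarrow> (nat \<Rightarrow> complex) \<Rightarrow> 'x" where
  "cinv c \<equiv> inv_into (cdom c) (cmap c)"

definition zariski :: "'x tvariety \<Rightarrow> 'x topology" where
  "zariski X = topology_generated_by
     {{x \<in> cdom c. peval (cmap c x) p \<noteq> 0} | c p. c \<in> charts X}"

definition classical :: "'x tvariety \<Rightarrow> 'x topology" where
  "classical X = topology_generated_by
     {{x \<in> cdom c. cmap c x \<in> V} | c V. c \<in> charts X \<and> open V}"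

text \<open>The third condition is separatedness: the diagonal is closed in each product of two charts.\<close>

definition algebraic_variety :: "'x tvariety \<Rightarrow> bool" where
  "algebraic_variety X \<longleftrightarrow>
     finite (charts X) \<and> pts X = (\<Union>c\<in>charts X. cdom c) \<and>
     (\<forall>c\<in>charts X. inj_on (cmap c) (cdom c) \<and> algebraic_set (cdim c) (cimg c)) \<and>
     (\<forall>c\<in>charts X. \<forall>c'\<in>charts X.
        (\<exists>Z. algebraic_set (cdim c) Z \<and> cmap c ` (cdom c \<inter> cdom c') = cimg c - Z) \<and>
        regular_map (cmap c ` (cdom c \<inter> cdom c')) (\<lambda>z. cmap c' (cinv c z))) \<and>
     (\<forall>c\<in>charts X. \<forall>c'\<in>charts X.
        algebraic_set (cdim c + cdim c')
          ((\<lambda>x. join_coords (cdim c) (cmap c x) (cmap c' x)) ` (cdom c \<inter> cdom c')))"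

definition irreducible_in :: "'x topology \<Rightarrow> 'x set \<Rightarrow> bool" where
  "irreducible_in S Z \<longleftrightarrow> Z \<noteq> {} \<and> Z \<subseteq> topspace S \<and>
     (\<forall>F G. closedin S F \<and> closedin S G \<and> Z \<subseteq> F \<union> G \<longrightarrow> Z \<subseteq> F \<or> Z \<subseteq> G)"

definition irreducible_chain :: "'x topology \<Rightarrow> nat \<Rightarrow> (nat \<Rightarrow> 'x set) \<Rightarrow> bool" where
  "irreducible_chain S n Z \<longleftrightarrow> (\<forall>i\<le>n. closedin S (Z i) \<and> irreducible_in S (Z i)) \<and>
     (\<forall>i<n. Z i \<subset> Z (Suc i))"

definition has_krull_dim :: "'x topology \<Rightarrow> nat \<Rightarrow> bool" where
  "has_krull_dim S n \<longleftrightarrow> (\<exists>Z. irreducible_chain S n Z) \<and> \<not> (\<exists>Z. irreducible_chain S (Suc n) Z)"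

text \<open>Morphisms from a locally closed subset \<open>W\<close> of an affine space to a variety.\<close>

definition regular_to_variety ::
  "(nat \<Rightarrow> complex) set \<Rightarrow> 'x tvariety \<Rightarrow> ((nat \<Rightarrow> complex) \<Rightarrow> 'x) \<Rightarrow> bool" where
  "regular_to_variety W X a \<longleftrightarrow> (\<forall>w\<in>W. \<exists>c\<in>charts X. \<exists>q. peval w q \<noteq> 0 \<and>
      a ` {z \<in> W. peval z q \<noteq> 0} \<subseteq> cdom c \<and>
      regular_map {z \<in> W. peval z q \<noteq> 0} (\<lambda>z. cmap c (a z)))"

definition affine_space_stratum :: "'x tvariety \<Rightarrow> 'x set \<Rightarrow> bool" where
  "affine_space_stratum X S \<longleftrightarrow>
     (\<exists>U F. openin (zariski X) U \<and> closedin (zariski X) F \<and> S = U \<inter> F) \<and>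
     (\<exists>m \<psi>. bij_betw \<psi> (cspace m) S \<and> regular_to_variety (cspace m) X \<psi> \<and>
        (\<forall>c\<in>charts X. regular_map (cmap c ` (S \<inter> cdom c))
           (\<lambda>z. inv_into (cspace m) \<psi> (cinv c z))))"


section \<open>Torus actions\<close>

definition torus :: "nat \<Rightarrow> (nat \<Rightarrow> complex) set" where
  "torus d = {t \<in> cspace d. \<forall>i<d. t i \<noteq> 0}"

definition torus_one :: "nat \<Rightarrow> (nat \<Rightarrow> complex)" where
  "torus_one d = (\<lambda>i. if i < d then 1 else 0)"

definition torus_mult :: "(nat \<Rightarrow> complex) \<Rightarrow> (nat \<Rightarrow> complex) \<Rightarrow> (nat \<Rightarrow> complex)" where
  "torus_mult s t = (\<lambda>i. s i * t i)"

definition algebraic_action :: "'x tvariety \<Rightarrow> bool" where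
  "algebraic_action X \<longleftrightarrow>
     (\<forall>t\<in>torus (trank X). \<forall>x\<in>pts X. tact X t x \<in> pts X) \<and>
     (\<forall>x\<in>pts X. tact X (torus_one (trank X)) x = x) \<and>
     (\<forall>s\<in>torus (trank X). \<forall>t\<in>torus (trank X). \<forall>x\<in>pts X.
        tact X (torus_mult s t) x = tact X s (tact X t x)) \<and>
     (\<forall>c\<in>charts X. regular_to_variety
        {z. first_coords (trank X) z \<in> torus (trank X) \<and> drop_coords (trank X) z \<in> cimg c} X
        (\<lambda>z. tact X (first_coords (trank X) z) (cinv c (drop_coords (trank X) z))))"

definition fixed_points :: "'x tvariety \<Rightarrow> 'x set" where
  "fixed_points X = {x \<in> pts X. \<forall>t\<in>torus (trank X). tact X t x = x}"

definition torus_orbit :: "'x tvariety \<Rightarrow> 'x \<Rightarrow> 'x set" where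
  "torus_orbit X x = (\<lambda>t. tact X t x) ` torus (trank X)"

definition one_dim_orbits :: "'x tvariety \<Rightarrow> 'x set set" where
  "one_dim_orbits X =
     {L. (\<exists>x\<in>pts X. L = torus_orbit X x) \<and> has_krull_dim (subtopology (zariski X) L) 1}"

definition limit_points :: "'x tvariety \<Rightarrow> 'x set \<Rightarrow> 'x set" where
  "limit_points X L = zariski X closure_of L - L"

text \<open>Algebraic homomorphisms from the multiplicative group (the torus of rank 1) to the torus of rank d.\<close>

definition cocharacter :: "nat \<Rightarrow> (complex \<Rightarrow> (nat \<Rightarrow> complex)) \<Rightarrow> bool" where
  "cocharacter d i \<longleftrightarrow> (\<forall>\<alpha>. \<alpha> \<noteq> 0 \<longrightarrow> i \<alpha> \<in> torus d) \<and>
     (\<forall>\<alpha> \<beta>. \<alpha> \<noteq> 0 \<and> \<beta> \<noteq> 0 \<longrightarrow> i (\<alpha> * \<beta>) = torus_mult (i \<alpha>) (i \<beta>)) \<and>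
     regular_map (torus 1) (\<lambda>z. i (z 0))"

definition orbit_stabilizer :: "'x tvariety \<Rightarrow> 'x set \<Rightarrow> (nat \<Rightarrow> complex) set" where
  "orbit_stabilizer X L = {t \<in> torus (trank X). \<forall>y\<in>L. tact X t y = y}"

text \<open>
  The Lie algebra of the torus of rank d is \<^term>\<open>cspace d\<close>, with coordinatewise exponential map.
  A closed subgroup has as Lie algebra the set of generators of its one-parameter subgroups.
\<close>

definition torus_exp :: "nat \<Rightarrow> (nat \<Rightarrow> complex) \<Rightarrow> (nat \<Rightarrow> complex)" where
  "torus_exp d \<xi> = (\<lambda>i. if i < d then exp (\<xi> i) else 0)"

definition lie_algebra :: "nat \<Rightarrow> (nat \<Rightarrow> complex) set \<Rightarrow> (nat \<Rightarrow> complex) set" where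
  "lie_algebra d H =
     {\<xi> \<in> cspace d. \<forall>s::real. torus_exp d (\<lambda>i. complex_of_real s * \<xi> i) \<in> H}"


section \<open>Whitney stratifications\<close>

text \<open>Velocities of curves in \<open>W\<close>; for a smooth submanifold this is its tangent space.\<close>

definition tangent_space :: "(nat \<Rightarrow> complex) set \<Rightarrow> (nat \<Rightarrow> complex) \<Rightarrow> (nat \<Rightarrow> complex) set" where
  "tangent_space W z = {v. \<exists>\<gamma> :: real \<Rightarrow> nat \<Rightarrow> complex. \<gamma> 0 = z \<and>
      eventually (\<lambda>t. \<gamma> t \<in> W) (nhds 0) \<and>
      (\<forall>i. ((\<lambda>t. \<gamma> t i) has_vector_derivative v i) (at 0))}"

text \<open>
  Convergence of a sequence of subsets in the sense of Kuratowski. For linear subspaces of constant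
  dimension in a finite-dimensional space this is convergence in the Grassmannian.
\<close>

definition subspaces_tend_to ::
  "(nat \<Rightarrow> (nat \<Rightarrow> complex) set) \<Rightarrow> (nat \<Rightarrow> complex) set \<Rightarrow> bool" where
  "subspaces_tend_to Ts \<tau> \<longleftrightarrow>
     (\<forall>v\<in>\<tau>. \<exists>u. (\<forall>k. u k \<in> Ts k) \<and> u \<longlonglongrightarrow> v) \<and>
     (\<forall>v u r. strict_mono (r :: nat \<Rightarrow> nat) \<and> (\<forall>k. u k \<in> Ts (r k)) \<and> u \<longlonglongrightarrow> v \<longrightarrow> v \<in> \<tau>)"

text \<open>Whitney's conditions (a) and (b) for a pair of submanifolds of complex n-space.\<close>

definition whitney_a :: "(nat \<Rightarrow> complex) set \<Rightarrow> (nat \<Rightarrow> complex) set \<Rightarrow> bool" where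
  "whitney_a W W' \<longleftrightarrow> (\<forall>xs y \<tau>. (\<forall>k. xs k \<in> W) \<and> y \<in> W' \<and> xs \<longlonglongrightarrow> y \<and>
      subspaces_tend_to (\<lambda>k. tangent_space W (xs k)) \<tau> \<longrightarrow> tangent_space W' y \<subseteq> \<tau>)"

definition whitney_b :: "nat \<Rightarrow> (nat \<Rightarrow> complex) set \<Rightarrow> (nat \<Rightarrow> complex) set \<Rightarrow> bool" where
  "whitney_b n W W' \<longleftrightarrow> (\<forall>xs ys y \<tau> v.
      (\<forall>k. xs k \<in> W \<and> ys k \<in> W' \<and> xs k \<noteq> ys k) \<and> y \<in> W' \<and> xs \<longlonglongrightarrow> y \<and> ys \<longlonglongrightarrow> y \<and>
      subspaces_tend_to (\<lambda>k. tangent_space W (xs k)) \<tau> \<and>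
      (\<lambda>k i. (xs k i - ys k i) /
         complex_of_real (L2_set (\<lambda>j. cmod (xs k j - ys k j)) {..<n})) \<longlonglongrightarrow> v
      \<longrightarrow> v \<in> \<tau>)"

definition whitney_affine_stratification :: "'x tvariety \<Rightarrow> bool" where
  "whitney_affine_stratification X \<longleftrightarrow>
     finite (strata X) \<and> partition_on (pts X) (strata X) \<and>
     (\<forall>S\<in>strata X. affine_space_stratum X S) \<and>
     (\<forall>S\<in>strata X. \<forall>S'\<in>strata X. S \<inter> zariski X closure_of S' \<noteq> {} \<longrightarrow>
        S \<subseteq> zariski X closure_of S') \<and>
     (\<forall>S\<in>strata X. \<forall>S'\<in>strata X. \<forall>c\<in>charts X. S \<noteq> S' \<longrightarrow>
        whitney_a (cmap c ` (S \<inter> cdom c)) (cmap c ` (S' \<inter> cdom c)) \<and>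
        whitney_b (cdim c) (cmap c ` (S \<inter> cdom c)) (cmap c ` (S' \<inter> cdom c)))"


section \<open>The standing assumptions on the T-variety\<close>

text \<open>
  The torus is identified with \<^term>\<open>torus (trank X)\<close>. The last two clauses (each stratum contains
  exactly one fixed point; the two limit points of a one-dimensional orbit) follow
  from the preceding ones in the geometry of torus actions; they are part of the standing description
  of \<open>X\<close> and are needed for the moment graph to be well defined.
\<close>

definition moment_variety :: "'x tvariety \<Rightarrow> bool" where
  "moment_variety X \<longleftrightarrow>
     algebraic_variety X \<and> irreducible_in (zariski X) (pts X) \<and> algebraic_action X \<and>
     (\<forall>x\<in>fixed_points X. \<exists>i U. cocharacter (trank X) i \<and> openin (zariski X) U \<and> x \<in> U \<and>
        (\<forall>y\<in>U. limitin (classical X) (\<lambda>\<alpha>. tact X (i \<alpha>) y) x (at 0))) \<and>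
     finite (one_dim_orbits X) \<and>
     whitney_affine_stratification X \<and>
     (\<forall>S\<in>strata X. \<forall>t\<in>torus (trank X). tact X t ` S \<subseteq> S) \<and>
     (\<forall>S\<in>strata X. \<exists>!x. x \<in> S \<inter> fixed_points X) \<and>
     (\<forall>L\<in>one_dim_orbits X. \<exists>x\<in>fixed_points X. \<exists>y\<in>fixed_points X. \<exists>S\<in>strata X. \<exists>S'\<in>strata X.
        x \<noteq> y \<and> limit_points X L = {x, y} \<and> L \<subseteq> S \<and> x \<in> S \<and>
        y \<in> S' \<and> S' \<subseteq> zariski X closure_of S)"

definition stratum_of :: "'x tvariety \<Rightarrow> 'x \<Rightarrow> 'x set" where
  "stratum_of X x = (THE S. S \<in> strata X \<and> x \<in> S)"


section \<open>Graded modules over the symmetric algebra\<close>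

record ('a, 'b) gmodule = "('a, 'b) module" +
  hcomp :: "int \<Rightarrow> 'b set"

text \<open>
  The coordinate functions identify the symmetric algebra of the dual of the Lie algebra with the
  polynomials in the variables of index \<open>< d\<close>. Linear forms have degree 2.
\<close>

definition sym_alg :: "nat \<Rightarrow> (cpoly, cpoly) gmodule" where
  "sym_alg d = \<lparr>
     carrier = {p. \<forall>m\<in>Poly_Mapping.keys p. Poly_Mapping.keys m \<subseteq> {..<d}},
     monoid.mult = (*), one = 1, zero = 0, add = (+), smult = (*),
     hcomp = (\<lambda>n. {p. \<forall>m\<in>Poly_Mapping.keys p. Poly_Mapping.keys m \<subseteq> {..<d} \<and>
        2 * int (\<Sum>i\<in>Poly_Mapping.keys m. Poly_Mapping.lookup m i) = n})\<rparr>"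

text \<open>The dual of the Lie algebra, as the degree 2 part.\<close>

abbreviation tdual :: "nat \<Rightarrow> cpoly set" where
  "tdual d \<equiv> hcomp (sym_alg d) 2"

text \<open>
  In the last clause \<open>f\<close> is the family of homogeneous components of \<open>m\<close>.
\<close>

definition graded_module :: "nat \<Rightarrow> (cpoly, 'b) gmodule \<Rightarrow> bool" where
  "graded_module d M \<longleftrightarrow>
     Module.module (sym_alg d) M \<and>
     (\<exists>B. finite B \<and> B \<subseteq> carrier M \<and>
        (\<forall>m\<in>carrier M. \<exists>c\<in>B \<rightarrow> carrier (sym_alg d). m = (\<Oplus>\<^bsub>M\<^esub>b\<in>B. c b \<odot>\<^bsub>M\<^esub> b))) \<and>
     (\<forall>n. subgroup (hcomp M n) (add_monoid M)) \<and>
     (\<forall>i j. \<forall>a\<in>hcomp (sym_alg d) i. \<forall>m\<in>hcomp M j. a \<odot>\<^bsub>M\<^esub> m \<in> hcomp M (i + j)) \<and>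
     (\<forall>m\<in>carrier M. \<exists>!f. (\<forall>n. f n \<in> hcomp M n) \<and> finite {n. f n \<noteq> \<zero>\<^bsub>M\<^esub>} \<and>
        m = (\<Oplus>\<^bsub>M\<^esub>n\<in>{n. f n \<noteq> \<zero>\<^bsub>M\<^esub>}. f n))"

definition gmod_hom :: "nat \<Rightarrow> (cpoly, 'b) gmodule \<Rightarrow> (cpoly, 'c) gmodule \<Rightarrow> ('b \<Rightarrow> 'c) set" where
  "gmod_hom d M N = {f \<in> hom (add_monoid M) (add_monoid N).
     (\<forall>a\<in>carrier (sym_alg d). \<forall>m\<in>carrier M. f (a \<odot>\<^bsub>M\<^esub> m) = a \<odot>\<^bsub>N\<^esub> f m) \<and>
     (\<forall>n. f ` hcomp M n \<subseteq> hcomp N n)}"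

definition gmod_iso :: "nat \<Rightarrow> (cpoly, 'b) gmodule \<Rightarrow> (cpoly, 'c) gmodule \<Rightarrow> ('b \<Rightarrow> 'c) set" where
  "gmod_iso d M N = {f \<in> gmod_hom d M N. bij_betw f (carrier M) (carrier N)}"

definition free_gmodule :: "nat \<Rightarrow> (cpoly, 'b) gmodule \<Rightarrow> bool" where
  "free_gmodule d M \<longleftrightarrow> graded_module d M \<and>
     (\<exists>B. finite B \<and> B \<subseteq> carrier M \<and> (\<forall>b\<in>B. \<exists>n. b \<in> hcomp M n) \<and>
        (\<forall>m\<in>carrier M. \<exists>!c. c \<in> B \<rightarrow>\<^sub>E carrier (sym_alg d) \<and>
           m = (\<Oplus>\<^bsub>M\<^esub>b\<in>B. c b \<odot>\<^bsub>M\<^esub> b)))"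

definition zero_gmodule :: "(cpoly, 'b) gmodule \<Rightarrow> bool" where
  "zero_gmodule M \<longleftrightarrow> carrier M = {\<zero>\<^bsub>M\<^esub>}"

text \<open>The submodule \<open>W M\<close>; it is closed under scalars because \<open>a (w m) = w (a m)\<close>.\<close>

definition mod_span :: "cpoly set \<Rightarrow> (cpoly, 'b) gmodule \<Rightarrow> 'b set" where
  "mod_span W M = generate (add_monoid M) {w \<odot>\<^bsub>M\<^esub> m | w m. w \<in> W \<and> m \<in> carrier M}"

text \<open>\<open>f\<close> exhibits \<open>N\<close> as the graded module \<open>M / W M\<close>.\<close>

definition quotient_map ::
  "nat \<Rightarrow> cpoly set \<Rightarrow> (cpoly, 'b) gmodule \<Rightarrow> (cpoly, 'c) gmodule \<Rightarrow> ('b \<Rightarrow> 'c) \<Rightarrow> bool" where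
  "quotient_map d W M N f \<longleftrightarrow> f \<in> gmod_hom d M N \<and> f ` carrier M = carrier N \<and>
     {m \<in> carrier M. f m = \<zero>\<^bsub>N\<^esub>} = mod_span W M"

definition reduction :: "nat \<Rightarrow> (cpoly, 'b) gmodule \<Rightarrow> 'b set monoid" where
  "reduction d M = add_monoid M Mod mod_span (tdual d) M"

text \<open>The coset map below is \<open>[p] \<mapsto> [f p]\<close>.\<close>

definition projective_cover ::
  "nat \<Rightarrow> (cpoly, 'b) gmodule \<Rightarrow> (cpoly, 'c) gmodule \<Rightarrow> ('b \<Rightarrow> 'c) \<Rightarrow> bool" where
  "projective_cover d P M f \<longleftrightarrow> free_gmodule d P \<and>
     f \<in> gmod_hom d P M \<and> f ` carrier P = carrier M \<and>
     (\<lambda>C. mod_span (tdual d) M <#>\<^bsub>add_monoid M\<^esub> (f ` C)) \<in> iso (reduction d P) (reduction d M)"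

definition shift_gmodule :: "int \<Rightarrow> (cpoly, 'b) gmodule \<Rightarrow> (cpoly, 'b) gmodule" where
  "shift_gmodule k M = M\<lparr>hcomp := (\<lambda>n. hcomp M (n + k))\<rparr>"

text \<open>
  Direct sum over a finite index set. The fields for an internal multiplication,
  which the module record inherits from rings, play no role for modules.
\<close>

definition dsum_gmodule :: "'i set \<Rightarrow> ('i \<Rightarrow> (cpoly, 'b) gmodule) \<Rightarrow> (cpoly, 'i \<Rightarrow> 'b) gmodule" where
  "dsum_gmodule I M = \<lparr>
     carrier = (\<Pi>\<^sub>E i\<in>I. carrier (M i)),
     monoid.mult = undefined, one = undefined,
     zero = (\<lambda>i\<in>I. \<zero>\<^bsub>M i\<^esub>),
     add = (\<lambda>f g. \<lambda>i\<in>I. f i \<oplus>\<^bsub>M i\<^esub> g i),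
     smult = (\<lambda>a f. \<lambda>i\<in>I. a \<odot>\<^bsub>M i\<^esub> f i),
     hcomp = (\<lambda>n. \<Pi>\<^sub>E i\<in>I. hcomp (M i) n)\<rparr>"

definition sub_gmodule :: "'b set \<Rightarrow> (cpoly, 'b) gmodule \<Rightarrow> (cpoly, 'b) gmodule" where
  "sub_gmodule C M = M\<lparr>carrier := C, hcomp := (\<lambda>n. hcomp M n \<inter> C)\<rparr>"


section \<open>Moment graphs\<close>

record ('v, 'e) mgraph =
  grank :: nat
  verts :: "'v set"
  edges :: "'e set"
  ends :: "'e \<Rightarrow> 'v set"
  dir :: "'e \<Rightarrow> cpoly set"
  vle :: "'v \<Rightarrow> 'v \<Rightarrow> bool"

definition moment_graph :: "'x tvariety \<Rightarrow> ('x, 'x set) mgraph" where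
  "moment_graph X = \<lparr>
     grank = trank X,
     verts = fixed_points X,
     edges = one_dim_orbits X,
     ends = limit_points X,
     dir = (\<lambda>L. {v \<in> tdual (trank X).
        \<forall>\<xi>\<in>lie_algebra (trank X) (orbit_stabilizer X L). peval \<xi> v = 0}),
     vle = (\<lambda>x y. stratum_of X x \<subseteq> zariski X closure_of (stratum_of X y))\<rparr>"

definition maximal_vertex :: "('v, 'e) mgraph \<Rightarrow> 'v \<Rightarrow> bool" where
  "maximal_vertex \<Gamma> x \<longleftrightarrow> x \<in> verts \<Gamma> \<and> (\<forall>y\<in>verts \<Gamma>. vle \<Gamma> x y \<longrightarrow> y = x)"

definition up_edges :: "('v, 'e) mgraph \<Rightarrow> 'v \<Rightarrow> 'e set" where
  "up_edges \<Gamma> x = {L \<in> edges \<Gamma>. \<exists>y\<in>verts \<Gamma>. ends \<Gamma> L = {x, y} \<and> vle \<Gamma> x y}"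

definition down_edges :: "('v, 'e) mgraph \<Rightarrow> 'v \<Rightarrow> 'e set" where
  "down_edges \<Gamma> x = {L \<in> edges \<Gamma>. \<exists>y\<in>verts \<Gamma>. ends \<Gamma> L = {x, y} \<and> vle \<Gamma> y x}"

definition adjacent_edges :: "('v, 'e) mgraph \<Rightarrow> 'v \<Rightarrow> 'e set" where
  "adjacent_edges \<Gamma> x = {L \<in> edges \<Gamma>. x \<in> ends \<Gamma> L}"

definition verts_above :: "('v, 'e) mgraph \<Rightarrow> 'v \<Rightarrow> 'v set" where
  "verts_above \<Gamma> x = {y \<in> verts \<Gamma>. vle \<Gamma> x y \<and> y \<noteq> x}"

definition edges_above :: "('v, 'e) mgraph \<Rightarrow> 'v \<Rightarrow> 'e set" where
  "edges_above \<Gamma> x = {L \<in> edges \<Gamma>. ends \<Gamma> L \<subseteq> verts_above \<Gamma> x}"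

definition graph_below :: "('v, 'e) mgraph \<Rightarrow> 'v \<Rightarrow> ('v, 'e) mgraph" where
  "graph_below \<Gamma> x = \<Gamma>\<lparr>
     verts := {y \<in> verts \<Gamma>. vle \<Gamma> y x},
     edges := {L \<in> edges \<Gamma>. ends \<Gamma> L \<subseteq> {y \<in> verts \<Gamma>. vle \<Gamma> y x}}\<rparr>"


section \<open>Sheaves on moment graphs\<close>

record ('v, 'e, 'm, 'l) gsheaf =
  vmod :: "'v \<Rightarrow> (cpoly, 'm) gmodule"
  emod :: "'e \<Rightarrow> (cpoly, 'l) gmodule"
  res :: "'v \<Rightarrow> 'e \<Rightarrow> 'm \<Rightarrow> 'l"

text \<open>A module over \<open>A_L = A / V_L A\<close> is an A-module annihilated by \<open>V_L\<close>.\<close>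

definition graph_sheaf :: "('v, 'e) mgraph \<Rightarrow> ('v, 'e, 'm, 'l) gsheaf \<Rightarrow> bool" where
  "graph_sheaf \<Gamma> F \<longleftrightarrow>
     (\<forall>x\<in>verts \<Gamma>. graded_module (grank \<Gamma>) (vmod F x)) \<and>
     (\<forall>L\<in>edges \<Gamma>. graded_module (grank \<Gamma>) (emod F L) \<and>
        (\<forall>v\<in>dir \<Gamma> L. \<forall>m\<in>carrier (emod F L). v \<odot>\<^bsub>emod F L\<^esub> m = \<zero>\<^bsub>emod F L\<^esub>)) \<and>
     (\<forall>x\<in>verts \<Gamma>. \<forall>L\<in>edges \<Gamma>. x \<in> ends \<Gamma> L \<longrightarrow>
        res F x L \<in> gmod_hom (grank \<Gamma>) (vmod F x) (emod F L))"

text \<open>Sections over the set of vertices \<open>Zv\<close> and edges \<open>Ze\<close>, and their restrictions to edges.\<close>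

definition sheaf_sections ::
  "('v, 'e) mgraph \<Rightarrow> ('v, 'e, 'm, 'l) gsheaf \<Rightarrow> 'v set \<Rightarrow> 'e set \<Rightarrow> (('v \<Rightarrow> 'm) \<times> ('e \<Rightarrow> 'l)) set" where
  "sheaf_sections \<Gamma> F Zv Ze = {(s, u).
     s \<in> (\<Pi>\<^sub>E x\<in>Zv. carrier (vmod F x)) \<and> u \<in> (\<Pi>\<^sub>E L\<in>Ze. carrier (emod F L)) \<and>
     (\<forall>x\<in>Zv. \<forall>L\<in>Ze. x \<in> ends \<Gamma> L \<longrightarrow> res F x L (s x) = u L)}"

definition edge_restriction :: "'e set \<Rightarrow> (('v \<Rightarrow> 'm) \<times> ('e \<Rightarrow> 'l)) \<Rightarrow> ('e \<Rightarrow> 'l)" where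
  "edge_restriction E' = (\<lambda>(s, u). restrict u E')"

text \<open>The image of the sections over \<open>\<Gamma>\<^sub>>\<^sub>x \<union> U\<^sub>x\<close> in the direct sum of the edge modules over \<open>U\<^sub>x\<close>.\<close>

definition boundary_image :: "('v, 'e) mgraph \<Rightarrow> ('v, 'e, 'm, 'l) gsheaf \<Rightarrow> 'v \<Rightarrow> ('e \<Rightarrow> 'l) set" where
  "boundary_image \<Gamma> F x = edge_restriction (up_edges \<Gamma> x) `
     sheaf_sections \<Gamma> F (verts_above \<Gamma> x) (edges_above \<Gamma> x \<union> up_edges \<Gamma> x)"

definition boundary_module ::
  "('v, 'e) mgraph \<Rightarrow> ('v, 'e, 'm, 'l) gsheaf \<Rightarrow> 'v \<Rightarrow> (cpoly, 'e \<Rightarrow> 'l) gmodule" where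
  "boundary_module \<Gamma> F x =
     sub_gmodule (boundary_image \<Gamma> F x) (dsum_gmodule (up_edges \<Gamma> x) (emod F))"

definition gsheaf_iso ::
  "('v, 'e) mgraph \<Rightarrow> ('v, 'e, 'm, 'l) gsheaf \<Rightarrow> ('v, 'e, 'm2, 'l2) gsheaf \<Rightarrow> bool" where
  "gsheaf_iso \<Gamma> F G \<longleftrightarrow> (\<exists>f g.
     (\<forall>x\<in>verts \<Gamma>. f x \<in> gmod_iso (grank \<Gamma>) (vmod F x) (vmod G x)) \<and>
     (\<forall>L\<in>edges \<Gamma>. g L \<in> gmod_iso (grank \<Gamma>) (emod F L) (emod G L)) \<and>
     (\<forall>x\<in>verts \<Gamma>. \<forall>L\<in>edges \<Gamma>. x \<in> ends \<Gamma> L \<longrightarrow>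
        (\<forall>m\<in>carrier (vmod F x). g L (res F x L m) = res G x L (f x m))))"

definition shift_gsheaf :: "int \<Rightarrow> ('v, 'e, 'm, 'l) gsheaf \<Rightarrow> ('v, 'e, 'm, 'l) gsheaf" where
  "shift_gsheaf k F = \<lparr>
     vmod = (\<lambda>x. shift_gmodule k (vmod F x)),
     emod = (\<lambda>L. shift_gmodule k (emod F L)),
     res = res F\<rparr>"

definition dsum_gsheaf ::
  "'i set \<Rightarrow> ('i \<Rightarrow> ('v, 'e, 'm, 'l) gsheaf) \<Rightarrow> ('v, 'e, 'i \<Rightarrow> 'm, 'i \<Rightarrow> 'l) gsheaf" where
  "dsum_gsheaf I F = \<lparr>
     vmod = (\<lambda>x. dsum_gmodule I (\<lambda>i. vmod (F i) x)),
     emod = (\<lambda>L. dsum_gmodule I (\<lambda>i. emod (F i) L)),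
     res = (\<lambda>x L m. \<lambda>i\<in>I. res (F i) x L (m i))\<rparr>"

definition zero_gsheaf :: "('v, 'e) mgraph \<Rightarrow> ('v, 'e, 'm, 'l) gsheaf \<Rightarrow> bool" where
  "zero_gsheaf \<Gamma> F \<longleftrightarrow> (\<forall>x\<in>verts \<Gamma>. zero_gmodule (vmod F x)) \<and>
     (\<forall>L\<in>edges \<Gamma>. zero_gmodule (emod F L))"

text \<open>
  Restricting the summands to the carrier types of \<open>F\<close> is harmless, since a direct summand
  of \<open>F\<close> is isomorphic to a subsheaf.
\<close>

definition indecomposable :: "('v, 'e) mgraph \<Rightarrow> ('v, 'e, 'm, 'l) gsheaf \<Rightarrow> bool" where
  "indecomposable \<Gamma> F \<longleftrightarrow> \<not> zero_gsheaf \<Gamma> F \<and>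
     (\<forall>G H :: ('v, 'e, 'm, 'l) gsheaf. graph_sheaf \<Gamma> G \<and> graph_sheaf \<Gamma> H \<and>
        gsheaf_iso \<Gamma> F (dsum_gsheaf UNIV (\<lambda>b. if b then G else H)) \<longrightarrow>
        zero_gsheaf \<Gamma> G \<or> zero_gsheaf \<Gamma> H)"

definition pure_sheaf :: "('v, 'e) mgraph \<Rightarrow> ('v, 'e, 'm, 'l) gsheaf \<Rightarrow> bool" where
  "pure_sheaf \<Gamma> F \<longleftrightarrow> graph_sheaf \<Gamma> F \<and>
     (\<forall>x\<in>verts \<Gamma>.
        free_gmodule (grank \<Gamma>) (vmod F x) \<and>
        (\<forall>L\<in>down_edges \<Gamma> x.
           quotient_map (grank \<Gamma>) (dir \<Gamma> L) (vmod F x) (emod F L) (res F x L)) \<and>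
        edge_restriction (up_edges \<Gamma> x) ` sheaf_sections \<Gamma> F {x} (adjacent_edges \<Gamma> x) =
          boundary_image \<Gamma> F x)"

text \<open>
  The canonical construction on a graph with top vertex \<open>x0\<close>, as a predicate. The modules
  at the lower vertices are determined by those strictly above, since \<^const>\<open>boundary_module\<close> at \<open>x\<close>
  only involves the part of the sheaf above \<open>x\<close>; the choices (of a copy of \<open>A\<close>, of quotients
  and of projective covers) are left open. For \<open>L\<close> in \<open>U\<^sub>x\<close> with upper
  vertex \<open>y\<close> one has \<open>L\<close> in \<open>D\<^sub>y\<close>, and every edge arises in this way.
\<close>

definition canonical_sheaf :: "('v, 'e) mgraph \<Rightarrow> 'v \<Rightarrow> ('v, 'e, 'm, 'l) gsheaf \<Rightarrow> bool" where
  "canonical_sheaf \<Gamma> x0 F \<longleftrightarrow> graph_sheaf \<Gamma> F \<and>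
     gmod_iso (grank \<Gamma>) (vmod F x0) (sym_alg (grank \<Gamma>)) \<noteq> {} \<and>
     (\<forall>y\<in>verts \<Gamma>. \<forall>L\<in>down_edges \<Gamma> y.
        quotient_map (grank \<Gamma>) (dir \<Gamma> L) (vmod F y) (emod F L) (res F y L)) \<and>
     (\<forall>x\<in>verts \<Gamma> - {x0}.
        projective_cover (grank \<Gamma>) (vmod F x) (boundary_module \<Gamma> F x)
          (\<lambda>m. \<lambda>L\<in>up_edges \<Gamma> x. res F x L m))"

text \<open>The canonical sheaf of \<open>\<Gamma>\<^sub>\<le>\<^sub>x\<close>, extended by zero.\<close>

definition canonical_below :: "('v, 'e) mgraph \<Rightarrow> 'v \<Rightarrow> ('v, 'e, 'm, 'l) gsheaf \<Rightarrow> bool" where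
  "canonical_below \<Gamma> x F \<longleftrightarrow> graph_sheaf \<Gamma> F \<and> canonical_sheaf (graph_below \<Gamma> x) x F \<and>
     (\<forall>y\<in>verts \<Gamma> - verts (graph_below \<Gamma> x). zero_gmodule (vmod F y)) \<and>
     (\<forall>L\<in>edges \<Gamma> - edges (graph_below \<Gamma> x). zero_gmodule (emod F L))"

end

theory Submission
  imports Defs
begin

text \<open>
  The only input from geometry is that the vertices form a finite poset with a top element: strata are
  locally closed, so mutual inclusion in closures forces equality, and irreducibility makes one stratum
  dense. The rest is algebra of finitely generated graded modules over a polynomial ring, where Nakayama's
  lemma gives minimal covers, unique up to isomorphism.

  A pure sheaf \<open>N\<close> is decomposed by extending, one vertex \<open>x\<close> at a time and from the top downwards, an
  isomorphism of \<open>N\<close> with a sum \<open>S\<close> of shifted canonical sheaves. It identifies the boundary modules of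
  \<open>N\<close> and \<open>S\<close> at \<open>x\<close>; as \<open>S\<^sub>x\<close> is free and a minimal cover of its boundary module, it embeds in \<open>N\<^sub>x\<close>, and
  minimal generators of the kernel of \<open>N\<^sub>x\<close> over the boundary, modulo the maximal ideal, span a free complement; each
  contributes a shift of the canonical sheaf of \<open>\<Gamma>\<^sub>\<le>\<^sub>x\<close>. An indecomposable pure sheaf has only one summand, and its
  value at the top vertex determines the summand and the shift.
\<close>

section \<open>The graded polynomial ring\<close>

text \<open>Carrier types shape the development. All stalks of one sheaf share a type, and all its
  edge modules share another. The existence proof therefore realises every free stalk inside
  \<open>nat \<Rightarrow> cpoly\<close> and every edge module on cosets, and sheaves over different
  types are compared only up to isomorphism. All modules have to be finitely generated, and the
  boundary modules are submodules of sums of edge modules; this is where Noetherianity enters, and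
  it rests on Dickson's lemma. The polynomial ring is not local: Nakayama's lemma works because
  graded modules are bounded below and linear forms have positive degree. A sheaf constructed on
  \<Gamma>_{\<le>x} has to be pure on the whole of \<Gamma>, where the boundary at a vertex sees
  more edges; \<open>min_pure\<close> collects the properties that survive the extension by zero.
  Uniqueness is not obtained by building an isomorphism from the top downwards: it is read off from
  the decomposition, because an idempotent endomorphism of an indecomposable sheaf is
  trivial.\<close>

lemma incseq_subseq_nat:
  fixes g :: "nat \<Rightarrow> nat"
  shows "\<exists>s. strict_mono s \<and> incseq (\<lambda>n. g (s n))"
proof -
  obtain s where s: "strict_mono s" "monoseq (\<lambda>n. g (s n))"
    using seq_monosub by blast
  show ?thesis
  proof (cases "incseq (\<lambda>n. g (s n))")
    case False
    define h where "h n = g (s n)" for n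
    from False s(2) have dec: "decseq h"
      by (auto simp: monoseq_iff h_def[abs_def])
    \<comment> \<open>A decreasing sequence of naturals attains its minimum at some \<open>N\<close>
      and is constant from there on, so its tail is increasing as well.\<close>
    obtain N where N: "\<And>n. h N \<le> h n"
      using ex_has_least_nat[of "\<lambda>_. True" 0 h] by auto
    have "h (n + N) = h N" for n
      using N[of "n + N"] decseqD[OF dec, of N "n + N"] by simp
    hence "incseq (\<lambda>n. g (s (n + N)))"
      by (simp add: h_def incseq_def)
    moreover have "strict_mono (\<lambda>n. s (n + N))"
      using s(1) by (simp add: strict_mono_def)
    ultimately show ?thesis by (intro exI[of _ "\<lambda>n. s (n + N)"]) simp
  qed (use s in blast)
qed

text \<open>Coordinates are treated one after the other; passing to a further subsequence keeps the
  earlier coordinates increasing.\<close>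

lemma incseq_subseq_coords:
  fixes f :: "nat \<Rightarrow> nat \<Rightarrow> nat"
  shows "\<exists>r. strict_mono r \<and> (\<forall>v<d. incseq (\<lambda>n. f (r n) v))"
proof (induction d)
  case 0
  show ?case by (auto intro: exI[of _ id] simp: strict_mono_def)
next
  case (Suc d)
  then obtain r where r: "strict_mono r" "\<forall>v<d. incseq (\<lambda>n. f (r n) v)" by blast
  obtain s where s: "strict_mono s" "incseq (\<lambda>n. f (r (s n)) d)"
    using incseq_subseq_nat[of "\<lambda>n. f (r n) d"] by blast
  have "incseq (\<lambda>n. f (r (s n)) v)" if "v < Suc d" for v
  proof (cases "v = d")
    case False
    hence "incseq (\<lambda>n. f (r n) v)" using that r(2) by simp
    thus ?thesis using s(1) by (simp add: incseq_def strict_mono_less_eq)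
  qed (use s in simp)
  moreover have "strict_mono (\<lambda>n. r (s n))"
    using r(1) s(1) by (simp add: strict_mono_def)
  ultimately show ?case by blast
qed

text \<open>Dickson's lemma: on a subsequence along which all coordinates below \<open>d\<close>
  increase, any two terms are comparable under divisibility, since the remaining coordinates
  vanish.\<close>

lemma dickson:
  fixes f :: "nat \<Rightarrow> (nat \<Rightarrow>\<^sub>0 nat)"
  assumes "\<And>n. Poly_Mapping.keys (f n) \<subseteq> {..<d}"
  shows "\<exists>i j. i < j \<and> (\<forall>v. Poly_Mapping.lookup (f i) v \<le> Poly_Mapping.lookup (f j) v)"
proof -
  obtain r where r: "strict_mono r" "\<forall>v<d. incseq (\<lambda>n. Poly_Mapping.lookup (f (r n)) v)"
    using incseq_subseq_coords[of d "\<lambda>n. Poly_Mapping.lookup (f n)"] by blast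
  have "Poly_Mapping.lookup (f (r 0)) v \<le> Poly_Mapping.lookup (f (r 1)) v" for v
  proof (cases "v < d")
    case True
    thus ?thesis using r(2) by (simp add: incseq_def)
  next
    case False
    hence "v \<notin> Poly_Mapping.keys (f (r 0))" using assms by blast
    thus ?thesis by (simp add: in_keys_iff)
  qed
  moreover have "r 0 < r 1" using r(1) by (simp add: strict_mono_less)
  ultimately show ?thesis by blast
qed

text \<open>A descending chain would contain, by Dickson's lemma, an earlier monomial dividing a
  later one, against the order. The order is the lexicographic one of \<open>less_fun\<close>; with
  infinitely many variables the variables themselves would form a descending chain, hence the bound
  \<open>d\<close>.\<close>

lemma wf_monomials:
  "wf {(m, n :: nat \<Rightarrow>\<^sub>0 nat). m < n \<and> Poly_Mapping.keys m \<subseteq> {..<d} \<and> Poly_Mapping.keys n \<subseteq> {..<d}}"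
proof (unfold wf_iff_no_infinite_down_chain, rule notI)
  assume "\<exists>f. \<forall>i. (f (Suc i), f i) \<in> {(m, n :: nat \<Rightarrow>\<^sub>0 nat). m < n \<and>
     Poly_Mapping.keys m \<subseteq> {..<d} \<and> Poly_Mapping.keys n \<subseteq> {..<d}}"
  then obtain f where "\<forall>i. (f (Suc i), f i) \<in> {(m, n :: nat \<Rightarrow>\<^sub>0 nat). m < n \<and>
     Poly_Mapping.keys m \<subseteq> {..<d} \<and> Poly_Mapping.keys n \<subseteq> {..<d}}" ..
  hence f: "\<And>i. f (Suc i) < f i" "\<And>i. Poly_Mapping.keys (f i) \<subseteq> {..<d}"
    by simp_all
  obtain i j where ij: "i < j" "\<And>v. Poly_Mapping.lookup (f i) v \<le> Poly_Mapping.lookup (f j) v"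
    using dickson[of f, OF f(2)] by blast
  have "f j < f i"
    using ij(1) by (induction j) (auto elim!: less_SucE intro: f(1) order.strict_trans[OF f(1)])
  hence "less_fun (Poly_Mapping.lookup (f j)) (Poly_Mapping.lookup (f i))"
    by (simp add: less_poly_mapping.rep_eq)
  thus False using ij(2) by (meson less_fun_def leD)
qed

section \<open>Total degree and the ring structure of \<open>sym_alg\<close>\<close>

definition mdeg :: "(nat \<Rightarrow>\<^sub>0 nat) \<Rightarrow> nat" where
  "mdeg m = (\<Sum>i\<in>Poly_Mapping.keys m. Poly_Mapping.lookup m i)"

lemma mdeg_superset:
  assumes "finite S" "Poly_Mapping.keys m \<subseteq> S"
  shows "mdeg m = (\<Sum>i\<in>S. Poly_Mapping.lookup m i)"
  unfolding mdeg_def by (rule sum.mono_neutral_left) (use assms in \<open>auto simp: in_keys_iff\<close>)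

lemma mdeg_add: "mdeg (m + n) = mdeg m + mdeg n"
proof -
  let ?S = "Poly_Mapping.keys m \<union> Poly_Mapping.keys n"
  have "mdeg (m + n) = (\<Sum>i\<in>?S. Poly_Mapping.lookup (m + n) i)"
    by (rule mdeg_superset) (use keys_add[of m n] in auto)
  also have "\<dots> = mdeg m + mdeg n"
    by (simp add: lookup_add sum.distrib flip: mdeg_superset[of ?S])
  finally show ?thesis .
qed

lemma mdeg_eq_0_iff: "mdeg m = 0 \<longleftrightarrow> m = 0"
  by (auto simp: mdeg_def in_keys_iff poly_mapping_eq_iff fun_eq_iff)

lemma mdeg_single [simp]: "mdeg (Poly_Mapping.single i k) = k"
  by (cases "k = 0") (auto simp: mdeg_def)

lemma keys_add_nat: "Poly_Mapping.keys (m + n :: nat \<Rightarrow>\<^sub>0 nat) = Poly_Mapping.keys m \<union> Poly_Mapping.keys n"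
  by (auto simp: in_keys_iff lookup_add)

lemma sym_alg_simps [simp]:
  "x \<oplus>\<^bsub>sym_alg d\<^esub> y = x + y" "x \<otimes>\<^bsub>sym_alg d\<^esub> y = x * y" "\<zero>\<^bsub>sym_alg d\<^esub> = 0" "\<one>\<^bsub>sym_alg d\<^esub> = 1"
  "x \<odot>\<^bsub>sym_alg d\<^esub> y = x * y"
  by (simp_all add: sym_alg_def)

lemma sym_alg_carrier:
  "p \<in> carrier (sym_alg d) \<longleftrightarrow> (\<forall>m\<in>Poly_Mapping.keys p. Poly_Mapping.keys m \<subseteq> {..<d})"
  by (simp add: sym_alg_def)

lemma sym_alg_hcomp:
  "p \<in> hcomp (sym_alg d) n \<longleftrightarrow> p \<in> carrier (sym_alg d) \<and> (\<forall>m\<in>Poly_Mapping.keys p. 2 * int (mdeg m) = n)"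
  by (auto simp: sym_alg_def mdeg_def)

lemma sym_alg_closed [simp]:
  "0 \<in> carrier (sym_alg d)" "1 \<in> carrier (sym_alg d)"
  "p \<in> carrier (sym_alg d) \<Longrightarrow> q \<in> carrier (sym_alg d) \<Longrightarrow> p + q \<in> carrier (sym_alg d)"
  "p \<in> carrier (sym_alg d) \<Longrightarrow> q \<in> carrier (sym_alg d) \<Longrightarrow> p * q \<in> carrier (sym_alg d)"
  "p \<in> carrier (sym_alg d) \<Longrightarrow> - p \<in> carrier (sym_alg d)"
  "p \<in> carrier (sym_alg d) \<Longrightarrow> q \<in> carrier (sym_alg d) \<Longrightarrow> p - q \<in> carrier (sym_alg d)"
  "Poly_Mapping.single 0 c \<in> carrier (sym_alg d)"
proof -
  show 1: "p \<in> carrier (sym_alg d) \<Longrightarrow> q \<in> carrier (sym_alg d) \<Longrightarrow> p + q \<in> carrier (sym_alg d)" for p q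
    unfolding sym_alg_carrier using keys_add[of p q] by blast
  show "p \<in> carrier (sym_alg d) \<Longrightarrow> q \<in> carrier (sym_alg d) \<Longrightarrow> p * q \<in> carrier (sym_alg d)"
    unfolding sym_alg_carrier using keys_mult[of p q] by (fastforce simp: keys_add_nat)
  show 2: "p \<in> carrier (sym_alg d) \<Longrightarrow> - p \<in> carrier (sym_alg d)" for p
    by (simp add: sym_alg_carrier in_keys_iff)
  show "p \<in> carrier (sym_alg d) \<Longrightarrow> q \<in> carrier (sym_alg d) \<Longrightarrow> p - q \<in> carrier (sym_alg d)"
    using 1[of p "- q"] 2[of q] by simp
qed (auto simp: sym_alg_carrier)

lemma cring_sym_alg: "cring (sym_alg d)"
proof (intro cringI abelian_groupI comm_monoidI)
  show "\<exists>y\<in>carrier (sym_alg d). y \<oplus>\<^bsub>sym_alg d\<^esub> x = \<zero>\<^bsub>sym_alg d\<^esub>" if "x \<in> carrier (sym_alg d)" for x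
    using that by (intro bexI[of _ "- x"]) auto
qed (auto simp: algebra_simps)

lemma sym_alg_uminus [simp]: "p \<in> carrier (sym_alg d) \<Longrightarrow> \<ominus>\<^bsub>sym_alg d\<^esub> p = - p"
proof -
  interpret cring "sym_alg d" by (rule cring_sym_alg)
  assume "p \<in> carrier (sym_alg d)"
  thus ?thesis by (intro minus_equality) auto
qed

lemma module_sym_alg: "Module.module (sym_alg d) (sym_alg d)"
  by (intro moduleI cring_sym_alg cring.axioms ring.is_abelian_group cring.axioms(1))
    (auto simp: algebra_simps)

section \<open>Generated submodules and the Hilbert basis theorem\<close>

lemma lookup_single_mult:
  fixes p :: cpoly
  shows "Poly_Mapping.lookup (Poly_Mapping.single e c * p) (e + m) = c * Poly_Mapping.lookup p m"
proof -
  have *: "(\<Sum>q. Poly_Mapping.lookup p q when e + m = e + q) = Poly_Mapping.lookup p m"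
    by simp
  show ?thesis
    unfolding lookup_mult by (simp add: lookup_single when_mult *)
qed

lemma poly_mapping_monomials:
  fixes p :: "'a \<Rightarrow>\<^sub>0 'b::comm_monoid_add"
  shows "p = (\<Sum>m\<in>Poly_Mapping.keys p. Poly_Mapping.single m (Poly_Mapping.lookup p m))"
proof (rule poly_mapping_eqI)
  fix k
  show "Poly_Mapping.lookup p k = Poly_Mapping.lookup (\<Sum>m\<in>Poly_Mapping.keys p.
      Poly_Mapping.single m (Poly_Mapping.lookup p m)) k"
    by (simp add: lookup_sum lookup_single when_def in_keys_iff sum.delta)
qed

text \<open>Defined as an intersection, so that inclusions follow from minimality alone;
  \<open>mgen_lincomb\<close> recovers linear combinations for finite \<open>B\<close>.\<close>

definition mgen :: "nat \<Rightarrow> (cpoly, 'b) gmodule \<Rightarrow> 'b set \<Rightarrow> 'b set" where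
  "mgen d M B = \<Inter>{C. submodule C (sym_alg d) M \<and> B \<subseteq> C}"

lemma mgen_subset: "B \<subseteq> mgen d M B"
  by (auto simp: mgen_def)

lemma mgen_least: "submodule C (sym_alg d) M \<Longrightarrow> B \<subseteq> C \<Longrightarrow> mgen d M B \<subseteq> C"
  by (auto simp: mgen_def)

lemma mgen_mono: "B \<subseteq> C \<Longrightarrow> mgen d M B \<subseteq> mgen d M C"
  by (auto simp: mgen_def)

lemma submodule_closed:
  assumes "submodule C R M"
  shows "C \<subseteq> carrier M" "x \<in> C \<Longrightarrow> x \<in> carrier M" "\<zero>\<^bsub>M\<^esub> \<in> C"
    "x \<in> C \<Longrightarrow> y \<in> C \<Longrightarrow> x \<oplus>\<^bsub>M\<^esub> y \<in> C"
    "x \<in> C \<Longrightarrow> \<ominus>\<^bsub>M\<^esub> x \<in> C"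
    "x \<in> C \<Longrightarrow> y \<in> C \<Longrightarrow> x \<ominus>\<^bsub>M\<^esub> y \<in> C"
    "a \<in> carrier R \<Longrightarrow> x \<in> C \<Longrightarrow> a \<odot>\<^bsub>M\<^esub> x \<in> C"
proof -
  have sg: "subgroup C (add_monoid M)" using assms by (rule submodule.axioms)
  show sub: "C \<subseteq> carrier M" using subgroup.subset[OF sg] by simp
  show "x \<in> C \<Longrightarrow> x \<in> carrier M" using sub by (rule subsetD)
  show "\<zero>\<^bsub>M\<^esub> \<in> C" using subgroup.one_closed[OF sg] by simp
  have add: "x \<oplus>\<^bsub>M\<^esub> y \<in> C" if "x \<in> C" "y \<in> C" for x y
    using subgroup.m_closed[OF sg that] by simp
  show "x \<in> C \<Longrightarrow> y \<in> C \<Longrightarrow> x \<oplus>\<^bsub>M\<^esub> y \<in> C" by (rule add)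
  have neg: "\<ominus>\<^bsub>M\<^esub> x \<in> C" if "x \<in> C" for x
    using subgroup.m_inv_closed[OF sg that] by (simp add: a_inv_def)
  show "x \<in> C \<Longrightarrow> \<ominus>\<^bsub>M\<^esub> x \<in> C" by (rule neg)
  show "x \<in> C \<Longrightarrow> y \<in> C \<Longrightarrow> x \<ominus>\<^bsub>M\<^esub> y \<in> C"
    unfolding a_minus_def by (intro add neg)
  show "a \<in> carrier R \<Longrightarrow> x \<in> C \<Longrightarrow> a \<odot>\<^bsub>M\<^esub> x \<in> C"
    by (rule submodule.smult_closed[OF assms])
qed

lemma submodule_mgen:
  assumes "Module.module (sym_alg d) M" "B \<subseteq> carrier M"
  shows "submodule (mgen d M B) (sym_alg d) M"
proof -
  interpret Module.module "sym_alg d" M by fact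
  have 1: "mgen d M B \<subseteq> carrier M"
    using mgen_least[OF carrier_is_submodule] assms(2) by blast
  show ?thesis
  proof (rule submoduleI[OF 1])
    fix a b x assume x: "x \<in> mgen d M B"
    { fix C assume C: "submodule C (sym_alg d) M" "B \<subseteq> C"
      have "x \<in> C" using x C by (auto simp: mgen_def)
      note submodule_closed(4)[OF C(1) this] submodule_closed(5)[OF C(1) this]
        submodule_closed(7)[OF C(1) _ this] }
    note * = this
    show "\<ominus>\<^bsub>M\<^esub> x \<in> mgen d M B"
      unfolding mgen_def by (intro InterI, elim CollectE conjE) (rule *(2))
    show "a \<odot>\<^bsub>M\<^esub> x \<in> mgen d M B" if "a \<in> carrier (sym_alg d)"
      unfolding mgen_def by (intro InterI, elim CollectE conjE) (rule *(3)[OF _ _ that])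
    show "x \<oplus>\<^bsub>M\<^esub> b \<in> mgen d M B" if "b \<in> mgen d M B"
      unfolding mgen_def
      by (intro InterI, elim CollectE conjE) (rule *(1), use that in \<open>auto simp: mgen_def\<close>)
  next
    show "\<zero>\<^bsub>M\<^esub> \<in> mgen d M B"
      unfolding mgen_def by (intro InterI, elim CollectE conjE) (rule submodule_closed(3))
  qed
qed

text \<open>Hilbert's basis theorem by leading monomials: if \<open>J\<close> were not finitely
  generated, one could keep choosing an element outside the ideal generated so far, with smallest
  possible leading monomial. Dickson's lemma finds two choices whose leading monomials divide each
  other, and cancelling the leading term of the later one contradicts its minimality.\<close>

lemma sym_alg_fin_gen:
  assumes J: "submodule J (sym_alg d) (sym_alg d)"
  shows "\<exists>B. finite B \<and> B \<subseteq> J \<and> J \<subseteq> mgen d (sym_alg d) B"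
proof (rule ccontr)
  let ?A = "sym_alg d"
  interpret A: Module.module ?A ?A by (rule module_sym_alg)
  have JA: "J \<subseteq> carrier ?A" using submodule_closed(1)[OF J] .
  assume neg: "\<not> ?thesis"
  hence ex: "\<exists>p. p \<in> J - mgen d ?A B" if "finite B" "B \<subseteq> J" for B
    using that neg by blast
  have zero: "0 \<in> mgen d ?A B" if "B \<subseteq> J" for B
    using submodule_closed(3)[OF submodule_mgen[OF module_sym_alg]] JA that by fastforce
  define lm :: "cpoly \<Rightarrow> _" where "lm p = Max (Poly_Mapping.keys p)" for p
  have lm_keys: "Poly_Mapping.keys (lm p) \<subseteq> {..<d}" "lm p \<in> Poly_Mapping.keys p"
    if "p \<in> carrier ?A" "p \<noteq> 0" for p
  proof -
    show "lm p \<in> Poly_Mapping.keys p" unfolding lm_def using that by (intro Max_in) auto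
    thus "Poly_Mapping.keys (lm p) \<subseteq> {..<d}" using that by (auto simp: sym_alg_carrier)
  qed
  \<comment> \<open>Well-foundedness on the monomials in \<open>d\<close> variables yields a
    smallest leading monomial among the elements not yet generated.\<close>
  have "\<exists>p. p \<in> J - mgen d ?A B \<and> (\<forall>q\<in>J - mgen d ?A B. \<not> lm q < lm p)"
    if B: "finite B" "B \<subseteq> J" for B
  proof -
    let ?S = "lm ` (J - mgen d ?A B)"
    have "?S \<noteq> {}" using ex[OF B] by blast
    then obtain x where x: "x \<in> ?S" "\<And>y. (y, x) \<in> {(m, n). m < n \<and>
       Poly_Mapping.keys m \<subseteq> {..<d} \<and> Poly_Mapping.keys n \<subseteq> {..<d}} \<Longrightarrow> y \<notin> ?S"
      using wf_monomials[of d] unfolding wf_eq_minimal by (metis (no_types, lifting) ex_in_conv)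
    have k: "Poly_Mapping.keys y \<subseteq> {..<d}" if "y \<in> ?S" for y
      using that lm_keys(1) JA zero[OF B(2)] by blast
    show ?thesis using x k by (auto simp: image_iff)
  qed
  then obtain nxt where nxt: "\<And>B. finite B \<Longrightarrow> B \<subseteq> J \<Longrightarrow> nxt B \<in> J - mgen d ?A B"
    "\<And>B q. finite B \<Longrightarrow> B \<subseteq> J \<Longrightarrow> q \<in> J - mgen d ?A B \<Longrightarrow> \<not> lm q < lm (nxt B)"
    by metis
  define Bs where "Bs = rec_nat {} (\<lambda>_ B. insert (nxt B) B)"
  have Bs: "Bs 0 = {}" "Bs (Suc n) = insert (nxt (Bs n)) (Bs n)" for n
    by (simp_all add: Bs_def)
  have fin: "finite (Bs n) \<and> Bs n \<subseteq> J" for n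
    by (induction n) (use nxt in \<open>auto simp: Bs\<close>)
  define p where "p n = nxt (Bs n)" for n
  have p: "p n \<in> J" "p n \<notin> mgen d ?A (Bs n)" "p n \<noteq> 0" "p n \<in> carrier ?A" for n
    using nxt(1)[of "Bs n"] fin[of n] zero[of "Bs n"] JA by (auto simp: p_def)
  have Bs_mono: "Bs i \<subseteq> Bs j" if "i \<le> j" for i j
    using that by (induction j rule: dec_induct) (auto simp: Bs)
  obtain i j where ij: "i < j" "\<And>v. Poly_Mapping.lookup (lm (p i)) v \<le> Poly_Mapping.lookup (lm (p j)) v"
    using dickson[of "\<lambda>n. lm (p n)" d, OF lm_keys(1)[OF p(4) p(3)]] by blast
  have pi: "p i \<in> mgen d ?A (Bs j)"
  proof -
    have "p i \<in> Bs (Suc i)" by (simp add: Bs p_def)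
    hence "p i \<in> Bs j" using Bs_mono[of "Suc i" j] ij(1) by auto
    thus ?thesis by (rule subsetD[OF mgen_subset])
  qed
  have sub: "submodule (mgen d ?A (Bs j)) ?A ?A"
    using submodule_mgen[OF module_sym_alg] fin[of j] JA by blast
  \<comment> \<open>The quotient of the two leading monomials; together with the ratio
    \<open>c\<close> of the leading coefficients it is chosen so that \<open>p j - s\<close> loses
    its leading term.\<close>
  define e where "e = lm (p j) - lm (p i)"
  have e: "lm (p j) = e + lm (p i)"
    using ij(2) by (simp add: e_def poly_mapping_eq_iff fun_eq_iff lookup_add lookup_minus)
  define c where "c = Poly_Mapping.lookup (p j) (lm (p j)) / Poly_Mapping.lookup (p i) (lm (p i))"
  have nz: "Poly_Mapping.lookup (p i) (lm (p i)) \<noteq> 0"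
    using lm_keys(2)[OF p(4) p(3), of i] by (simp add: in_keys_iff)
  define s where "s = Poly_Mapping.single e c * p i"
  have se: "Poly_Mapping.single e c \<in> carrier ?A"
    using lm_keys(1)[OF p(4) p(3), of j] by (auto simp: sym_alg_carrier e keys_add_nat)
  have sB: "s \<in> mgen d ?A (Bs j)" and sJ: "s \<in> J"
    unfolding s_def using submodule_closed(7)[OF sub se pi] submodule_closed(7)[OF J se p(1)] by auto
  have sA: "s \<in> carrier ?A" using sJ JA by blast
  define q where "q = p j - s"
  have qJ: "q \<in> J" unfolding q_def
    using submodule_closed(6)[OF J p(1)[of j] sJ] sA by (simp add: a_minus_def)
  \<comment> \<open>The subtracted multiple \<open>s\<close> lies in the ideal generated before
    stage \<open>j\<close>, so \<open>q\<close> is outside of it exactly as \<open>p j\<close> is,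
    and competes with \<open>p j\<close> for minimality.\<close>
  have qB: "q \<notin> mgen d ?A (Bs j)"
  proof
    assume "q \<in> mgen d ?A (Bs j)"
    hence "q + s \<in> mgen d ?A (Bs j)" using submodule_closed(4)[OF sub _ sB] by simp
    thus False using p(2)[of j] by (simp add: q_def)
  qed
  have q0: "q \<noteq> 0" using qB zero[of "Bs j"] fin[of j] by auto
  have "lm q \<in> Poly_Mapping.keys q" using lm_keys(2)[of q] qJ JA q0 by blast
  \<comment> \<open>The order is compatible with multiplication by the monomial \<open>e\<close>, so
    no monomial of \<open>s\<close> exceeds \<open>e + lm (p i)\<close>, which is
    \<open>lm (p j)\<close>.\<close>
  have keys: "m \<le> lm (p j)" if "m \<in> Poly_Mapping.keys q" for m
  proof -
    have "m \<in> Poly_Mapping.keys (p j) \<or> m \<in> Poly_Mapping.keys s"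
      using that by (auto simp: q_def in_keys_iff lookup_minus)
    thus ?thesis
    proof
      assume "m \<in> Poly_Mapping.keys (p j)"
      thus ?thesis by (simp add: lm_def)
    next
      assume "m \<in> Poly_Mapping.keys s"
      then obtain m' where m': "m = e + m'" "m' \<in> Poly_Mapping.keys (p i)"
        unfolding s_def using keys_mult[of "Poly_Mapping.single e c" "p i"] by (auto split: if_splits)
      hence "m' \<le> lm (p i)" by (simp add: lm_def)
      thus ?thesis unfolding m'(1) e by (rule add_left_mono)
    qed
  qed
  have "Poly_Mapping.lookup q (lm (p j)) = 0"
    unfolding q_def lookup_minus s_def e lookup_single_mult
    using nz by (simp add: c_def flip: e)
  hence "lm q \<noteq> lm (p j)" using \<open>lm q \<in> Poly_Mapping.keys q\<close> by (auto simp: in_keys_iff)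
  hence "lm q < lm (p j)" using keys[OF \<open>lm q \<in> Poly_Mapping.keys q\<close>] by simp
  thus False using nxt(2)[of "Bs j" q] fin[of j] qJ qB by (simp add: p_def)
qed

section \<open>Graded modules\<close>

lemma (in abelian_monoid) finsum_mem:
  assumes "f \<in> I \<rightarrow> S" "S \<subseteq> carrier G" "\<zero> \<in> S" "\<And>x y. x \<in> S \<Longrightarrow> y \<in> S \<Longrightarrow> x \<oplus> y \<in> S"
  shows "(\<Oplus>i\<in>I. f i) \<in> S"
  using assms(1)
proof (induction I rule: infinite_finite_induct)
  case (insert i I)
  hence "f \<in> I \<rightarrow> carrier G" "f i \<in> carrier G" using assms(2) by auto
  thus ?case using insert assms(4) by simp
qed (use assms(3) in auto)

lemma finsum_hom:
  assumes "abelian_monoid M" "abelian_monoid N" "f \<in> carrier M \<rightarrow> carrier N"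
    "\<And>x y. x \<in> carrier M \<Longrightarrow> y \<in> carrier M \<Longrightarrow> f (x \<oplus>\<^bsub>M\<^esub> y) = f x \<oplus>\<^bsub>N\<^esub> f y"
    "f \<zero>\<^bsub>M\<^esub> = \<zero>\<^bsub>N\<^esub>" "g \<in> I \<rightarrow> carrier M"
  shows "f (\<Oplus>\<^bsub>M\<^esub>i\<in>I. g i) = (\<Oplus>\<^bsub>N\<^esub>i\<in>I. f (g i))"
proof -
  interpret M: abelian_monoid M by fact
  interpret N: abelian_monoid N by fact
  show ?thesis using assms(6)
  proof (induction I rule: infinite_finite_induct)
    case (insert i I)
    hence "g \<in> I \<rightarrow> carrier M" "g i \<in> carrier M" by auto
    moreover from this have "(\<lambda>i. f (g i)) \<in> I \<rightarrow> carrier N" "f (g i) \<in> carrier N"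
      using assms(3) by auto
    ultimately show ?case using insert by (simp add: assms(4))
  qed (use assms(5) in auto)
qed

text \<open>The linear combinations form a submodule containing \<open>B\<close>, so minimality of
  \<open>mgen\<close> gives the nontrivial inclusion. This links \<open>mgen\<close> to the finite
  generation clause of \<open>graded_module\<close>.\<close>

lemma mgen_lincomb:
  assumes "Module.module (sym_alg d) M" "finite B" "B \<subseteq> carrier M"
  shows "m \<in> mgen d M B \<longleftrightarrow>
    (\<exists>c\<in>B \<rightarrow> carrier (sym_alg d). m = (\<Oplus>\<^bsub>M\<^esub>b\<in>B. c b \<odot>\<^bsub>M\<^esub> b))"
proof
  interpret Module.module "sym_alg d" M by fact
  note sub = submodule_mgen[OF assms(1,3)]
  show "m \<in> mgen d M B" if c: "\<exists>c\<in>B \<rightarrow> carrier (sym_alg d). m = (\<Oplus>\<^bsub>M\<^esub>b\<in>B. c b \<odot>\<^bsub>M\<^esub> b)"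
  proof -
    from c obtain c where c: "c \<in> B \<rightarrow> carrier (sym_alg d)" "m = (\<Oplus>\<^bsub>M\<^esub>b\<in>B. c b \<odot>\<^bsub>M\<^esub> b)" ..
    have "(\<lambda>b. c b \<odot>\<^bsub>M\<^esub> b) \<in> B \<rightarrow> mgen d M B"
      using c(1) mgen_subset[of B d M] submodule_closed(7)[OF sub] by (auto simp: subset_iff)
    thus ?thesis unfolding c(2)
      by (rule M.finsum_mem) (use submodule_closed[OF sub] in auto)
  qed
  let ?L = "{\<Oplus>\<^bsub>M\<^esub>b\<in>B. c b \<odot>\<^bsub>M\<^esub> b | c. c \<in> B \<rightarrow> carrier (sym_alg d)}"
  have cl: "c b \<odot>\<^bsub>M\<^esub> b \<in> carrier M" if "c \<in> B \<rightarrow> carrier (sym_alg d)" "b \<in> B" for c b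
    using that assms(3) by auto
  have add: "(\<Oplus>\<^bsub>M\<^esub>b\<in>B. c b \<odot>\<^bsub>M\<^esub> b) \<oplus>\<^bsub>M\<^esub> (\<Oplus>\<^bsub>M\<^esub>b\<in>B. c' b \<odot>\<^bsub>M\<^esub> b) \<in> ?L"
    if c: "c \<in> B \<rightarrow> carrier (sym_alg d)" "c' \<in> B \<rightarrow> carrier (sym_alg d)" for c c'
  proof -
    have "(\<Oplus>\<^bsub>M\<^esub>b\<in>B. c b \<odot>\<^bsub>M\<^esub> b) \<oplus>\<^bsub>M\<^esub> (\<Oplus>\<^bsub>M\<^esub>b\<in>B. c' b \<odot>\<^bsub>M\<^esub> b)
      = (\<Oplus>\<^bsub>M\<^esub>b\<in>B. c b \<odot>\<^bsub>M\<^esub> b \<oplus>\<^bsub>M\<^esub> c' b \<odot>\<^bsub>M\<^esub> b)"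
      by (rule M.finsum_addf[symmetric]) (use cl c in auto)
    also have "\<dots> = (\<Oplus>\<^bsub>M\<^esub>b\<in>B. (c b + c' b) \<odot>\<^bsub>M\<^esub> b)"
      by (rule M.finsum_cong')
        (use c assms(3) in \<open>auto simp: smult_l_distr[simplified] Pi_def subset_iff\<close>)
    finally show ?thesis using c by (auto intro!: exI[of _ "\<lambda>b. c b + c' b"] simp: Pi_def)
  qed
  have smult: "a \<odot>\<^bsub>M\<^esub> (\<Oplus>\<^bsub>M\<^esub>b\<in>B. c b \<odot>\<^bsub>M\<^esub> b) \<in> ?L"
    if c: "c \<in> B \<rightarrow> carrier (sym_alg d)" "a \<in> carrier (sym_alg d)" for c a
  proof -
    have "a \<odot>\<^bsub>M\<^esub> (\<Oplus>\<^bsub>M\<^esub>b\<in>B. c b \<odot>\<^bsub>M\<^esub> b) = (\<Oplus>\<^bsub>M\<^esub>b\<in>B. a \<odot>\<^bsub>M\<^esub> (c b \<odot>\<^bsub>M\<^esub> b))"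
      by (rule finsum_smult_ldistr) (use cl c assms(2) in auto)
    also have "\<dots> = (\<Oplus>\<^bsub>M\<^esub>b\<in>B. (a * c b) \<odot>\<^bsub>M\<^esub> b)"
      by (rule M.finsum_cong')
        (use c assms(3) in \<open>auto simp: smult_assoc1[simplified] Pi_def subset_iff\<close>)
    finally show ?thesis using c by (auto intro!: exI[of _ "\<lambda>b. a * c b"] simp: Pi_def)
  qed
  have LM: "?L \<subseteq> carrier M" using cl by (auto intro!: M.finsum_closed)
  have "submodule ?L (sym_alg d) M"
  proof (rule submoduleI[OF LM])
    show "\<zero>\<^bsub>M\<^esub> \<in> ?L"
    proof (intro CollectI exI conjI)
      show "\<zero>\<^bsub>M\<^esub> = (\<Oplus>\<^bsub>M\<^esub>b\<in>B. (\<lambda>_. 0) b \<odot>\<^bsub>M\<^esub> b)"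
        by (rule M.add.finprod_one_eqI[symmetric]) (use assms(3) smult_l_null[simplified] in auto)
    qed auto
    show "\<ominus>\<^bsub>M\<^esub> x \<in> ?L" if "x \<in> ?L" for x
    proof -
      have "\<ominus>\<^bsub>M\<^esub> x = (- 1) \<odot>\<^bsub>M\<^esub> x"
        using smult_l_minus[of 1 x] that LM smult_one by auto
      also have "\<dots> \<in> ?L" using smult[of _ "- 1"] that by auto
      finally show ?thesis .
    qed
  qed (use add smult in auto)
  moreover have "B \<subseteq> ?L"
  proof
    fix b assume b: "b \<in> B"
    have "(\<Oplus>\<^bsub>M\<^esub>b'\<in>B. (if b' = b then 1 else 0) \<odot>\<^bsub>M\<^esub> b') = (\<Oplus>\<^bsub>M\<^esub>b'\<in>B. if b = b' then b' else \<zero>\<^bsub>M\<^esub>)"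
      by (rule M.finsum_cong')
        (use assms(3) smult_l_null[simplified] smult_one[simplified] in \<open>auto simp: subset_iff\<close>)
    also have "\<dots> = b"
      by (rule M.finsum_singleton) (use b assms in auto)
    finally show "b \<in> ?L" by (intro CollectI exI[of _ "\<lambda>b'. if b' = b then 1 else 0"]) auto
  qed
  ultimately have "mgen d M B \<subseteq> ?L" by (rule mgen_least)
  thus "\<exists>c\<in>B \<rightarrow> carrier (sym_alg d). m = (\<Oplus>\<^bsub>M\<^esub>b\<in>B. c b \<odot>\<^bsub>M\<^esub> b)" if "m \<in> mgen d M B"
    using that by blast
qed

text \<open>The homogeneous component of degree \<open>n\<close>. The description picks out the
  unique decomposition guaranteed by \<open>graded_module\<close> and is meaningful only for
  \<open>m\<close> in the carrier.\<close>

definition gcomp :: "(cpoly, 'b) gmodule \<Rightarrow> int \<Rightarrow> 'b \<Rightarrow> 'b" where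
  "gcomp M n m = (THE f. (\<forall>n. f n \<in> hcomp M n) \<and> finite {n. f n \<noteq> \<zero>\<^bsub>M\<^esub>} \<and>
     m = (\<Oplus>\<^bsub>M\<^esub>n\<in>{n. f n \<noteq> \<zero>\<^bsub>M\<^esub>}. f n)) n"

locale gmod =
  fixes d :: nat and M :: "(cpoly, 'b) gmodule" (structure)
  assumes gm: "graded_module d M"

sublocale gmod \<subseteq> Module.module "sym_alg d" M
  using gm by (simp add: graded_module_def)

context gmod
begin

lemma smult_add: "a \<in> carrier (sym_alg d) \<Longrightarrow> b \<in> carrier (sym_alg d) \<Longrightarrow> x \<in> carrier M \<Longrightarrow>
    (a + b) \<odot> x = a \<odot> x \<oplus> b \<odot> x"
  using smult_l_distr by simp

lemma smult_mult: "a \<in> carrier (sym_alg d) \<Longrightarrow> b \<in> carrier (sym_alg d) \<Longrightarrow> x \<in> carrier M \<Longrightarrow>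
    (a * b) \<odot> x = a \<odot> (b \<odot> x)"
  using smult_assoc1 by simp

lemma smult_1 [simp]: "x \<in> carrier M \<Longrightarrow> 1 \<odot> x = x"
  using smult_one by simp

lemma smult_0 [simp]: "x \<in> carrier M \<Longrightarrow> 0 \<odot> x = \<zero>"
  using smult_l_null by simp

lemma smult_neg: "a \<in> carrier (sym_alg d) \<Longrightarrow> x \<in> carrier M \<Longrightarrow> (- a) \<odot> x = \<ominus> (a \<odot> x)"
  using smult_l_minus[of a x] by simp

lemma hcomp_subgroup: "subgroup (hcomp M n) (add_monoid M)"
  using gm by (simp add: graded_module_def)

lemma hcomp_closed:
  shows "x \<in> hcomp M n \<Longrightarrow> x \<in> carrier M" "\<zero> \<in> hcomp M n"
    "x \<in> hcomp M n \<Longrightarrow> y \<in> hcomp M n \<Longrightarrow> x \<oplus> y \<in> hcomp M n"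
    "x \<in> hcomp M n \<Longrightarrow> \<ominus> x \<in> hcomp M n"
  using subgroup.subset[OF hcomp_subgroup] subgroup.one_closed[OF hcomp_subgroup]
    subgroup.m_closed[OF hcomp_subgroup] subgroup.m_inv_closed[OF hcomp_subgroup]
  by (auto simp: a_inv_def)

lemma hcomp_smult:
  "a \<in> hcomp (sym_alg d) i \<Longrightarrow> m \<in> hcomp M j \<Longrightarrow> a \<odot> m \<in> hcomp M (i + j)"
  using gm by (simp add: graded_module_def)

lemma fin_gen: "\<exists>B. finite B \<and> B \<subseteq> carrier M \<and> carrier M \<subseteq> mgen d M B"
proof -
  obtain B where B: "finite B" "B \<subseteq> carrier M"
    "\<forall>m\<in>carrier M. \<exists>c\<in>B \<rightarrow> carrier (sym_alg d). m = (\<Oplus>b\<in>B. c b \<odot> b)"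
    using gm unfolding graded_module_def by blast
  moreover have "carrier M \<subseteq> mgen d M B"
    using B mgen_lincomb[OF module_axioms B(1,2)] by blast
  ultimately show ?thesis by blast
qed

lemma finsum_support:
  assumes "\<And>n. f n \<in> hcomp M n" "finite S" "\<And>n. n \<notin> S \<Longrightarrow> f n = \<zero>"
  shows "(\<Oplus>n\<in>S. f n) = (\<Oplus>n\<in>{n. f n \<noteq> \<zero>}. f n)"
proof -
  have "{n. f n \<noteq> \<zero>} \<subseteq> S" using assms(3) by auto
  thus ?thesis
    by (intro M.add.finprod_mono_neutral_cong_right)
      (use assms hcomp_closed(1)[OF assms(1)] in auto)
qed

text \<open>Components may be read off from any finite decomposition; the index set \<open>S\<close>
  is allowed to be larger than the support.\<close>

lemma gcomp_unique:
  assumes "\<And>n. f n \<in> hcomp M n" "finite S" "\<And>n. n \<notin> S \<Longrightarrow> f n = \<zero>" "m = (\<Oplus>n\<in>S. f n)"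
  shows "gcomp M n m = f n"
proof -
  have m: "m \<in> carrier M"
    unfolding assms(4) using assms(1) hcomp_closed(1) by (intro M.finsum_closed) auto
  have f: "(\<forall>n. f n \<in> hcomp M n) \<and> finite {n. f n \<noteq> \<zero>} \<and> m = (\<Oplus>n\<in>{n. f n \<noteq> \<zero>}. f n)"
    using assms finsum_support[OF assms(1,2,3)]
    by (auto intro: finite_subset[of _ S])
  have "\<exists>!f. (\<forall>n. f n \<in> hcomp M n) \<and> finite {n. f n \<noteq> \<zero>} \<and> m = (\<Oplus>n\<in>{n. f n \<noteq> \<zero>}. f n)"
    using gm m by (simp add: graded_module_def)
  then obtain g where g: "\<And>f. ((\<forall>n. f n \<in> hcomp M n) \<and> finite {n. f n \<noteq> \<zero>} \<and>
      m = (\<Oplus>n\<in>{n. f n \<noteq> \<zero>}. f n)) \<longleftrightarrow> f = g"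
    unfolding Ex1_def by metis
  show ?thesis using f unfolding gcomp_def g by simp
qed

lemma gcomp_decomp:
  assumes "m \<in> carrier M"
  shows "gcomp M n m \<in> hcomp M n" "finite {n. gcomp M n m \<noteq> \<zero>}"
    "m = (\<Oplus>n\<in>{n. gcomp M n m \<noteq> \<zero>}. gcomp M n m)"
proof -
  have "\<exists>!f. (\<forall>n. f n \<in> hcomp M n) \<and> finite {n. f n \<noteq> \<zero>} \<and> m = (\<Oplus>n\<in>{n. f n \<noteq> \<zero>}. f n)"
    using gm assms by (simp add: graded_module_def)
  from theI'[OF this] show "gcomp M n m \<in> hcomp M n" "finite {n. gcomp M n m \<noteq> \<zero>}"
    "m = (\<Oplus>n\<in>{n. gcomp M n m \<noteq> \<zero>}. gcomp M n m)"
    unfolding gcomp_def by blast+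
qed

lemma gcomp_carrier: "m \<in> carrier M \<Longrightarrow> gcomp M n m \<in> carrier M"
  using gcomp_decomp(1) hcomp_closed(1) by blast

lemma gcomp_sum:
  assumes "m \<in> carrier M" "finite S" "{n. gcomp M n m \<noteq> \<zero>} \<subseteq> S"
  shows "m = (\<Oplus>n\<in>S. gcomp M n m)"
  using finsum_support[of "\<lambda>n. gcomp M n m" S] gcomp_decomp[OF assms(1)] assms(2,3) by force

lemma gcomp_hcomp:
  assumes "m \<in> hcomp M k"
  shows "gcomp M n m = (if n = k then m else \<zero>)"
  by (rule gcomp_unique[where S = "{k}"]) (use assms hcomp_closed in auto)

lemma gcomp_zero [simp]: "gcomp M n \<zero> = \<zero>"
  using gcomp_hcomp[OF hcomp_closed(2)] by simp

lemma gcomp_add: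
  assumes "x \<in> carrier M" "y \<in> carrier M"
  shows "gcomp M n (x \<oplus> y) = gcomp M n x \<oplus> gcomp M n y"
proof (rule gcomp_unique)
  let ?S = "{n. gcomp M n x \<noteq> \<zero>} \<union> {n. gcomp M n y \<noteq> \<zero>}"
  show "finite ?S" using gcomp_decomp(2) assms by simp
  show "x \<oplus> y = (\<Oplus>n\<in>?S. gcomp M n x \<oplus> gcomp M n y)"
    using gcomp_sum[OF assms(1) \<open>finite ?S\<close>] gcomp_sum[OF assms(2) \<open>finite ?S\<close>]
    by (subst M.finsum_addf) (use gcomp_carrier assms in auto)
qed (use assms gcomp_decomp(1) hcomp_closed(3) in auto)

text \<open>An element is the finite sum of its components, so an additively closed set containing
  all of them contains the element.\<close>

lemma homogeneous_induct:
  assumes "S \<subseteq> carrier M" "\<zero> \<in> S" "\<And>x y. x \<in> S \<Longrightarrow> y \<in> S \<Longrightarrow> x \<oplus> y \<in> S"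
    "\<And>n. gcomp M n m \<in> S" "m \<in> carrier M"
  shows "m \<in> S"
proof -
  have "(\<Oplus>n\<in>{n. gcomp M n m \<noteq> \<zero>}. gcomp M n m) \<in> S"
    by (rule M.finsum_mem) (use assms in auto)
  thus ?thesis using gcomp_decomp(3)[OF assms(5)] by simp
qed

lemma gcomp_smult:
  assumes "a \<in> hcomp (sym_alg d) i" "m \<in> carrier M"
  shows "gcomp M n (a \<odot> m) = a \<odot> gcomp M (n - i) m"
proof -
  have a: "a \<in> carrier (sym_alg d)" using assms(1) by (simp add: sym_alg_hcomp)
  let ?f = "\<lambda>n. a \<odot> gcomp M (n - i) m"
  have S: "finite ((\<lambda>n. n + i) ` {n. gcomp M n m \<noteq> \<zero>})"
    using gcomp_decomp(2)[OF assms(2)] by simp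
  show ?thesis
  proof (rule gcomp_unique[OF _ S, of ?f])
    show "?f n \<in> hcomp M n" for n
      using hcomp_smult[OF assms(1) gcomp_decomp(1)[OF assms(2)], of "n - i"] by simp
    show "?f n = \<zero>" if "n \<notin> (\<lambda>n. n + i) ` {n. gcomp M n m \<noteq> \<zero>}" for n
    proof -
      have "gcomp M (n - i) m = \<zero>"
        using that by (auto simp: image_iff dest: spec[of _ "n - i"])
      thus ?thesis using a by simp
    qed
    have "a \<odot> m = a \<odot> (\<Oplus>n\<in>{n. gcomp M n m \<noteq> \<zero>}. gcomp M n m)"
      using gcomp_decomp(3)[OF assms(2)] by simp
    also have "\<dots> = (\<Oplus>n\<in>{n. gcomp M n m \<noteq> \<zero>}. a \<odot> gcomp M n m)"
      by (rule finsum_smult_ldistr) (use gcomp_decomp(2) gcomp_carrier assms a in auto)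
    also have "\<dots> = (\<Oplus>n\<in>(\<lambda>n. n + i) ` {n. gcomp M n m \<noteq> \<zero>}. ?f n)"
      by (subst M.finsum_reindex) (use gcomp_carrier assms a in auto)
    finally show "a \<odot> m = (\<Oplus>n\<in>(\<lambda>n. n + i) ` {n. gcomp M n m \<noteq> \<zero>}. ?f n)" .
  qed
qed

end

text \<open>
  Replaces the unique-decomposition clause by projections onto the homogeneous components and the
  requirement that the components generate the module additively.
\<close>

lemma graded_moduleI:
  fixes M (structure)
  assumes "Module.module (sym_alg d) M"
    and B: "finite B" "B \<subseteq> carrier M" "carrier M \<subseteq> mgen d M B"
    and sg: "\<And>n. subgroup (hcomp M n) (add_monoid M)"
    and sm: "\<And>i j a m. a \<in> hcomp (sym_alg d) i \<Longrightarrow> m \<in> hcomp M j \<Longrightarrow> a \<odot> m \<in> hcomp M (i + j)"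
    and p_add: "\<And>n x y. x \<in> carrier M \<Longrightarrow> y \<in> carrier M \<Longrightarrow> p n (x \<oplus> y) = p n x \<oplus> p n y"
    and p_in: "\<And>n x. x \<in> carrier M \<Longrightarrow> p n x \<in> hcomp M n"
    and p_hcomp: "\<And>n k x. x \<in> hcomp M k \<Longrightarrow> p n x = (if n = k then x else \<zero>)"
    and gen: "\<And>S x. S \<subseteq> carrier M \<Longrightarrow> \<zero> \<in> S \<Longrightarrow> (\<And>x y. x \<in> S \<Longrightarrow> y \<in> S \<Longrightarrow> x \<oplus> y \<in> S) \<Longrightarrow>
       (\<And>n. hcomp M n \<subseteq> S) \<Longrightarrow> x \<in> carrier M \<Longrightarrow> x \<in> S"
  shows "graded_module d M \<and> (\<forall>x\<in>carrier M. \<forall>n. gcomp M n x = p n x)"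
proof (intro conjI ballI allI)
  interpret Module.module "sym_alg d" M by fact
  have hc: "hcomp M n \<subseteq> carrier M" "\<zero> \<in> hcomp M n" for n
    using subgroup.subset[OF sg] subgroup.one_closed[OF sg] by auto
  have pc: "p n x \<in> carrier M" if "x \<in> carrier M" for n x using p_in that hc by blast
  have neutral: "(\<Oplus>n\<in>S. p n x) = (\<Oplus>n\<in>{n. p n x \<noteq> \<zero>}. p n x)"
    if "finite S" "{n. p n x \<noteq> \<zero>} \<subseteq> S" "x \<in> carrier M" for S x
    by (rule M.add.finprod_mono_neutral_cong_right) (use that pc in auto)
  \<comment> \<open>The elements that are the finite sum of their projections. This set contains the
    homogeneous elements and is closed under addition, so \<open>gen\<close> makes it
    everything.\<close>
  let ?S = "{x \<in> carrier M. finite {n. p n x \<noteq> \<zero>} \<and> x = (\<Oplus>n\<in>{n. p n x \<noteq> \<zero>}. p n x)}"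
  have p0: "p n \<zero> = \<zero>" for n using p_hcomp[OF hc(2)] by simp
  have dec: "x \<in> ?S" if "x \<in> carrier M" for x
  proof (rule gen[OF _ _ _ _ that])
    show "\<zero> \<in> ?S" by (simp add: p0)
    show "hcomp M k \<subseteq> ?S" for k
    proof
      fix x assume x: "x \<in> hcomp M k"
      hence xc: "x \<in> carrier M" using hc by blast
      have sub: "{n. p n x \<noteq> \<zero>} \<subseteq> {k}" using p_hcomp[OF x] by auto
      have "(\<Oplus>n\<in>{k}. p n x) = x" using xc p_hcomp[OF x, of k] by simp
      thus "x \<in> ?S" using neutral[OF _ sub xc] finite_subset[OF sub] xc by simp
    qed
    fix x y assume x: "x \<in> ?S" and y: "y \<in> ?S"
    let ?T = "{n. p n x \<noteq> \<zero>} \<union> {n. p n y \<noteq> \<zero>}"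
    have fT: "finite ?T" using x y by simp
    have sub: "{n. p n (x \<oplus> y) \<noteq> \<zero>} \<subseteq> ?T" using x y by (auto simp: p_add)
    have "(\<Oplus>n\<in>{n. p n (x \<oplus> y) \<noteq> \<zero>}. p n (x \<oplus> y)) = (\<Oplus>n\<in>?T. p n (x \<oplus> y))"
      using neutral[OF fT sub] x y by simp
    also have "\<dots> = (\<Oplus>n\<in>?T. p n x \<oplus> p n y)"
      by (rule M.finsum_cong') (use x y pc in \<open>auto simp: p_add\<close>)
    also have "\<dots> = (\<Oplus>n\<in>?T. p n x) \<oplus> (\<Oplus>n\<in>?T. p n y)"
      by (rule M.finsum_addf) (use x y pc in auto)
    also have "\<dots> = x \<oplus> y"
      using neutral[OF fT, of x] neutral[OF fT, of y] x y by simp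
    finally show "x \<oplus> y \<in> ?S" using x y finite_subset[OF sub fT] by simp
  qed auto
  have uniq: "f = (\<lambda>n. p n x)"
    if f: "\<forall>n. f n \<in> hcomp M n" "finite {n. f n \<noteq> \<zero>}" "x = (\<Oplus>n\<in>{n. f n \<noteq> \<zero>}. f n)" for f x
  proof
    fix k
    have fc: "f n \<in> carrier M" for n using f(1) hc by blast
    \<comment> \<open>Applying the projection \<open>p k\<close> to a decomposition leaves only its
      \<open>k\<close>-th term; this is the uniqueness of the decomposition.\<close>
    have "p k x = (\<Oplus>n\<in>{n. f n \<noteq> \<zero>}. p k (f n))"
      unfolding f(3)
      by (rule finsum_hom[OF M.abelian_monoid_axioms M.abelian_monoid_axioms])
        (use pc p_add p0 fc in auto)
    also have "\<dots> = (\<Oplus>n\<in>{n. f n \<noteq> \<zero>}. if k = n then f n else \<zero>)"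
      by (rule M.finsum_cong') (use p_hcomp f(1) fc in auto)
    also have "\<dots> = f k"
    proof (cases "f k = \<zero>")
      case True
      have "(\<Oplus>n\<in>{n. f n \<noteq> \<zero>}. if k = n then f n else \<zero>) = \<zero>"
        by (rule M.add.finprod_one_eqI) (use True in auto)
      thus ?thesis using True by simp
    next
      case False
      show ?thesis by (rule M.finsum_singleton) (use False f(2) fc in auto)
    qed
    finally show "f k = p k x" by simp
  qed
  have fg: "\<exists>c\<in>B \<rightarrow> carrier (sym_alg d). m = (\<Oplus>b\<in>B. c b \<odot> b)" if "m \<in> carrier M" for m
    using mgen_lincomb[OF assms(1) B(1,2)] B(3) that by blast
  show gm: "graded_module d M"
    unfolding graded_module_def
  proof (intro conjI ballI allI assms(1) sg)
    show "\<exists>B. finite B \<and> B \<subseteq> carrier M \<and>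
      (\<forall>m\<in>carrier M. \<exists>c\<in>B \<rightarrow> carrier (sym_alg d). m = (\<Oplus>b\<in>B. c b \<odot> b))"
      using B(1,2) fg by blast
    show "\<exists>!f. (\<forall>n. f n \<in> hcomp M n) \<and> finite {n. f n \<noteq> \<zero>} \<and> m = (\<Oplus>n\<in>{n. f n \<noteq> \<zero>}. f n)"
      if "m \<in> carrier M" for m
    proof (rule ex1I[of _ "\<lambda>n. p n m"])
      show "(\<forall>n. p n m \<in> hcomp M n) \<and> finite {n. p n m \<noteq> \<zero>} \<and>
          m = (\<Oplus>n\<in>{n. p n m \<noteq> \<zero>}. p n m)"
        using dec[OF that] p_in[OF that] by simp
      fix f assume "(\<forall>n. f n \<in> hcomp M n) \<and> finite {n. f n \<noteq> \<zero>} \<and>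
          m = (\<Oplus>n\<in>{n. f n \<noteq> \<zero>}. f n)"
      thus "f = (\<lambda>n. p n m)" using uniq[of f m] by simp
    qed
    show "a \<odot> m \<in> hcomp M (i + j)" if "a \<in> hcomp (sym_alg d) i" "m \<in> hcomp M j" for i j a m
      using that by (rule sm)
  qed
  fix x n assume x: "x \<in> carrier M"
  show "gcomp M n x = p n x"
  proof (rule gmod.gcomp_unique[of d M "\<lambda>n. p n x" "{n. p n x \<noteq> \<zero>}" x n])
    show "gmod d M" using gm by (rule gmod.intro)
    show "p n x \<in> hcomp M n" for n using x by (rule p_in)
    show "finite {n. p n x \<noteq> \<zero>}" "x = (\<Oplus>n\<in>{n. p n x \<noteq> \<zero>}. p n x)"
      using dec[OF x] by blast+
  qed simp
qed

text \<open>Homogeneity of a submodule is expressed by closure under components instead of by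
  homogeneous generators, which makes it easy to check for kernels, images and glued
  sections.\<close>

definition gsub :: "nat \<Rightarrow> (cpoly, 'b) gmodule \<Rightarrow> 'b set \<Rightarrow> bool" where
  "gsub d M C \<longleftrightarrow> submodule C (sym_alg d) M \<and> (\<forall>x\<in>C. \<forall>n. gcomp M n x \<in> C)"

lemma gsubD:
  assumes "gsub d M C"
  shows "submodule C (sym_alg d) M" "C \<subseteq> carrier M" "x \<in> C \<Longrightarrow> x \<in> carrier M" "\<zero>\<^bsub>M\<^esub> \<in> C"
    "x \<in> C \<Longrightarrow> y \<in> C \<Longrightarrow> x \<oplus>\<^bsub>M\<^esub> y \<in> C" "x \<in> C \<Longrightarrow> \<ominus>\<^bsub>M\<^esub> x \<in> C"
    "x \<in> C \<Longrightarrow> y \<in> C \<Longrightarrow> x \<ominus>\<^bsub>M\<^esub> y \<in> C" "a \<in> carrier (sym_alg d) \<Longrightarrow> x \<in> C \<Longrightarrow> a \<odot>\<^bsub>M\<^esub> x \<in> C"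
    "x \<in> C \<Longrightarrow> gcomp M n x \<in> C"
proof -
  show s: "submodule C (sym_alg d) M" using assms by (simp add: gsub_def)
  note c = submodule_closed[OF s]
  show "C \<subseteq> carrier M" by (fact c(1))
  show "x \<in> C \<Longrightarrow> x \<in> carrier M" by (rule c(2))
  show "\<zero>\<^bsub>M\<^esub> \<in> C" by (fact c(3))
  show "x \<in> C \<Longrightarrow> y \<in> C \<Longrightarrow> x \<oplus>\<^bsub>M\<^esub> y \<in> C" by (rule c(4))
  show "x \<in> C \<Longrightarrow> \<ominus>\<^bsub>M\<^esub> x \<in> C" by (rule c(5))
  show "x \<in> C \<Longrightarrow> y \<in> C \<Longrightarrow> x \<ominus>\<^bsub>M\<^esub> y \<in> C" by (rule c(6))
  show "a \<in> carrier (sym_alg d) \<Longrightarrow> x \<in> C \<Longrightarrow> a \<odot>\<^bsub>M\<^esub> x \<in> C" by (rule c(7))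
  show "x \<in> C \<Longrightarrow> gcomp M n x \<in> C" using assms by (simp add: gsub_def)
qed

lemma (in gmod) gsubI:
  assumes "C \<subseteq> carrier M" "\<zero> \<in> C" "\<And>x y. x \<in> C \<Longrightarrow> y \<in> C \<Longrightarrow> x \<oplus> y \<in> C"
    "\<And>a x. a \<in> carrier (sym_alg d) \<Longrightarrow> x \<in> C \<Longrightarrow> a \<odot> x \<in> C" "\<And>x n. x \<in> C \<Longrightarrow> gcomp M n x \<in> C"
  shows "gsub d M C"
proof -
  have "\<ominus> x \<in> C" if "x \<in> C" for x
    using smult_neg[of 1 x] assms(4)[of "- 1" x] assms(1) that by auto
  thus ?thesis unfolding gsub_def using assms by (auto intro!: submoduleI)
qed

lemma (in gmod) gsub_carrier: "gsub d M (carrier M)"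
  by (rule gsubI) (use gcomp_carrier in auto)

section \<open>Homomorphisms, submodules and shifts\<close>

context abelian_group
begin

lemma add_add_swap: "a \<in> carrier G \<Longrightarrow> b \<in> carrier G \<Longrightarrow> x \<in> carrier G \<Longrightarrow> y \<in> carrier G \<Longrightarrow>
    (a \<oplus> b) \<oplus> (x \<oplus> y) = (a \<oplus> x) \<oplus> (b \<oplus> y)"
  by (simp add: a_ac)

lemma add_diff_self: "x \<in> carrier G \<Longrightarrow> y \<in> carrier G \<Longrightarrow> x \<oplus> (y \<ominus> x) = y"
  by (metis a_comm a_minus_def add.inv_closed add.m_assoc l_neg r_zero)

lemma diff_add_self: "x \<in> carrier G \<Longrightarrow> y \<in> carrier G \<Longrightarrow> (x \<oplus> y) \<ominus> y = x"
  by (simp add: a_minus_def a_assoc r_neg)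

lemma diff_zero_iff: "x \<in> carrier G \<Longrightarrow> y \<in> carrier G \<Longrightarrow> x \<ominus> y = \<zero> \<longleftrightarrow> x = y"
  by (metis add_diff_self r_zero a_minus_def r_neg)

lemma diff_closed: "x \<in> carrier G \<Longrightarrow> y \<in> carrier G \<Longrightarrow> x \<ominus> y \<in> carrier G"
  by (simp add: a_minus_def)

lemma diff_add_diff:
  "a \<in> carrier G \<Longrightarrow> b \<in> carrier G \<Longrightarrow> x \<in> carrier G \<Longrightarrow> y \<in> carrier G \<Longrightarrow>
    (a \<oplus> b) \<ominus> (x \<oplus> y) = (a \<ominus> x) \<oplus> (b \<ominus> y)"
  by (simp add: a_minus_def minus_add a_ac)

lemma minus_diff: "x \<in> carrier G \<Longrightarrow> y \<in> carrier G \<Longrightarrow> \<ominus> (x \<ominus> y) = y \<ominus> x"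
  by (simp add: a_minus_def minus_add a_comm)

end

lemma gmod_homI:
  assumes "\<And>x. x \<in> carrier M \<Longrightarrow> f x \<in> carrier N"
    "\<And>x y. x \<in> carrier M \<Longrightarrow> y \<in> carrier M \<Longrightarrow> f (x \<oplus>\<^bsub>M\<^esub> y) = f x \<oplus>\<^bsub>N\<^esub> f y"
    "\<And>a x. a \<in> carrier (sym_alg d) \<Longrightarrow> x \<in> carrier M \<Longrightarrow> f (a \<odot>\<^bsub>M\<^esub> x) = a \<odot>\<^bsub>N\<^esub> f x"
    "\<And>n x. x \<in> hcomp M n \<Longrightarrow> f x \<in> hcomp N n"
  shows "f \<in> gmod_hom d M N"
  using assms by (auto simp: gmod_hom_def hom_def)

lemma gmod_homD:
  assumes "f \<in> gmod_hom d M N"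
  shows "x \<in> carrier M \<Longrightarrow> f x \<in> carrier N"
    "x \<in> carrier M \<Longrightarrow> y \<in> carrier M \<Longrightarrow> f (x \<oplus>\<^bsub>M\<^esub> y) = f x \<oplus>\<^bsub>N\<^esub> f y"
    "a \<in> carrier (sym_alg d) \<Longrightarrow> x \<in> carrier M \<Longrightarrow> f (a \<odot>\<^bsub>M\<^esub> x) = a \<odot>\<^bsub>N\<^esub> f x"
    "x \<in> hcomp M n \<Longrightarrow> f x \<in> hcomp N n"
  using assms by (auto simp: gmod_hom_def hom_def image_subset_iff)

lemma gmod_hom_comp:
  "f \<in> gmod_hom d M N \<Longrightarrow> g \<in> gmod_hom d N P \<Longrightarrow> (\<lambda>x. g (f x)) \<in> gmod_hom d M P"
  by (rule gmod_homI) (auto simp: gmod_homD)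

locale ghom = M: gmod d M + N: gmod d N
  for d and M :: "(cpoly, 'b) gmodule" and N :: "(cpoly, 'c) gmodule" +
  fixes f assumes f: "f \<in> gmod_hom d M N"
begin

lemmas closed = gmod_homD(1)[OF f] and add = gmod_homD(2)[OF f] and smult = gmod_homD(3)[OF f]
  and hcomp = gmod_homD(4)[OF f]

lemma zero: "f \<zero>\<^bsub>M\<^esub> = \<zero>\<^bsub>N\<^esub>"
  using smult[of 0 "\<zero>\<^bsub>M\<^esub>"] closed[of "\<zero>\<^bsub>M\<^esub>"] by simp

lemma neg: "x \<in> carrier M \<Longrightarrow> f (\<ominus>\<^bsub>M\<^esub> x) = \<ominus>\<^bsub>N\<^esub> f x"
  using smult[of "- 1" x] M.smult_neg[of 1 x] N.smult_neg[of 1 "f x"] closed[of x] by simp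

lemma diff: "x \<in> carrier M \<Longrightarrow> y \<in> carrier M \<Longrightarrow> f (x \<ominus>\<^bsub>M\<^esub> y) = f x \<ominus>\<^bsub>N\<^esub> f y"
  by (simp add: a_minus_def add neg)

lemma finsum: "g \<in> I \<rightarrow> carrier M \<Longrightarrow> f (\<Oplus>\<^bsub>M\<^esub>i\<in>I. g i) = (\<Oplus>\<^bsub>N\<^esub>i\<in>I. f (g i))"
  by (rule finsum_hom) (auto simp: closed add zero M.M.abelian_monoid_axioms N.M.abelian_monoid_axioms)

lemma gcomp: "x \<in> carrier M \<Longrightarrow> gcomp N n (f x) = f (gcomp M n x)"
proof (rule N.gcomp_unique)
  assume x: "x \<in> carrier M"
  show "f (gcomp M n x) \<in> hcomp N n" for n using hcomp M.gcomp_decomp(1)[OF x] .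
  show "finite {n. gcomp M n x \<noteq> \<zero>\<^bsub>M\<^esub>}" using M.gcomp_decomp(2)[OF x] .
  show "f x = (\<Oplus>\<^bsub>N\<^esub>n\<in>{n. gcomp M n x \<noteq> \<zero>\<^bsub>M\<^esub>}. f (gcomp M n x))"
    by (subst M.gcomp_decomp(3)[OF x], rule finsum) (use M.gcomp_carrier[OF x] in auto)
qed (auto simp: zero)

lemma kernel: "gsub d M {x \<in> carrier M. f x = \<zero>\<^bsub>N\<^esub>}"
  by (rule M.gsubI) (auto simp: zero add smult M.gcomp_carrier simp flip: gcomp)

lemma image_gsub:
  assumes "gsub d M C" shows "gsub d N (f ` C)"
proof (rule N.gsubI)
  note C = gsubD[OF assms]
  show "f ` C \<subseteq> carrier N" using C(3) closed by auto
  show "\<zero>\<^bsub>N\<^esub> \<in> f ` C" using imageI[OF C(4), of f] zero by simp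
  fix x assume "x \<in> f ` C"
  then obtain u where u: "u \<in> C" "x = f u" by blast
  hence uc: "u \<in> carrier M" using C(3) by simp
  show "x \<oplus>\<^bsub>N\<^esub> y \<in> f ` C" if y: "y \<in> f ` C" for y
  proof -
    from y obtain v where v: "v \<in> C" "y = f v" by blast
    thus ?thesis using imageI[OF C(5)[OF u(1) v(1)], of f] add[OF uc C(3)[OF v(1)]] u by simp
  qed
  show "a \<odot>\<^bsub>N\<^esub> x \<in> f ` C" if a: "a \<in> carrier (sym_alg d)" for a
    using imageI[OF C(8)[OF a u(1)], of f] smult[OF a uc] u by simp
  show "gcomp N n x \<in> f ` C" for n
    using imageI[OF C(9)[OF u(1)], of f] gcomp[OF uc] u by simp
qed

end

lemma ghomI: "graded_module d M \<Longrightarrow> graded_module d N \<Longrightarrow> f \<in> gmod_hom d M N \<Longrightarrow> ghom d M N f"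
  by (simp add: ghom_def gmod_def ghom_axioms_def)

lemma gmod_iso_inv:
  assumes "graded_module d M" "graded_module d N" "f \<in> gmod_iso d M N"
  shows "inv_into (carrier M) f \<in> gmod_iso d N M"
proof -
  interpret ghom d M N f using assms by (auto intro: ghomI simp: gmod_iso_def)
  have b: "bij_betw f (carrier M) (carrier N)" using assms(3) by (simp add: gmod_iso_def)
  let ?g = "inv_into (carrier M) f"
  have g: "?g y \<in> carrier M" "f (?g y) = y" if "y \<in> carrier N" for y
    using b that bij_betw_inv_into_right[OF b] bij_betwE[OF bij_betw_inv_into[OF b]] by auto
  have gf: "?g (f x) = x" if "x \<in> carrier M" for x
    using b that by (simp add: bij_betw_def)
  have "?g \<in> gmod_hom d N M"
  proof (rule gmod_homI)
    fix x y assume xy: "x \<in> carrier N" "y \<in> carrier N"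
    have "?g (x \<oplus>\<^bsub>N\<^esub> y) = ?g (f (?g x \<oplus>\<^bsub>M\<^esub> ?g y))" using xy g by (simp add: add)
    thus "?g (x \<oplus>\<^bsub>N\<^esub> y) = ?g x \<oplus>\<^bsub>M\<^esub> ?g y" using xy g gf by simp
  next
    fix a x assume ax: "a \<in> carrier (sym_alg d)" "x \<in> carrier N"
    have "?g (a \<odot>\<^bsub>N\<^esub> x) = ?g (f (a \<odot>\<^bsub>M\<^esub> ?g x))" using ax g by (simp add: smult)
    thus "?g (a \<odot>\<^bsub>N\<^esub> x) = a \<odot>\<^bsub>M\<^esub> ?g x" using ax g gf by simp
  next
    fix n y assume y: "y \<in> hcomp N n"
    hence yc: "y \<in> carrier N" by (rule N.hcomp_closed)
    \<comment> \<open>The inverse respects degrees: \<open>f\<close> maps the degree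
      \<open>n\<close> component of the preimage to \<open>y\<close> too, so by injectivity the
      preimage is its own component.\<close>
    have "f (gcomp M n (?g y)) = y"
      using gcomp[OF g(1)[OF yc], of n] N.gcomp_hcomp[OF y] g(2)[OF yc] by simp
    hence "?g y = gcomp M n (?g y)" using gf[OF M.gcomp_carrier[OF g(1)[OF yc]]] by metis
    thus "?g y \<in> hcomp M n" using M.gcomp_decomp(1)[OF g(1)[OF yc]] by metis
  qed (use g in auto)
  thus ?thesis using b by (simp add: gmod_iso_def bij_betw_inv_into)
qed

section \<open>Graded submodules and quotients as modules in their own right\<close>

lemma sub_gmodule_simps [simp]:
  "carrier (sub_gmodule C M) = C" "x \<oplus>\<^bsub>sub_gmodule C M\<^esub> y = x \<oplus>\<^bsub>M\<^esub> y" "\<zero>\<^bsub>sub_gmodule C M\<^esub> = \<zero>\<^bsub>M\<^esub>"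
  "a \<odot>\<^bsub>sub_gmodule C M\<^esub> x = a \<odot>\<^bsub>M\<^esub> x" "hcomp (sub_gmodule C M) n = hcomp M n \<inter> C"
  by (simp_all add: sub_gmodule_def)

lemma module_subgroupI:
  assumes "Module.module (sym_alg d) M" "H \<subseteq> carrier M" "\<zero>\<^bsub>M\<^esub> \<in> H"
    "\<And>x y. x \<in> H \<Longrightarrow> y \<in> H \<Longrightarrow> x \<oplus>\<^bsub>M\<^esub> y \<in> H" "\<And>x. x \<in> H \<Longrightarrow> \<ominus>\<^bsub>M\<^esub> x \<in> H"
  shows "subgroup H (add_monoid M)"
  using assms by (intro subgroup.intro) (auto simp: a_inv_def)

context gmod
begin

lemma module_sub:
  assumes "submodule C (sym_alg d) M"
  shows "Module.module (sym_alg d) (sub_gmodule C M)"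
proof -
  note C = submodule_closed[OF assms]
  show ?thesis
  proof (intro moduleI abelian_groupI cring_sym_alg)
    fix x assume "x \<in> carrier (sub_gmodule C M)"
    thus "\<exists>y\<in>carrier (sub_gmodule C M). y \<oplus>\<^bsub>sub_gmodule C M\<^esub> x = \<zero>\<^bsub>sub_gmodule C M\<^esub>"
      using C(2,5) M.l_neg by (intro bexI[of _ "\<ominus> x"]) auto
  qed (use C in \<open>auto simp: M.a_ac smult_add smult_r_distr smult_mult\<close>)
qed

text \<open>A finite generating set is supplied by hand here; \<open>gsub_graded\<close> obtains it
  from Noetherianity later.\<close>

lemma graded_sub:
  assumes C: "gsub d M C" and B: "finite B" "B \<subseteq> C" "C \<subseteq> mgen d M B"
  shows "graded_module d (sub_gmodule C M)" "x \<in> C \<Longrightarrow> gcomp (sub_gmodule C M) n x = gcomp M n x"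
proof -
  note c = gsubD[OF C]
  let ?C = "sub_gmodule C M"
  have mod: "Module.module (sym_alg d) ?C" using module_sub[OF c(1)] .
  interpret S: Module.module "sym_alg d" ?C by fact
  have inv: "\<ominus>\<^bsub>?C\<^esub> x = \<ominus> x" if "x \<in> C" for x
    by (rule S.minus_equality) (use that c(3,6) M.l_neg in auto)
  \<comment> \<open>A submodule of the submodule is a submodule of \<open>M\<close>, so generation
    inside \<open>C\<close> can be compared with generation inside \<open>M\<close>.\<close>
  have sub: "submodule (mgen d ?C B) (sym_alg d) M"
  proof -
    have s: "submodule (mgen d ?C B) (sym_alg d) ?C" using submodule_mgen[OF mod] B by simp
    note s = submodule_closed[OF s, simplified]
    show ?thesis by (rule submoduleI) (use s inv c in fastforce)+
  qed
  have gen: "C \<subseteq> mgen d ?C B"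
    using mgen_least[OF sub, of B] mgen_subset[of B d ?C] B(3) by auto
  have *: "graded_module d ?C \<and> (\<forall>x\<in>carrier ?C. \<forall>n. gcomp ?C n x = gcomp M n x)"
  proof (rule graded_moduleI[of d ?C B "gcomp M", OF mod B(1)])
    fix n
    show "subgroup (hcomp ?C n) (add_monoid ?C)"
      by (rule module_subgroupI[OF mod]) (use c hcomp_closed inv in auto)
  next
    fix S x assume S: "S \<subseteq> carrier ?C" "\<zero>\<^bsub>?C\<^esub> \<in> S" "\<And>x y. x \<in> S \<Longrightarrow> y \<in> S \<Longrightarrow> x \<oplus>\<^bsub>?C\<^esub> y \<in> S"
      "\<And>n. hcomp ?C n \<subseteq> S" "x \<in> carrier ?C"
    show "x \<in> S"
    proof (rule homogeneous_induct)
      show "gcomp M n x \<in> S" for n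
        using S(4)[of n] S(5) c(3,9) gcomp_decomp(1)[of x n] by auto
    qed (use S c in auto)
  next
    show "x \<in> hcomp ?C k \<Longrightarrow> gcomp M n x = (if n = k then x else \<zero>\<^bsub>?C\<^esub>)" for n k x
      using gcomp_hcomp by auto
  next
    show "a \<odot>\<^bsub>?C\<^esub> m \<in> hcomp ?C (i + j)" if "a \<in> hcomp (sym_alg d) i" "m \<in> hcomp ?C j" for i j a m
      using that hcomp_smult c(8) by (simp add: sym_alg_hcomp)
    show "gcomp M n (x \<oplus>\<^bsub>?C\<^esub> y) = gcomp M n x \<oplus>\<^bsub>?C\<^esub> gcomp M n y"
      if "x \<in> carrier ?C" "y \<in> carrier ?C" for n x y
      using that gcomp_add c(3) by simp
    show "gcomp M n x \<in> hcomp ?C n" if "x \<in> carrier ?C" for n x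
      using that gcomp_decomp(1) c(3,9) by simp
  qed (use B gen in auto)
  show "graded_module d ?C" using * by blast
  show "x \<in> C \<Longrightarrow> gcomp ?C n x = gcomp M n x" using * by simp
qed

end

text \<open>Transport of the module structure along a map \<open>q\<close>: the operations act on
  chosen preimages. This is meaningful when the fibres of \<open>q\<close> are the cosets of a
  submodule, and it then models the quotient on the values of \<open>q\<close>.\<close>

definition img_gmodule :: "('b \<Rightarrow> 'c) \<Rightarrow> (cpoly, 'b) gmodule \<Rightarrow> (cpoly, 'c) gmodule" where
  "img_gmodule q M = \<lparr>carrier = q ` carrier M, monoid.mult = undefined, one = undefined,
     zero = q \<zero>\<^bsub>M\<^esub>,
     add = (\<lambda>X Y. q (inv_into (carrier M) q X \<oplus>\<^bsub>M\<^esub> inv_into (carrier M) q Y)),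
     smult = (\<lambda>a X. q (a \<odot>\<^bsub>M\<^esub> inv_into (carrier M) q X)),
     hcomp = (\<lambda>n. q ` hcomp M n)\<rparr>"

text \<open>The second hypothesis says that the fibres of \<open>q\<close> are the cosets of
  \<open>C\<close>, so the choice of preimages in \<open>img_gmodule\<close> does not affect the
  operations. It is instantiated with the coset map in \<open>quotient_exists\<close>.\<close>

lemma (in gmod) graded_img:
  assumes C: "gsub d M C"
    and q: "\<And>x y. x \<in> carrier M \<Longrightarrow> y \<in> carrier M \<Longrightarrow> q x = q y \<longleftrightarrow> x \<ominus> y \<in> C"
  shows "graded_module d (img_gmodule q M)" "q \<in> gmod_hom d M (img_gmodule q M)"
    "q ` carrier M = carrier (img_gmodule q M)" "{m \<in> carrier M. q m = \<zero>\<^bsub>img_gmodule q M\<^esub>} = C"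
proof -
  note c = gsubD[OF C]
  let ?Q = "img_gmodule q M"
  define r where "r = inv_into (carrier M) q"
  have r: "r (q x) \<in> carrier M" "q (r (q x)) = q x" if "x \<in> carrier M" for x
    using that by (auto simp: r_def inv_into_into f_inv_into_f)
  have qz: "q x = q \<zero> \<longleftrightarrow> x \<in> C" if "x \<in> carrier M" for x
    using q[OF that M.zero_closed] that M.add_diff_self[of \<zero> x]
    by (simp add: M.diff_closed)
  have simps: "carrier ?Q = q ` carrier M" "\<zero>\<^bsub>?Q\<^esub> = q \<zero>" "hcomp ?Q n = q ` hcomp M n" for n
    by (simp_all add: img_gmodule_def)
  have add: "q x \<oplus>\<^bsub>?Q\<^esub> q y = q (x \<oplus> y)" if "x \<in> carrier M" "y \<in> carrier M" for x y
  proof -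
    have "q x \<oplus>\<^bsub>?Q\<^esub> q y = q (r (q x) \<oplus> r (q y))" by (simp add: img_gmodule_def r_def)
    also have "\<dots> = q (x \<oplus> y)"
      using that r c(5) by (subst q) (auto simp: M.diff_add_diff simp flip: q)
    finally show ?thesis .
  qed
  have smult: "a \<odot>\<^bsub>?Q\<^esub> q x = q (a \<odot> x)" if "a \<in> carrier (sym_alg d)" "x \<in> carrier M" for a x
  proof -
    have "a \<odot>\<^bsub>?Q\<^esub> q x = q (a \<odot> r (q x))" by (simp add: img_gmodule_def r_def)
    also have "\<dots> = q (a \<odot> x)"
    proof (subst q)
      have "a \<odot> r (q x) \<ominus> a \<odot> x = a \<odot> (r (q x) \<ominus> x)"
        using that r by (simp add: a_minus_def smult_r_distr smult_r_minus)
      thus "a \<odot> r (q x) \<ominus> a \<odot> x \<in> C" using c(8) q that r by metis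
    qed (use that r in auto)
    finally show ?thesis .
  qed
  have mod: "Module.module (sym_alg d) ?Q"
  proof (intro moduleI abelian_groupI cring_sym_alg)
    fix x assume "x \<in> carrier ?Q"
    then obtain y where y: "y \<in> carrier M" "x = q y" by (auto simp: simps)
    show "\<exists>y\<in>carrier ?Q. y \<oplus>\<^bsub>?Q\<^esub> x = \<zero>\<^bsub>?Q\<^esub>"
      using y by (intro bexI[of _ "q (\<ominus> y)"]) (auto simp: simps add M.l_neg)
  qed (auto simp: simps add smult M.a_ac smult_add smult_r_distr smult_mult)
  interpret Q: Module.module "sym_alg d" ?Q by fact
  have inv: "\<ominus>\<^bsub>?Q\<^esub> q x = q (\<ominus> x)" if "x \<in> carrier M" for x
    by (rule Q.minus_equality) (use that in \<open>auto simp: simps add M.l_neg\<close>)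
  have pre: "submodule {x \<in> carrier M. q x \<in> S} (sym_alg d) M" if "submodule S (sym_alg d) ?Q" for S
    by (rule submoduleI) (use submodule_closed[OF that] in \<open>auto simp: simps simp flip: add smult inv\<close>)
  obtain B where B: "finite B" "B \<subseteq> carrier M" "carrier M \<subseteq> mgen d M B" using fin_gen by blast
  have sg: "submodule (mgen d ?Q (q ` B)) (sym_alg d) ?Q"
    by (rule submodule_mgen[OF mod]) (use B in \<open>auto simp: simps\<close>)
  have gen: "carrier ?Q \<subseteq> mgen d ?Q (q ` B)"
  proof -
    have "mgen d M B \<subseteq> {x \<in> carrier M. q x \<in> mgen d ?Q (q ` B)}"
      by (rule mgen_least[OF pre[OF sg]]) (use B(2) mgen_subset[of "q ` B" d ?Q] in auto)
    thus ?thesis using B(3) by (auto simp: simps)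
  qed
  define p where "p n X = q (gcomp M n (r X))" for n X
  have p: "p n (q x) = q (gcomp M n x)" if "x \<in> carrier M" for n x
  proof -
    have "gcomp M n (r (q x)) \<ominus> gcomp M n x = gcomp M n (r (q x) \<ominus> x)"
      using that r gcomp_add[of "r (q x) \<ominus> x" x n] gcomp_carrier[of _ n]
        M.diff_add_self[of "gcomp M n (r (q x) \<ominus> x)" "gcomp M n x"]
        M.add_diff_self[of x "r (q x)"] M.a_comm[of x] M.diff_closed by simp
    also have "\<dots> \<in> C" using c(9) q that r by metis
    finally show ?thesis unfolding p_def using that r gcomp_carrier by (subst q) auto
  qed
  show gm: "graded_module d ?Q"
  proof (rule conjunct1[OF graded_moduleI[of d ?Q "q ` B" p, OF mod]])
    fix n
    show "subgroup (hcomp ?Q n) (add_monoid ?Q)"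
      by (rule module_subgroupI[OF mod])
        (use hcomp_closed in \<open>auto simp: simps add inv intro!: imageI\<close>)
  next
    fix S x assume S: "S \<subseteq> carrier ?Q" "\<zero>\<^bsub>?Q\<^esub> \<in> S" "\<And>x y. x \<in> S \<Longrightarrow> y \<in> S \<Longrightarrow> x \<oplus>\<^bsub>?Q\<^esub> y \<in> S"
      "\<And>n. hcomp ?Q n \<subseteq> S" "x \<in> carrier ?Q"
    obtain y where y: "y \<in> carrier M" "x = q y" using S(5) by (auto simp: simps)
    have "y \<in> {y \<in> carrier M. q y \<in> S}"
    proof (rule homogeneous_induct)
      show "gcomp M n y \<in> {y \<in> carrier M. q y \<in> S}" for n
        using S(4)[of n] gcomp_decomp(1)[OF y(1), of n] gcomp_carrier[OF y(1)] by (auto simp: simps)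
    qed (use S(2,3) y in \<open>auto simp: simps simp flip: add\<close>)
    thus "x \<in> S" using y by simp
  next
    show "p n x = (if n = k then x else \<zero>\<^bsub>?Q\<^esub>)" if "x \<in> hcomp ?Q k" for n k x
      using that gcomp_hcomp hcomp_closed by (auto simp: simps p)
  next
    fix i j a m assume "a \<in> hcomp (sym_alg d) i" "m \<in> hcomp ?Q j"
    thus "a \<odot>\<^bsub>?Q\<^esub> m \<in> hcomp ?Q (i + j)"
      using hcomp_smult hcomp_closed(1) by (auto simp: simps smult sym_alg_hcomp intro!: imageI)
  next
    show "p n (x \<oplus>\<^bsub>?Q\<^esub> y) = p n x \<oplus>\<^bsub>?Q\<^esub> p n y" if "x \<in> carrier ?Q" "y \<in> carrier ?Q" for n x y
      using that gcomp_add gcomp_carrier by (auto simp: simps add p)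
  next
    show "p n x \<in> hcomp ?Q n" if "x \<in> carrier ?Q" for n x
      using that gcomp_decomp(1) by (auto simp: simps p)
  qed (use B gen in \<open>auto simp: simps\<close>)
  show "q \<in> gmod_hom d M ?Q"
    by (rule gmod_homI) (auto simp: simps add smult)
  show "q ` carrier M = carrier ?Q" by (simp add: simps)
  show "{m \<in> carrier M. q m = \<zero>\<^bsub>?Q\<^esub>} = C" using qz c(3) by (auto simp: simps)
qed

section \<open>Shifts of the grading\<close>

lemma shift_gmodule_simps [simp]:
  "carrier (shift_gmodule k M) = carrier M" "x \<oplus>\<^bsub>shift_gmodule k M\<^esub> y = x \<oplus>\<^bsub>M\<^esub> y"
  "\<zero>\<^bsub>shift_gmodule k M\<^esub> = \<zero>\<^bsub>M\<^esub>" "a \<odot>\<^bsub>shift_gmodule k M\<^esub> x = a \<odot>\<^bsub>M\<^esub> x"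
  "hcomp (shift_gmodule k M) n = hcomp M (n + k)"
  by (simp_all add: shift_gmodule_def)

lemma mgen_shift [simp]: "mgen d (shift_gmodule k M) B = mgen d M B"
  by (simp add: mgen_def submodule_def submodule_axioms_def shift_gmodule_def)

lemma mod_span_shift [simp]: "mod_span W (shift_gmodule k M) = mod_span W M"
  by (simp add: mod_span_def shift_gmodule_def)

lemma (in gmod) graded_shift:
  shows "graded_module d (shift_gmodule k M)"
    "x \<in> carrier M \<Longrightarrow> gcomp (shift_gmodule k M) n x = gcomp M (n + k) x"
proof -
  let ?S = "shift_gmodule k M"
  have mod: "Module.module (sym_alg d) ?S"
    using module_axioms
    by (simp add: shift_gmodule_def module_def abelian_group_def abelian_monoid_def
        abelian_group_axioms_def module_axioms_def)
  obtain B where B: "finite B" "B \<subseteq> carrier M" "carrier M \<subseteq> mgen d M B" using fin_gen by blast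
  have *: "graded_module d ?S \<and> (\<forall>x\<in>carrier ?S. \<forall>n. gcomp ?S n x = gcomp M (n + k) x)"
  proof (rule graded_moduleI[of d ?S B "\<lambda>n. gcomp M (n + k)", OF mod B(1)])
    show "subgroup (hcomp ?S n) (add_monoid ?S)" for n
      using hcomp_subgroup[of "n + k"] by (simp add: shift_gmodule_def)
  next
    fix S x assume S: "S \<subseteq> carrier ?S" "\<zero>\<^bsub>?S\<^esub> \<in> S" "\<And>x y. x \<in> S \<Longrightarrow> y \<in> S \<Longrightarrow> x \<oplus>\<^bsub>?S\<^esub> y \<in> S"
      "\<And>n. hcomp ?S n \<subseteq> S" "x \<in> carrier ?S"
    have "hcomp M n \<subseteq> S" for n using S(4)[of "n - k"] by simp
    note h = this
    show "x \<in> S"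
    proof (rule homogeneous_induct)
      show "gcomp M n x \<in> S" for n
        using h[of n] S(5) gcomp_decomp(1)[of x n] by auto
    qed (use S in auto)
  next
    show "a \<odot>\<^bsub>?S\<^esub> m \<in> hcomp ?S (i + j)" if "a \<in> hcomp (sym_alg d) i" "m \<in> hcomp ?S j" for i j a m
      using hcomp_smult[OF that(1), of m "j + k"] that(2) by (simp add: add.assoc)
  next
    show "gcomp M (n + k) x \<in> hcomp ?S n" if "x \<in> carrier ?S" for n x
      using that gcomp_decomp(1) by simp
    show "gcomp M (n + k) (x \<oplus>\<^bsub>?S\<^esub> y) = gcomp M (n + k) x \<oplus>\<^bsub>?S\<^esub> gcomp M (n + k) y"
      if "x \<in> carrier ?S" "y \<in> carrier ?S" for n x y
      using that gcomp_add by simp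
    show "gcomp M (n + k) x = (if n = k' then x else \<zero>\<^bsub>?S\<^esub>)" if "x \<in> hcomp ?S k'" for n k' x
      using that gcomp_hcomp by simp
  qed (use B in auto)
  show "graded_module d ?S" using * by blast
  show "x \<in> carrier M \<Longrightarrow> gcomp ?S n x = gcomp M (n + k) x" using * by simp
qed

section \<open>Direct sums\<close>

text \<open>A zero module on an arbitrary type; it fills the places outside
  \<open>graph_below\<close> when a sheaf is extended by zero.\<close>

definition zero_mod :: "'b \<Rightarrow> (cpoly, 'b) gmodule" where
  "zero_mod c = \<lparr>carrier = {c}, monoid.mult = undefined, one = undefined, zero = c,
     add = (\<lambda>_ _. c), smult = (\<lambda>_ _. c), hcomp = (\<lambda>_. {c})\<rparr>"

lemma graded_zero_mod: "graded_module d (zero_mod c)"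
proof -
  have mod: "Module.module (sym_alg d) (zero_mod c)"
    by (intro moduleI abelian_groupI cring_sym_alg) (auto simp: zero_mod_def)
  have "submodule (mgen d (zero_mod c) {}) (sym_alg d) (zero_mod c)"
    by (rule submodule_mgen[OF mod]) simp
  hence gen: "carrier (zero_mod c) \<subseteq> mgen d (zero_mod c) {}"
    using submodule_closed(3) by (fastforce simp: zero_mod_def)
  show ?thesis
  proof (rule conjunct1[OF graded_moduleI[of d "zero_mod c" "{}" "\<lambda>_ _. c", OF mod]])
    show "subgroup (hcomp (zero_mod c) n) (add_monoid (zero_mod c))" for n
      by (rule module_subgroupI[OF mod])
        (use abelian_group.a_inv_closed[OF module.axioms(2)[OF mod]] in \<open>auto simp: zero_mod_def\<close>)
  qed (use gen in \<open>auto simp: zero_mod_def\<close>)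
qed

lemma dsum_gmodule_simps [simp]:
  "carrier (dsum_gmodule I M) = (\<Pi>\<^sub>E i\<in>I. carrier (M i))"
  "\<zero>\<^bsub>dsum_gmodule I M\<^esub> = (\<lambda>i\<in>I. \<zero>\<^bsub>M i\<^esub>)"
  "f \<oplus>\<^bsub>dsum_gmodule I M\<^esub> g = (\<lambda>i\<in>I. f i \<oplus>\<^bsub>M i\<^esub> g i)"
  "a \<odot>\<^bsub>dsum_gmodule I M\<^esub> f = (\<lambda>i\<in>I. a \<odot>\<^bsub>M i\<^esub> f i)"
  "hcomp (dsum_gmodule I M) n = (\<Pi>\<^sub>E i\<in>I. hcomp (M i) n)"
  by (simp_all add: dsum_gmodule_def)

definition dinj :: "'i set \<Rightarrow> ('i \<Rightarrow> (cpoly, 'b) gmodule) \<Rightarrow> 'i \<Rightarrow> 'b \<Rightarrow> 'i \<Rightarrow> 'b" where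
  "dinj I M i x = (\<lambda>j\<in>I. if j = i then x else \<zero>\<^bsub>M j\<^esub>)"

locale gfam =
  fixes d :: nat and I :: "'i set" and M :: "'i \<Rightarrow> (cpoly, 'b) gmodule"
  assumes fin: "finite I" and gmod: "\<And>i. i \<in> I \<Longrightarrow> graded_module d (M i)"
begin

abbreviation D where "D \<equiv> dsum_gmodule I M"

lemma gm: "i \<in> I \<Longrightarrow> gmod d (M i)"
  using gmod by (simp add: gmod_def)

lemma m: "i \<in> I \<Longrightarrow> Module.module (sym_alg d) (M i)"
  using gmod by (simp add: graded_module_def)

lemma ag: "i \<in> I \<Longrightarrow> abelian_group (M i)"
  using m by (simp add: module_def)

lemmas mc = abelian_monoid.zero_closed[OF abelian_group.axioms(1)[OF ag]]
  abelian_monoid.a_closed[OF abelian_group.axioms(1)[OF ag]]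
  abelian_group.a_inv_closed[OF ag] module.smult_closed[OF m]

lemma module_dsum: "Module.module (sym_alg d) D"
proof (intro moduleI abelian_groupI cring_sym_alg)
  fix x y assume x: "x \<in> carrier D" and y: "y \<in> carrier D"
  hence xi: "x i \<in> carrier (M i)" "y i \<in> carrier (M i)" if "i \<in> I" for i using that by auto
  have xu: "x i = undefined" if "i \<notin> I" for i
    using x PiE_arb[of x I "\<lambda>i. carrier (M i)" i] that by simp
  show "x \<oplus>\<^bsub>D\<^esub> y \<in> carrier D" using xi by (simp add: PiE_iff mc)
  show "x \<oplus>\<^bsub>D\<^esub> y = y \<oplus>\<^bsub>D\<^esub> x"
    by (simp, intro restrict_ext abelian_monoid.a_comm[OF abelian_group.axioms(1)[OF ag]] xi)
  show "\<zero>\<^bsub>D\<^esub> \<oplus>\<^bsub>D\<^esub> x = x"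
    using xi by (auto simp: fun_eq_iff restrict_def xu
        abelian_monoid.l_zero[OF abelian_group.axioms(1)[OF ag]])
  show "\<exists>y\<in>carrier D. y \<oplus>\<^bsub>D\<^esub> x = \<zero>\<^bsub>D\<^esub>"
    using xi by (intro bexI[of _ "\<lambda>i\<in>I. \<ominus>\<^bsub>M i\<^esub> x i"])
      (auto simp: fun_eq_iff restrict_def abelian_group.l_neg[OF ag] mc)
  show "x \<oplus>\<^bsub>D\<^esub> y \<oplus>\<^bsub>D\<^esub> z = x \<oplus>\<^bsub>D\<^esub> (y \<oplus>\<^bsub>D\<^esub> z)" if "z \<in> carrier D" for z
    using xi that by (auto simp: fun_eq_iff restrict_def PiE_iff
        abelian_monoid.a_assoc[OF abelian_group.axioms(1)[OF ag]])
  show "a \<odot>\<^bsub>D\<^esub> x \<in> carrier D" if "a \<in> carrier (sym_alg d)" for a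
    using xi that by (auto intro: mc)
  show "(a \<oplus>\<^bsub>sym_alg d\<^esub> b) \<odot>\<^bsub>D\<^esub> x = a \<odot>\<^bsub>D\<^esub> x \<oplus>\<^bsub>D\<^esub> b \<odot>\<^bsub>D\<^esub> x"
    if "a \<in> carrier (sym_alg d)" "b \<in> carrier (sym_alg d)" for a b
    using xi that by (auto simp: fun_eq_iff restrict_def gmod.smult_add[OF gm])
  show "a \<odot>\<^bsub>D\<^esub> (x \<oplus>\<^bsub>D\<^esub> y) = a \<odot>\<^bsub>D\<^esub> x \<oplus>\<^bsub>D\<^esub> a \<odot>\<^bsub>D\<^esub> y" if "a \<in> carrier (sym_alg d)" for a
    using xi that by (auto simp: fun_eq_iff restrict_def module.smult_r_distr[OF m])
  show "(a \<otimes>\<^bsub>sym_alg d\<^esub> b) \<odot>\<^bsub>D\<^esub> x = a \<odot>\<^bsub>D\<^esub> (b \<odot>\<^bsub>D\<^esub> x)"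
    if "a \<in> carrier (sym_alg d)" "b \<in> carrier (sym_alg d)" for a b
    using xi that by (auto simp: fun_eq_iff restrict_def gmod.smult_mult[OF gm])
  show "\<one>\<^bsub>sym_alg d\<^esub> \<odot>\<^bsub>D\<^esub> x = x"
    using xi by (auto simp: fun_eq_iff restrict_def xu gmod.smult_1[OF gm])
qed (auto intro: mc)

sublocale D: Module.module "sym_alg d" D
  by (rule module_dsum)

lemma proj_hom: "i \<in> I \<Longrightarrow> (\<lambda>f. f i) \<in> gmod_hom d D (M i)"
  by (rule gmod_homI) auto

lemma dinj_hom: "i \<in> I \<Longrightarrow> dinj I M i \<in> gmod_hom d (M i) D"
proof (rule gmod_homI)
  assume i: "i \<in> I"
  have z: "\<zero>\<^bsub>M j\<^esub> \<oplus>\<^bsub>M j\<^esub> \<zero>\<^bsub>M j\<^esub> = \<zero>\<^bsub>M j\<^esub>" if "j \<in> I" for j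
    using that mc by (simp add: abelian_monoid.l_zero[OF abelian_group.axioms(1)[OF ag]])
  show "dinj I M i (x \<oplus>\<^bsub>M i\<^esub> y) = dinj I M i x \<oplus>\<^bsub>D\<^esub> dinj I M i y" for x y
    by (auto simp: dinj_def fun_eq_iff z)
  show "dinj I M i (a \<odot>\<^bsub>M i\<^esub> x) = a \<odot>\<^bsub>D\<^esub> dinj I M i x" if "a \<in> carrier (sym_alg d)" for a x
    using that by (auto simp: dinj_def fun_eq_iff module.smult_r_null[OF m])
  show "dinj I M i x \<in> hcomp D n" if "x \<in> hcomp (M i) n" for n x
    using that gmod.hcomp_closed(2)[OF gm] by (auto simp: dinj_def)
qed (auto simp: dinj_def intro: mc)

lemma neg_apply: "x \<in> carrier D \<Longrightarrow> i \<in> I \<Longrightarrow> (\<ominus>\<^bsub>D\<^esub> x) i = \<ominus>\<^bsub>M i\<^esub> x i"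
proof -
  assume x: "x \<in> carrier D" and i: "i \<in> I"
  have "(\<ominus>\<^bsub>D\<^esub> x) i \<in> carrier (M i)" "x i \<in> carrier (M i)"
    using D.a_inv_closed[OF x] x i by auto
  moreover have "(\<ominus>\<^bsub>D\<^esub> x \<oplus>\<^bsub>D\<^esub> x) i = \<zero>\<^bsub>M i\<^esub>" using D.l_neg[OF x] i by (simp del: dsum_gmodule_simps(3))
  ultimately show ?thesis
    using i abelian_group.minus_equality[OF ag[OF i], of "(\<ominus>\<^bsub>D\<^esub> x) i" "x i"] by simp
qed

lemma finsum_apply:
  assumes "g \<in> J \<rightarrow> carrier D" "i \<in> I"
  shows "(\<Oplus>\<^bsub>D\<^esub>j\<in>J. g j) i = (\<Oplus>\<^bsub>M i\<^esub>j\<in>J. g j i)"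
  using finsum_hom[of D "M i" "\<lambda>f. f i" g J] assms D.M.abelian_monoid_axioms
    abelian_group.axioms(1)[OF ag[OF assms(2)]] by auto

lemma dinj_sum:
  assumes "f \<in> carrier D" shows "f = (\<Oplus>\<^bsub>D\<^esub>i\<in>I. dinj I M i (f i))"
proof
  fix j
  have cl: "(\<lambda>i. dinj I M i (f i)) \<in> I \<rightarrow> carrier D"
    by (intro funcsetI gmod_homD(1)[OF dinj_hom]) (use assms in auto)
  show "f j = (\<Oplus>\<^bsub>D\<^esub>i\<in>I. dinj I M i (f i)) j"
  proof (cases "j \<in> I")
    case True
    interpret Mj: abelian_group "M j" using ag[OF True] .
    have "(\<Oplus>\<^bsub>D\<^esub>i\<in>I. dinj I M i (f i)) j = (\<Oplus>\<^bsub>M j\<^esub>i\<in>I. dinj I M i (f i) j)"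
      by (rule finsum_apply[OF cl True])
    also have "\<dots> = (\<Oplus>\<^bsub>M j\<^esub>i\<in>I. if j = i then f j else \<zero>\<^bsub>M j\<^esub>)"
      by (rule Mj.finsum_cong') (use True assms in \<open>auto simp: dinj_def\<close>)
    also have "\<dots> = f j"
      by (rule Mj.finsum_singleton) (use True assms fin in auto)
    finally show ?thesis by simp
  next
    case False
    have "(\<Oplus>\<^bsub>D\<^esub>i\<in>I. dinj I M i (f i)) \<in> carrier D" using cl by (rule D.finsum_closed)
    thus ?thesis
      using PiE_arb[OF _ False, of f "\<lambda>i. carrier (M i)"] PiE_arb[OF _ False, of _ "\<lambda>i. carrier (M i)"]
        assms by (metis dsum_gmodule_simps(1))
  qed
qed

lemma graded_dsum:
  shows "graded_module d D"
    "x \<in> carrier D \<Longrightarrow> gcomp D n x = (\<lambda>i\<in>I. gcomp (M i) n (x i))"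
proof -
  have "\<exists>B. finite B \<and> B \<subseteq> carrier (M i) \<and> carrier (M i) \<subseteq> mgen d (M i) B" if "i \<in> I" for i
    using gmod.fin_gen[OF gm[OF that]] .
  then obtain B where B: "\<And>i. i \<in> I \<Longrightarrow> finite (B i)" "\<And>i. i \<in> I \<Longrightarrow> B i \<subseteq> carrier (M i)"
    "\<And>i. i \<in> I \<Longrightarrow> carrier (M i) \<subseteq> mgen d (M i) (B i)" by metis
  let ?B = "\<Union>i\<in>I. dinj I M i ` B i"
  have dc: "dinj I M i x \<in> carrier D" if "i \<in> I" "x \<in> carrier (M i)" for i x
    using gmod_homD(1)[OF dinj_hom] that by blast
  have Bc: "?B \<subseteq> carrier D" using B(2) dc by blast
  have sub: "submodule (mgen d D ?B) (sym_alg d) D"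
    using submodule_mgen[OF module_dsum Bc] .
  note s = submodule_closed[OF sub]
  have neg: "dinj I M i (\<ominus>\<^bsub>M i\<^esub> x) = \<ominus>\<^bsub>D\<^esub> dinj I M i x" if i: "i \<in> I" and x: "x \<in> carrier (M i)" for i x
  proof -
    interpret Mi: gmod d "M i" using gm[OF i] .
    have "dinj I M i (\<ominus>\<^bsub>M i\<^esub> x) = dinj I M i ((- 1) \<odot>\<^bsub>M i\<^esub> x)"
      using Mi.smult_neg[of 1 x] x by simp
    also have "\<dots> = (- 1) \<odot>\<^bsub>D\<^esub> dinj I M i x"
      by (rule gmod_homD(3)[OF dinj_hom[OF i]]) (use x in auto)
    also have "\<dots> = \<ominus>\<^bsub>D\<^esub> dinj I M i x"
      using D.smult_l_minus[of 1, OF _ dc[OF i x]] D.smult_one[OF dc[OF i x]]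
      by (simp del: dsum_gmodule_simps)
    finally show ?thesis .
  qed
  have inB: "dinj I M i x \<in> mgen d D ?B" if i: "i \<in> I" and x: "x \<in> carrier (M i)" for i x
  proof -
    interpret Mi: gmod d "M i" using gm[OF i] .
    note h = gmod_homD[OF dinj_hom[OF i]]
    have z: "dinj I M i \<zero>\<^bsub>M i\<^esub> = \<zero>\<^bsub>D\<^esub>" by (auto simp: dinj_def fun_eq_iff)
    \<comment> \<open>The preimage of the generated submodule under the \<open>i\<close>-th
      injection is a submodule of \<open>M i\<close> containing the generators \<open>B i\<close>,
      hence it is all of \<open>M i\<close>.\<close>
    have "submodule {x \<in> carrier (M i). dinj I M i x \<in> mgen d D ?B} (sym_alg d) (M i)"
      by (rule Mi.submoduleI)
        (use s(3-5,7) in \<open>auto simp del: dsum_gmodule_simps simp: h z neg[OF i]\<close>)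
    hence "mgen d (M i) (B i) \<subseteq> {x \<in> carrier (M i). dinj I M i x \<in> mgen d D ?B}"
      by (rule mgen_least) (use B(2) i mgen_subset[of ?B d D] in blast)
    thus ?thesis using x B(3)[OF i] by blast
  qed
  have gen: "carrier D \<subseteq> mgen d D ?B"
  proof
    fix f assume f: "f \<in> carrier D"
    have "(\<Oplus>\<^bsub>D\<^esub>i\<in>I. dinj I M i (f i)) \<in> mgen d D ?B"
      by (rule D.finsum_mem) (use inB f s in auto)
    thus "f \<in> mgen d D ?B" using dinj_sum[OF f] by simp
  qed
  define p where "p n x = (\<lambda>i\<in>I. gcomp (M i) n (x i))" for n x
  have *: "graded_module d D \<and> (\<forall>x\<in>carrier D. \<forall>n. gcomp D n x = p n x)"
  proof (rule graded_moduleI[of d D ?B p, OF module_dsum _ Bc gen])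
    show "finite ?B" using fin B(1) by blast
  next
    fix n
    show "subgroup (hcomp D n) (add_monoid D)"
    proof (rule module_subgroupI[OF module_dsum])
      show sub: "hcomp D n \<subseteq> carrier D" using gmod.hcomp_closed(1)[OF gm] by fastforce
      show "\<zero>\<^bsub>D\<^esub> \<in> hcomp D n" using gmod.hcomp_closed(2)[OF gm] by auto
      show "x \<oplus>\<^bsub>D\<^esub> y \<in> hcomp D n" if "x \<in> hcomp D n" "y \<in> hcomp D n" for x y
        using that gmod.hcomp_closed(3)[OF gm] by (auto simp: PiE_iff)
      show "\<ominus>\<^bsub>D\<^esub> x \<in> hcomp D n" if x: "x \<in> hcomp D n" for x
      proof -
        have xc: "x \<in> carrier D" using x sub by blast
        have "(\<ominus>\<^bsub>D\<^esub> x) i \<in> hcomp (M i) n" if "i \<in> I" for i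
          using gmod.hcomp_closed(4)[OF gm[OF that], of "x i" n] neg_apply[OF xc that] x that by auto
        thus ?thesis using D.a_inv_closed[OF xc] by (simp add: PiE_iff)
      qed
    qed
    fix x y assume x: "x \<in> carrier D" and y: "y \<in> carrier D"
    hence xi: "x i \<in> carrier (M i)" "y i \<in> carrier (M i)" if "i \<in> I" for i using that by auto
    show "p n (x \<oplus>\<^bsub>D\<^esub> y) = p n x \<oplus>\<^bsub>D\<^esub> p n y"
      using xi by (auto simp: p_def fun_eq_iff gmod.gcomp_add[OF gm])
    show "p n x \<in> hcomp D n"
      using xi gmod.gcomp_decomp(1)[OF gm] by (auto simp: p_def)
  next
    show "p n x = (if n = k then x else \<zero>\<^bsub>D\<^esub>)" if "x \<in> hcomp D k" for n k x
    proof
      fix i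
      show "p n x i = (if n = k then x else \<zero>\<^bsub>D\<^esub>) i"
      proof (cases "i \<in> I")
        case True
        hence "x i \<in> hcomp (M i) k" using that by auto
        thus ?thesis using gmod.gcomp_hcomp[OF gm[OF True]] True by (simp add: p_def)
      qed (use that in \<open>auto simp: p_def\<close>)
    qed
    show "a \<odot>\<^bsub>D\<^esub> m \<in> hcomp D (i + j)" if "a \<in> hcomp (sym_alg d) i" "m \<in> hcomp D j" for i j a m
      using that gmod.hcomp_smult[OF gm] by (auto simp: PiE_iff)
  next
    fix S x assume S: "S \<subseteq> carrier D" "\<zero>\<^bsub>D\<^esub> \<in> S" "\<And>x y. x \<in> S \<Longrightarrow> y \<in> S \<Longrightarrow> x \<oplus>\<^bsub>D\<^esub> y \<in> S"
      "\<And>n. hcomp D n \<subseteq> S" "x \<in> carrier D"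
    have "dinj I M i y \<in> S" if i: "i \<in> I" and y: "y \<in> carrier (M i)" for i y
    proof -
      interpret Mi: gmod d "M i" using gm[OF i] .
      note h = gmod_homD[OF dinj_hom[OF i]]
      have z: "dinj I M i \<zero>\<^bsub>M i\<^esub> = \<zero>\<^bsub>D\<^esub>" by (auto simp: dinj_def fun_eq_iff)
      have "y \<in> {y \<in> carrier (M i). dinj I M i y \<in> S}"
      proof (rule Mi.homogeneous_induct)
        show "gcomp (M i) n y \<in> {y \<in> carrier (M i). dinj I M i y \<in> S}" for n
          using subsetD[OF S(4) h(4)[OF Mi.gcomp_decomp(1)[OF y]]] Mi.gcomp_carrier[OF y] by blast
      qed (use S(2,3) y in \<open>auto simp del: dsum_gmodule_simps simp: h z\<close>)
      thus ?thesis by blast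
    qed
    hence "(\<Oplus>\<^bsub>D\<^esub>i\<in>I. dinj I M i (x i)) \<in> S"
      using S(1-3,5) by (intro D.finsum_mem) (auto simp del: dsum_gmodule_simps(2,3) simp: PiE_iff)
    thus "x \<in> S" using dinj_sum[OF S(5)] by simp
  qed
  show "graded_module d D" using * by blast
  show "x \<in> carrier D \<Longrightarrow> gcomp D n x = (\<lambda>i\<in>I. gcomp (M i) n (x i))"
    using * by (simp add: p_def del: dsum_gmodule_simps)
qed

text \<open>Universal property of the finite direct sum: it produces the maps out of free modules
  and, in the decomposition, the map assembled from the lifts of the summands.\<close>

lemma sum_hom:
  assumes N: "graded_module d N" and s: "\<And>i. i \<in> I \<Longrightarrow> s i \<in> gmod_hom d (M i) N"
  shows "(\<lambda>m. \<Oplus>\<^bsub>N\<^esub>i\<in>I. s i (m i)) \<in> gmod_hom d D N"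
proof -
  interpret N: gmod d N using N by (simp add: gmod_def)
  have cl: "s i (m i) \<in> carrier N" if "m \<in> carrier D" "i \<in> I" for m i
    using gmod_homD(1)[OF s[OF that(2)]] that by auto
  show ?thesis
  proof (rule gmod_homI)
    show "(\<Oplus>\<^bsub>N\<^esub>i\<in>I. s i (m i)) \<in> carrier N" if "m \<in> carrier D" for m
      using cl[OF that] by (intro N.finsum_closed) auto
    show "(\<Oplus>\<^bsub>N\<^esub>i\<in>I. s i ((x \<oplus>\<^bsub>D\<^esub> y) i)) = (\<Oplus>\<^bsub>N\<^esub>i\<in>I. s i (x i)) \<oplus>\<^bsub>N\<^esub> (\<Oplus>\<^bsub>N\<^esub>i\<in>I. s i (y i))"
      if x: "x \<in> carrier D" and y: "y \<in> carrier D" for x y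
    proof -
      have "(\<Oplus>\<^bsub>N\<^esub>i\<in>I. s i ((x \<oplus>\<^bsub>D\<^esub> y) i)) = (\<Oplus>\<^bsub>N\<^esub>i\<in>I. s i (x i) \<oplus>\<^bsub>N\<^esub> s i (y i))"
        by (rule N.finsum_cong') (use x y cl gmod_homD(2)[OF s] in \<open>auto simp: PiE_iff\<close>)
      also have "\<dots> = (\<Oplus>\<^bsub>N\<^esub>i\<in>I. s i (x i)) \<oplus>\<^bsub>N\<^esub> (\<Oplus>\<^bsub>N\<^esub>i\<in>I. s i (y i))"
        by (rule N.finsum_addf) (use cl[OF x] cl[OF y] in auto)
      finally show ?thesis .
    qed
    show "(\<Oplus>\<^bsub>N\<^esub>i\<in>I. s i ((a \<odot>\<^bsub>D\<^esub> x) i)) = a \<odot>\<^bsub>N\<^esub> (\<Oplus>\<^bsub>N\<^esub>i\<in>I. s i (x i))"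
      if a: "a \<in> carrier (sym_alg d)" and x: "x \<in> carrier D" for a x
    proof -
      have "(\<Oplus>\<^bsub>N\<^esub>i\<in>I. s i ((a \<odot>\<^bsub>D\<^esub> x) i)) = (\<Oplus>\<^bsub>N\<^esub>i\<in>I. a \<odot>\<^bsub>N\<^esub> s i (x i))"
        by (rule N.finsum_cong') (use x a cl gmod_homD(3)[OF s] in \<open>auto simp: PiE_iff\<close>)
      thus ?thesis using N.finsum_smult_ldistr[OF fin a, of "\<lambda>i. s i (x i)"] cl[OF x] by auto
    qed
    show "(\<Oplus>\<^bsub>N\<^esub>i\<in>I. s i (x i)) \<in> hcomp N n" if x: "x \<in> hcomp D n" for n x
      by (rule N.finsum_mem) (use x gmod_homD(4)[OF s] N.hcomp_closed in auto)
  qed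
qed

end

lemma graded_sym_alg: "graded_module d (sym_alg d)"
  and gcomp_sym_alg: "p \<in> carrier (sym_alg d) \<Longrightarrow>
    Poly_Mapping.lookup (gcomp (sym_alg d) n p) m = (if 2 * int (mdeg m) = n then Poly_Mapping.lookup p m else 0)"
proof -
  let ?A = "sym_alg d"
  note mod = module_sym_alg[of d]
  interpret A: Module.module ?A ?A by (rule mod)
  define h :: "int \<Rightarrow> cpoly \<Rightarrow> cpoly" where
    "h n p = (\<Sum>m\<in>{m\<in>Poly_Mapping.keys p. 2 * int (mdeg m) = n}. Poly_Mapping.single m (Poly_Mapping.lookup p m))" for n p
  have lh: "Poly_Mapping.lookup (h n p) m = (if 2 * int (mdeg m) = n then Poly_Mapping.lookup p m else 0)" for n p m
    by (auto simp: h_def lookup_sum lookup_single when_def sum.delta in_keys_iff)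
  have kh: "Poly_Mapping.keys (h n p) = {m \<in> Poly_Mapping.keys p. 2 * int (mdeg m) = n}" for n p
    by (auto simp: in_keys_iff lh split: if_splits)
  have sg: "submodule (mgen d ?A {1}) ?A ?A" by (rule submodule_mgen[OF mod]) simp
  have gen: "carrier ?A \<subseteq> mgen d ?A {1}"
    using submodule_closed(7)[OF sg _ subsetD[OF mgen_subset]] by fastforce
  have *: "graded_module d ?A \<and> (\<forall>x\<in>carrier ?A. \<forall>n. gcomp ?A n x = h n x)"
  proof (rule graded_moduleI[of d ?A "{1}" h, OF mod _ _ gen])
    fix n
    show "subgroup (hcomp ?A n) (add_monoid ?A)"
    proof (rule module_subgroupI[OF mod])
      show "x \<oplus>\<^bsub>?A\<^esub> y \<in> hcomp ?A n" if "x \<in> hcomp ?A n" "y \<in> hcomp ?A n" for x y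
        using that keys_add[of x y] by (auto simp: sym_alg_hcomp)
    qed (auto simp: sym_alg_hcomp)
    show "h n (x \<oplus>\<^bsub>?A\<^esub> y) = h n x \<oplus>\<^bsub>?A\<^esub> h n y" for x y
      by (simp add: poly_mapping_eq_iff fun_eq_iff lh lookup_add)
    show "h n x \<in> hcomp ?A n" if "x \<in> carrier ?A" for x
      using that by (auto simp: sym_alg_hcomp sym_alg_carrier kh)
    show "h n x = (if n = k then x else \<zero>\<^bsub>?A\<^esub>)" if "x \<in> hcomp ?A k" for k x
      using that by (auto simp: poly_mapping_eq_iff fun_eq_iff lh sym_alg_hcomp in_keys_iff)
  next
    fix i j a m assume "a \<in> hcomp ?A i" "m \<in> hcomp ?A j"
    thus "a \<odot>\<^bsub>?A\<^esub> m \<in> hcomp ?A (i + j)"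
      using keys_mult[of a m] by (fastforce simp: sym_alg_hcomp mdeg_add)
  next
    fix S x assume S: "S \<subseteq> carrier ?A" "\<zero>\<^bsub>?A\<^esub> \<in> S" "\<And>x y. x \<in> S \<Longrightarrow> y \<in> S \<Longrightarrow> x \<oplus>\<^bsub>?A\<^esub> y \<in> S"
      "\<And>n. hcomp ?A n \<subseteq> S" "x \<in> carrier ?A"
    have "Poly_Mapping.single m (Poly_Mapping.lookup x m) \<in> S" if "m \<in> Poly_Mapping.keys x" for m
      using S(5) that
      by (intro subsetD[OF S(4)[of "2 * int (mdeg m)"]]) (auto simp: sym_alg_hcomp sym_alg_carrier)
    note k = this
    have "(\<Sum>m\<in>K. Poly_Mapping.single m (Poly_Mapping.lookup x m)) \<in> S"
      if "finite K" "K \<subseteq> Poly_Mapping.keys x" for K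
      using that by (induction K rule: finite_induct) (use S(2,3) k in auto)
    thus "x \<in> S" using poly_mapping_monomials[of x] by (metis finite_keys order_refl)
  qed auto
  show "graded_module d ?A" using * by blast
  show "p \<in> carrier (sym_alg d) \<Longrightarrow>
    Poly_Mapping.lookup (gcomp (sym_alg d) n p) m = (if 2 * int (mdeg m) = n then Poly_Mapping.lookup p m else 0)"
    using * by (simp add: lh)
qed

section \<open>Noetherianity and Nakayama\<close>

lemma tdual_carrier: "w \<in> tdual d \<Longrightarrow> w \<in> carrier (sym_alg d)"
  by (simp add: sym_alg_hcomp)

context gmod
begin

lemma mod_span_incl: "w \<in> W \<Longrightarrow> m \<in> carrier M \<Longrightarrow> w \<odot> m \<in> mod_span W M"
  unfolding mod_span_def by (rule generate.incl) blast

lemma mod_span_zero: "\<zero> \<in> mod_span W M"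
  unfolding mod_span_def using generate.one[of "add_monoid M"] by simp

lemma mod_span_add: "x \<in> mod_span W M \<Longrightarrow> y \<in> mod_span W M \<Longrightarrow> x \<oplus> y \<in> mod_span W M"
  unfolding mod_span_def using generate.eng[of _ "add_monoid M"] by simp

text \<open>Generation as a subgroup has a case for inverses; it is absorbed into the case of
  products because the inverse of a product of \<open>w\<close> and \<open>m\<close> is the product
  of \<open>w\<close> and the inverse of \<open>m\<close>.\<close>

lemma mod_span_induct [consumes 2, case_names zero smult add]:
  assumes W: "W \<subseteq> carrier (sym_alg d)" and x: "x \<in> mod_span W M"
    and zero: "P \<zero>" and smult: "\<And>w m. w \<in> W \<Longrightarrow> m \<in> carrier M \<Longrightarrow> P (w \<odot> m)"
    and add: "\<And>x y. x \<in> mod_span W M \<Longrightarrow> y \<in> mod_span W M \<Longrightarrow> P x \<Longrightarrow> P y \<Longrightarrow> P (x \<oplus> y)"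
  shows "P x"
  using x unfolding mod_span_def
proof (induction rule: generate.induct)
  case one
  show ?case using zero by simp
next
  case (incl h)
  thus ?case using smult by blast
next
  case (inv h)
  then obtain w m where h: "h = w \<odot> m" "w \<in> W" "m \<in> carrier M" by blast
  have "inv\<^bsub>add_monoid M\<^esub> h = w \<odot> (\<ominus> m)"
    using h W smult_r_minus[of w m] by (auto simp: a_inv_def)
  thus ?case using smult h by simp
next
  case (eng h1 h2)
  thus ?case using add[of h1 h2] by (simp add: mod_span_def)
qed

lemma mod_span_submodule:
  assumes W: "W \<subseteq> carrier (sym_alg d)"
  shows "submodule (mod_span W M) (sym_alg d) M"
proof (rule submoduleI)
  have sub: "x \<in> carrier M" if "x \<in> mod_span W M" for x
    using W that by (induction rule: mod_span_induct) (use W in auto)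
  thus "mod_span W M \<subseteq> carrier M" by blast
  have sm: "a \<odot> x \<in> mod_span W M" if a: "a \<in> carrier (sym_alg d)" and x: "x \<in> mod_span W M" for a x
    using W x
  proof (induction rule: mod_span_induct)
    case (smult w m)
    have "a \<odot> (w \<odot> m) = w \<odot> (a \<odot> m)"
      using smult a W smult_mult[of a w m] smult_mult[of w a m] by (auto simp: mult.commute)
    thus ?case using mod_span_incl smult a by simp
  qed (use a sub mod_span_zero mod_span_add in \<open>auto simp: smult_r_distr\<close>)
  show "a \<odot> x \<in> mod_span W M" if "a \<in> carrier (sym_alg d)" "x \<in> mod_span W M" for a x
    using sm that .
  show "\<ominus> x \<in> mod_span W M" if "x \<in> mod_span W M" for x
    using sm[of "- 1" x] smult_neg[of 1 x] sub that by simp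
qed (use mod_span_zero mod_span_add in auto)

lemma mod_span_gsub:
  assumes W: "W \<subseteq> tdual d"
  shows "gsub d M (mod_span W M)"
proof -
  have Wc: "W \<subseteq> carrier (sym_alg d)" using W tdual_carrier by blast
  have sub: "submodule (mod_span W M) (sym_alg d) M" by (rule mod_span_submodule[OF Wc])
  have "gcomp M n x \<in> mod_span W M" if "x \<in> mod_span W M" for n x
    using Wc that
  proof (induction rule: mod_span_induct)
    case (smult w m)
    thus ?case using gcomp_smult[of w 2 m n] W mod_span_incl gcomp_carrier by auto
  next
    case (add x y)
    thus ?case using gcomp_add[of x y n] submodule_closed(2)[OF sub] mod_span_add by simp
  qed (simp add: mod_span_zero)
  thus ?thesis using sub by (simp add: gsub_def)
qed

lemmas max_gsub = mod_span_gsub[OF order_refl]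

text \<open>Every nonconstant monomial splits off a variable, so the polynomials without constant
  term form the ideal generated by the linear forms.\<close>

lemma smult_max:
  assumes a: "a \<in> carrier (sym_alg d)" "Poly_Mapping.lookup a 0 = 0" and m: "m \<in> carrier M"
  shows "a \<odot> m \<in> mod_span (tdual d) M"
proof -
  note s = gsubD[OF max_gsub]
  have mono: "Poly_Mapping.single k c \<odot> m \<in> mod_span (tdual d) M"
    if k: "Poly_Mapping.keys k \<subseteq> {..<d}" "k \<noteq> 0" for k c
  proof -
    obtain i where i: "i \<in> Poly_Mapping.keys k"
      using k(2) by (auto simp: in_keys_iff poly_mapping_eq_iff fun_eq_iff)
    define e where "e = Poly_Mapping.single i (1 :: nat)"
    have ke: "k = e + (k - e)"
      using i by (auto simp: e_def poly_mapping_eq_iff fun_eq_iff lookup_add lookup_minus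
          lookup_single when_def in_keys_iff)
    have kk: "Poly_Mapping.keys (k - e) \<subseteq> {..<d}" "i < d"
      using k(1) i by (auto simp: subset_iff in_keys_iff lookup_minus)
    have "Poly_Mapping.single k c = Poly_Mapping.single e 1 * Poly_Mapping.single (k - e) c"
      by (subst ke) (simp add: mult_single)
    moreover have "Poly_Mapping.single e 1 \<in> tdual d"
      using kk by (auto simp: sym_alg_hcomp sym_alg_carrier e_def)
    moreover have "Poly_Mapping.single (k - e) c \<in> carrier (sym_alg d)"
      using kk by (auto simp: sym_alg_carrier)
    ultimately show ?thesis
      using m smult_mult[of "Poly_Mapping.single e 1" "Poly_Mapping.single (k - e) c" m]
        mod_span_incl tdual_carrier by simp
  qed
  have keys: "Poly_Mapping.keys k \<subseteq> {..<d}" "k \<noteq> 0" if "k \<in> Poly_Mapping.keys a" for k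
    using that a by (auto simp: sym_alg_carrier in_keys_iff)
  have "(\<Sum>k\<in>K. Poly_Mapping.single k (Poly_Mapping.lookup a k)) \<in> carrier (sym_alg d) \<and>
    (\<Sum>k\<in>K. Poly_Mapping.single k (Poly_Mapping.lookup a k)) \<odot> m \<in> mod_span (tdual d) M"
    if "finite K" "K \<subseteq> Poly_Mapping.keys a" for K
    using that
  proof (induction K rule: finite_induct)
    case (insert k K)
    have "Poly_Mapping.single k (Poly_Mapping.lookup a k) \<in> carrier (sym_alg d)"
      using keys[of k] insert.prems by (auto simp: sym_alg_carrier)
    thus ?case using insert mono[OF keys] m s(5) by (simp add: smult_add)
  qed (use m s(4) in simp)
  thus ?thesis using poly_mapping_monomials[of a] by (metis finite_keys order_refl)
qed

end

lemma (in ghom) mod_span_image: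
  assumes W: "W \<subseteq> carrier (sym_alg d)" and x: "x \<in> mod_span W M"
  shows "f x \<in> mod_span W N"
proof -
  note s = submodule_closed[OF M.mod_span_submodule[OF W]]
  show ?thesis using W x
    by (induction rule: M.mod_span_induct)
      (use W in \<open>auto simp: zero add smult s(2) subset_iff intro!: N.mod_span_zero N.mod_span_add N.mod_span_incl closed\<close>)
qed

lemma (in ghom) mod_span_surj:
  assumes W: "W \<subseteq> carrier (sym_alg d)" and surj: "f ` carrier M = carrier N" and y: "y \<in> mod_span W N"
  shows "\<exists>x\<in>mod_span W M. f x = y"
proof -
  note f_zero = zero and f_add = add and f_smult = smult
  show ?thesis using W y
  proof (induction rule: N.mod_span_induct)
    case zero
    show ?case using M.mod_span_zero[of W] f_zero by blast
  next
    case (smult w m)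
    then obtain x where x: "x \<in> carrier M" "m = f x" using surj by blast
    have "f (w \<odot>\<^bsub>M\<^esub> x) = w \<odot>\<^bsub>N\<^esub> m" using f_smult[of w x] x smult(1) W by auto
    thus ?case using M.mod_span_incl[OF smult(1) x(1)] by blast
  next
    case (add x y)
    then obtain u v where uv: "u \<in> mod_span W M" "f u = x" "v \<in> mod_span W M" "f v = y" by blast
    have "f (u \<oplus>\<^bsub>M\<^esub> v) = x \<oplus>\<^bsub>N\<^esub> y"
      using f_add[of u v] uv submodule_closed(2)[OF M.mod_span_submodule[OF W]] by simp
    thus ?case using M.mod_span_add[OF uv(1,3)] by blast
  qed
qed

lemma (in gfam) mod_span_dsum:
  assumes W: "W \<subseteq> carrier (sym_alg d)" and x: "x \<in> carrier D"
  shows "x \<in> mod_span W D \<longleftrightarrow> (\<forall>i\<in>I. x i \<in> mod_span W (M i))"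
proof
  interpret DD: gmod d D using graded_dsum(1) by (simp add: gmod_def)
  show "\<forall>i\<in>I. x i \<in> mod_span W (M i)" if "x \<in> mod_span W D"
  proof
    fix i assume i: "i \<in> I"
    interpret ghom d D "M i" "\<lambda>f. f i" by (rule ghomI[OF graded_dsum(1) gmod[OF i] proj_hom[OF i]])
    show "x i \<in> mod_span W (M i)" using mod_span_image[OF W that] .
  qed
  assume xi: "\<forall>i\<in>I. x i \<in> mod_span W (M i)"
  have in_span: "dinj I M i (x i) \<in> mod_span W D" if i: "i \<in> I" for i
  proof -
    interpret ghom d "M i" D "dinj I M i" by (rule ghomI[OF gmod[OF i] graded_dsum(1) dinj_hom[OF i]])
    show ?thesis using mod_span_image[OF W] xi i by blast
  qed
  have "(\<Oplus>\<^bsub>D\<^esub>i\<in>I. dinj I M i (x i)) \<in> mod_span W D"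
    by (rule D.finsum_mem)
      (use in_span submodule_closed[OF DD.mod_span_submodule[OF W]] in \<open>auto simp del: dsum_gmodule_simps\<close>)
  thus "x \<in> mod_span W D" using dinj_sum[OF x] by simp
qed

section \<open>Noetherianity of graded modules and the graded Nakayama lemma\<close>

context gmod
begin

lemma submodule_sum:
  assumes C: "submodule C (sym_alg d) M" and E: "submodule E (sym_alg d) M"
  shows "submodule {x \<oplus> y | x y. x \<in> C \<and> y \<in> E} (sym_alg d) M"
proof (rule submoduleI)
  note c = submodule_closed[OF C] and e = submodule_closed[OF E]
  show "{x \<oplus> y | x y. x \<in> C \<and> y \<in> E} \<subseteq> carrier M" using c(2) e(2) by auto
  show "\<zero> \<in> {x \<oplus> y | x y. x \<in> C \<and> y \<in> E}" using c(3) e(3) by force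
  fix s assume "s \<in> {x \<oplus> y | x y. x \<in> C \<and> y \<in> E}"
  then obtain x y where s: "s = x \<oplus> y" "x \<in> C" "y \<in> E" by blast
  hence xy: "x \<in> carrier M" "y \<in> carrier M" using c(2) e(2) by auto
  show "\<ominus> s \<in> {x \<oplus> y | x y. x \<in> C \<and> y \<in> E}"
    using M.minus_add[OF xy] c(5)[OF s(2)] e(5)[OF s(3)] s(1) by blast
  show "a \<odot> s \<in> {x \<oplus> y | x y. x \<in> C \<and> y \<in> E}" if "a \<in> carrier (sym_alg d)" for a
    using smult_r_distr[OF that xy] c(7)[OF that s(2)] e(7)[OF that s(3)] s(1) by blast
  fix t assume "t \<in> {x \<oplus> y | x y. x \<in> C \<and> y \<in> E}"
  then obtain u v where t: "t = u \<oplus> v" "u \<in> C" "v \<in> E" by blast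
  hence uv: "u \<in> carrier M" "v \<in> carrier M" using c(2) e(2) by auto
  show "s \<oplus> t \<in> {x \<oplus> y | x y. x \<in> C \<and> y \<in> E}"
    using M.add_add_swap[OF xy uv] c(4)[OF s(2) t(2)] e(4)[OF s(3) t(3)] s(1) t(1) by blast
qed

lemma submodule_smult_range:
  assumes "g \<in> carrier M"
  shows "submodule {a \<odot> g | a. a \<in> carrier (sym_alg d)} (sym_alg d) M"
proof (rule submoduleI)
  show "\<zero> \<in> {a \<odot> g | a. a \<in> carrier (sym_alg d)}"
    using smult_0[OF assms] sym_alg_closed(1) by (metis (mono_tags, lifting) mem_Collect_eq)
  fix s assume "s \<in> {a \<odot> g | a. a \<in> carrier (sym_alg d)}"
  then obtain a where a: "s = a \<odot> g" "a \<in> carrier (sym_alg d)" by blast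
  show "\<ominus> s \<in> {a \<odot> g | a. a \<in> carrier (sym_alg d)}"
    using smult_neg[OF a(2) assms] a sym_alg_closed(5)[OF a(2)] by (metis (mono_tags, lifting) mem_Collect_eq)
  show "b \<odot> s \<in> {a \<odot> g | a. a \<in> carrier (sym_alg d)}" if "b \<in> carrier (sym_alg d)" for b
    using smult_mult[OF that a(2) assms] a sym_alg_closed(4)[OF that a(2)] by (metis (mono_tags, lifting) mem_Collect_eq)
  fix t assume "t \<in> {a \<odot> g | a. a \<in> carrier (sym_alg d)}"
  then obtain b where b: "t = b \<odot> g" "b \<in> carrier (sym_alg d)" by blast
  show "s \<oplus> t \<in> {a \<odot> g | a. a \<in> carrier (sym_alg d)}"
    using smult_add[OF a(2) b(2) assms] a(1) b(1) sym_alg_closed(3)[OF a(2) b(2)] by (metis (mono_tags, lifting) mem_Collect_eq)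
qed (use assms in auto)

text \<open>Induction on the number of generators. For a new generator \<open>g\<close>, the
  possible coefficients of \<open>g\<close> in elements of \<open>C\<close> form an ideal, finitely
  generated by Hilbert's theorem; what remains after matching these coefficients lies in the span of
  the old generators.\<close>

lemma noetherian_mgen:
  assumes "finite G" "G \<subseteq> carrier M" "submodule C (sym_alg d) M" "C \<subseteq> mgen d M G"
  shows "\<exists>B. finite B \<and> B \<subseteq> C \<and> C \<subseteq> mgen d M B"
  using assms
proof (induction G arbitrary: C rule: finite_induct)
  case empty
  thus ?case by (intro exI[of _ "{}"]) auto
next
  case (insert g G)
  let ?A = "sym_alg d"
  interpret A: Module.module ?A ?A by (rule module_sym_alg)
  have g: "g \<in> carrier M" and G: "G \<subseteq> carrier M" using insert.prems(1) by auto
  note c = submodule_closed[OF insert.prems(2)]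
  have subG: "submodule (mgen d M G) ?A M" using submodule_mgen[OF module_axioms G] .
  note mg = submodule_closed[OF subG]
  let ?R = "{a \<odot> g | a. a \<in> carrier ?A}"
  have "submodule {x \<oplus> y | x y. x \<in> ?R \<and> y \<in> mgen d M G} ?A M"
    by (rule submodule_sum[OF submodule_smult_range[OF g] subG])
  moreover have "insert g G \<subseteq> {x \<oplus> y | x y. x \<in> ?R \<and> y \<in> mgen d M G}"
  proof
    fix x assume x: "x \<in> insert g G"
    show "x \<in> {x \<oplus> y | x y. x \<in> ?R \<and> y \<in> mgen d M G}"
    proof (cases "x = g")
      case True
      have "x = 1 \<odot> g \<oplus> \<zero>" using g True by simp
      thus ?thesis using mg(3) sym_alg_closed(2) by blast
    next
      case False
      hence xG: "x \<in> G" using x by blast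
      hence "x = 0 \<odot> g \<oplus> x" using g G by auto
      moreover have "x \<in> mgen d M G" using xG mgen_subset[of G d M] by blast
      ultimately show ?thesis using sym_alg_closed(1) by blast
    qed
  qed
  ultimately have "mgen d M (insert g G) \<subseteq> {x \<oplus> y | x y. x \<in> ?R \<and> y \<in> mgen d M G}"
    by (rule mgen_least)
  hence dec: "\<exists>a s. a \<in> carrier ?A \<and> s \<in> mgen d M G \<and> m = a \<odot> g \<oplus> s" if "m \<in> C" for m
    using that insert.prems(3) by blast
  \<comment> \<open>The ideal of the coefficients with which \<open>g\<close> occurs in elements of
    \<open>C\<close>, modulo the span of \<open>G\<close>.\<close>
  let ?J = "{a \<in> carrier ?A. \<exists>s\<in>mgen d M G. a \<odot> g \<oplus> s \<in> C}"
  \<comment> \<open>Stated for an arbitrary submodule \<open>E\<close>, because it is applied to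
    \<open>C\<close> and again to the part of \<open>C\<close> generated by the lifts.\<close>
  have closedJ: "submodule {a \<in> carrier ?A. \<exists>s\<in>mgen d M G. a \<odot> g \<oplus> s \<in> E} ?A ?A"
    if E: "submodule E ?A M" for E
  proof (rule A.submoduleI)
    note e = submodule_closed[OF E]
    show "\<zero>\<^bsub>?A\<^esub> \<in> {a \<in> carrier ?A. \<exists>s\<in>mgen d M G. a \<odot> g \<oplus> s \<in> E}"
      using g mg(3) e(3) by (auto intro!: bexI[of _ \<zero>])
    fix a assume "a \<in> {a \<in> carrier ?A. \<exists>s\<in>mgen d M G. a \<odot> g \<oplus> s \<in> E}"
    then obtain s where a: "a \<in> carrier ?A" "s \<in> mgen d M G" "a \<odot> g \<oplus> s \<in> E" by blast
    have s: "s \<in> carrier M" using a mg(2) by blast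
    have sm: "b * a \<in> {a \<in> carrier ?A. \<exists>s\<in>mgen d M G. a \<odot> g \<oplus> s \<in> E}" if b: "b \<in> carrier ?A" for b
    proof -
      have "(b * a) \<odot> g \<oplus> b \<odot> s = b \<odot> (a \<odot> g \<oplus> s)"
        using b a g s by (simp add: smult_mult smult_r_distr)
      hence "(b * a) \<odot> g \<oplus> b \<odot> s \<in> E" using e(7)[OF b a(3)] by simp
      thus ?thesis using mg(7)[OF b a(2)] a(1) b by (intro CollectI conjI bexI[of _ "b \<odot> s"]) auto
    qed
    show "b \<odot>\<^bsub>?A\<^esub> a \<in> {a \<in> carrier ?A. \<exists>s\<in>mgen d M G. a \<odot> g \<oplus> s \<in> E}" if b: "b \<in> carrier ?A" for b
      using sm[OF b] by simp
    show "\<ominus>\<^bsub>?A\<^esub> a \<in> {a \<in> carrier ?A. \<exists>s\<in>mgen d M G. a \<odot> g \<oplus> s \<in> E}"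
      using sm[of "- 1"] a(1) by simp
    fix b assume "b \<in> {a \<in> carrier ?A. \<exists>s\<in>mgen d M G. a \<odot> g \<oplus> s \<in> E}"
    then obtain t where b: "b \<in> carrier ?A" "t \<in> mgen d M G" "b \<odot> g \<oplus> t \<in> E" by blast
    have t: "t \<in> carrier M" using b mg(2) by blast
    have "(a + b) \<odot> g \<oplus> (s \<oplus> t) = (a \<odot> g \<oplus> s) \<oplus> (b \<odot> g \<oplus> t)"
      using a(1) b(1) g s t by (simp add: smult_add M.add_add_swap)
    thus "a \<oplus>\<^bsub>?A\<^esub> b \<in> {a \<in> carrier ?A. \<exists>s\<in>mgen d M G. a \<odot> g \<oplus> s \<in> E}"
      using e(4)[OF a(3) b(3)] mg(4)[OF a(2) b(2)] a(1) b(1) by (auto intro!: bexI[of _ "s \<oplus> t"])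
  qed auto
  obtain T where T: "finite T" "T \<subseteq> ?J" "?J \<subseteq> mgen d ?A T"
    using sym_alg_fin_gen[OF closedJ[OF insert.prems(2)]] by blast
  \<comment> \<open>Each of the finitely many generators \<open>t\<close> of the coefficient ideal
    is realised by an element of \<open>C\<close>.\<close>
  have "\<exists>u. u \<in> C \<and> (\<exists>s\<in>mgen d M G. u = t \<odot> g \<oplus> s)" if "t \<in> T" for t
    using T(2) that by blast
  then obtain e where e: "\<And>t. t \<in> T \<Longrightarrow> e t \<in> C"
    "\<And>t. t \<in> T \<Longrightarrow> \<exists>s\<in>mgen d M G. e t = t \<odot> g \<oplus> s" by metis
  have sCG: "submodule (C \<inter> mgen d M G) ?A M"
    by (rule submoduleI) (use c mg in auto)
  obtain B where B: "finite B" "B \<subseteq> C \<inter> mgen d M G" "C \<inter> mgen d M G \<subseteq> mgen d M B"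
    using insert.IH[OF G sCG] by blast
  let ?B = "e ` T \<union> B"
  have BC: "?B \<subseteq> C" using e(1) B(2) by blast
  have subB: "submodule (mgen d M ?B) ?A M"
    by (rule submodule_mgen[OF module_axioms]) (use BC c(1) in blast)
  note mb = submodule_closed[OF subB]
  have sub': "submodule (mgen d M ?B \<inter> C) ?A M"
    by (rule submoduleI) (use c mb in auto)
  have "T \<subseteq> {a \<in> carrier ?A. \<exists>s\<in>mgen d M G. a \<odot> g \<oplus> s \<in> mgen d M ?B \<inter> C}"
  proof
    fix t assume t: "t \<in> T"
    obtain s where s: "s \<in> mgen d M G" "e t = t \<odot> g \<oplus> s" using e(2)[OF t] by blast
    have "e t \<in> mgen d M ?B \<inter> C" using mgen_subset[of ?B d M] t e(1) by blast
    thus "t \<in> {a \<in> carrier ?A. \<exists>s\<in>mgen d M G. a \<odot> g \<oplus> s \<in> mgen d M ?B \<inter> C}"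
      using s t T(2) by auto
  qed
  \<comment> \<open>The generators \<open>T\<close> of the coefficient ideal are already realised
    inside the span of \<open>?B\<close>, and the coefficients realised there form an ideal; hence
    all coefficients are.\<close>
  from mgen_least[OF closedJ[OF sub'] this]
  have JB: "?J \<subseteq> {a \<in> carrier ?A. \<exists>s\<in>mgen d M G. a \<odot> g \<oplus> s \<in> mgen d M ?B \<inter> C}"
    using T(3) by blast
  have "C \<subseteq> mgen d M ?B"
  proof
    fix m assume m: "m \<in> C"
    obtain a s where as: "a \<in> carrier ?A" "s \<in> mgen d M G" "m = a \<odot> g \<oplus> s" using dec[OF m] by blast
    hence "a \<in> ?J" using m by blast
    then obtain s' where s': "s' \<in> mgen d M G" "a \<odot> g \<oplus> s' \<in> mgen d M ?B" "a \<odot> g \<oplus> s' \<in> C"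
      using JB by blast
    have sc: "s \<in> carrier M" "s' \<in> carrier M" "a \<odot> g \<in> carrier M" using as s' mg(2) g by auto
    \<comment> \<open>Two elements of \<open>C\<close> with the same coefficient of \<open>g\<close>
      differ by an element of \<open>C\<close> in the span of \<open>G\<close>, to which the
      induction hypothesis applies.\<close>
    have "m \<ominus> (a \<odot> g \<oplus> s') = s \<ominus> s'"
      using sc by (simp add: as(3) M.diff_add_diff) (simp add: a_minus_def M.r_neg)
    hence "m \<ominus> (a \<odot> g \<oplus> s') \<in> C \<inter> mgen d M G"
      using c(6)[OF m s'(3)] mg(6)[OF as(2) s'(1)] by simp
    hence "m \<ominus> (a \<odot> g \<oplus> s') \<in> mgen d M ?B" using B(3) mgen_mono[of B ?B d M] by blast
    hence "(a \<odot> g \<oplus> s') \<oplus> (m \<ominus> (a \<odot> g \<oplus> s')) \<in> mgen d M ?B" using mb(4) s'(2) by blast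
    thus "m \<in> mgen d M ?B" using M.add_diff_self[of "a \<odot> g \<oplus> s'" m] c(2) s'(3) m by simp
  qed
  thus ?case using BC T(1) B(1) by (intro exI[of _ ?B]) simp
qed

lemma noetherian:
  assumes "submodule C (sym_alg d) M"
  shows "\<exists>B. finite B \<and> B \<subseteq> C \<and> C \<subseteq> mgen d M B"
proof -
  obtain G where "finite G" "G \<subseteq> carrier M" "carrier M \<subseteq> mgen d M G" using fin_gen by blast
  thus ?thesis using noetherian_mgen[of G C] assms submodule_closed(1)[OF assms] by blast
qed

lemma gsub_graded:
  assumes "gsub d M C"
  shows "graded_module d (sub_gmodule C M)" "x \<in> C \<Longrightarrow> gcomp (sub_gmodule C M) n x = gcomp M n x"
proof -
  obtain B where B: "finite B" "B \<subseteq> C" "C \<subseteq> mgen d M B"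
    using noetherian[OF gsubD(1)[OF assms]] by blast
  show "graded_module d (sub_gmodule C M)" by (rule graded_sub(1)[OF assms B])
  show "x \<in> C \<Longrightarrow> gcomp (sub_gmodule C M) n x = gcomp M n x" by (rule graded_sub(2)[OF assms B])
qed

text \<open>Polynomials have no components of negative degree, so scalar multiplication cannot lead
  below the degrees of the finitely many generators.\<close>

lemma bounded_below: "\<exists>n0. \<forall>n<n0. hcomp M n = {\<zero>}"
proof -
  let ?A = "sym_alg d"
  interpret A: gmod d ?A using graded_sym_alg by (simp add: gmod_def)
  obtain B where B: "finite B" "B \<subseteq> carrier M" "carrier M \<subseteq> mgen d M B" using fin_gen by blast
  have "finite (\<Union>b\<in>B. {n. gcomp M n b \<noteq> \<zero>})" using B gcomp_decomp(2) by auto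
  then obtain n0 where n0: "\<forall>n\<in>(\<Union>b\<in>B. {n. gcomp M n b \<noteq> \<zero>}). n0 \<le> n"
    by (metis bdd_below_finite bdd_below.E)
  let ?D = "{m \<in> carrier M. \<forall>n<n0. gcomp M n m = \<zero>}"
  have sm: "a \<odot> m \<in> ?D" if a: "a \<in> carrier ?A" and m: "m \<in> ?D" for a m
  proof -
    have "a \<in> {a \<in> carrier ?A. a \<odot> m \<in> ?D}"
    proof (rule A.homogeneous_induct)
      show "gcomp ?A i a \<in> {a \<in> carrier ?A. a \<odot> m \<in> ?D}" for i
      proof -
        have h: "gcomp ?A i a \<in> hcomp ?A i" using A.gcomp_decomp(1)[OF a] .
        have "gcomp M n (gcomp ?A i a \<odot> m) = \<zero>" if n: "n < n0" for n
        proof (cases "i < 0")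
          case True
          hence "gcomp ?A i a = 0"
            using h by (auto simp: sym_alg_hcomp poly_mapping_eq_iff fun_eq_iff in_keys_iff)
          thus ?thesis using m by simp
        next
          case False
          thus ?thesis using gcomp_smult[OF h, of m n] m n A.gcomp_carrier[OF a] by simp
        qed
        thus ?thesis using A.gcomp_carrier[OF a] m by simp
      qed
      show "x \<oplus>\<^bsub>?A\<^esub> y \<in> {a \<in> carrier ?A. a \<odot> m \<in> ?D}"
        if "x \<in> {a \<in> carrier ?A. a \<odot> m \<in> ?D}" "y \<in> {a \<in> carrier ?A. a \<odot> m \<in> ?D}" for x y
        using that m gcomp_add[of "x \<odot> m" "y \<odot> m"] by (simp add: smult_add)
    qed (use a m in auto)
    thus ?thesis by blast
  qed
  have "submodule ?D ?A M"
  proof (rule submoduleI)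
    show "\<ominus> x \<in> ?D" if "x \<in> ?D" for x
      using sm[of "- 1" x] smult_neg[of 1 x] that by simp
  qed (use sm in \<open>auto simp: gcomp_add\<close>)
  moreover have "B \<subseteq> ?D" using B(2) n0 by force
  ultimately have "mgen d M B \<subseteq> ?D" by (rule mgen_least)
  hence all: "gcomp M n m = \<zero>" if "m \<in> carrier M" "n < n0" for m n using that B(3) by blast
  have "m = \<zero>" if "m \<in> hcomp M n" "n < n0" for m n
    using all[of m n] gcomp_hcomp[OF that(1), of n] hcomp_closed(1) that by simp
  thus ?thesis using hcomp_closed(2) by (intro exI[of _ n0]) auto
qed

text \<open>Induction on the degree replaces the usual argument over a local ring: in degree
  \<open>n\<close> the error term is a sum of linear forms times elements of degree
  \<open>n - 2\<close>, which are already known to lie in \<open>C\<close>. The induction starts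
  because degrees are bounded below.\<close>

lemma nakayama:
  assumes C: "gsub d M C"
    and cover: "\<And>m. m \<in> carrier M \<Longrightarrow> \<exists>c\<in>C. \<exists>w\<in>mod_span (tdual d) M. m = c \<oplus> w"
  shows "C = carrier M"
proof -
  note c = gsubD[OF C]
  obtain n0 where n0: "\<And>n. n < n0 \<Longrightarrow> hcomp M n = {\<zero>}" using bounded_below by blast
  have W: "tdual d \<subseteq> carrier (sym_alg d)" using tdual_carrier by blast
  \<comment> \<open>\<open>k\<close> counts degrees from the lower bound \<open>n0\<close>; all
    degrees below \<open>n0 + k\<close> are settled at once, so that the step of size 2 is
    available.\<close>
  have "hcomp M n \<subseteq> C" if "n < n0 + int k" for k n
    using that
  proof (induction k arbitrary: n)
    case 0
    thus ?case using n0 c(4) by simp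
  next
    case (Suc k)
    have span: "gcomp M n w \<in> C" if "w \<in> mod_span (tdual d) M" for w
      using W that
    proof (induction rule: mod_span_induct)
      case (smult w m)
      have "gcomp M (n - 2) m \<in> C"
        using Suc.IH[of "n - 2"] Suc.prems gcomp_decomp(1)[OF smult(2), of "n - 2"] by auto
      thus ?case using gcomp_smult[OF smult(1,2), of n] c(8) W smult(1) by auto
    next
      case (add x y)
      thus ?case using gcomp_add[of x y n] gsubD(3)[OF max_gsub] c(5) by simp
    qed (simp add: c(4))
    show ?case
    proof
      fix m assume m: "m \<in> hcomp M n"
      then obtain u w where uw: "u \<in> C" "w \<in> mod_span (tdual d) M" "m = u \<oplus> w"
        using cover hcomp_closed(1) by blast
      have "m = gcomp M n u \<oplus> gcomp M n w"
        using gcomp_hcomp[OF m, of n] gcomp_add[of u w n] uw c(3) gsubD(3)[OF max_gsub] by simp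
      thus "m \<in> C" using c(5,9) uw span by simp
    qed
  qed
  hence all: "hcomp M n \<subseteq> C" for n
    by (metis add.commute add_diff_cancel_right' less_add_one nat_0_le linorder_not_le order_less_le_trans
        zle_iff_zadd zless_add1_eq)
  have "m \<in> C" if m: "m \<in> carrier M" for m
  proof (rule homogeneous_induct)
    show "gcomp M n m \<in> C" for n using all gcomp_decomp(1)[OF m] by blast
  qed (use c m in auto)
  thus ?thesis using c(2) by blast
qed

end

section \<open>Free modules and minimal covers\<close>

lemma gfam_const:
  "finite I \<Longrightarrow> (\<And>i. i \<in> I \<Longrightarrow> graded_module d (M i)) \<Longrightarrow> gfam d I M"
  by (simp add: gfam_def)

lemma graded_shift_sym: "graded_module d (shift_gmodule k (sym_alg d))"
  by (rule gmod.graded_shift(1)) (simp add: gmod_def graded_sym_alg)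

text \<open>The shift by \<open>- k\<close> places the unit of the ring in degree \<open>k\<close>,
  which is the degree of \<open>b\<close>.\<close>

lemma (in gmod) smult_hom:
  assumes "b \<in> hcomp M k"
  shows "(\<lambda>a. a \<odot> b) \<in> gmod_hom d (shift_gmodule (- k) (sym_alg d)) M"
proof (rule gmod_homI)
  have b: "b \<in> carrier M" using assms by (rule hcomp_closed)
  show "x \<odot> b \<in> hcomp M n" if "x \<in> hcomp (shift_gmodule (- k) (sym_alg d)) n" for n x
    using hcomp_smult[OF _ assms, of x "n - k"] that by simp
qed (use hcomp_closed(1)[OF assms] in \<open>auto simp: smult_add smult_mult\<close>)

lemma (in gmod) lincomb_hom:
  assumes "finite T" "\<And>t. t \<in> T \<Longrightarrow> q t \<in> hcomp M (k t)"
  shows "(\<lambda>c. \<Oplus>t\<in>T. c t \<odot> q t) \<in>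
    gmod_hom d (dsum_gmodule T (\<lambda>t. shift_gmodule (- k t) (sym_alg d))) M"
proof -
  have gmM: "graded_module d M" by (rule gm)
  interpret gfam d T "\<lambda>t. shift_gmodule (- k t) (sym_alg d)"
    by (rule gfam_const) (use assms graded_shift_sym in auto)
  show ?thesis using sum_hom[OF gmM, of "\<lambda>t a. a \<odot> q t"] smult_hom assms(2) by simp
qed

text \<open>Unique expansion in a homogeneous basis is the bijectivity of the map in
  \<open>lincomb_hom\<close>; this turns the definition of freeness into an isomorphism with a sum
  of shifted rings.\<close>

lemma free_gmodule_iso:
  assumes "free_gmodule d P"
  shows "\<exists>B k. finite B \<and> B \<subseteq> carrier P \<and> (\<forall>b\<in>B. b \<in> hcomp P (k b)) \<and>
    (\<lambda>c. \<Oplus>\<^bsub>P\<^esub>b\<in>B. c b \<odot>\<^bsub>P\<^esub> b) \<in> gmod_iso d (dsum_gmodule B (\<lambda>b. shift_gmodule (- k b) (sym_alg d))) P"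
proof -
  interpret gmod d P using assms by (simp add: free_gmodule_def gmod_def)
  obtain B where B: "finite B" "B \<subseteq> carrier P" "\<forall>b\<in>B. \<exists>n. b \<in> hcomp P n"
    "\<forall>m\<in>carrier P. \<exists>!c. c \<in> B \<rightarrow>\<^sub>E carrier (sym_alg d) \<and> m = (\<Oplus>\<^bsub>P\<^esub>b\<in>B. c b \<odot>\<^bsub>P\<^esub> b)"
    using assms unfolding free_gmodule_def by blast
  obtain k where k: "\<And>b. b \<in> B \<Longrightarrow> b \<in> hcomp P (k b)" using B(3) by metis
  let ?F = "\<lambda>c. \<Oplus>\<^bsub>P\<^esub>b\<in>B. c b \<odot>\<^bsub>P\<^esub> b"
  have h: "?F \<in> gmod_hom d (dsum_gmodule B (\<lambda>b. shift_gmodule (- k b) (sym_alg d))) P"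
    by (rule lincomb_hom[OF B(1) k])
  have cl: "?F c \<in> carrier P" if "c \<in> B \<rightarrow>\<^sub>E carrier (sym_alg d)" for c
    using that B(2) by (intro M.finsum_closed) auto
  have "bij_betw ?F (B \<rightarrow>\<^sub>E carrier (sym_alg d)) (carrier P)"
    unfolding bij_betw_def
  proof
    show "inj_on ?F (B \<rightarrow>\<^sub>E carrier (sym_alg d))"
    proof (rule inj_onI)
      fix c c' assume c: "c \<in> B \<rightarrow>\<^sub>E carrier (sym_alg d)" "c' \<in> B \<rightarrow>\<^sub>E carrier (sym_alg d)" "?F c = ?F c'"
      show "c = c'" using B(4)[rule_format, OF cl[OF c(1)]] c by (metis (no_types, lifting))
    qed
    show "?F ` (B \<rightarrow>\<^sub>E carrier (sym_alg d)) = carrier P"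
    proof
      show "?F ` (B \<rightarrow>\<^sub>E carrier (sym_alg d)) \<subseteq> carrier P" using cl by blast
      show "carrier P \<subseteq> ?F ` (B \<rightarrow>\<^sub>E carrier (sym_alg d))"
      proof
        fix m assume "m \<in> carrier P"
        then obtain c where "c \<in> B \<rightarrow>\<^sub>E carrier (sym_alg d)" "m = ?F c"
          using B(4) by blast
        thus "m \<in> ?F ` (B \<rightarrow>\<^sub>E carrier (sym_alg d))" by blast
      qed
    qed
  qed
  hence "?F \<in> gmod_iso d (dsum_gmodule B (\<lambda>b. shift_gmodule (- k b) (sym_alg d))) P"
    using h by (simp add: gmod_iso_def)
  thus ?thesis using B(1,2) k by blast
qed

text \<open>Graded projectivity. The map \<open>h\<close> may fail to be surjective: it is enough
  that its image contains that of \<open>g\<close>, which is the situation of maps into the sum of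
  the edge modules at a vertex.\<close>

lemma free_lift:
  assumes P: "free_gmodule d P" and M: "graded_module d M" and N: "graded_module d N"
    and h: "h \<in> gmod_hom d M N" and g: "g \<in> gmod_hom d P N"
    and ex: "\<And>p. p \<in> carrier P \<Longrightarrow> \<exists>m\<in>carrier M. h m = g p"
  shows "\<exists>F\<in>gmod_hom d P M. \<forall>p\<in>carrier P. h (F p) = g p"
proof -
  have Pg: "graded_module d P" using P by (simp add: free_gmodule_def)
  interpret P: gmod d P using Pg by (simp add: gmod_def)
  interpret M: gmod d M using M by (simp add: gmod_def)
  interpret N: gmod d N using N by (simp add: gmod_def)
  interpret h: ghom d M N h by (rule ghomI[OF M N h])
  interpret g: ghom d P N g by (rule ghomI[OF Pg N g])
  obtain B k where B: "finite B" "B \<subseteq> carrier P" "\<And>b. b \<in> B \<Longrightarrow> b \<in> hcomp P (k b)"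
    "(\<lambda>c. \<Oplus>\<^bsub>P\<^esub>b\<in>B. c b \<odot>\<^bsub>P\<^esub> b) \<in> gmod_iso d (dsum_gmodule B (\<lambda>b. shift_gmodule (- k b) (sym_alg d))) P"
    using free_gmodule_iso[OF P] by blast
  let ?D = "dsum_gmodule B (\<lambda>b. shift_gmodule (- k b) (sym_alg d))"
  let ?F = "\<lambda>c. \<Oplus>\<^bsub>P\<^esub>b\<in>B. c b \<odot>\<^bsub>P\<^esub> b"
  interpret D: gfam d B "\<lambda>b. shift_gmodule (- k b) (sym_alg d)"
    by (rule gfam_const) (use B graded_shift_sym in auto)
  have "\<exists>m. m \<in> hcomp M (k b) \<and> h m = g b" if b: "b \<in> B" for b
  proof -
    obtain m where m: "m \<in> carrier M" "h m = g b" using ex B(2) b by blast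
    \<comment> \<open>Only the component of degree \<open>k b\<close> of a preimage is kept; it
      still maps to \<open>g b\<close> and makes the lift preserve degrees.\<close>
    have "h (gcomp M (k b) m) = g b"
      using h.gcomp[OF m(1), of "k b"] m(2) N.gcomp_hcomp[OF g.hcomp[OF B(3)[OF b]], of "k b"] by simp
    thus ?thesis using M.gcomp_decomp(1)[OF m(1)] by blast
  qed
  then obtain mm where mm: "\<And>b. b \<in> B \<Longrightarrow> mm b \<in> hcomp M (k b)" "\<And>b. b \<in> B \<Longrightarrow> h (mm b) = g b"
    by metis
  let ?G = "\<lambda>c. \<Oplus>\<^bsub>M\<^esub>b\<in>B. c b \<odot>\<^bsub>M\<^esub> mm b"
  have G: "?G \<in> gmod_hom d ?D M" by (rule M.lincomb_hom[OF B(1) mm(1)])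
  define ri where "ri = inv_into (carrier ?D) ?F"
  have "ri \<in> gmod_iso d P ?D"
    unfolding ri_def by (rule gmod_iso_inv[OF D.graded_dsum(1) Pg B(4)])
  hence ri: "ri \<in> gmod_hom d P ?D" by (simp add: gmod_iso_def)
  have Fri: "?F (ri p) = p" if "p \<in> carrier P" for p
  proof -
    have "bij_betw ?F (carrier ?D) (carrier P)"
      using B(4) by (simp add: gmod_iso_def del: dsum_gmodule_simps)
    from bij_betw_inv_into_right[OF this that] show ?thesis by (simp only: ri_def)
  qed
  have "h (?G (ri p)) = g p" if p: "p \<in> carrier P" for p
  proof -
    have c: "ri p b \<in> carrier (sym_alg d)" if "b \<in> B" for b
      using gmod_homD(1)[OF ri p] that by auto
    have "h (?G (ri p)) = (\<Oplus>\<^bsub>N\<^esub>b\<in>B. h (ri p b \<odot>\<^bsub>M\<^esub> mm b))"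
      by (rule h.finsum) (use c M.hcomp_closed(1)[OF mm(1)] in auto)
    also have "\<dots> = (\<Oplus>\<^bsub>N\<^esub>b\<in>B. g (ri p b \<odot>\<^bsub>P\<^esub> b))"
    proof (rule N.finsum_cong')
      fix b assume b: "b \<in> B"
      show "h (ri p b \<odot>\<^bsub>M\<^esub> mm b) = g (ri p b \<odot>\<^bsub>P\<^esub> b)"
        using h.smult[OF c[OF b] M.hcomp_closed(1)[OF mm(1)[OF b]]] mm(2)[OF b]
          g.smult[OF c[OF b], of b] B(2) b by auto
    qed (use c B(2) g.closed in auto)
    also have "\<dots> = g (?F (ri p))"
      by (rule g.finsum[symmetric]) (use c B(2) in auto)
    finally show ?thesis using Fri[OF p] by simp
  qed
  thus ?thesis
    using gmod_hom_comp[OF ri G] by (intro bexI[of _ "\<lambda>p. ?G (ri p)"] ballI)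
qed

text \<open>Freeness of \<open>N\<close> gives a section \<open>s\<close> of \<open>F\<close>. Every
  element of \<open>P\<close> is a value of \<open>s\<close> plus a kernel element, and the kernel
  lies in the maximal ideal times \<open>P\<close>; by Nakayama \<open>s\<close> is surjective, so
  \<open>F\<close> is injective.\<close>

lemma surj_free_inj:
  assumes P: "graded_module d P" and N: "free_gmodule d N" and F: "F \<in> gmod_hom d P N"
    and surj: "F ` carrier P = carrier N"
    and ker: "\<And>p. p \<in> carrier P \<Longrightarrow> F p = \<zero>\<^bsub>N\<^esub> \<Longrightarrow> p \<in> mod_span (tdual d) P"
  shows "F \<in> gmod_iso d P N"
proof -
  have Ng: "graded_module d N" using N by (simp add: free_gmodule_def)
  interpret F: ghom d P N F by (rule ghomI[OF P Ng F])
  have id: "(\<lambda>x. x) \<in> gmod_hom d N N" by (rule gmod_homI) auto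
  obtain s where s: "s \<in> gmod_hom d N P" "\<And>n. n \<in> carrier N \<Longrightarrow> F (s n) = n"
    using free_lift[OF N P Ng F id] surj by (metis (no_types, lifting) imageE)
  interpret s: ghom d N P s by (rule ghomI[OF Ng P s(1)])
  have "s ` carrier N = carrier P"
  proof (rule F.M.nakayama)
    show "gsub d P (s ` carrier N)" by (rule s.image_gsub[OF F.N.gsub_carrier])
    fix m assume m: "m \<in> carrier P"
    have Fm: "F m \<in> carrier N" using F.closed[OF m] .
    have "m \<ominus>\<^bsub>P\<^esub> s (F m) \<in> mod_span (tdual d) P"
      by (rule ker)
        (use m s.closed[OF Fm] F.diff[OF m s.closed[OF Fm]] s(2)[OF Fm] F.N.diff_zero_iff[OF Fm Fm]
           F.M.diff_closed in auto)
    moreover have "m = s (F m) \<oplus>\<^bsub>P\<^esub> (m \<ominus>\<^bsub>P\<^esub> s (F m))"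
      using F.M.add_diff_self[OF s.closed[OF Fm] m] by simp
    ultimately show "\<exists>c\<in>s ` carrier N. \<exists>w\<in>mod_span (tdual d) P. m = c \<oplus>\<^bsub>P\<^esub> w"
      using Fm by blast
  qed
  hence "inj_on F (carrier P)" using s(2) by (metis (no_types, lifting) imageE inj_onI)
  thus ?thesis using F surj by (simp add: gmod_iso_def bij_betw_def)
qed

lemma sym_alg_const_part:
  assumes "p \<in> carrier (sym_alg d)"
  obtains r where "r \<in> carrier (sym_alg d)" "Poly_Mapping.lookup r 0 = 0"
    "p = Poly_Mapping.single 0 (Poly_Mapping.lookup p 0) + r"
proof
  show "p - Poly_Mapping.single 0 (Poly_Mapping.lookup p 0) \<in> carrier (sym_alg d)"
    using assms by simp
qed (auto simp: lookup_minus lookup_single)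

context gmod
begin

text \<open>
  A family of minimal cardinality generating \<open>K0\<close> modulo the maximal ideal has no relation with
  an invertible coefficient.
\<close>

lemma minimal_cover:
  assumes K0: "gsub d M K0"
  shows "\<exists>T. finite T \<and> T \<subseteq> K0 \<and> (\<forall>t\<in>T. \<exists>n. t \<in> hcomp M n) \<and>
    (\<forall>m\<in>K0. \<exists>s\<in>mgen d M T. \<exists>w\<in>mod_span (tdual d) M. m = s \<oplus> w) \<and>
    (\<forall>c\<in>T \<rightarrow> carrier (sym_alg d). (\<Oplus>t\<in>T. c t \<odot> t) \<in> mod_span (tdual d) M \<longrightarrow>
       (\<forall>t\<in>T. Poly_Mapping.lookup (c t) 0 = 0))"
proof -
  let ?m = "mod_span (tdual d) M"
  note k = gsubD[OF K0] and mm = gsubD[OF max_gsub]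
  define good where "good T \<longleftrightarrow> finite T \<and> T \<subseteq> K0 \<and> (\<forall>t\<in>T. \<exists>n. t \<in> hcomp M n) \<and>
    (\<forall>m\<in>K0. \<exists>s\<in>mgen d M T. \<exists>w\<in>?m. m = s \<oplus> w)" for T
  have subT: "submodule (mgen d M T) (sym_alg d) M" if "T \<subseteq> K0" for T
    by (rule submodule_mgen[OF module_axioms]) (use that k in blast)
  obtain B where B: "finite B" "B \<subseteq> K0" "K0 \<subseteq> mgen d M B" using noetherian[OF k(1)] by blast
  \<comment> \<open>Components of finitely many generators: a finite homogeneous system, so
    admissible systems exist and one of least cardinality can be taken.\<close>
  let ?T = "\<Union>b\<in>B. (\<lambda>n. gcomp M n b) ` {n. gcomp M n b \<noteq> \<zero>}"
  have TK: "?T \<subseteq> K0" using B(2) k(9) by blast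
  have "good ?T" unfolding good_def
  proof (intro conjI ballI)
    show "finite ?T" using B k(3) gcomp_decomp(2) by blast
    show "?T \<subseteq> K0" by (fact TK)
    show "\<exists>n. t \<in> hcomp M n" if "t \<in> ?T" for t
      using that B(2) k(3) gcomp_decomp(1) by blast
    note s = submodule_closed[OF subT[OF TK]]
    have "B \<subseteq> mgen d M ?T"
    proof
      fix b assume b: "b \<in> B"
      show "b \<in> mgen d M ?T"
      proof (rule homogeneous_induct)
        show "gcomp M n b \<in> mgen d M ?T" for n
        proof (cases "gcomp M n b = \<zero>")
          case False
          hence "gcomp M n b \<in> ?T" using b by blast
          thus ?thesis by (rule subsetD[OF mgen_subset])
        qed (use s(3) in simp)
      qed (use s b B(2) k(3) in auto)
    qed
    hence "mgen d M B \<subseteq> mgen d M ?T" by (rule mgen_least[OF subT[OF TK]])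
    moreover fix m assume "m \<in> K0"
    ultimately have "m \<in> mgen d M ?T" "m = m \<oplus> \<zero>" using B(3) k(3) by auto
    thus "\<exists>s\<in>mgen d M ?T. \<exists>w\<in>?m. m = s \<oplus> w" using mm(4) by blast
  qed
  then obtain T where T: "good T" and least: "\<And>T'. good T' \<Longrightarrow> card T \<le> card T'"
    using ex_has_least_nat[of good ?T card] by auto
  have T': "finite T" "T \<subseteq> K0" "\<And>t. t \<in> T \<Longrightarrow> \<exists>n. t \<in> hcomp M n"
    "\<And>m. m \<in> K0 \<Longrightarrow> \<exists>s\<in>mgen d M T. \<exists>w\<in>?m. m = s \<oplus> w"
    using T unfolding good_def by auto
  have Tc: "t \<in> carrier M" if "t \<in> T" for t using T'(2) k(3) that by blast
  have "Poly_Mapping.lookup (c t0) 0 = 0"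
    if c: "c \<in> T \<rightarrow> carrier (sym_alg d)" and rel: "(\<Oplus>t\<in>T. c t \<odot> t) \<in> ?m" and t0: "t0 \<in> T" for c t0
  proof (rule ccontr)
    let ?R = "T - {t0}"
    define \<gamma> where "\<gamma> = Poly_Mapping.lookup (c t0) 0"
    assume "Poly_Mapping.lookup (c t0) 0 \<noteq> 0"
    hence \<gamma>: "\<gamma> \<noteq> 0" by (simp add: \<gamma>_def)
    \<comment> \<open>Everything reached without \<open>t0\<close>, modulo the maximal ideal. The
      aim is to show that \<open>t0\<close> itself belongs to it, so that \<open>t0\<close> could be
      discarded.\<close>
    define Q where "Q = {s \<oplus> w | s w. s \<in> mgen d M ?R \<and> w \<in> ?m}"
    have RK: "?R \<subseteq> K0" using T'(2) by blast
    note sR = submodule_closed[OF subT[OF RK]]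
    have Qs: "submodule Q (sym_alg d) M"
      unfolding Q_def by (rule submodule_sum[OF subT[OF RK] mm(1)])
    note q = submodule_closed[OF Qs]
    have RQ: "x \<in> Q" if "x \<in> mgen d M ?R" for x
    proof -
      have "x = x \<oplus> \<zero>" using sR(2)[OF that] by simp
      thus ?thesis unfolding Q_def using that mm(4) by blast
    qed
    have mQ: "x \<in> Q" if "x \<in> ?m" for x
    proof -
      have "x = \<zero> \<oplus> x" using mm(3)[OF that] by simp
      thus ?thesis unfolding Q_def using that sR(3) by blast
    qed
    \<comment> \<open>The coefficient of \<open>t0\<close> is a nonzero constant plus a polynomial
      without constant term. The latter sends \<open>t0\<close> into the maximal ideal times the
      module, and the former can be divided out.\<close>
    obtain r where r: "r \<in> carrier (sym_alg d)" "Poly_Mapping.lookup r 0 = 0"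
      "c t0 = Poly_Mapping.single 0 \<gamma> + r"
      using sym_alg_const_part[of "c t0" d] c t0 unfolding \<gamma>_def by auto
    have ct: "c t \<odot> t \<in> carrier M" if "t \<in> T" for t using c Tc that by auto
    have "(\<Oplus>t\<in>?R. c t \<odot> t) \<in> mgen d M ?R"
    proof (rule M.finsum_mem)
      show "(\<lambda>t. c t \<odot> t) \<in> ?R \<rightarrow> mgen d M ?R"
        using sR(7) mgen_subset[of ?R d M] c by (auto simp: Pi_def subset_iff)
    qed (use sR in auto)
    hence 1: "(\<Oplus>t\<in>?R. c t \<odot> t) \<in> Q" by (rule RQ)
    have "(\<Oplus>t\<in>T. c t \<odot> t) = (\<Oplus>t\<in>insert t0 ?R. c t \<odot> t)"
      using t0 by (simp add: insert_absorb)
    also have "\<dots> = c t0 \<odot> t0 \<oplus> (\<Oplus>t\<in>?R. c t \<odot> t)"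
      by (rule M.finsum_insert) (use T'(1) ct t0 in auto)
    finally have 2: "(\<Oplus>t\<in>T. c t \<odot> t) = c t0 \<odot> t0 \<oplus> (\<Oplus>t\<in>?R. c t \<odot> t)" .
    have "c t0 \<odot> t0 = (\<Oplus>t\<in>T. c t \<odot> t) \<ominus> (\<Oplus>t\<in>?R. c t \<odot> t)"
      unfolding 2 using M.diff_add_self[OF ct[OF t0] q(2)[OF 1]] by simp
    hence 3: "c t0 \<odot> t0 \<in> Q" using q(6)[OF mQ[OF rel] 1] by simp
    have "c t0 \<odot> t0 = Poly_Mapping.single 0 \<gamma> \<odot> t0 \<oplus> r \<odot> t0"
      unfolding r(3) using r(1) Tc[OF t0] by (simp add: smult_add)
    hence "Poly_Mapping.single 0 \<gamma> \<odot> t0 = c t0 \<odot> t0 \<ominus> r \<odot> t0"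
      using M.diff_add_self[of "Poly_Mapping.single 0 \<gamma> \<odot> t0" "r \<odot> t0"] r(1) Tc[OF t0] by simp
    hence "Poly_Mapping.single 0 \<gamma> \<odot> t0 \<in> Q"
      using q(6)[OF 3 mQ[OF smult_max[OF r(1,2) Tc[OF t0]]]] by simp
    hence "Poly_Mapping.single 0 (1 / \<gamma>) \<odot> (Poly_Mapping.single 0 \<gamma> \<odot> t0) \<in> Q"
      by (rule q(7)[rotated]) simp
    moreover have "Poly_Mapping.single 0 (1 / \<gamma>) \<odot> (Poly_Mapping.single 0 \<gamma> \<odot> t0) = t0"
      using \<gamma> Tc[OF t0] smult_mult[of "Poly_Mapping.single 0 (1 / \<gamma>)" "Poly_Mapping.single 0 \<gamma>" t0]
      by (simp add: mult_single)
    ultimately have t0Q: "t0 \<in> Q" by simp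
    have "T \<subseteq> Q"
    proof
      fix t assume t: "t \<in> T"
      show "t \<in> Q"
      proof (cases "t = t0")
        case False
        hence "t \<in> ?R" using t by blast
        thus ?thesis by (intro RQ) (rule subsetD[OF mgen_subset])
      qed (use t0Q in simp)
    qed
    hence TQ: "mgen d M T \<subseteq> Q" by (rule mgen_least[OF Qs])
    \<comment> \<open>The smaller system still generates modulo the maximal ideal, contradicting the
      minimal cardinality of \<open>T\<close>.\<close>
    have "good ?R" unfolding good_def
    proof (intro conjI ballI)
      show "\<exists>n. t \<in> hcomp M n" if "t \<in> ?R" for t using T'(3) that by blast
      fix m assume "m \<in> K0"
      then obtain s w where "s \<in> mgen d M T" "w \<in> ?m" "m = s \<oplus> w" using T'(4) by blast
      hence "m \<in> Q" using TQ mQ q(4) by blast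
      thus "\<exists>s\<in>mgen d M ?R. \<exists>w\<in>?m. m = s \<oplus> w" unfolding Q_def by blast
    qed (use T'(1) RK in auto)
    from least[OF this] show False using T'(1) t0 by (metis card_Diff1_less linorder_not_le)
  qed
  thus ?thesis
    using T' by (intro exI[of _ T] conjI ballI impI) auto
qed

end

lemma free_dsum_sym:
  assumes I: "finite I"
  shows "free_gmodule d (dsum_gmodule I (\<lambda>i. shift_gmodule (k i) (sym_alg d)))"
proof -
  let ?M = "\<lambda>i. shift_gmodule (k i) (sym_alg d)"
  interpret gfam d I ?M by (rule gfam_const) (use I graded_shift_sym in auto)
  let ?e = "\<lambda>i. dinj I ?M i 1"
  have ec: "?e i \<in> carrier D" if "i \<in> I" for i
    using that gmod_homD(1)[OF dinj_hom[OF that], of 1] by (simp del: dsum_gmodule_simps)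
  have inj: "inj_on ?e I"
  proof (rule inj_onI)
    fix i j assume "i \<in> I" "j \<in> I" "?e i = ?e j"
    thus "i = j" by (auto simp: dinj_def dest!: fun_cong[of _ _ i] split: if_splits)
  qed
  have val: "(\<Oplus>\<^bsub>D\<^esub>b\<in>?e ` I. c b \<odot>\<^bsub>D\<^esub> b) = (\<lambda>i\<in>I. c (?e i))"
    if c: "c \<in> ?e ` I \<rightarrow> carrier (sym_alg d)" for c
  proof -
    have cc: "(\<lambda>i\<in>I. c (?e i)) \<in> carrier D" using c by auto
    have "(\<Oplus>\<^bsub>D\<^esub>b\<in>?e ` I. c b \<odot>\<^bsub>D\<^esub> b) = (\<Oplus>\<^bsub>D\<^esub>i\<in>I. c (?e i) \<odot>\<^bsub>D\<^esub> ?e i)"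
      by (rule D.finsum_reindex) (use c ec D.smult_closed inj in \<open>auto simp del: dsum_gmodule_simps\<close>)
    also have "\<dots> = (\<Oplus>\<^bsub>D\<^esub>i\<in>I. dinj I ?M i ((\<lambda>i\<in>I. c (?e i)) i))"
    proof (rule D.finsum_cong')
      fix i assume i: "i \<in> I"
      show "c (?e i) \<odot>\<^bsub>D\<^esub> ?e i = dinj I ?M i ((\<lambda>i\<in>I. c (?e i)) i)"
        using i by (auto simp: dinj_def fun_eq_iff)
    next
      show "(\<lambda>i. dinj I ?M i ((\<lambda>i\<in>I. c (?e i)) i)) \<in> I \<rightarrow> carrier D"
      proof
        fix i assume i: "i \<in> I"
        show "dinj I ?M i ((\<lambda>i\<in>I. c (?e i)) i) \<in> carrier D"
          using gmod_homD(1)[OF dinj_hom[OF i], of "c (?e i)"] c i by (auto simp del: dsum_gmodule_simps)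
      qed
    qed auto
    also have "\<dots> = (\<lambda>i\<in>I. c (?e i))" by (rule dinj_sum[OF cc, symmetric])
    finally show ?thesis .
  qed
  show ?thesis unfolding free_gmodule_def
  proof (intro conjI exI[of _ "?e ` I"] ballI graded_dsum(1))
    show "finite (?e ` I)" using I by simp
    show "?e ` I \<subseteq> carrier D" using ec by blast
    fix b assume "b \<in> ?e ` I"
    then obtain i where i: "i \<in> I" "b = ?e i" by blast
    have "1 \<in> hcomp (?M i) (- k i)" by (auto simp: sym_alg_hcomp sym_alg_carrier mdeg_def)
    thus "\<exists>n. b \<in> hcomp D n" using gmod_homD(4)[OF dinj_hom[OF i(1)]] i(2) by blast
  next
    fix m assume m: "m \<in> carrier D"
    hence mi: "m i \<in> carrier (sym_alg d)" if "i \<in> I" for i using that by auto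
    let ?c = "\<lambda>b\<in>?e ` I. m (the_inv_into I ?e b)"
    have ti: "the_inv_into I ?e (?e i) = i" if "i \<in> I" for i
      by (rule the_inv_into_f_f[OF inj that])
    have ci: "?c (?e i) = m i" if "i \<in> I" for i
      using that by (simp add: ti)
    have c: "?c \<in> ?e ` I \<rightarrow>\<^sub>E carrier (sym_alg d)" using ti mi by auto
    show "\<exists>!c. c \<in> ?e ` I \<rightarrow>\<^sub>E carrier (sym_alg d) \<and> m = (\<Oplus>\<^bsub>D\<^esub>b\<in>?e ` I. c b \<odot>\<^bsub>D\<^esub> b)"
    proof (rule ex1I[of _ ?c])
      have "(\<lambda>i\<in>I. ?c (?e i)) = (\<lambda>i\<in>I. m i)" by (rule restrict_ext) (rule ci)
      also have "\<dots> = m" using m by (simp add: PiE_restrict)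
      finally show "?c \<in> ?e ` I \<rightarrow>\<^sub>E carrier (sym_alg d) \<and> m = (\<Oplus>\<^bsub>D\<^esub>b\<in>?e ` I. ?c b \<odot>\<^bsub>D\<^esub> b)"
        using val[of ?c] c by (simp del: restrict_apply dsum_gmodule_simps add: PiE_iff Pi_iff)
    next
      fix c' assume c': "c' \<in> ?e ` I \<rightarrow>\<^sub>E carrier (sym_alg d) \<and> m = (\<Oplus>\<^bsub>D\<^esub>b\<in>?e ` I. c' b \<odot>\<^bsub>D\<^esub> b)"
      have "m = (\<lambda>i\<in>I. c' (?e i))" using val[of c'] c' by (simp add: PiE_iff Pi_iff del: dsum_gmodule_simps)
      hence "c' (?e i) = m i" if "i \<in> I" for i using that by simp
      thus "c' = ?c" using ci c' c
        by (intro PiE_ext[of c' "?e ` I" "\<lambda>_. carrier (sym_alg d)" ?c]) auto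
    qed
  qed
qed

text \<open>Indexing the summands by an initial segment of the naturals keeps the cover in the fixed
  type \<open>nat \<Rightarrow> cpoly\<close>, whatever the type of \<open>N\<close>. This is what
  allows one stalk type for all vertices of the constructed sheaves.\<close>

lemma free_cover:
  assumes N: "graded_module d N"
  shows "\<exists>(r :: nat) k f. f \<in> gmod_hom d (dsum_gmodule {..<r} (\<lambda>i. shift_gmodule (k i) (sym_alg d))) N \<and>
    f ` carrier (dsum_gmodule {..<r} (\<lambda>i. shift_gmodule (k i) (sym_alg d))) = carrier N \<and>
    (\<forall>p\<in>carrier (dsum_gmodule {..<r} (\<lambda>i. shift_gmodule (k i) (sym_alg d))). f p = \<zero>\<^bsub>N\<^esub> \<longrightarrow>
       p \<in> mod_span (tdual d) (dsum_gmodule {..<r} (\<lambda>i. shift_gmodule (k i) (sym_alg d))))"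
proof -
  interpret N: gmod d N using N by (simp add: gmod_def)
  interpret A: gmod d "sym_alg d" using graded_sym_alg by (simp add: gmod_def)
  obtain T where T: "finite T" "T \<subseteq> carrier N" "\<forall>t\<in>T. \<exists>n. t \<in> hcomp N n"
    and cover: "\<forall>m\<in>carrier N. \<exists>s\<in>mgen d N T. \<exists>w\<in>mod_span (tdual d) N. m = s \<oplus>\<^bsub>N\<^esub> w"
    and rel: "\<forall>c\<in>T \<rightarrow> carrier (sym_alg d). (\<Oplus>\<^bsub>N\<^esub>t\<in>T. c t \<odot>\<^bsub>N\<^esub> t) \<in> mod_span (tdual d) N \<longrightarrow>
       (\<forall>t\<in>T. Poly_Mapping.lookup (c t) 0 = 0)"
    using N.minimal_cover[OF N.gsub_carrier] by (elim exE conjE)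
  obtain e where e: "bij_betw e {..<card T} T"
    using ex_bij_betw_nat_finite[OF T(1)] by (auto simp: atLeast0LessThan)
  obtain n where n: "\<And>t. t \<in> T \<Longrightarrow> t \<in> hcomp N (n t)" using T(3) by metis
  have eT: "e i \<in> T" if "i < card T" for i using e that by (auto simp: bij_betw_def)
  let ?I = "{..<card T}"
  let ?M = "\<lambda>i. shift_gmodule (- n (e i)) (sym_alg d)"
  interpret gfam d ?I ?M by (rule gfam_const) (use graded_shift_sym in auto)
  let ?f = "\<lambda>c. \<Oplus>\<^bsub>N\<^esub>i\<in>?I. c i \<odot>\<^bsub>N\<^esub> e i"
  have f: "?f \<in> gmod_hom d D N"
    using N.lincomb_hom[of ?I e "\<lambda>i. n (e i)"] n eT by simp
  interpret f: ghom d D N ?f by (rule ghomI[OF graded_dsum(1) N f])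
  have re: "?f (\<lambda>i\<in>?I. c (e i)) = (\<Oplus>\<^bsub>N\<^esub>t\<in>T. c t \<odot>\<^bsub>N\<^esub> t)" if "c \<in> T \<rightarrow> carrier (sym_alg d)" for c
  proof -
    have "(\<Oplus>\<^bsub>N\<^esub>t\<in>e ` ?I. c t \<odot>\<^bsub>N\<^esub> t) = (\<Oplus>\<^bsub>N\<^esub>i\<in>?I. c (e i) \<odot>\<^bsub>N\<^esub> e i)"
      by (rule N.M.finsum_reindex) (use e that T(2) in \<open>auto simp: bij_betw_def Pi_def subset_iff\<close>)
    moreover have "\<dots> = ?f (\<lambda>i\<in>?I. c (e i))"
      by (rule N.M.finsum_cong') (use eT that T(2) in \<open>auto simp: Pi_def subset_iff\<close>)
    ultimately show ?thesis using e by (simp add: bij_betw_def)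
  qed
  have "?f ` carrier D = carrier N"
  proof (rule N.nakayama)
    show "gsub d N (?f ` carrier D)"
      by (rule f.image_gsub) (rule f.M.gsub_carrier)
    fix m assume "m \<in> carrier N"
    then obtain s w where sw: "s \<in> mgen d N T" "w \<in> mod_span (tdual d) N" "m = s \<oplus>\<^bsub>N\<^esub> w"
      using cover by blast
    obtain c where c: "c \<in> T \<rightarrow> carrier (sym_alg d)" "s = (\<Oplus>\<^bsub>N\<^esub>t\<in>T. c t \<odot>\<^bsub>N\<^esub> t)"
      using sw(1) mgen_lincomb[OF N.module_axioms T(1,2)] by blast
    have "(\<lambda>i\<in>?I. c (e i)) \<in> carrier D" using c(1) eT by auto
    hence "s \<in> ?f ` carrier D" unfolding c(2) re[OF c(1), symmetric] by (rule imageI)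
    thus "\<exists>c\<in>?f ` carrier D. \<exists>w\<in>mod_span (tdual d) N. m = c \<oplus>\<^bsub>N\<^esub> w" using sw(2,3) by blast
  qed
  moreover have "p \<in> mod_span (tdual d) D" if p: "p \<in> carrier D" and fp: "?f p = \<zero>\<^bsub>N\<^esub>" for p
  proof -
    have pA: "p i \<in> carrier (sym_alg d)" if "i < card T" for i using p that by auto
    let ?c = "\<lambda>t. p (the_inv_into ?I e t)"
    have ce: "?c (e i) = p i" if "i < card T" for i
      using e that by (simp add: bij_betw_def the_inv_into_f_f)
    have cT: "?c \<in> T \<rightarrow> carrier (sym_alg d)"
    proof
      fix t assume "t \<in> T"
      then obtain i where "i < card T" "t = e i" using e by (auto simp: bij_betw_def)
      thus "?c t \<in> carrier (sym_alg d)" using ce pA by simp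
    qed
    have "(\<lambda>i\<in>?I. ?c (e i)) = (\<lambda>i\<in>?I. p i)" by (rule restrict_ext) (simp add: ce)
    also have "\<dots> = p" using p by (simp add: PiE_restrict)
    finally have "(\<Oplus>\<^bsub>N\<^esub>t\<in>T. ?c t \<odot>\<^bsub>N\<^esub> t) = \<zero>\<^bsub>N\<^esub>" using re[OF cT] fp by simp
    \<comment> \<open>By minimality of \<open>T\<close>, the coefficients of a relation have no
      constant term; coordinatewise this places \<open>p\<close> in the maximal ideal times the free
      module.\<close>
    hence "\<forall>t\<in>T. Poly_Mapping.lookup (?c t) 0 = 0" using bspec[OF rel cT] N.mod_span_zero by simp
    hence "Poly_Mapping.lookup (p i) 0 = 0" if "i < card T" for i using ce[OF that] eT[OF that] by metis
    hence "p i \<in> mod_span (tdual d) (?M i)" if "i < card T" for i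
      using A.smult_max[OF pA[OF that], of 1] that by simp
    thus ?thesis
      using mod_span_dsum[OF _ p, of "tdual d"] tdual_carrier by blast
  qed
  ultimately show ?thesis
    using f by (intro exI[of _ "card T"] exI[of _ "\<lambda>i. - n (e i)"] exI[of _ ?f] conjI ballI impI)
qed

section \<open>Projective covers and quotients\<close>

lemma (in gmod) coset_eq_iff:
  assumes H: "submodule H (sym_alg d) M" and x: "x \<in> carrier M" and y: "y \<in> carrier M"
  shows "H #>\<^bsub>add_monoid M\<^esub> x = H #>\<^bsub>add_monoid M\<^esub> y \<longleftrightarrow> x \<ominus> y \<in> H"
proof -
  note h = submodule_closed[OF H]
  have coset: "H #>\<^bsub>add_monoid M\<^esub> z = (\<lambda>h. h \<oplus> z) ` H" for z
    by (auto simp: r_coset_def)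
  show ?thesis
  proof
    assume eq: "H #>\<^bsub>add_monoid M\<^esub> x = H #>\<^bsub>add_monoid M\<^esub> y"
    have "x \<in> (\<lambda>h. h \<oplus> x) ` H" using h(3) x by (intro image_eqI[of _ _ \<zero>]) auto
    then obtain h' where h': "h' \<in> H" "x = h' \<oplus> y" using eq unfolding coset by blast
    thus "x \<ominus> y \<in> H" using M.diff_add_self[OF h(2)[OF h'(1)] y] by simp
  next
    assume D: "x \<ominus> y \<in> H"
    have sub: "(\<lambda>h. h \<oplus> x) ` H \<subseteq> (\<lambda>h. h \<oplus> y) ` H"
      if x: "x \<in> carrier M" and y: "y \<in> carrier M" and D: "x \<ominus> y \<in> H" for x y
    proof
      fix z assume "z \<in> (\<lambda>h. h \<oplus> x) ` H"
      then obtain k where k: "k \<in> H" "z = k \<oplus> x" by blast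
      have "z = (k \<oplus> (x \<ominus> y)) \<oplus> y"
        using k h(2)[OF k(1)] x y M.add_diff_self[OF y x] M.a_assoc M.diff_closed[OF x y] M.a_comm[of y]
        by simp
      thus "z \<in> (\<lambda>h. h \<oplus> y) ` H" using h(4)[OF k(1) D] by blast
    qed
    have "y \<ominus> x \<in> H" using h(5)[OF D] M.minus_diff[OF x y] by simp
    thus "H #>\<^bsub>add_monoid M\<^esub> x = H #>\<^bsub>add_monoid M\<^esub> y"
      unfolding coset using sub[OF x y D] sub[OF y x] by blast
  qed
qed

text \<open>\<open>f\<close> maps the maximal ideal times \<open>M\<close> into the maximal ideal
  times \<open>N\<close>, so the set product in \<open>projective_cover\<close> absorbs it and is a
  single coset.\<close>

lemma (in ghom) projective_cover_map:
  assumes p: "p \<in> carrier M"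
  shows "mod_span (tdual d) N <#>\<^bsub>add_monoid N\<^esub> (f ` (mod_span (tdual d) M #>\<^bsub>add_monoid M\<^esub> p))
    = mod_span (tdual d) N #>\<^bsub>add_monoid N\<^esub> f p"
proof -
  let ?m = "mod_span (tdual d) M" and ?n = "mod_span (tdual d) N"
  note mm = gsubD[OF M.max_gsub] and nn = gsubD[OF N.max_gsub]
  have W: "tdual d \<subseteq> carrier (sym_alg d)" using tdual_carrier by blast
  have fm: "f x \<in> ?n" if "x \<in> ?m" for x using mod_span_image[OF W that] .
  have "?n <#>\<^bsub>add_monoid N\<^esub> (f ` (?m #>\<^bsub>add_monoid M\<^esub> p))
    = {y \<oplus>\<^bsub>N\<^esub> f (x \<oplus>\<^bsub>M\<^esub> p) | x y. x \<in> ?m \<and> y \<in> ?n}"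
    by (auto simp: set_mult_def r_coset_def)
  also have "\<dots> = {y \<oplus>\<^bsub>N\<^esub> f p | y. y \<in> ?n}"
  proof (intro subset_antisym subsetI)
    fix z assume "z \<in> {y \<oplus>\<^bsub>N\<^esub> f (x \<oplus>\<^bsub>M\<^esub> p) | x y. x \<in> ?m \<and> y \<in> ?n}"
    then obtain x y where z: "z = y \<oplus>\<^bsub>N\<^esub> f (x \<oplus>\<^bsub>M\<^esub> p)" "x \<in> ?m" "y \<in> ?n" by blast
    have "z = (y \<oplus>\<^bsub>N\<^esub> f x) \<oplus>\<^bsub>N\<^esub> f p"
      unfolding z(1) using add[OF mm(3)[OF z(2)] p] N.M.a_assoc[OF nn(3)[OF z(3)] closed[OF mm(3)[OF z(2)]] closed[OF p]]
      by simp
    thus "z \<in> {y \<oplus>\<^bsub>N\<^esub> f p | y. y \<in> ?n}" using nn(5)[OF z(3) fm[OF z(2)]] by blast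
  next
    fix z assume "z \<in> {y \<oplus>\<^bsub>N\<^esub> f p | y. y \<in> ?n}"
    then obtain y where "z = y \<oplus>\<^bsub>N\<^esub> f p" "y \<in> ?n" by blast
    moreover have "f (\<zero>\<^bsub>M\<^esub> \<oplus>\<^bsub>M\<^esub> p) = f p" using p by simp
    ultimately show "z \<in> {y \<oplus>\<^bsub>N\<^esub> f (x \<oplus>\<^bsub>M\<^esub> p) | x y. x \<in> ?m \<and> y \<in> ?n}"
      using mm(4) by (metis (mono_tags, lifting) mem_Collect_eq)
  qed
  also have "\<dots> = ?n #>\<^bsub>add_monoid N\<^esub> f p" by (auto simp: r_coset_def)
  finally show ?thesis .
qed

lemma reduction_carrier:
  "carrier (reduction d M) = (\<lambda>p. mod_span (tdual d) M #>\<^bsub>add_monoid M\<^esub> p) ` carrier M"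
  by (auto simp: reduction_def FactGroup_def RCOSETS_def)

lemma (in gmod) reduction_mult:
  assumes "x \<in> carrier M" "y \<in> carrier M"
  shows "(mod_span (tdual d) M #>\<^bsub>add_monoid M\<^esub> x) \<otimes>\<^bsub>reduction d M\<^esub> (mod_span (tdual d) M #>\<^bsub>add_monoid M\<^esub> y)
    = mod_span (tdual d) M #>\<^bsub>add_monoid M\<^esub> (x \<oplus> y)"
proof -
  have "subgroup (mod_span (tdual d) M) (add_monoid M)"
    using gsubD(1)[OF max_gsub] by (rule submodule.axioms)
  hence "mod_span (tdual d) M \<lhd> add_monoid M"
    using comm_group.normal_iff_subgroup[OF M.a_comm_group] by blast
  from normal.rcos_sum[OF this, of x y] assms show ?thesis
    by (simp add: reduction_def FactGroup_def)
qed

text \<open>For surjective \<open>f\<close>, bijectivity on the reductions amounts to the kernel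
  lying in the maximal ideal times \<open>P\<close>. Together with \<open>projective_coverD\<close>
  this kernel condition replaces the coset groups in all later arguments.\<close>

lemma projective_coverI:
  assumes P: "free_gmodule d P" and M: "graded_module d M" and f: "f \<in> gmod_hom d P M"
    and surj: "f ` carrier P = carrier M"
    and ker: "\<And>p. p \<in> carrier P \<Longrightarrow> f p = \<zero>\<^bsub>M\<^esub> \<Longrightarrow> p \<in> mod_span (tdual d) P"
  shows "projective_cover d P M f"
proof -
  have Pg: "graded_module d P" using P by (simp add: free_gmodule_def)
  interpret ghom d P M f by (rule ghomI[OF Pg M f])
  let ?m = "mod_span (tdual d) P" and ?n = "mod_span (tdual d) M"
  have W: "tdual d \<subseteq> carrier (sym_alg d)" using tdual_carrier by blast
  let ?\<phi> = "\<lambda>C. ?n <#>\<^bsub>add_monoid M\<^esub> (f ` C)"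
  note map = projective_cover_map
  note mm = gsubD[OF M.max_gsub]
  have "?\<phi> \<in> hom (reduction d P) (reduction d M)"
  proof (rule homI)
    show "?\<phi> X \<in> carrier (reduction d M)" if "X \<in> carrier (reduction d P)" for X
      using that map closed by (auto simp: reduction_carrier)
    fix X Y assume "X \<in> carrier (reduction d P)" "Y \<in> carrier (reduction d P)"
    then obtain x y where xy: "x \<in> carrier P" "X = ?m #>\<^bsub>add_monoid P\<^esub> x"
      "y \<in> carrier P" "Y = ?m #>\<^bsub>add_monoid P\<^esub> y" by (auto simp: reduction_carrier)
    show "?\<phi> (X \<otimes>\<^bsub>reduction d P\<^esub> Y) = ?\<phi> X \<otimes>\<^bsub>reduction d M\<^esub> ?\<phi> Y"
      using xy M.reduction_mult[OF xy(1,3)] N.reduction_mult[OF closed[OF xy(1)] closed[OF xy(3)]]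
        map[OF xy(1)] map[OF xy(3)] map[OF M.M.a_closed[OF xy(1,3)]] add[OF xy(1,3)] by simp
  qed
  moreover have "inj_on ?\<phi> (carrier (reduction d P))"
  proof (rule inj_onI)
    fix X Y assume "X \<in> carrier (reduction d P)" "Y \<in> carrier (reduction d P)" and eq: "?\<phi> X = ?\<phi> Y"
    then obtain x y where xy: "x \<in> carrier P" "X = ?m #>\<^bsub>add_monoid P\<^esub> x"
      "y \<in> carrier P" "Y = ?m #>\<^bsub>add_monoid P\<^esub> y" by (auto simp: reduction_carrier)
    have "?n #>\<^bsub>add_monoid M\<^esub> f x = ?n #>\<^bsub>add_monoid M\<^esub> f y" using eq xy map by simp
    hence "f x \<ominus>\<^bsub>M\<^esub> f y \<in> ?n"
      using N.coset_eq_iff[OF gsubD(1)[OF N.max_gsub] closed[OF xy(1)] closed[OF xy(3)]] by simp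
    \<comment> \<open>Surjectivity lifts the difference of the images to an element \<open>u\<close>
      of the maximal ideal times \<open>P\<close>; correcting \<open>x - y\<close> by
      \<open>u\<close> lands in the kernel.\<close>
    then obtain u where u: "u \<in> ?m" "f u = f x \<ominus>\<^bsub>M\<^esub> f y"
      using mod_span_surj[OF W surj] by blast
    have D: "x \<ominus>\<^bsub>P\<^esub> y \<in> carrier P" using M.M.diff_closed xy by simp
    have fu: "f u \<in> carrier M" using closed mm(3) u(1) by blast
    have "f ((x \<ominus>\<^bsub>P\<^esub> y) \<ominus>\<^bsub>P\<^esub> u) = \<zero>\<^bsub>M\<^esub>"
      using diff[OF D mm(3)[OF u(1)]] diff[OF xy(1,3)] u(2) N.M.diff_zero_iff[OF fu fu] by simp
    hence "(x \<ominus>\<^bsub>P\<^esub> y) \<ominus>\<^bsub>P\<^esub> u \<in> ?m" by (rule ker[OF M.M.diff_closed[OF D mm(3)[OF u(1)]]])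
    hence "u \<oplus>\<^bsub>P\<^esub> ((x \<ominus>\<^bsub>P\<^esub> y) \<ominus>\<^bsub>P\<^esub> u) \<in> ?m" by (rule mm(5)[OF u(1)])
    hence "x \<ominus>\<^bsub>P\<^esub> y \<in> ?m" using M.M.add_diff_self[OF mm(3)[OF u(1)] D] by simp
    thus "X = Y" using M.coset_eq_iff[OF mm(1) xy(1,3)] xy(2,4) by simp
  qed
  moreover have "?\<phi> ` carrier (reduction d P) = carrier (reduction d M)"
  proof -
    have "?\<phi> ` carrier (reduction d P) = (\<lambda>p. ?n #>\<^bsub>add_monoid M\<^esub> f p) ` carrier P"
      unfolding reduction_carrier image_image by (rule image_cong) (use map in auto)
    also have "\<dots> = (\<lambda>p. ?n #>\<^bsub>add_monoid M\<^esub> p) ` (f ` carrier P)" by (simp add: image_image)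
    finally show ?thesis unfolding surj reduction_carrier .
  qed
  ultimately have "?\<phi> \<in> iso (reduction d P) (reduction d M)"
    by (simp add: iso_def bij_betw_def)
  thus ?thesis using P f surj by (simp add: projective_cover_def)
qed

lemma projective_coverD:
  assumes pc: "projective_cover d P M f" and M: "graded_module d M"
    and p: "p \<in> carrier P" "f p = \<zero>\<^bsub>M\<^esub>"
  shows "p \<in> mod_span (tdual d) P"
proof -
  have P: "graded_module d P" and f: "f \<in> gmod_hom d P M"
    using pc by (auto simp: projective_cover_def free_gmodule_def)
  interpret ghom d P M f by (rule ghomI[OF P M f])
  let ?m = "mod_span (tdual d) P" and ?n = "mod_span (tdual d) M"
  let ?\<phi> = "\<lambda>C. ?n <#>\<^bsub>add_monoid M\<^esub> (f ` C)"
  have inj: "inj_on ?\<phi> (carrier (reduction d P))"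
    using pc by (simp add: projective_cover_def iso_def bij_betw_def)
  have "?\<phi> (?m #>\<^bsub>add_monoid P\<^esub> p) = ?\<phi> (?m #>\<^bsub>add_monoid P\<^esub> \<zero>\<^bsub>P\<^esub>)"
    using projective_cover_map[OF p(1)] projective_cover_map[OF M.M.zero_closed] p(2) zero by simp
  hence "?m #>\<^bsub>add_monoid P\<^esub> p = ?m #>\<^bsub>add_monoid P\<^esub> \<zero>\<^bsub>P\<^esub>"
    by (rule inj_onD[OF inj]) (use p in \<open>auto simp: reduction_carrier\<close>)
  hence "p \<ominus>\<^bsub>P\<^esub> \<zero>\<^bsub>P\<^esub> \<in> ?m"
    using M.coset_eq_iff[OF gsubD(1)[OF M.max_gsub] p(1) M.M.zero_closed] by simp
  thus ?thesis using M.M.add_diff_self[OF M.M.zero_closed p(1)] M.M.diff_closed[OF p(1) M.M.zero_closed] by simp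
qed

text \<open>The quotient is realised on cosets, which is why the edge modules of the constructed
  sheaves have carrier type \<open>(nat \<Rightarrow> cpoly) set\<close>.\<close>

lemma (in gmod) quotient_exists:
  assumes W: "W \<subseteq> tdual d"
  shows "\<exists>(N :: (cpoly, 'b set) gmodule) q. graded_module d N \<and> quotient_map d W M N q \<and>
    (\<forall>v\<in>W. \<forall>m\<in>carrier N. v \<odot>\<^bsub>N\<^esub> m = \<zero>\<^bsub>N\<^esub>)"
proof -
  let ?C = "mod_span W M"
  let ?q = "\<lambda>x. ?C #>\<^bsub>add_monoid M\<^esub> x"
  have C: "gsub d M ?C" by (rule mod_span_gsub[OF W])
  note q = graded_img[OF C, of ?q, OF coset_eq_iff[OF gsubD(1)[OF C]]]
  let ?N = "img_gmodule ?q M"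
  have "v \<odot>\<^bsub>?N\<^esub> m = \<zero>\<^bsub>?N\<^esub>" if v: "v \<in> W" and m: "m \<in> carrier ?N" for v m
  proof -
    obtain x where x: "x \<in> carrier M" "m = ?q x" using m q(3) by blast
    have "v \<in> carrier (sym_alg d)" using v W tdual_carrier by blast
    hence "v \<odot>\<^bsub>?N\<^esub> m = ?q (v \<odot> x)" using gmod_homD(3)[OF q(2), of v x] x by simp
    also have "?q (v \<odot> x) = \<zero>\<^bsub>?N\<^esub>" using mod_span_incl[OF v x(1)] q(4) by blast
    finally show ?thesis .
  qed
  thus ?thesis using q by (intro exI[of _ ?N] exI[of _ ?q]) (simp add: quotient_map_def)
qed

text \<open>\<open>f\<close> matches the submodules spanned by \<open>W\<close> on both sides, so
  its composite with \<open>p'\<close> factors through \<open>p\<close>, and the factor is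
  injective.\<close>

lemma quotient_iso:
  assumes gr: "graded_module d M" "graded_module d N" "graded_module d M'" "graded_module d N'"
    and W: "W \<subseteq> carrier (sym_alg d)"
    and p: "quotient_map d W M N p" and p': "quotient_map d W M' N' p'"
    and f: "f \<in> gmod_iso d M M'"
  shows "\<exists>g\<in>gmod_iso d N N'. \<forall>m\<in>carrier M. g (p m) = p' (f m)"
proof -
  interpret p: ghom d M N p using p gr by (intro ghomI) (auto simp: quotient_map_def)
  interpret p': ghom d M' N' p' using p' gr by (intro ghomI) (auto simp: quotient_map_def)
  have fh: "f \<in> gmod_hom d M M'" and fb: "bij_betw f (carrier M) (carrier M')"
    using f by (auto simp: gmod_iso_def)
  interpret f: ghom d M M' f by (rule ghomI[OF gr(1,3) fh])
  have pk: "p m = \<zero>\<^bsub>N\<^esub> \<longleftrightarrow> m \<in> mod_span W M" if "m \<in> carrier M" for m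
    using p that unfolding quotient_map_def by blast
  have pk': "p' m = \<zero>\<^bsub>N'\<^esub> \<longleftrightarrow> m \<in> mod_span W M'" if "m \<in> carrier M'" for m
    using p' that unfolding quotient_map_def by blast
  have ps: "p ` carrier M = carrier N" "p' ` carrier M' = carrier N'"
    using p p' by (auto simp: quotient_map_def)
  have fk: "f m \<in> mod_span W M' \<longleftrightarrow> m \<in> mod_span W M" if m: "m \<in> carrier M" for m
  proof
    assume "f m \<in> mod_span W M'"
    then obtain x where x: "x \<in> mod_span W M" "f x = f m"
      using f.mod_span_surj[OF W bij_betw_imp_surj_on[OF fb]] by blast
    have "x \<in> carrier M" using submodule_closed(2)[OF p.M.mod_span_submodule[OF W] x(1)] .
    hence "x = m" using fb x(2) m by (auto simp: bij_betw_def dest: inj_onD)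
    thus "m \<in> mod_span W M" using x by simp
  qed (rule f.mod_span_image[OF W])
  define g where "g y = p' (f (inv_into (carrier M) p y))" for y
  have g: "g (p m) = p' (f m)" if m: "m \<in> carrier M" for m
  proof -
    define m' where "m' = inv_into (carrier M) p (p m)"
    have m': "m' \<in> carrier M" "p m' = p m"
      using m by (auto simp: m'_def inv_into_into f_inv_into_f)
    have D: "m' \<ominus>\<^bsub>M\<^esub> m \<in> carrier M" using p.M.diff_closed m m' by simp
    have "p (m' \<ominus>\<^bsub>M\<^esub> m) = \<zero>\<^bsub>N\<^esub>"
      using p.diff[OF m'(1) m] m'(2) p.N.diff_zero_iff[OF p.closed[OF m] p.closed[OF m]] by simp
    hence "f (m' \<ominus>\<^bsub>M\<^esub> m) \<in> mod_span W M'" using pk[OF D] fk[OF D] by simp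
    hence "p' (f (m' \<ominus>\<^bsub>M\<^esub> m)) = \<zero>\<^bsub>N'\<^esub>" using pk'[OF f.closed[OF D]] by simp
    hence "p' (f m') \<ominus>\<^bsub>N'\<^esub> p' (f m) = \<zero>\<^bsub>N'\<^esub>"
      using f.diff[OF m'(1) m] p'.diff[OF f.closed[OF m'(1)] f.closed[OF m]] by simp
    hence "p' (f m') = p' (f m)"
      using p'.N.diff_zero_iff[OF p'.closed[OF f.closed[OF m'(1)]] p'.closed[OF f.closed[OF m]]] by simp
    thus ?thesis by (simp add: g_def m'_def)
  qed
  have rep: "\<exists>m\<in>carrier M. y = p m" if "y \<in> carrier N" for y using ps(1) that by blast
  have "g \<in> gmod_hom d N N'"
  proof (rule gmod_homI)
    show "g y \<in> carrier N'" if "y \<in> carrier N" for y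
      using rep[OF that] g p'.closed f.closed by auto
    fix y z assume "y \<in> carrier N" "z \<in> carrier N"
    then obtain m n where mn: "m \<in> carrier M" "y = p m" "n \<in> carrier M" "z = p n" using rep by blast
    have "g (y \<oplus>\<^bsub>N\<^esub> z) = g (p (m \<oplus>\<^bsub>M\<^esub> n))" using mn p.add by simp
    also have "\<dots> = p' (f m) \<oplus>\<^bsub>N'\<^esub> p' (f n)"
      using mn g f.add p'.add f.closed by simp
    finally show "g (y \<oplus>\<^bsub>N\<^esub> z) = g y \<oplus>\<^bsub>N'\<^esub> g z" using mn g by simp
  next
    fix a y assume a: "a \<in> carrier (sym_alg d)" and "y \<in> carrier N"
    then obtain m where m: "m \<in> carrier M" "y = p m" using rep by blast
    have "g (a \<odot>\<^bsub>N\<^esub> y) = g (p (a \<odot>\<^bsub>M\<^esub> m))" using m p.smult a by simp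
    also have "\<dots> = a \<odot>\<^bsub>N'\<^esub> p' (f m)" using m a g f.smult p'.smult f.closed by simp
    finally show "g (a \<odot>\<^bsub>N\<^esub> y) = a \<odot>\<^bsub>N'\<^esub> g y" using m g by simp
  next
    fix n y assume y: "y \<in> hcomp N n"
    then obtain m where m: "m \<in> carrier M" "y = p m" using rep p.N.hcomp_closed(1) by blast
    have "y = p (gcomp M n m)" using p.gcomp[OF m(1), of n] p.N.gcomp_hcomp[OF y, of n] m(2) by simp
    thus "g y \<in> hcomp N' n"
      using g[OF p.M.gcomp_carrier[OF m(1)]] p.M.gcomp_decomp(1)[OF m(1), of n] f.hcomp p'.hcomp by simp
  qed
  then interpret g: ghom d N N' g by (rule ghomI[OF gr(2,4)])
  have "inj_on g (carrier N)"
  proof (rule inj_onI)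
    fix y z assume yz: "y \<in> carrier N" "z \<in> carrier N" "g y = g z"
    obtain m where m: "m \<in> carrier M" "y \<ominus>\<^bsub>N\<^esub> z = p m"
      using rep[OF p.N.diff_closed[OF yz(1,2)]] by blast
    have "g (p m) = \<zero>\<^bsub>N'\<^esub>"
      using g.diff[OF yz(1,2)] yz(3) p'.N.diff_zero_iff[OF g.closed[OF yz(2)] g.closed[OF yz(2)]] m(2) by simp
    hence "p m = \<zero>\<^bsub>N\<^esub>" using g[OF m(1)] pk'[OF f.closed[OF m(1)]] fk[OF m(1)] pk[OF m(1)] by simp
    thus "y = z" using m(2) p.N.diff_zero_iff[OF yz(1,2)] by simp
  qed
  moreover have "g ` carrier N = carrier N'"
  proof -
    have "g ` carrier N = (\<lambda>m. p' (f m)) ` carrier M"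
      unfolding ps(1)[symmetric] image_image by (rule image_cong) (use g in auto)
    also have "\<dots> = p' ` (f ` carrier M)" by (simp add: image_image)
    finally show ?thesis using fb ps(2) by (simp add: bij_betw_def)
  qed
  ultimately have "g \<in> gmod_iso d N N'" using g.f by (simp add: gmod_iso_def bij_betw_def)
  thus ?thesis using g by blast
qed

lemma quotient_map_shift:
  assumes "quotient_map d W M N p"
  shows "quotient_map d W (shift_gmodule k M) (shift_gmodule k N) p"
  using assms by (auto simp: quotient_map_def gmod_hom_def shift_gmodule_def mod_span_def)

lemma gmod_hom_shift:
  "f \<in> gmod_hom d M N \<Longrightarrow> f \<in> gmod_hom d (shift_gmodule k M) (shift_gmodule k N)"
  by (rule gmod_homI) (auto dest: gmod_homD)

lemma gmod_hom_dsum: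
  assumes "\<And>i. i \<in> I \<Longrightarrow> p i \<in> gmod_hom d (M i) (N i)"
  shows "(\<lambda>m. \<lambda>i\<in>I. p i (m i)) \<in> gmod_hom d (dsum_gmodule I M) (dsum_gmodule I N)"
  by (rule gmod_homI) (use gmod_homD[OF assms] in \<open>auto simp: PiE_iff fun_eq_iff\<close>)

lemma quotient_map_dsum:
  assumes I: "finite I" and gr: "\<And>i. i \<in> I \<Longrightarrow> graded_module d (M i)"
    and W: "W \<subseteq> carrier (sym_alg d)" and p: "\<And>i. i \<in> I \<Longrightarrow> quotient_map d W (M i) (N i) (p i)"
  shows "quotient_map d W (dsum_gmodule I M) (dsum_gmodule I N) (\<lambda>m. \<lambda>i\<in>I. p i (m i))"
proof -
  interpret gfam d I M by (rule gfam_const[OF I gr])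
  have ph: "p i \<in> gmod_hom d (M i) (N i)" "p i ` carrier (M i) = carrier (N i)"
    "{m \<in> carrier (M i). p i m = \<zero>\<^bsub>N i\<^esub>} = mod_span W (M i)" if "i \<in> I" for i
    using p[OF that] by (auto simp: quotient_map_def)
  let ?p = "\<lambda>m. \<lambda>i\<in>I. p i (m i)"
  have "?p ` carrier D = carrier (dsum_gmodule I N)"
  proof (intro subset_antisym subsetI)
    fix y assume "y \<in> ?p ` carrier D"
    thus "y \<in> carrier (dsum_gmodule I N)" using gmod_homD(1)[OF ph(1)] by (auto simp: PiE_iff)
  next
    fix y assume y: "y \<in> carrier (dsum_gmodule I N)"
    have "\<forall>i\<in>I. \<exists>x. x \<in> carrier (M i) \<and> p i x = y i"
    proof
      fix i assume i: "i \<in> I"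
      have "y i \<in> carrier (N i)"
        by (rule PiE_mem[OF y[unfolded dsum_gmodule_simps] i])
      hence "y i \<in> p i ` carrier (M i)" unfolding ph(2)[OF i] .
      then obtain x where "y i = p i x" "x \<in> carrier (M i)" by (rule imageE)
      thus "\<exists>x. x \<in> carrier (M i) \<and> p i x = y i" by (intro exI[of _ x]) simp
    qed
    then obtain x where "\<forall>i\<in>I. x i \<in> carrier (M i) \<and> p i (x i) = y i"
      by (elim bchoice[THEN exE])
    hence x: "\<And>i. i \<in> I \<Longrightarrow> x i \<in> carrier (M i) \<and> p i (x i) = y i" by simp
    have "?p (\<lambda>i\<in>I. x i) = y"
    proof
      fix i
      show "?p (\<lambda>i\<in>I. x i) i = y i"
      proof (cases "i \<in> I")
        case False
        have "y i = undefined" using y False by (intro PiE_arb[of y I "\<lambda>i. carrier (N i)"]) simp_all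
        thus ?thesis using False by simp
      qed (simp add: x)
    qed
    moreover have "(\<lambda>i\<in>I. x i) \<in> carrier D" using x by auto
    ultimately show "y \<in> ?p ` carrier D" by blast
  qed
  moreover have "{m \<in> carrier D. ?p m = \<zero>\<^bsub>dsum_gmodule I N\<^esub>} = mod_span W D"
  proof -
    interpret DD: gmod d D using graded_dsum(1) by (simp add: gmod_def)
    have "?p m = \<zero>\<^bsub>dsum_gmodule I N\<^esub> \<longleftrightarrow> m \<in> mod_span W D" if m: "m \<in> carrier D" for m
    proof -
      have "?p m = \<zero>\<^bsub>dsum_gmodule I N\<^esub> \<longleftrightarrow> (\<forall>i\<in>I. p i (m i) = \<zero>\<^bsub>N i\<^esub>)"
        by (auto simp: fun_eq_iff restrict_def)
      also have "\<dots> \<longleftrightarrow> (\<forall>i\<in>I. m i \<in> mod_span W (M i))"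
        using ph(3) m by (auto simp: set_eq_iff PiE_iff)
      finally show ?thesis using mod_span_dsum[OF W m] by simp
    qed
    thus ?thesis using submodule_closed(2)[OF DD.mod_span_submodule[OF W]] by blast
  qed
  ultimately show ?thesis
    unfolding quotient_map_def using gmod_hom_dsum[of I p d M N] ph(1) by blast
qed

section \<open>Modules isomorphic to the ring, and zero modules\<close>

lemma gmod_iso_comp:
  "f \<in> gmod_iso d M N \<Longrightarrow> g \<in> gmod_iso d N P \<Longrightarrow> (\<lambda>x. g (f x)) \<in> gmod_iso d M P"
  unfolding gmod_iso_def using gmod_hom_comp[of f d M N g P] bij_betw_trans[of f _ _ g]
  by (auto simp: comp_def)

lemma gmod_isoD:
  assumes "f \<in> gmod_iso d M N"
  shows "f \<in> gmod_hom d M N" "bij_betw f (carrier M) (carrier N)"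
  using assms by (auto simp: gmod_iso_def)

lemma sym_alg_one_hcomp: "1 \<in> hcomp (sym_alg d) 0"
  by (auto simp: sym_alg_hcomp sym_alg_carrier mdeg_def)

lemma iso_sym_alg_generator:
  assumes K: "graded_module d K" and f: "f \<in> gmod_iso d K (sym_alg d)"
  obtains e where "e \<in> hcomp K 0" "f e = 1" "e \<noteq> \<zero>\<^bsub>K\<^esub>"
    "\<And>m. m \<in> carrier K \<Longrightarrow> f m \<in> carrier (sym_alg d) \<and> m = f m \<odot>\<^bsub>K\<^esub> e"
proof -
  note fi = gmod_isoD[OF f]
  interpret f: ghom d K "sym_alg d" f by (rule ghomI[OF K graded_sym_alg fi(1)])
  define e where "e = inv_into (carrier K) f 1"
  note gi = gmod_isoD[OF gmod_iso_inv[OF K graded_sym_alg f]]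
  have e: "e \<in> hcomp K 0" unfolding e_def by (rule gmod_homD(4)[OF gi(1) sym_alg_one_hcomp])
  have fe: "f e = 1" unfolding e_def by (rule bij_betw_inv_into_right[OF fi(2)]) simp
  have ec: "e \<in> carrier K" using e by (rule f.M.hcomp_closed)
  show thesis
  proof
    show "e \<noteq> \<zero>\<^bsub>K\<^esub>" using fe f.zero by auto
    fix m assume m: "m \<in> carrier K"
    have fm: "f m \<in> carrier (sym_alg d)" using f.closed[OF m] .
    have "f (f m \<odot>\<^bsub>K\<^esub> e) = f m" using f.smult[OF fm ec] fe by simp
    hence "f m \<odot>\<^bsub>K\<^esub> e = m"
      using fi(2) m f.M.smult_closed[OF fm ec] by (auto simp: bij_betw_def dest: inj_onD)
    thus "f m \<in> carrier (sym_alg d) \<and> m = f m \<odot>\<^bsub>K\<^esub> e" using fm by simp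
  qed (fact e fe)+
qed

lemma free_of_iso:
  assumes K: "graded_module d K" and f: "f \<in> gmod_iso d K (sym_alg d)"
  shows "free_gmodule d K"
proof -
  interpret K: gmod d K using K by (simp add: gmod_def)
  note fi = gmod_isoD[OF f]
  obtain e where e: "e \<in> hcomp K 0" "f e = 1"
    "\<And>m. m \<in> carrier K \<Longrightarrow> f m \<in> carrier (sym_alg d) \<and> m = f m \<odot>\<^bsub>K\<^esub> e"
    using iso_sym_alg_generator[OF K f] by metis
  have ec: "e \<in> carrier K" using e(1) by (rule K.hcomp_closed)
  have sum1: "(\<Oplus>\<^bsub>K\<^esub>b\<in>{e}. c b \<odot>\<^bsub>K\<^esub> b) = c e \<odot>\<^bsub>K\<^esub> e" if "c \<in> {e} \<rightarrow>\<^sub>E carrier (sym_alg d)" for c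
    using ec K.smult_closed[OF PiE_mem[OF that, of e] ec] by (subst K.M.finsum_insert) auto
  show ?thesis unfolding free_gmodule_def
  proof (intro conjI exI[of _ "{e}"] ballI K)
    show "\<exists>n. b \<in> hcomp K n" if "b \<in> {e}" for b using that e(1) by blast
    fix m assume m: "m \<in> carrier K"
    show "\<exists>!c. c \<in> {e} \<rightarrow>\<^sub>E carrier (sym_alg d) \<and> m = (\<Oplus>\<^bsub>K\<^esub>b\<in>{e}. c b \<odot>\<^bsub>K\<^esub> b)"
    proof (rule ex1I[of _ "\<lambda>b\<in>{e}. f m"])
      have c: "(\<lambda>b\<in>{e}. f m) \<in> {e} \<rightarrow>\<^sub>E carrier (sym_alg d)" using e(3)[OF m] by auto
      show "(\<lambda>b\<in>{e}. f m) \<in> {e} \<rightarrow>\<^sub>E carrier (sym_alg d) \<and> m = (\<Oplus>\<^bsub>K\<^esub>b\<in>{e}. (\<lambda>b\<in>{e}. f m) b \<odot>\<^bsub>K\<^esub> b)"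
        using sum1[OF c] c e(3)[OF m] by simp
      fix c' assume c': "c' \<in> {e} \<rightarrow>\<^sub>E carrier (sym_alg d) \<and> m = (\<Oplus>\<^bsub>K\<^esub>b\<in>{e}. c' b \<odot>\<^bsub>K\<^esub> b)"
      hence "m = c' e \<odot>\<^bsub>K\<^esub> e" using sum1 by simp
      hence "f m = c' e" using gmod_homD(3)[OF fi(1), of "c' e" e] c' ec e(2) by auto
      hence "c' x = (\<lambda>b\<in>{e}. f m) x" if "x \<in> {e}" for x using that by simp
      thus "c' = (\<lambda>b\<in>{e}. f m)" by (rule PiE_ext[OF conjunct1[OF c'] c])
    qed
  qed (use ec in auto)
qed

lemma free_zero:
  assumes K: "graded_module d K" and z: "zero_gmodule K"
  shows "free_gmodule d K"
proof -
  interpret K: gmod d K using K by (simp add: gmod_def)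
  show ?thesis unfolding free_gmodule_def
    by (intro conjI exI[of _ "{}"] K) (use z in \<open>auto simp: zero_gmodule_def\<close>)
qed

lemma zero_gmoduleD: "zero_gmodule K \<Longrightarrow> x \<in> carrier K \<Longrightarrow> x = \<zero>\<^bsub>K\<^esub>"
  by (simp add: zero_gmodule_def)

lemma (in gmod) zero_gmoduleI: "(\<And>x. x \<in> carrier M \<Longrightarrow> x = \<zero>) \<Longrightarrow> zero_gmodule M"
  by (auto simp: zero_gmodule_def)

lemma (in gmod) nakayama_zero:
  assumes "\<And>x. x \<in> carrier M \<Longrightarrow> x \<in> mod_span (tdual d) M"
  shows "zero_gmodule M"
proof -
  have "{\<zero>} = carrier M"
  proof (rule nakayama)
    show "gsub d M {\<zero>}" by (rule gsubI) auto
    fix m assume m: "m \<in> carrier M"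
    have "m = \<zero> \<oplus> m" using m by simp
    thus "\<exists>c\<in>{\<zero>}. \<exists>w\<in>mod_span (tdual d) M. m = c \<oplus> w" using assms[OF m] by blast
  qed
  thus ?thesis by (simp add: zero_gmodule_def)
qed

section \<open>Sheaves on moment graphs\<close>

lemma sheaf_sections_cong:
  assumes "\<And>x. x \<in> Zv \<Longrightarrow> vmod F x = vmod G x" "\<And>L. L \<in> Ze \<Longrightarrow> emod F L = emod G L"
    "\<And>x L. x \<in> Zv \<Longrightarrow> L \<in> Ze \<Longrightarrow> x \<in> ends \<Gamma> L \<Longrightarrow> res F x L = res G x L"
  shows "sheaf_sections \<Gamma> F Zv Ze = sheaf_sections \<Gamma> G Zv Ze"
proof -
  have "(\<Pi>\<^sub>E x\<in>Zv. carrier (vmod F x)) = (\<Pi>\<^sub>E x\<in>Zv. carrier (vmod G x))"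
    "(\<Pi>\<^sub>E L\<in>Ze. carrier (emod F L)) = (\<Pi>\<^sub>E L\<in>Ze. carrier (emod G L))"
    by (rule PiE_cong; use assms in simp)+
  moreover have "(\<forall>x\<in>Zv. \<forall>L\<in>Ze. x \<in> ends \<Gamma> L \<longrightarrow> res F x L (s x) = u L) \<longleftrightarrow>
    (\<forall>x\<in>Zv. \<forall>L\<in>Ze. x \<in> ends \<Gamma> L \<longrightarrow> res G x L (s x) = u L)" for s u
    by (intro ball_cong refl imp_cong) (simp add: assms(3))
  ultimately show ?thesis by (simp add: sheaf_sections_def)
qed

lemma dsum_gmodule_cong:
  assumes "\<And>i. i \<in> I \<Longrightarrow> M i = N i"
  shows "dsum_gmodule I M = dsum_gmodule I N"
proof -
  have "(\<Pi>\<^sub>E i\<in>I. carrier (M i)) = (\<Pi>\<^sub>E i\<in>I. carrier (N i))"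
    "(\<Pi>\<^sub>E i\<in>I. hcomp (M i) n) = (\<Pi>\<^sub>E i\<in>I. hcomp (N i) n)" for n
    by (rule PiE_cong; use assms in simp)+
  moreover have "(\<lambda>i\<in>I. \<zero>\<^bsub>M i\<^esub>) = (\<lambda>i\<in>I. \<zero>\<^bsub>N i\<^esub>)"
    "(\<lambda>i\<in>I. f i \<oplus>\<^bsub>M i\<^esub> g i) = (\<lambda>i\<in>I. f i \<oplus>\<^bsub>N i\<^esub> g i)"
    "(\<lambda>i\<in>I. a \<odot>\<^bsub>M i\<^esub> f i) = (\<lambda>i\<in>I. a \<odot>\<^bsub>N i\<^esub> f i)" for f g a
    by (rule restrict_ext; use assms in simp)+
  ultimately show ?thesis by (simp add: dsum_gmodule_def)
qed

text \<open>The map from the stalk at \<open>x\<close> to its boundary, in the very form in which it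
  occurs in \<open>canonical_sheaf\<close>.\<close>

definition bmap :: "('v, 'e) mgraph \<Rightarrow> ('v, 'e, 'm, 'l) gsheaf \<Rightarrow> 'v \<Rightarrow> 'm \<Rightarrow> 'e \<Rightarrow> 'l" where
  "bmap \<Gamma> F x m = (\<lambda>L\<in>up_edges \<Gamma> x. res F x L m)"

definition is_end :: "('v, 'e) mgraph \<Rightarrow> 'e \<Rightarrow> 'v \<Rightarrow> 'v \<Rightarrow> bool" where
  "is_end \<Gamma> L x y \<longleftrightarrow> x \<in> verts \<Gamma> \<and> y \<in> verts \<Gamma> \<and> x \<noteq> y \<and> vle \<Gamma> y x \<and> ends \<Gamma> L = {x, y}"

text \<open>The graph record stores the ends of an edge as an unordered set; the orientation is
  recovered by choice, and \<open>e_unique\<close> shows that antisymmetry leaves only one.\<close>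

definition e_up :: "('v, 'e) mgraph \<Rightarrow> 'e \<Rightarrow> 'v" where
  "e_up \<Gamma> L = (SOME x. \<exists>y. is_end \<Gamma> L x y)"

definition e_lo :: "('v, 'e) mgraph \<Rightarrow> 'e \<Rightarrow> 'v" where
  "e_lo \<Gamma> L = (SOME y. is_end \<Gamma> L (e_up \<Gamma> L) y)"

text \<open>What the algebra uses of a moment graph: a finite poset, edges with two distinct
  comparable ends, and directions among the linear forms. A top vertex is not included; it is named
  separately where needed. Each subgraph \<open>graph_below\<close> is again an instance.\<close>

locale moment =
  fixes \<Gamma> :: "('v, 'e) mgraph"
  assumes finV: "finite (verts \<Gamma>)" and finE: "finite (edges \<Gamma>)"
    and vrefl: "x \<in> verts \<Gamma> \<Longrightarrow> vle \<Gamma> x x"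
    and vtrans: "x \<in> verts \<Gamma> \<Longrightarrow> y \<in> verts \<Gamma> \<Longrightarrow> z \<in> verts \<Gamma> \<Longrightarrow> vle \<Gamma> x y \<Longrightarrow> vle \<Gamma> y z \<Longrightarrow> vle \<Gamma> x z"
    and vanti: "x \<in> verts \<Gamma> \<Longrightarrow> y \<in> verts \<Gamma> \<Longrightarrow> vle \<Gamma> x y \<Longrightarrow> vle \<Gamma> y x \<Longrightarrow> x = y"
    and ends_ex: "L \<in> edges \<Gamma> \<Longrightarrow> \<exists>x y. is_end \<Gamma> L x y"
    and dir_sub: "L \<in> edges \<Gamma> \<Longrightarrow> dir \<Gamma> L \<subseteq> tdual (grank \<Gamma>)"
begin

abbreviation d where "d \<equiv> grank \<Gamma>"
abbreviation up where "up \<equiv> e_up \<Gamma>"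
abbreviation lo where "lo \<equiv> e_lo \<Gamma>"

lemma e_ends:
  assumes "L \<in> edges \<Gamma>"
  shows "up L \<in> verts \<Gamma>" "lo L \<in> verts \<Gamma>" "up L \<noteq> lo L" "vle \<Gamma> (lo L) (up L)" "ends \<Gamma> L = {up L, lo L}"
proof -
  have "\<exists>y. is_end \<Gamma> L (up L) y"
    unfolding e_up_def by (rule someI_ex) (rule ends_ex[OF assms])
  hence "is_end \<Gamma> L (up L) (lo L)" unfolding e_lo_def by (rule someI_ex)
  thus "up L \<in> verts \<Gamma>" "lo L \<in> verts \<Gamma>" "up L \<noteq> lo L" "vle \<Gamma> (lo L) (up L)" "ends \<Gamma> L = {up L, lo L}"
    by (auto simp: is_end_def)
qed

lemma e_unique:
  assumes "L \<in> edges \<Gamma>" "is_end \<Gamma> L x y"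
  shows "up L = x" "lo L = y"
proof -
  note e = e_ends[OF assms(1)]
  have "{x, y} = {up L, lo L}" using assms(2) e(5) by (simp add: is_end_def)
  hence "up L = x \<and> lo L = y \<or> up L = y \<and> lo L = x" by (auto simp: doubleton_eq_iff)
  thus "up L = x" "lo L = y"
    using assms(2) e vanti[of x y] by (auto simp: is_end_def)
qed

lemma up_edges_iff: "L \<in> up_edges \<Gamma> x \<longleftrightarrow> L \<in> edges \<Gamma> \<and> lo L = x"
proof
  assume "L \<in> up_edges \<Gamma> x"
  then obtain y where y: "L \<in> edges \<Gamma>" "y \<in> verts \<Gamma>" "ends \<Gamma> L = {x, y}" "vle \<Gamma> x y"
    by (auto simp: up_edges_def)
  note e = e_ends[OF y(1)]
  have "x = up L \<and> y = lo L \<or> x = lo L \<and> y = up L" using y(3) e(5) by (auto simp: doubleton_eq_iff)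
  thus "L \<in> edges \<Gamma> \<and> lo L = x" using y e vanti by auto
next
  assume "L \<in> edges \<Gamma> \<and> lo L = x"
  thus "L \<in> up_edges \<Gamma> x" using e_ends[of L] by (auto simp: up_edges_def)
qed

lemma down_edges_iff: "L \<in> down_edges \<Gamma> x \<longleftrightarrow> L \<in> edges \<Gamma> \<and> up L = x"
proof
  assume "L \<in> down_edges \<Gamma> x"
  then obtain y where y: "L \<in> edges \<Gamma>" "y \<in> verts \<Gamma>" "ends \<Gamma> L = {x, y}" "vle \<Gamma> y x"
    by (auto simp: down_edges_def)
  note e = e_ends[OF y(1)]
  have "x = up L \<and> y = lo L \<or> x = lo L \<and> y = up L" using y(3) e(5) by (auto simp: doubleton_eq_iff)
  thus "L \<in> edges \<Gamma> \<and> up L = x" using y e vanti by auto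
next
  assume "L \<in> edges \<Gamma> \<and> up L = x"
  thus "L \<in> down_edges \<Gamma> x" using e_ends[of L] by (auto simp: down_edges_def)
qed

lemma adjacent_edges_iff: "L \<in> adjacent_edges \<Gamma> x \<longleftrightarrow> L \<in> edges \<Gamma> \<and> (lo L = x \<or> up L = x)"
  using e_ends(5)[of L] by (auto simp: adjacent_edges_def)

lemma verts_above_iff: "y \<in> verts_above \<Gamma> x \<longleftrightarrow> y \<in> verts \<Gamma> \<and> vle \<Gamma> x y \<and> y \<noteq> x"
  by (simp add: verts_above_def)

lemma edges_above_iff:
  "L \<in> edges_above \<Gamma> x \<longleftrightarrow> L \<in> edges \<Gamma> \<and> up L \<in> verts_above \<Gamma> x \<and> lo L \<in> verts_above \<Gamma> x"
  using e_ends(5)[of L] by (auto simp: edges_above_def)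

lemma up_above_lo: "L \<in> edges \<Gamma> \<Longrightarrow> up L \<in> verts_above \<Gamma> (lo L)"
  using e_ends[of L] by (auto simp: verts_above_iff)

lemma up_edges_fin: "finite (up_edges \<Gamma> x)"
  by (rule finite_subset[OF _ finE]) (auto simp: up_edges_def)

lemma verts_above_fin: "finite (verts_above \<Gamma> x)"
  by (rule finite_subset[OF _ finV]) (auto simp: verts_above_def)

text \<open>Induction from the top downwards over upper sets of vertices: removing a minimal vertex
  leaves an upper set.\<close>

lemma upper_induct [consumes 1, case_names empty insert]:
  assumes "\<And>x. x \<in> I \<Longrightarrow> x \<in> verts \<Gamma> \<and> verts_above \<Gamma> x \<subseteq> I"
    and empty: "P {}"
    and insert: "\<And>I x. I \<subseteq> verts \<Gamma> \<Longrightarrow> (\<And>y. y \<in> I \<Longrightarrow> verts_above \<Gamma> y \<subseteq> I) \<Longrightarrow> x \<in> verts \<Gamma> \<Longrightarrow> x \<notin> I \<Longrightarrow>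
       verts_above \<Gamma> x \<subseteq> I \<Longrightarrow> P I \<Longrightarrow> P (insert x I)"
  shows "P I"
  using assms(1)
proof (induction "card I" arbitrary: I)
  case 0
  have "I \<subseteq> verts \<Gamma>" using 0(2) by blast
  hence "I = {}" using 0(1) finV finite_subset by fastforce
  thus ?case using empty by simp
next
  case (Suc n)
  have IV: "I \<subseteq> verts \<Gamma>" using Suc.prems by blast
  hence fI: "finite I" using finV finite_subset by blast
  let ?below = "\<lambda>x. {z \<in> verts \<Gamma>. vle \<Gamma> z x}"
  obtain x0 where "x0 \<in> I" using Suc.hyps(2) by fastforce
  \<comment> \<open>A vertex of \<open>I\<close> with the fewest vertices below it is minimal in
    \<open>I\<close>, since anything strictly below has strictly fewer.\<close>
  then obtain x where x: "x \<in> I" "\<And>y. y \<in> I \<Longrightarrow> card (?below x) \<le> card (?below y)"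
    using ex_has_least_nat[of "\<lambda>x. x \<in> I" x0 "\<lambda>x. card (?below x)"] by blast
  have xmin: "y = x" if y: "y \<in> I" "vle \<Gamma> y x" for y
  proof (rule ccontr)
    assume "y \<noteq> x"
    have "?below y \<subset> ?below x"
    proof
      show "?below y \<subseteq> ?below x" using vtrans[of _ y x] y x(1) IV by blast
      have "x \<in> ?below x" using x(1) IV vrefl by blast
      moreover have "x \<notin> ?below y" using y x(1) IV vanti[of x y] \<open>y \<noteq> x\<close> by blast
      ultimately show "?below y \<noteq> ?below x" by blast
    qed
    hence "card (?below y) < card (?below x)" by (rule psubset_card_mono[rotated]) (simp add: finV)
    thus False using x(2)[OF y(1)] by simp
  qed
  have up: "verts_above \<Gamma> y \<subseteq> I - {x}" if y: "y \<in> I" for y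
    using Suc.prems[OF y] xmin[OF y] by (auto simp: verts_above_iff)
  have "P (I - {x})"
    by (rule Suc.hyps(1)) (use Suc.hyps(2) x(1) fI up IV in auto)
  hence "P (insert x (I - {x}))"
    by (rule insert[rotated 5]) (use IV up x(1) in auto)
  thus ?case using x(1) by (simp add: insert_absorb)
qed

text \<open>The part of \<open>graph_sheaf\<close> that the boundary at \<open>x\<close> can see.
  Unlike \<open>graph_sheaf\<close>, it makes sense for a sheaf that has been constructed only above
  \<open>x\<close>.\<close>

definition above_ok :: "('v, 'e, 'm, 'l) gsheaf \<Rightarrow> 'v \<Rightarrow> bool" where
  "above_ok F x \<longleftrightarrow> (\<forall>y\<in>verts_above \<Gamma> x. graded_module d (vmod F y)) \<and>
     (\<forall>L\<in>edges \<Gamma>. up L \<in> verts_above \<Gamma> x \<longrightarrow> graded_module d (emod F L) \<and>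
        res F (up L) L \<in> gmod_hom d (vmod F (up L)) (emod F L)) \<and>
     (\<forall>L\<in>edges_above \<Gamma> x. res F (lo L) L \<in> gmod_hom d (vmod F (lo L)) (emod F L))"

lemma graph_sheafD:
  assumes "graph_sheaf \<Gamma> F"
  shows "x \<in> verts \<Gamma> \<Longrightarrow> graded_module d (vmod F x)" "L \<in> edges \<Gamma> \<Longrightarrow> graded_module d (emod F L)"
    "L \<in> edges \<Gamma> \<Longrightarrow> res F (up L) L \<in> gmod_hom d (vmod F (up L)) (emod F L)"
    "L \<in> edges \<Gamma> \<Longrightarrow> res F (lo L) L \<in> gmod_hom d (vmod F (lo L)) (emod F L)"
  using assms e_ends[of L] by (auto simp: graph_sheaf_def)

lemma graph_sheafI:
  assumes "\<And>x. x \<in> verts \<Gamma> \<Longrightarrow> graded_module d (vmod F x)" "\<And>L. L \<in> edges \<Gamma> \<Longrightarrow> graded_module d (emod F L)"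
    "\<And>L v m. L \<in> edges \<Gamma> \<Longrightarrow> v \<in> dir \<Gamma> L \<Longrightarrow> m \<in> carrier (emod F L) \<Longrightarrow> v \<odot>\<^bsub>emod F L\<^esub> m = \<zero>\<^bsub>emod F L\<^esub>"
    "\<And>L. L \<in> edges \<Gamma> \<Longrightarrow> res F (up L) L \<in> gmod_hom d (vmod F (up L)) (emod F L)"
    "\<And>L. L \<in> edges \<Gamma> \<Longrightarrow> res F (lo L) L \<in> gmod_hom d (vmod F (lo L)) (emod F L)"
  shows "graph_sheaf \<Gamma> F"
proof -
  have "res F x L \<in> gmod_hom d (vmod F x) (emod F L)" if "L \<in> edges \<Gamma>" "x \<in> ends \<Gamma> L" for x L
    using assms(4,5)[OF that(1)] that(2) e_ends(5)[OF that(1)] by auto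
  thus ?thesis using assms(1-3) by (simp add: graph_sheaf_def)
qed

lemma graph_sheaf_above_ok: "graph_sheaf \<Gamma> F \<Longrightarrow> above_ok F x"
  unfolding above_ok_def using graph_sheafD[of F] by (auto simp: verts_above_iff edges_above_iff)

definition glued :: "('v, 'e, 'm, 'l) gsheaf \<Rightarrow> 'v \<Rightarrow> ('v \<Rightarrow> 'm) set" where
  "glued F x = {s \<in> (\<Pi>\<^sub>E y\<in>verts_above \<Gamma> x. carrier (vmod F y)).
     \<forall>L\<in>edges_above \<Gamma> x. res F (lo L) L (s (lo L)) = res F (up L) L (s (up L))}"

definition germ :: "('v, 'e, 'm, 'l) gsheaf \<Rightarrow> 'v \<Rightarrow> ('v \<Rightarrow> 'm) \<Rightarrow> ('e \<Rightarrow> 'l)" where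
  "germ F x s = (\<lambda>L\<in>up_edges \<Gamma> x. res F (up L) L (s (up L)))"

text \<open>The edge components of a section above \<open>x\<close> are determined by its vertex components.\<close>

lemma boundary_image_eq:
  assumes ok: "above_ok F x"
  shows "boundary_image \<Gamma> F x = germ F x ` glued F x"
proof (intro subset_antisym subsetI)
  fix u assume "u \<in> boundary_image \<Gamma> F x"
  then obtain s w where s: "s \<in> (\<Pi>\<^sub>E y\<in>verts_above \<Gamma> x. carrier (vmod F y))"
    "\<forall>y\<in>verts_above \<Gamma> x. \<forall>L\<in>edges_above \<Gamma> x \<union> up_edges \<Gamma> x. y \<in> ends \<Gamma> L \<longrightarrow> res F y L (s y) = w L"
    "u = restrict w (up_edges \<Gamma> x)"
    by (auto simp: boundary_image_def sheaf_sections_def edge_restriction_def)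
  have "res F (lo L) L (s (lo L)) = w L" "res F (up L) L (s (up L)) = w L" if "L \<in> edges_above \<Gamma> x" for L
    using s(2) that e_ends(5)[of L] by (auto simp: edges_above_iff)
  hence "s \<in> glued F x" using s(1) by (simp add: glued_def)
  moreover have "u = germ F x s"
    unfolding s(3) germ_def
  proof (rule restrict_ext)
    fix L assume L: "L \<in> up_edges \<Gamma> x"
    hence "up L \<in> verts_above \<Gamma> x" "up L \<in> ends \<Gamma> L"
      using up_above_lo[of L] e_ends(5)[of L] by (auto simp: up_edges_iff)
    thus "w L = res F (up L) L (s (up L))" using s(2) L by simp
  qed
  ultimately show "u \<in> germ F x ` glued F x" by blast
next
  fix u assume "u \<in> germ F x ` glued F x"
  then obtain s where s: "s \<in> glued F x" "u = germ F x s" by blast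
  define w where "w = (\<lambda>L\<in>edges_above \<Gamma> x \<union> up_edges \<Gamma> x. res F (up L) L (s (up L)))"
  have upL: "up L \<in> verts_above \<Gamma> x" "L \<in> edges \<Gamma>" if "L \<in> edges_above \<Gamma> x \<union> up_edges \<Gamma> x" for L
    using that up_above_lo[of L] by (auto simp: edges_above_iff up_edges_iff)
  have sc: "s y \<in> carrier (vmod F y)" if "y \<in> verts_above \<Gamma> x" for y
    using s(1) that by (auto simp: glued_def)
  have wc: "w \<in> (\<Pi>\<^sub>E L\<in>edges_above \<Gamma> x \<union> up_edges \<Gamma> x. carrier (emod F L))"
  proof (rule PiE_I)
    fix L assume L: "L \<in> edges_above \<Gamma> x \<union> up_edges \<Gamma> x"
    have "res F (up L) L \<in> gmod_hom d (vmod F (up L)) (emod F L)"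
      using ok upL[OF L] by (simp add: above_ok_def)
    thus "w L \<in> carrier (emod F L)" using gmod_homD(1) sc[OF upL(1)[OF L]] L by (fastforce simp: w_def)
  qed (simp add: w_def)
  have "res F y L (s y) = w L"
    if y: "y \<in> verts_above \<Gamma> x" and L: "L \<in> edges_above \<Gamma> x \<union> up_edges \<Gamma> x" and e: "y \<in> ends \<Gamma> L" for y L
  proof (cases "y = up L")
    case False
    hence lo: "y = lo L" using e e_ends(5)[OF upL(2)[OF L]] by auto
    hence "L \<in> edges_above \<Gamma> x" using L y by (auto simp: up_edges_iff verts_above_iff)
    thus ?thesis using s(1) lo by (simp add: glued_def w_def)
  qed (use L in \<open>simp add: w_def\<close>)
  hence "(s, w) \<in> sheaf_sections \<Gamma> F (verts_above \<Gamma> x) (edges_above \<Gamma> x \<union> up_edges \<Gamma> x)"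
    using s(1) wc by (simp add: sheaf_sections_def glued_def)
  moreover have "edge_restriction (up_edges \<Gamma> x) (s, w) = u"
    unfolding edge_restriction_def s(2) germ_def w_def by (auto simp: restrict_def fun_eq_iff)
  ultimately show "u \<in> boundary_image \<Gamma> F x" unfolding boundary_image_def by (rule image_eqI[rotated, OF _ sym])
qed

text \<open>A section over \<open>x\<close> and its adjacent edges is determined by its value at
  \<open>x\<close>, and every value extends; so the purity condition becomes a statement about
  \<open>bmap\<close>.\<close>

lemma local_image_eq:
  assumes F: "graph_sheaf \<Gamma> F" and x: "x \<in> verts \<Gamma>"
  shows "edge_restriction (up_edges \<Gamma> x) ` sheaf_sections \<Gamma> F {x} (adjacent_edges \<Gamma> x) = bmap \<Gamma> F x ` carrier (vmod F x)"
proof (intro subset_antisym subsetI)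
  fix u assume "u \<in> edge_restriction (up_edges \<Gamma> x) ` sheaf_sections \<Gamma> F {x} (adjacent_edges \<Gamma> x)"
  then obtain s w where s: "s \<in> (\<Pi>\<^sub>E y\<in>{x}. carrier (vmod F y))"
    "\<forall>L\<in>adjacent_edges \<Gamma> x. x \<in> ends \<Gamma> L \<longrightarrow> res F x L (s x) = w L" "u = restrict w (up_edges \<Gamma> x)"
    by (auto simp: sheaf_sections_def edge_restriction_def)
  have "u = bmap \<Gamma> F x (s x)"
    unfolding s(3) bmap_def
    by (rule restrict_ext) (use s(2) in \<open>auto simp: adjacent_edges_def up_edges_def\<close>)
  moreover have "s x \<in> carrier (vmod F x)" using s(1) by auto
  ultimately show "u \<in> bmap \<Gamma> F x ` carrier (vmod F x)" by blast
next
  fix u assume "u \<in> bmap \<Gamma> F x ` carrier (vmod F x)"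
  then obtain m where m: "m \<in> carrier (vmod F x)" "u = bmap \<Gamma> F x m" by blast
  have "res F x L m \<in> carrier (emod F L)" if "L \<in> adjacent_edges \<Gamma> x" for L
  proof -
    have "res F x L \<in> gmod_hom d (vmod F x) (emod F L)"
      using F x that by (simp add: graph_sheaf_def adjacent_edges_def)
    thus ?thesis using m(1) by (rule gmod_homD(1))
  qed
  hence "((\<lambda>_\<in>{x}. m), (\<lambda>L\<in>adjacent_edges \<Gamma> x. res F x L m)) \<in> sheaf_sections \<Gamma> F {x} (adjacent_edges \<Gamma> x)"
    using m(1) by (auto simp: sheaf_sections_def)
  moreover have "edge_restriction (up_edges \<Gamma> x) ((\<lambda>_\<in>{x}. m), (\<lambda>L\<in>adjacent_edges \<Gamma> x. res F x L m)) = u"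
    unfolding edge_restriction_def m(2) bmap_def
    by (auto simp: fun_eq_iff restrict_def adjacent_edges_iff up_edges_iff)
  ultimately show "u \<in> edge_restriction (up_edges \<Gamma> x) ` sheaf_sections \<Gamma> F {x} (adjacent_edges \<Gamma> x)"
    by (rule image_eqI[rotated, OF _ sym])
qed

lemma pure_sheaf_iff:
  assumes F: "graph_sheaf \<Gamma> F"
  shows "pure_sheaf \<Gamma> F \<longleftrightarrow> (\<forall>x\<in>verts \<Gamma>. free_gmodule d (vmod F x) \<and>
     bmap \<Gamma> F x ` carrier (vmod F x) = boundary_image \<Gamma> F x) \<and>
     (\<forall>L\<in>edges \<Gamma>. quotient_map d (dir \<Gamma> L) (vmod F (up L)) (emod F L) (res F (up L) L))"
proof -
  have "(\<forall>x\<in>verts \<Gamma>. \<forall>L\<in>down_edges \<Gamma> x. quotient_map d (dir \<Gamma> L) (vmod F x) (emod F L) (res F x L)) \<longleftrightarrow>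
    (\<forall>L\<in>edges \<Gamma>. quotient_map d (dir \<Gamma> L) (vmod F (up L)) (emod F L) (res F (up L) L))"
    using e_ends(1) by (auto simp: down_edges_iff)
  moreover have "edge_restriction (up_edges \<Gamma> x) ` sheaf_sections \<Gamma> F {x} (adjacent_edges \<Gamma> x) =
      boundary_image \<Gamma> F x \<longleftrightarrow> bmap \<Gamma> F x ` carrier (vmod F x) = boundary_image \<Gamma> F x" if "x \<in> verts \<Gamma>" for x
    by (simp only: local_image_eq[OF F that])
  ultimately show ?thesis
    unfolding pure_sheaf_def using F by (simp add: ball_conj_distrib) blast
qed

text \<open>The compatible families of vertex values form a graded submodule of a direct sum, and
  \<open>germ\<close> is a graded homomorphism, so the boundary is the image of a graded
  submodule.\<close>

lemma boundary_gsub: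
  assumes ok: "above_ok F x" and x: "x \<in> verts \<Gamma>"
  shows "gsub d (dsum_gmodule (up_edges \<Gamma> x) (emod F)) (boundary_image \<Gamma> F x)"
    "graded_module d (dsum_gmodule (up_edges \<Gamma> x) (emod F))"
proof -
  have upL: "up L \<in> verts_above \<Gamma> x" "L \<in> edges \<Gamma>" if "L \<in> up_edges \<Gamma> x" for L
    using that up_above_lo[of L] by (auto simp: up_edges_iff)
  have ea: "up L \<in> verts_above \<Gamma> x" "lo L \<in> verts_above \<Gamma> x" "L \<in> edges \<Gamma>" if "L \<in> edges_above \<Gamma> x" for L
    using that by (auto simp: edges_above_iff)
  interpret V: gfam d "verts_above \<Gamma> x" "vmod F"
    by (rule gfam_const[OF verts_above_fin]) (use ok in \<open>simp add: above_ok_def\<close>)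
  interpret E: gfam d "up_edges \<Gamma> x" "emod F"
    by (rule gfam_const[OF up_edges_fin]) (use ok upL in \<open>simp add: above_ok_def\<close>)
  have h: "res F (up L) L \<in> gmod_hom d (vmod F (up L)) (emod F L)"
    if "up L \<in> verts_above \<Gamma> x" "L \<in> edges \<Gamma>" for L
    using ok that by (simp add: above_ok_def)
  have hl: "res F (lo L) L \<in> gmod_hom d (vmod F (lo L)) (emod F L)" if "L \<in> edges_above \<Gamma> x" for L
    using ok that by (simp add: above_ok_def)
  have eg: "graded_module d (emod F L)" if "up L \<in> verts_above \<Gamma> x" "L \<in> edges \<Gamma>" for L
    using ok that by (simp add: above_ok_def)
  interpret VD: gmod d V.D using V.graded_dsum(1) by (simp add: gmod_def)
  have gl: "gsub d V.D (glued F x)"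
  proof (rule VD.gsubI)
    show sub: "glued F x \<subseteq> carrier V.D" by (auto simp: glued_def)
    have ghu: "ghom d (vmod F (up L)) (emod F L) (res F (up L) L)" if "L \<in> edges_above \<Gamma> x" for L
      by (rule ghomI) (use ea[OF that] V.gmod eg h in auto)
    have ghl: "ghom d (vmod F (lo L)) (emod F L) (res F (lo L) L)" if "L \<in> edges_above \<Gamma> x" for L
      by (rule ghomI) (use ea[OF that] V.gmod eg hl[OF that] in auto)
    have sc: "s y \<in> carrier (vmod F y)" if "s \<in> glued F x" "y \<in> verts_above \<Gamma> x" for s y
      using that by (auto simp: glued_def)
    have eq: "res F (lo L) L (s (lo L)) = res F (up L) L (s (up L))" if "s \<in> glued F x" "L \<in> edges_above \<Gamma> x" for s L
      using that by (auto simp: glued_def)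
    show "\<zero>\<^bsub>V.D\<^esub> \<in> glued F x"
      using V.D.zero_closed ghom.zero[OF ghu] ghom.zero[OF ghl] ea by (auto simp: glued_def)
    show "s \<oplus>\<^bsub>V.D\<^esub> t \<in> glued F x" if s: "s \<in> glued F x" and t: "t \<in> glued F x" for s t
    proof -
      have "s \<oplus>\<^bsub>V.D\<^esub> t \<in> carrier V.D" by (rule V.D.M.a_closed) (use s t sub in blast)+
      thus ?thesis
        using gmod_homD(2)[OF h] gmod_homD(2)[OF hl] ea sc[OF s] sc[OF t] eq[OF s] eq[OF t]
        by (simp add: glued_def)
    qed
    show "a \<odot>\<^bsub>V.D\<^esub> s \<in> glued F x" if a: "a \<in> carrier (sym_alg d)" and s: "s \<in> glued F x" for a s
    proof -
      have "a \<odot>\<^bsub>V.D\<^esub> s \<in> carrier V.D" by (rule V.D.smult_closed) (use a s sub in blast)+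
      thus ?thesis
        using gmod_homD(3)[OF h] gmod_homD(3)[OF hl] ea sc[OF s] eq[OF s] a
        by (simp add: glued_def)
    qed
    show "gcomp V.D n s \<in> glued F x" if s: "s \<in> glued F x" for s n
    proof -
      have s': "s \<in> carrier V.D" using s sub by blast
      have "gcomp V.D n s \<in> carrier V.D" by (rule VD.gcomp_carrier[OF s'])
      moreover have "gcomp V.D n s y = gcomp (vmod F y) n (s y)" if "y \<in> verts_above \<Gamma> x" for y
        using V.graded_dsum(2)[OF s'] that by simp
      ultimately show ?thesis
        using ea sc[OF s] eq[OF s]
        by (simp add: glued_def flip: ghom.gcomp[OF ghu] ghom.gcomp[OF ghl])
    qed
  qed
  have germ: "germ F x \<in> gmod_hom d V.D E.D"
  proof (rule gmod_homI)
    show "germ F x s \<in> carrier E.D" if "s \<in> carrier V.D" for s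
      using gmod_homD(1)[OF h] upL that by (auto simp: germ_def PiE_iff)
    show "germ F x (s \<oplus>\<^bsub>V.D\<^esub> t) = germ F x s \<oplus>\<^bsub>E.D\<^esub> germ F x t"
      if "s \<in> carrier V.D" "t \<in> carrier V.D" for s t
      using that gmod_homD(2)[OF h] upL by (auto simp: germ_def fun_eq_iff PiE_iff)
    show "germ F x (a \<odot>\<^bsub>V.D\<^esub> s) = a \<odot>\<^bsub>E.D\<^esub> germ F x s"
      if "a \<in> carrier (sym_alg d)" "s \<in> carrier V.D" for a s
      using that gmod_homD(3)[OF h] upL by (auto simp: germ_def fun_eq_iff PiE_iff)
    show "germ F x s \<in> hcomp E.D n" if "s \<in> hcomp V.D n" for s n
      using gmod_homD(4)[OF h] upL that by (auto simp: germ_def PiE_iff)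
  qed
  interpret G: ghom d V.D E.D "germ F x"
    by (rule ghomI[OF V.graded_dsum(1) E.graded_dsum(1) germ])
  show "gsub d E.D (boundary_image \<Gamma> F x)"
    unfolding boundary_image_eq[OF ok] by (rule G.image_gsub[OF gl])
  show "graded_module d E.D" by (rule E.graded_dsum(1))
qed

text \<open>Finite generation is the point: it comes from Noetherianity, as the boundary is a
  submodule of a finite sum of edge modules.\<close>

lemma boundary_graded:
  assumes "above_ok F x" "x \<in> verts \<Gamma>"
  shows "graded_module d (boundary_module \<Gamma> F x)"
  unfolding boundary_module_def
  using gmod.gsub_graded(1)[of d "dsum_gmodule (up_edges \<Gamma> x) (emod F)"] boundary_gsub[OF assms]
  by (simp add: gmod_def)

end

section \<open>Existence of the canonical sheaf\<close>

lemma gmod_hom_cong: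
  assumes M: "graded_module d M" and f: "f \<in> gmod_hom d M N"
    and g: "\<And>x. x \<in> carrier M \<Longrightarrow> g x = f x"
  shows "g \<in> gmod_hom d M N"
proof -
  interpret gmod d M using M by (simp add: gmod_def)
  show ?thesis
    by (rule gmod_homI) (simp_all add: g gmod_homD[OF f] hcomp_closed(1))
qed

context moment
begin

text \<open>An edge counts as soon as its upper end lies in \<open>I\<close>, in keeping with the
  order of the construction: an edge module is determined by the stalk at the upper end.\<close>

definition agree_on :: "'v set \<Rightarrow> ('v, 'e, 'm, 'l) gsheaf \<Rightarrow> ('v, 'e, 'm, 'l) gsheaf \<Rightarrow> bool" where
  "agree_on I F G \<longleftrightarrow> (\<forall>x\<in>I. vmod F x = vmod G x) \<and>
     (\<forall>L\<in>edges \<Gamma>. up L \<in> I \<longrightarrow> emod F L = emod G L \<and> res F (up L) L = res G (up L) L \<and>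
        (lo L \<in> I \<longrightarrow> res F (lo L) L = res G (lo L) L))"

text \<open>Every edge that enters the boundary at \<open>x\<close> has its upper end strictly above
  \<open>x\<close>, hence in \<open>I\<close>.\<close>

lemma boundary_module_cong:
  assumes a: "agree_on I F G" and I: "verts_above \<Gamma> x \<subseteq> I"
  shows "boundary_module \<Gamma> F x = boundary_module \<Gamma> G x"
proof -
  let ?E = "edges_above \<Gamma> x \<union> up_edges \<Gamma> x"
  have upL: "up L \<in> I" "L \<in> edges \<Gamma>" if "L \<in> ?E" for L
    using that up_above_lo[of L] I by (auto simp: edges_above_iff up_edges_iff)
  have e: "emod F L = emod G L" if "L \<in> ?E" for L
    using a upL[OF that] by (simp add: agree_on_def)
  have "sheaf_sections \<Gamma> F (verts_above \<Gamma> x) ?E = sheaf_sections \<Gamma> G (verts_above \<Gamma> x) ?E"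
  proof (rule sheaf_sections_cong[OF _ e])
    show "vmod F y = vmod G y" if "y \<in> verts_above \<Gamma> x" for y
      using a I that by (auto simp: agree_on_def)
    fix y L assume y: "y \<in> verts_above \<Gamma> x" and L: "L \<in> ?E" and yL: "y \<in> ends \<Gamma> L"
    have "y = up L \<or> y = lo L" using yL e_ends(5)[OF upL(2)[OF L]] by blast
    thus "res F y L = res G y L" using a upL[OF L] I y by (auto simp: agree_on_def)
  qed
  moreover have "dsum_gmodule (up_edges \<Gamma> x) (emod F) = dsum_gmodule (up_edges \<Gamma> x) (emod G)"
    by (rule dsum_gmodule_cong) (use e in blast)
  ultimately show ?thesis by (simp add: boundary_module_def boundary_image_def)
qed

lemma bmap_cong:
  assumes a: "agree_on I F G" and I: "verts_above \<Gamma> x \<subseteq> I" and x: "x \<in> I"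
  shows "bmap \<Gamma> F x = bmap \<Gamma> G x"
proof -
  have "res F x L = res G x L" if "L \<in> up_edges \<Gamma> x" for L
    using a I x that up_above_lo[of L] by (auto simp: agree_on_def up_edges_iff)
  thus ?thesis by (auto simp: bmap_def fun_eq_iff restrict_def)
qed

text \<open>A canonical sheaf constructed as far as the upper set \<open>I\<close> and the edges
  descending from it. The maps to an edge from its lower end are required only once that end has
  been reached.\<close>

definition canon_on :: "'v \<Rightarrow> 'v set \<Rightarrow> ('v, 'e, 'm, 'l) gsheaf \<Rightarrow> bool" where
  "canon_on z I F \<longleftrightarrow> (\<forall>x\<in>I. free_gmodule d (vmod F x)) \<and>
     (\<forall>L\<in>edges \<Gamma>. up L \<in> I \<longrightarrow> graded_module d (emod F L) \<and>
        (\<forall>v\<in>dir \<Gamma> L. \<forall>m\<in>carrier (emod F L). v \<odot>\<^bsub>emod F L\<^esub> m = \<zero>\<^bsub>emod F L\<^esub>) \<and>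
        quotient_map d (dir \<Gamma> L) (vmod F (up L)) (emod F L) (res F (up L) L) \<and>
        (lo L \<in> I \<longrightarrow> res F (lo L) L \<in> gmod_hom d (vmod F (lo L)) (emod F L))) \<and>
     (\<forall>x\<in>I - {z}. projective_cover d (vmod F x) (boundary_module \<Gamma> F x) (bmap \<Gamma> F x)) \<and>
     (z \<in> I \<longrightarrow> gmod_iso d (vmod F z) (sym_alg d) \<noteq> {})"

lemma canon_on_cong:
  assumes a: "agree_on I F G" and I: "\<And>y. y \<in> I \<Longrightarrow> verts_above \<Gamma> y \<subseteq> I" and F: "canon_on z I F"
  shows "canon_on z I G"
proof -
  have v: "vmod G x = vmod F x" if "x \<in> I" for x using a that by (simp add: agree_on_def)
  have e: "emod G L = emod F L" "res G (up L) L = res F (up L) L" "lo L \<in> I \<Longrightarrow> res G (lo L) L = res F (lo L) L"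
    if "L \<in> edges \<Gamma>" "up L \<in> I" for L using a that by (auto simp: agree_on_def)
  have b: "boundary_module \<Gamma> G x = boundary_module \<Gamma> F x" "bmap \<Gamma> G x = bmap \<Gamma> F x" if "x \<in> I" for x
    using boundary_module_cong[OF a I[OF that]] bmap_cong[OF a I[OF that] that] by simp_all
  show ?thesis using F unfolding canon_on_def by (simp add: v e b)
qed

lemma canon_on_canonical:
  assumes "canon_on z (verts \<Gamma>) F" "z \<in> verts \<Gamma>"
  shows "canonical_sheaf \<Gamma> z F"
proof -
  have q: "quotient_map d (dir \<Gamma> L) (vmod F (up L)) (emod F L) (res F (up L) L)" if "L \<in> edges \<Gamma>" for L
    using assms(1) e_ends(1)[OF that] that by (simp add: canon_on_def)
  have "graph_sheaf \<Gamma> F"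
  proof (rule graph_sheafI)
    show "res F (up L) L \<in> gmod_hom d (vmod F (up L)) (emod F L)" if "L \<in> edges \<Gamma>" for L
      using q[OF that] by (simp add: quotient_map_def)
  qed (use assms(1) e_ends(1,2) in \<open>auto simp: canon_on_def free_gmodule_def\<close>)
  moreover have "\<forall>y\<in>verts \<Gamma>. \<forall>L\<in>down_edges \<Gamma> y.
      quotient_map d (dir \<Gamma> L) (vmod F y) (emod F L) (res F y L)"
    using q by (auto simp: down_edges_iff)
  moreover have "\<forall>x\<in>verts \<Gamma> - {z}. projective_cover d (vmod F x) (boundary_module \<Gamma> F x)
      (\<lambda>m. \<lambda>L\<in>up_edges \<Gamma> x. res F x L m)"
    using assms(1) unfolding canon_on_def bmap_def by blast
  moreover have "gmod_iso d (vmod F z) (sym_alg d) \<noteq> {}"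
    using assms unfolding canon_on_def by blast
  ultimately show ?thesis by (simp add: canonical_sheaf_def)
qed

lemma canon_on_above_ok:
  assumes F: "canon_on z I F" and I: "verts_above \<Gamma> x \<subseteq> I"
  shows "above_ok F x"
  unfolding above_ok_def
proof (intro conjI ballI impI)
  show "graded_module d (vmod F y)" if "y \<in> verts_above \<Gamma> x" for y
    using F I that by (auto simp: canon_on_def free_gmodule_def)
  fix L
  show "graded_module d (emod F L)" "res F (up L) L \<in> gmod_hom d (vmod F (up L)) (emod F L)"
    if "L \<in> edges \<Gamma>" "up L \<in> verts_above \<Gamma> x"
    using F I that by (auto simp: canon_on_def quotient_map_def)
  show "res F (lo L) L \<in> gmod_hom d (vmod F (lo L)) (emod F L)" if "L \<in> edges_above \<Gamma> x"
    using F I that by (auto simp: canon_on_def edges_above_iff)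
qed

text \<open>At \<open>x\<close> the stalk is a minimal free cover of the boundary, or the ring if
  \<open>x\<close> is the top; quotients of this stalk are then placed on the edges descending from
  \<open>x\<close>. What was built on \<open>I\<close> stays unchanged, and so do its
  boundaries.\<close>

lemma canon_step:
  fixes F :: "('v, 'e, nat \<Rightarrow> cpoly, (nat \<Rightarrow> cpoly) set) gsheaf"
  assumes top: "\<And>y. y \<in> verts \<Gamma> \<Longrightarrow> vle \<Gamma> y z" and z: "z \<in> verts \<Gamma>"
    and IV: "I \<subseteq> verts \<Gamma>" and I: "\<And>y. y \<in> I \<Longrightarrow> verts_above \<Gamma> y \<subseteq> I"
    and x: "x \<in> verts \<Gamma>" "x \<notin> I" "verts_above \<Gamma> x \<subseteq> I" and F: "canon_on z I F"
  shows "\<exists>F' :: ('v, 'e, nat \<Rightarrow> cpoly, (nat \<Rightarrow> cpoly) set) gsheaf. canon_on z (insert x I) F'"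
proof -
  have upx: "up L \<in> verts_above \<Gamma> x" "up L \<in> I" "L \<in> edges \<Gamma>" if "L \<in> up_edges \<Gamma> x" for L
    using that up_above_lo[of L] x(3) by (auto simp: up_edges_iff)
  \<comment> \<open>Nothing lies above the top vertex, so at \<open>z\<close> no maps to upper edges
    have to be supplied and \<open>undefined\<close> can stand for \<open>f\<close>.\<close>
  have Upz: "up_edges \<Gamma> z = {}"
  proof (rule ccontr)
    assume "up_edges \<Gamma> z \<noteq> {}"
    then obtain L where "L \<in> up_edges \<Gamma> z" by blast
    hence "L \<in> edges \<Gamma>" "lo L = z" by (simp_all add: up_edges_iff)
    thus False using up_above_lo[of L] top[of "up L"] vanti[of z "up L"] z by (auto simp: verts_above_iff)
  qed
  have Pf: "\<exists>(P :: (cpoly, nat \<Rightarrow> cpoly) gmodule) f. free_gmodule d P \<and>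
    (\<forall>L\<in>up_edges \<Gamma> x. (\<lambda>m. f m L) \<in> gmod_hom d P (emod F L)) \<and>
    (if x = z then gmod_iso d P (sym_alg d) \<noteq> {}
     else projective_cover d P (boundary_module \<Gamma> F x) (\<lambda>m. \<lambda>L\<in>up_edges \<Gamma> x. f m L))"
  proof (cases "x = z")
    case True
    \<comment> \<open>The ring is written as a sum over a single index to bring it into the type
      \<open>nat \<Rightarrow> cpoly\<close>.\<close>
    let ?M = "\<lambda>_ :: nat. shift_gmodule 0 (sym_alg d)"
    let ?P = "dsum_gmodule {..<1 :: nat} ?M"
    interpret gfam d "{..<1 :: nat}" ?M by (rule gfam_const) (auto intro: graded_shift_sym)
    have h: "(\<lambda>f. f 0) \<in> gmod_hom d ?P (?M 0)" by (rule proj_hom) simp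
    have "(\<lambda>f. f (0 :: nat)) \<in> gmod_iso d ?P (sym_alg d)"
      unfolding gmod_iso_def
    proof (intro CollectI conjI)
      show "(\<lambda>f. f 0) \<in> gmod_hom d ?P (sym_alg d)"
        by (rule gmod_homI) (use gmod_homD[OF h] in \<open>auto simp: PiE_iff\<close>)
      show "bij_betw (\<lambda>f. f (0 :: nat)) (carrier ?P) (carrier (sym_alg d))"
      proof (rule bij_betw_byWitness[where f' = "\<lambda>a. \<lambda>i\<in>{..<1 :: nat}. a"])
        show "\<forall>f\<in>carrier ?P. (\<lambda>i\<in>{..<1 :: nat}. f 0) = f"
        proof
          fix f assume "f \<in> carrier ?P"
          hence ext: "f \<in> extensional {..<1}" by (simp add: PiE_def)
          show "(\<lambda>i\<in>{..<1}. f 0) = f"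
          proof
            fix i :: nat
            show "(\<lambda>i\<in>{..<1}. f 0) i = f i"
            proof (cases "i = 0")
              case False
              thus ?thesis using extensional_arb[OF ext, of i] by simp
            qed simp
          qed
        qed
        show "\<forall>a\<in>carrier (sym_alg d). (\<lambda>i\<in>{..<1 :: nat}. a) 0 = a" by simp
        show "(\<lambda>f. f 0) ` carrier ?P \<subseteq> carrier (sym_alg d)"
          using gmod_homD(1)[OF h] by (simp only: shift_gmodule_simps image_subset_iff) blast
        show "(\<lambda>a. \<lambda>i\<in>{..<1 :: nat}. a) ` carrier (sym_alg d) \<subseteq> carrier ?P"
          by (simp only: dsum_gmodule_simps shift_gmodule_simps image_subset_iff restrict_PiE_iff) simp
      qed
    qed
    hence ne: "gmod_iso d ?P (sym_alg d) \<noteq> {}" by blast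
    have fr: "free_gmodule d ?P" by (rule free_dsum_sym) simp
    show ?thesis
    proof (rule exI[of _ ?P], rule exI[of _ undefined], intro conjI ballI)
      show "(\<lambda>m. undefined m L) \<in> gmod_hom d ?P (emod F L)" if "L \<in> up_edges \<Gamma> x" for L
        using that True Upz by simp
      show "if x = z then gmod_iso d ?P (sym_alg d) \<noteq> {}
        else projective_cover d ?P (boundary_module \<Gamma> F x) (\<lambda>m. \<lambda>L\<in>up_edges \<Gamma> x. undefined m L)"
        unfolding if_P[OF True] by (rule ne)
    qed (rule fr)
  next
    case False
    note ok = canon_on_above_ok[OF F x(3)]
    let ?E = "dsum_gmodule (up_edges \<Gamma> x) (emod F)"
    let ?B = "boundary_module \<Gamma> F x"
    have gB: "graded_module d ?B" by (rule boundary_graded[OF ok x(1)])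
    have Bc: "carrier ?B \<subseteq> carrier ?E" using gsubD(2)[OF boundary_gsub(1)[OF ok x(1)]]
      by (simp add: boundary_module_def)
    have Bs: "a \<oplus>\<^bsub>?B\<^esub> b = a \<oplus>\<^bsub>?E\<^esub> b" "c \<odot>\<^bsub>?B\<^esub> a = c \<odot>\<^bsub>?E\<^esub> a" "hcomp ?B n \<subseteq> hcomp ?E n" for a b c n
      by (simp_all add: boundary_module_def)
    obtain r :: nat and k f where f: "f \<in> gmod_hom d (dsum_gmodule {..<r} (\<lambda>i. shift_gmodule (k i) (sym_alg d))) ?B"
      "f ` carrier (dsum_gmodule {..<r} (\<lambda>i. shift_gmodule (k i) (sym_alg d))) = carrier ?B"
      "\<forall>p\<in>carrier (dsum_gmodule {..<r} (\<lambda>i. shift_gmodule (k i) (sym_alg d))). f p = \<zero>\<^bsub>?B\<^esub> \<longrightarrow>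
        p \<in> mod_span (tdual d) (dsum_gmodule {..<r} (\<lambda>i. shift_gmodule (k i) (sym_alg d)))"
      using free_cover[OF gB] by (elim exE conjE)
    define P where "P = dsum_gmodule {..<r} (\<lambda>i. shift_gmodule (k i) (sym_alg d))"
    note f = f[folded P_def]
    have P: "free_gmodule d P" unfolding P_def by (rule free_dsum_sym) simp
    have fE: "f \<in> gmod_hom d P ?E"
    proof (rule gmod_homI)
      show "f p \<in> carrier ?E" if "p \<in> carrier P" for p
        using subsetD[OF Bc gmod_homD(1)[OF f(1) that]] .
      show "f (p \<oplus>\<^bsub>P\<^esub> q) = f p \<oplus>\<^bsub>?E\<^esub> f q" if "p \<in> carrier P" "q \<in> carrier P" for p q
        using gmod_homD(2)[OF f(1) that] unfolding Bs .
      show "f (a \<odot>\<^bsub>P\<^esub> p) = a \<odot>\<^bsub>?E\<^esub> f p" if "a \<in> carrier (sym_alg d)" "p \<in> carrier P" for a p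
        using gmod_homD(3)[OF f(1) that] unfolding Bs .
      show "f p \<in> hcomp ?E n" if "p \<in> hcomp P n" for n p
        using subsetD[OF Bs(3) gmod_homD(4)[OF f(1) that]] .
    qed
    have ext: "(\<lambda>L\<in>up_edges \<Gamma> x. f m L) = f m" if "m \<in> carrier P" for m
      using gmod_homD(1)[OF fE that] by (simp add: PiE_restrict)
    have "projective_cover d P ?B (\<lambda>m. \<lambda>L\<in>up_edges \<Gamma> x. f m L)"
    proof (rule projective_coverI[OF P gB])
      have Pg: "graded_module d P" using P by (simp add: free_gmodule_def)
      show "(\<lambda>m. \<lambda>L\<in>up_edges \<Gamma> x. f m L) \<in> gmod_hom d P ?B"
        by (rule gmod_hom_cong[OF Pg f(1) ext])
      show "(\<lambda>m. \<lambda>L\<in>up_edges \<Gamma> x. f m L) ` carrier P = carrier ?B"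
        unfolding f(2)[symmetric] by (rule image_cong) (auto simp: ext)
      show "p \<in> mod_span (tdual d) P" if "p \<in> carrier P" "(\<lambda>L\<in>up_edges \<Gamma> x. f p L) = \<zero>\<^bsub>?B\<^esub>" for p
        using f(3) that by (simp add: ext)
    qed
    moreover have "(\<lambda>m. f m L) \<in> gmod_hom d P (emod F L)" if L: "L \<in> up_edges \<Gamma> x" for L
    proof -
      interpret E: gfam d "up_edges \<Gamma> x" "emod F"
        by (rule gfam_const[OF up_edges_fin]) (use ok upx in \<open>simp add: above_ok_def\<close>)
      show ?thesis by (rule gmod_hom_comp[OF fE E.proj_hom[OF L]])
    qed
    ultimately show ?thesis using P False by (intro exI[of _ P] exI[of _ f]) simp
  qed
  then obtain P :: "(cpoly, nat \<Rightarrow> cpoly) gmodule" and f where P: "free_gmodule d P"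
    "\<forall>L\<in>up_edges \<Gamma> x. (\<lambda>m. f m L) \<in> gmod_hom d P (emod F L)"
    "if x = z then gmod_iso d P (sym_alg d) \<noteq> {}
     else projective_cover d P (boundary_module \<Gamma> F x) (\<lambda>m. \<lambda>L\<in>up_edges \<Gamma> x. f m L)"
    by (elim exE conjE)
  interpret Pg: gmod d P using P(1) by (simp add: free_gmodule_def gmod_def)
  \<comment> \<open>Module and quotient map are packed into a pair so that one application of choice
    yields both.\<close>
  have "\<forall>L\<in>edges \<Gamma>. \<exists>Nq :: (cpoly, (nat \<Rightarrow> cpoly) set) gmodule \<times> _. graded_module d (fst Nq) \<and>
      quotient_map d (dir \<Gamma> L) P (fst Nq) (snd Nq) \<and>
      (\<forall>v\<in>dir \<Gamma> L. \<forall>m\<in>carrier (fst Nq). v \<odot>\<^bsub>fst Nq\<^esub> m = \<zero>\<^bsub>fst Nq\<^esub>)"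
  proof
    fix L assume L: "L \<in> edges \<Gamma>"
    obtain N :: "(cpoly, (nat \<Rightarrow> cpoly) set) gmodule" and q where "graded_module d N"
      "quotient_map d (dir \<Gamma> L) P N q" "\<forall>v\<in>dir \<Gamma> L. \<forall>m\<in>carrier N. v \<odot>\<^bsub>N\<^esub> m = \<zero>\<^bsub>N\<^esub>"
      using Pg.quotient_exists[OF dir_sub[OF L]] by (elim exE conjE)
    thus "\<exists>Nq :: (cpoly, (nat \<Rightarrow> cpoly) set) gmodule \<times> _. graded_module d (fst Nq) \<and>
      quotient_map d (dir \<Gamma> L) P (fst Nq) (snd Nq) \<and>
      (\<forall>v\<in>dir \<Gamma> L. \<forall>m\<in>carrier (fst Nq). v \<odot>\<^bsub>fst Nq\<^esub> m = \<zero>\<^bsub>fst Nq\<^esub>)"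
      by (intro exI[of _ "(N, q)"]) simp
  qed
  from bchoice[OF this] obtain Q :: "'e \<Rightarrow> (cpoly, (nat \<Rightarrow> cpoly) set) gmodule \<times> _"
    where Q: "\<forall>L\<in>edges \<Gamma>. graded_module d (fst (Q L)) \<and>
      quotient_map d (dir \<Gamma> L) P (fst (Q L)) (snd (Q L)) \<and>
      (\<forall>v\<in>dir \<Gamma> L. \<forall>m\<in>carrier (fst (Q L)). v \<odot>\<^bsub>fst (Q L)\<^esub> m = \<zero>\<^bsub>fst (Q L)\<^esub>)" ..
  define F' where "F' = \<lparr>vmod = (vmod F)(x := P),
    emod = (\<lambda>L. if up L = x then fst (Q L) else emod F L),
    res = (\<lambda>y L. if y = x then (if up L = x then snd (Q L) else (\<lambda>m. f m L)) else res F y L)\<rparr>"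
  have ag: "agree_on I F F'"
    unfolding agree_on_def F'_def using x(2) by auto
  have cI: "canon_on z I F'" by (rule canon_on_cong[OF ag I F])
  have bm: "boundary_module \<Gamma> F' x = boundary_module \<Gamma> F x"
    using boundary_module_cong[OF ag x(3)] by simp
  have upx': "up L \<noteq> x" if "L \<in> up_edges \<Gamma> x" for L using upx(2)[OF that] x(2) by auto
  have bmx: "bmap \<Gamma> F' x = (\<lambda>m. \<lambda>L\<in>up_edges \<Gamma> x. f m L)"
    using upx' by (auto simp: bmap_def F'_def fun_eq_iff restrict_def)
  \<comment> \<open>No edge descends from \<open>x\<close> into \<open>insert x I\<close>: if its
    lower end were in the upper set \<open>I\<close>, then \<open>x\<close> would be as well, and
    its two ends are distinct.\<close>
  have lox: "lo L \<notin> insert x I" if "L \<in> edges \<Gamma>" "up L = x" for L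
    using up_above_lo[OF that(1)] I[of "lo L"] x(2) that e_ends(3)[OF that(1)] by auto
  have "canon_on z (insert x I) F'"
    unfolding canon_on_def
  proof (intro conjI ballI impI)
    show "free_gmodule d (vmod F' y)" if "y \<in> insert x I" for y
      using that cI P(1) by (auto simp: canon_on_def F'_def)
  next
    fix L assume L: "L \<in> edges \<Gamma>" "up L \<in> insert x I"
    show "graded_module d (emod F' L)"
      using L cI Q by (cases "up L = x") (auto simp: canon_on_def F'_def)
    show "v \<odot>\<^bsub>emod F' L\<^esub> m = \<zero>\<^bsub>emod F' L\<^esub>" if "v \<in> dir \<Gamma> L" "m \<in> carrier (emod F' L)" for v m
      using L cI Q that by (cases "up L = x") (auto simp: canon_on_def F'_def)
    show "quotient_map d (dir \<Gamma> L) (vmod F' (up L)) (emod F' L) (res F' (up L) L)"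
    proof (cases "up L = x")
      case True
      thus ?thesis using L Q by (simp add: F'_def)
    next
      case False
      thus ?thesis using L cI by (simp add: canon_on_def)
    qed
    show "res F' (lo L) L \<in> gmod_hom d (vmod F' (lo L)) (emod F' L)" if lo: "lo L \<in> insert x I"
    proof (cases "lo L = x")
      case True
      hence "L \<in> up_edges \<Gamma> x" using L by (simp add: up_edges_iff)
      thus ?thesis using P(2) True upx' by (simp add: F'_def)
    next
      case False
      moreover have "up L \<noteq> x" using lox[OF L(1)] lo by blast
      ultimately show ?thesis using L cI lo by (simp add: canon_on_def)
    qed
  next
    fix y assume y: "y \<in> insert x I - {z}"
    show "projective_cover d (vmod F' y) (boundary_module \<Gamma> F' y) (bmap \<Gamma> F' y)"
    proof (cases "y = x")
      case True
      hence "x \<noteq> z" using y by blast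
      thus ?thesis using P(3) unfolding True bm bmx by (simp add: F'_def)
    next
      case False
      thus ?thesis using y cI by (simp add: canon_on_def)
    qed
  next
    assume zI: "z \<in> insert x I"
    show "gmod_iso d (vmod F' z) (sym_alg d) \<noteq> {}"
    proof (cases "x = z")
      case True
      thus ?thesis using P(3) by (simp add: F'_def)
    next
      case False
      thus ?thesis using zI cI by (simp add: canon_on_def)
    qed
  qed
  thus ?thesis by blast
qed

lemma canon_exists:
  assumes top: "\<And>y. y \<in> verts \<Gamma> \<Longrightarrow> vle \<Gamma> y z" and z: "z \<in> verts \<Gamma>"
  shows "\<exists>F :: ('v, 'e, nat \<Rightarrow> cpoly, (nat \<Rightarrow> cpoly) set) gsheaf. canon_on z (verts \<Gamma>) F"
proof (rule upper_induct[of "verts \<Gamma>"])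
  show "x \<in> verts \<Gamma> \<and> verts_above \<Gamma> x \<subseteq> verts \<Gamma>" if "x \<in> verts \<Gamma>" for x
    using that by (auto simp: verts_above_def)
  show "\<exists>F :: ('v, 'e, nat \<Rightarrow> cpoly, (nat \<Rightarrow> cpoly) set) gsheaf. canon_on z {} F"
    by (simp add: canon_on_def)
next
  fix I x
  assume I: "I \<subseteq> verts \<Gamma>" "\<And>y. y \<in> I \<Longrightarrow> verts_above \<Gamma> y \<subseteq> I" "x \<in> verts \<Gamma>" "x \<notin> I" "verts_above \<Gamma> x \<subseteq> I"
    and "\<exists>F :: ('v, 'e, nat \<Rightarrow> cpoly, (nat \<Rightarrow> cpoly) set) gsheaf. canon_on z I F"
  then obtain F :: "('v, 'e, nat \<Rightarrow> cpoly, (nat \<Rightarrow> cpoly) set) gsheaf" where F: "canon_on z I F" by blast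
  show "\<exists>F :: ('v, 'e, nat \<Rightarrow> cpoly, (nat \<Rightarrow> cpoly) set) gsheaf. canon_on z (insert x I) F"
    by (rule canon_step[OF top z I F])
qed

section \<open>The subgraph below a vertex and the extension by zero\<close>

lemma below_simps [simp]:
  "grank (graph_below \<Gamma> z) = d" "verts (graph_below \<Gamma> z) = {y \<in> verts \<Gamma>. vle \<Gamma> y z}"
  "ends (graph_below \<Gamma> z) = ends \<Gamma>" "dir (graph_below \<Gamma> z) = dir \<Gamma>" "vle (graph_below \<Gamma> z) = vle \<Gamma>"
  by (simp_all add: graph_below_def)

lemma below_edges:
  assumes "z \<in> verts \<Gamma>"
  shows "L \<in> edges (graph_below \<Gamma> z) \<longleftrightarrow> L \<in> edges \<Gamma> \<and> vle \<Gamma> (up L) z"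
  using e_ends[of L] vtrans[of "lo L" "up L" z] assms by (auto simp: graph_below_def)

lemma below_is_end:
  assumes "z \<in> verts \<Gamma>" "L \<in> edges (graph_below \<Gamma> z)"
  shows "is_end (graph_below \<Gamma> z) L (up L) (lo L)"
  using assms e_ends[of L] vtrans[of "lo L" "up L" z] by (auto simp: is_end_def below_edges)

lemma below_moment:
  assumes z: "z \<in> verts \<Gamma>"
  shows "moment (graph_below \<Gamma> z)"
proof
  show "finite (edges (graph_below \<Gamma> z))"
    by (rule finite_subset[OF _ finE]) (auto simp: below_edges[OF z])
  show "\<exists>x y. is_end (graph_below \<Gamma> z) L x y" if "L \<in> edges (graph_below \<Gamma> z)" for L
    using below_is_end[OF z that] by blast
  show "dir (graph_below \<Gamma> z) L \<subseteq> tdual (grank (graph_below \<Gamma> z))" if "L \<in> edges (graph_below \<Gamma> z)" for L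
    using dir_sub[of L] that by (simp add: below_edges[OF z])
qed (use finV vrefl vanti in \<open>auto intro: vtrans\<close>)

lemma below_e:
  assumes z: "z \<in> verts \<Gamma>" and L: "L \<in> edges (graph_below \<Gamma> z)"
  shows "e_up (graph_below \<Gamma> z) L = up L" "e_lo (graph_below \<Gamma> z) L = lo L"
  using moment.e_unique[OF below_moment[OF z] L below_is_end[OF z L]] by simp_all

lemma below_up_edges:
  assumes z: "z \<in> verts \<Gamma>"
  shows "up_edges (graph_below \<Gamma> z) x = up_edges \<Gamma> x \<inter> edges (graph_below \<Gamma> z)"
  using moment.up_edges_iff[OF below_moment[OF z]] below_e[OF z] up_edges_iff below_edges[OF z]
  by (auto simp del: below_simps)

lemma below_verts_above: "verts_above (graph_below \<Gamma> z) x = {y \<in> verts_above \<Gamma> x. vle \<Gamma> y z}"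
  by (auto simp: verts_above_def)

text \<open>The construction is run on \<open>graph_below\<close>, where \<open>z\<close> is the top
  vertex, and the result is padded with zero modules.\<close>

lemma canonical_below_exists:
  assumes z: "z \<in> verts \<Gamma>"
  shows "\<exists>K :: ('v, 'e, nat \<Rightarrow> cpoly, (nat \<Rightarrow> cpoly) set) gsheaf. canonical_below \<Gamma> z K"
proof -
  let ?G = "graph_below \<Gamma> z"
  interpret B: moment ?G by (rule below_moment[OF z])
  have zB: "z \<in> verts ?G" using z vrefl by simp
  obtain F :: "('v, 'e, nat \<Rightarrow> cpoly, (nat \<Rightarrow> cpoly) set) gsheaf" where F: "B.canon_on z (verts ?G) F"
    using B.canon_exists[of z] zB by auto
  \<comment> \<open>On edges outside the subgraph, including those whose lower end is inside, the
    maps take the only value of \<open>zero_mod undefined\<close>.\<close>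
  define K :: "('v, 'e, nat \<Rightarrow> cpoly, (nat \<Rightarrow> cpoly) set) gsheaf" where
    "K = \<lparr>vmod = (\<lambda>y. if y \<in> verts ?G then vmod F y else zero_mod undefined),
      emod = (\<lambda>L. if L \<in> edges ?G then emod F L else zero_mod undefined),
      res = (\<lambda>y L. if L \<in> edges ?G then res F y L else (\<lambda>_. undefined))\<rparr>"
  have Ksimps: "vmod K y = (if y \<in> verts ?G then vmod F y else zero_mod undefined)"
    "emod K L = (if L \<in> edges ?G then emod F L else zero_mod undefined)"
    "res K y L = (if L \<in> edges ?G then res F y L else (\<lambda>_. undefined))" for y L
    by (simp_all add: K_def)
  have "B.agree_on (verts ?G) F K" by (simp add: B.agree_on_def Ksimps del: below_simps)
  from B.canon_on_cong[OF this _ F] have cK: "B.canon_on z (verts ?G) K"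
    by (auto simp: verts_above_def)
  have can: "canonical_sheaf ?G z K" by (rule B.canon_on_canonical[OF cK zB])
  hence gK: "graph_sheaf ?G K" by (simp add: canonical_sheaf_def)
  have gr: "graded_module d (vmod K y)" for y
    using B.graph_sheafD(1)[OF gK, of y] by (cases "y \<in> verts ?G") (simp_all add: Ksimps graded_zero_mod)
  have hz: "(\<lambda>_. undefined) \<in> gmod_hom d M (zero_mod undefined)" for M :: "(cpoly, nat \<Rightarrow> cpoly) gmodule"
    by (rule gmod_homI) (simp_all add: zero_mod_def)
  have "graph_sheaf \<Gamma> K"
  proof (rule graph_sheafI[OF gr])
    fix L assume "L \<in> edges \<Gamma>"
    show "graded_module d (emod K L)"
      using B.graph_sheafD(2)[OF gK, of L] by (cases "L \<in> edges ?G") (simp_all add: Ksimps graded_zero_mod)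
    show "v \<odot>\<^bsub>emod K L\<^esub> m = \<zero>\<^bsub>emod K L\<^esub>" if "v \<in> dir \<Gamma> L" "m \<in> carrier (emod K L)" for v m
    proof (cases "L \<in> edges ?G")
      case True
      thus ?thesis using gK that by (simp add: graph_sheaf_def del: below_simps(2))
    qed (simp add: Ksimps zero_mod_def)
    show "res K (up L) L \<in> gmod_hom d (vmod K (up L)) (emod K L)"
    proof (cases "L \<in> edges ?G")
      case True
      thus ?thesis using B.graph_sheafD(3)[OF gK True] below_e[OF z True] by simp
    next
      case False
      have "emod K L = zero_mod undefined" "res K (up L) L = (\<lambda>_. undefined)"
        using False by (simp_all add: Ksimps)
      thus ?thesis using hz by (simp only:)
    qed
    show "res K (lo L) L \<in> gmod_hom d (vmod K (lo L)) (emod K L)"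
    proof (cases "L \<in> edges ?G")
      case True
      thus ?thesis using B.graph_sheafD(4)[OF gK True] below_e[OF z True] by simp
    next
      case False
      have "emod K L = zero_mod undefined" "res K (lo L) L = (\<lambda>_. undefined)"
        using False by (simp_all add: Ksimps)
      thus ?thesis using hz by (simp only:)
    qed
  qed
  moreover have "\<forall>y\<in>verts \<Gamma> - verts ?G. zero_gmodule (vmod K y)"
    by (simp add: Ksimps zero_gmodule_def zero_mod_def)
  moreover have "\<forall>L\<in>edges \<Gamma> - edges ?G. zero_gmodule (emod K L)"
    by (simp add: Ksimps zero_gmodule_def zero_mod_def)
  ultimately show ?thesis using can by (auto simp: canonical_below_def simp del: below_simps)
qed

end

section \<open>Minimal pure sheaves and indecomposability\<close>

lemma (in ghom) iso_inj:
  assumes "f \<in> gmod_iso d M N" "x \<in> carrier M" "f x = \<zero>\<^bsub>N\<^esub>"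
  shows "x = \<zero>\<^bsub>M\<^esub>"
  by (rule inj_onD[OF bij_betw_imp_inj_on[OF gmod_isoD(2)[OF assms(1)]]]) (use assms(2,3) zero in auto)

lemma gmod_iso_surjD:
  assumes "f \<in> gmod_iso d M N" "y \<in> carrier N"
  shows "\<exists>x\<in>carrier M. f x = y"
proof -
  have "y \<in> f ` carrier M" using gmod_isoD(2)[OF assms(1)] assms(2) by (simp add: bij_betw_def)
  thus ?thesis by blast
qed

lemma dsum_gsheaf_simps [simp]:
  "vmod (dsum_gsheaf I F) x = dsum_gmodule I (\<lambda>i. vmod (F i) x)"
  "emod (dsum_gsheaf I F) L = dsum_gmodule I (\<lambda>i. emod (F i) L)"
  "res (dsum_gsheaf I F) x L m = (\<lambda>i\<in>I. res (F i) x L (m i))"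
  by (simp_all add: dsum_gsheaf_def)

lemma shift_gsheaf_simps [simp]:
  "vmod (shift_gsheaf k F) x = shift_gmodule k (vmod F x)"
  "emod (shift_gsheaf k F) L = shift_gmodule k (emod F L)"
  "res (shift_gsheaf k F) = res F"
  by (simp_all add: shift_gsheaf_def)

lemma sym_alg_hcomp_0: "p \<in> hcomp (sym_alg d) 0 \<Longrightarrow> p = Poly_Mapping.single 0 (Poly_Mapping.lookup p 0)"
  by (rule poly_mapping_eqI) (auto simp: sym_alg_hcomp in_keys_iff lookup_single when_def mdeg_eq_0_iff)

text \<open>The ring is an indecomposable graded module because its degree 0 part consists of the
  scalars: projecting its generator to one summand multiplies it by a scalar, and if that is zero
  the summand vanishes, otherwise all the others do.\<close>

lemma (in gfam) sym_alg_summand: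
  assumes K: "graded_module d K" and \<phi>: "\<phi> \<in> gmod_iso d K (sym_alg d)" and f: "f \<in> gmod_iso d K D"
    and b: "b \<in> I"
  shows "zero_gmodule (M b) \<or> (\<forall>b'\<in>I - {b}. zero_gmodule (M b'))"
proof -
  interpret f: ghom d K D f by (rule ghomI[OF K graded_dsum(1) gmod_isoD(1)[OF f]])
  obtain e where e: "e \<in> hcomp K 0" "\<phi> e = 1" "e \<noteq> \<zero>\<^bsub>K\<^esub>"
    "\<And>m. m \<in> carrier K \<Longrightarrow> \<phi> m \<in> carrier (sym_alg d) \<and> m = \<phi> m \<odot>\<^bsub>K\<^esub> e"
    using iso_sym_alg_generator[OF K \<phi>] by metis
  have ec: "e \<in> carrier K" using e(1) by (rule f.M.hcomp_closed)
  let ?t = "f e"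
  have t: "?t \<in> hcomp D 0" by (rule f.hcomp[OF e(1)])
  have ti: "?t i \<in> hcomp (M i) 0" "?t i \<in> carrier (M i)" if "i \<in> I" for i
    using t f.closed[OF ec] that by (auto simp: PiE_iff)
  have gen: "\<exists>a\<in>carrier (sym_alg d). v = a \<odot>\<^bsub>M i\<^esub> ?t i" if i: "i \<in> I" and v: "v \<in> carrier (M i)" for i v
  proof -
    obtain m where m: "m \<in> carrier K" "f m = dinj I M i v"
      using gmod_iso_surjD[OF f gmod_homD(1)[OF dinj_hom[OF i] v]] by blast
    have a: "\<phi> m \<in> carrier (sym_alg d)" "m = \<phi> m \<odot>\<^bsub>K\<^esub> e" using e(4)[OF m(1)] by auto
    have "f m = \<phi> m \<odot>\<^bsub>D\<^esub> ?t" using f.smult[OF a(1) ec] a(2) by simp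
    hence "v = \<phi> m \<odot>\<^bsub>M i\<^esub> ?t i" using m(2) i by (simp add: dinj_def fun_eq_iff restrict_def split: if_splits)
    thus ?thesis using a(1) by blast
  qed
  have zeroI: "zero_gmodule (M i)" if i: "i \<in> I" and z: "?t i = \<zero>\<^bsub>M i\<^esub>" for i
  proof (rule gmod.zero_gmoduleI[OF gm[OF i]])
    fix v assume "v \<in> carrier (M i)"
    then obtain a where "a \<in> carrier (sym_alg d)" "v = a \<odot>\<^bsub>M i\<^esub> ?t i" using gen[OF i] by blast
    thus "v = \<zero>\<^bsub>M i\<^esub>" using z module.smult_r_null[OF m[OF i]] by simp
  qed
  note fi = gmod_isoD(1)[OF gmod_iso_inv[OF K graded_dsum(1) f]]
  \<comment> \<open>The \<open>b\<close>-component of the image of the generator, put back into the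
    sum. It has degree 0 and is therefore a scalar multiple \<open>c\<close> of the whole
    image.\<close>
  let ?u = "dinj I M b (?t b)"
  have u: "?u \<in> hcomp D 0" by (rule gmod_homD(4)[OF dinj_hom[OF b] ti(1)[OF b]])
  define m where "m = inv_into (carrier K) f ?u"
  have m0: "m \<in> hcomp K 0" unfolding m_def by (rule gmod_homD(4)[OF fi u])
  have mc: "m \<in> carrier K" using m0 by (rule f.M.hcomp_closed)
  have fm: "f m = ?u"
    unfolding m_def by (rule bij_betw_inv_into_right[OF gmod_isoD(2)[OF f]])
      (rule gmod_homD(1)[OF dinj_hom[OF b] ti(2)[OF b]])
  define c where "c = Poly_Mapping.lookup (\<phi> m) 0"
  have phim: "\<phi> m = Poly_Mapping.single 0 c"
    unfolding c_def by (rule sym_alg_hcomp_0[OF gmod_homD(4)[OF gmod_isoD(1)[OF \<phi>] m0]])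
  have "f m = Poly_Mapping.single 0 c \<odot>\<^bsub>D\<^esub> ?t"
    using f.smult[of "\<phi> m" e] e(4)[OF mc] ec phim by simp
  hence comp: "?u i = Poly_Mapping.single 0 c \<odot>\<^bsub>M i\<^esub> ?t i" if "i \<in> I" for i
    using fm that by simp
  show ?thesis
  proof (cases "c = 0")
    case True
    have "?t b = 0 \<odot>\<^bsub>M b\<^esub> ?t b" using comp[OF b] True b by (simp add: dinj_def)
    hence "?t b = \<zero>\<^bsub>M b\<^esub>" using gmod.smult_0[OF gm[OF b] ti(2)[OF b]] by simp
    thus ?thesis using zeroI[OF b] by blast
  next
    case False
    have "zero_gmodule (M i)" if i: "i \<in> I - {b}" for i
    proof -
      have iI: "i \<in> I" using i by blast
      interpret Mi: gmod d "M i" using gm[OF iI] .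
      have z: "Poly_Mapping.single 0 c \<odot>\<^bsub>M i\<^esub> ?t i = \<zero>\<^bsub>M i\<^esub>" using comp[OF iI] i by (auto simp: dinj_def)
      have "?t i = (Poly_Mapping.single 0 (1 / c) * Poly_Mapping.single 0 c) \<odot>\<^bsub>M i\<^esub> ?t i"
        using False ti(2)[OF iI] by (simp add: mult_single)
      also have "\<dots> = Poly_Mapping.single 0 (1 / c) \<odot>\<^bsub>M i\<^esub> (Poly_Mapping.single 0 c \<odot>\<^bsub>M i\<^esub> ?t i)"
        by (rule Mi.smult_mult) (use ti(2)[OF iI] in auto)
      also have "\<dots> = \<zero>\<^bsub>M i\<^esub>" unfolding z by (rule Mi.smult_r_null) simp
      finally show ?thesis by (rule zeroI[OF iI])
    qed
    thus ?thesis by blast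
  qed
qed

context moment
begin

text \<open>What is used of the canonical sheaf of \<Gamma>_{\<le>z} after extension by zero,
  phrased on the whole graph: purity, the ring as stalk at \<open>z\<close>, minimality of the cover
  of the boundary at all other vertices, and vanishing at vertices not below
  \<open>z\<close>.\<close>

definition min_pure :: "'v \<Rightarrow> ('v, 'e, 'm, 'l) gsheaf \<Rightarrow> bool" where
  "min_pure z K \<longleftrightarrow> z \<in> verts \<Gamma> \<and> graph_sheaf \<Gamma> K \<and> gmod_iso d (vmod K z) (sym_alg d) \<noteq> {} \<and>
     (\<forall>x\<in>verts \<Gamma>. free_gmodule d (vmod K x) \<and> bmap \<Gamma> K x ` carrier (vmod K x) = boundary_image \<Gamma> K x) \<and>
     (\<forall>L\<in>edges \<Gamma>. quotient_map d (dir \<Gamma> L) (vmod K (up L)) (emod K L) (res K (up L) L)) \<and>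
     (\<forall>x\<in>verts \<Gamma> - {z}. \<forall>m\<in>carrier (vmod K x).
        (\<forall>L\<in>up_edges \<Gamma> x. res K x L m = \<zero>\<^bsub>emod K L\<^esub>) \<longrightarrow> m \<in> mod_span (tdual d) (vmod K x)) \<and>
     (\<forall>y\<in>verts \<Gamma>. \<not> vle \<Gamma> y z \<longrightarrow> zero_gmodule (vmod K y))"

lemma min_pure_pure: "min_pure z K \<Longrightarrow> pure_sheaf \<Gamma> K"
  unfolding min_pure_def using pure_sheaf_iff by blast

lemma quotient_zero:
  assumes "quotient_map d W M N p" "zero_gmodule M" "graded_module d M" "graded_module d N"
  shows "zero_gmodule N"
proof -
  interpret ghom d M N p using assms by (intro ghomI) (auto simp: quotient_map_def)
  have "p ` carrier M = carrier N" using assms(1) by (simp add: quotient_map_def)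
  moreover have "carrier M = {\<zero>\<^bsub>M\<^esub>}" using assms(2) by (simp add: zero_gmodule_def)
  ultimately have "carrier N = {p \<zero>\<^bsub>M\<^esub>}" by simp
  thus ?thesis by (simp add: zero zero_gmodule_def)
qed

lemma zero_quotient:
  assumes p: "p \<in> gmod_hom d M N" and z: "zero_gmodule M" "zero_gmodule N"
    and gr: "graded_module d M" "graded_module d N" and W: "W \<subseteq> carrier (sym_alg d)"
  shows "quotient_map d W M N p"
proof -
  interpret ghom d M N p by (rule ghomI[OF gr p])
  have c: "carrier M = {\<zero>\<^bsub>M\<^esub>}" "carrier N = {\<zero>\<^bsub>N\<^esub>}" using z by (auto simp: zero_gmodule_def)
  have "mod_span W M = {\<zero>\<^bsub>M\<^esub>}"
    using submodule_closed(1)[OF M.mod_span_submodule[OF W]] M.mod_span_zero[of W] c(1) by blast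
  moreover have "{m \<in> carrier M. p m = \<zero>\<^bsub>N\<^esub>} = {\<zero>\<^bsub>M\<^esub>}" unfolding c(1) using zero by auto
  ultimately show ?thesis unfolding quotient_map_def using p c zero by simp
qed

text \<open>A direct sum of zero modules is a single point, so the image of the stalk and the
  boundary both reduce to it.\<close>

lemma germ_zero:
  assumes G: "graph_sheaf \<Gamma> K" and z: "\<And>L. L \<in> up_edges \<Gamma> x \<Longrightarrow> zero_gmodule (emod K L)"
    and x: "x \<in> verts \<Gamma>"
  shows "bmap \<Gamma> K x ` carrier (vmod K x) = boundary_image \<Gamma> K x"
proof -
  have ok: "above_ok K x" by (rule graph_sheaf_above_ok[OF G])
  let ?E = "dsum_gmodule (up_edges \<Gamma> x) (emod K)"
  have "u = \<zero>\<^bsub>?E\<^esub>" if u: "u \<in> carrier ?E" for u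
  proof
    fix L
    show "u L = \<zero>\<^bsub>?E\<^esub> L"
    proof (cases "L \<in> up_edges \<Gamma> x")
      case True
      thus ?thesis using zero_gmoduleD[OF z[OF True], of "u L"] u by (simp add: PiE_iff)
    next
      case False
      thus ?thesis using u by (simp add: PiE_iff extensional_def)
    qed
  qed
  hence E: "carrier ?E \<subseteq> {\<zero>\<^bsub>?E\<^esub>}" by blast
  have "bmap \<Gamma> K x m \<in> carrier ?E" if "m \<in> carrier (vmod K x)" for m
  proof -
    have "res K x L m \<in> carrier (emod K L)" if "L \<in> up_edges \<Gamma> x" for L
      using graph_sheafD(4)[OF G, of L] that gmod_homD(1) \<open>m \<in> carrier (vmod K x)\<close> by (fastforce simp: up_edges_iff)
    thus ?thesis by (simp add: bmap_def)
  qed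
  hence 1: "bmap \<Gamma> K x m = \<zero>\<^bsub>?E\<^esub>" if "m \<in> carrier (vmod K x)" for m
    using subsetD[OF E] that by simp
  interpret gmod d "vmod K x" using graph_sheafD(1)[OF G x] by (simp add: gmod_def)
  have "bmap \<Gamma> K x ` carrier (vmod K x) = (\<lambda>_. \<zero>\<^bsub>?E\<^esub>) ` carrier (vmod K x)"
    by (rule image_cong[OF refl 1])
  also have "\<dots> = {\<zero>\<^bsub>?E\<^esub>}"
    by (rule image_constant[OF M.zero_closed])
  also have "\<dots> = boundary_image \<Gamma> K x"
  proof (rule subset_antisym)
    show "boundary_image \<Gamma> K x \<subseteq> {\<zero>\<^bsub>?E\<^esub>}"
      using gsubD(2)[OF boundary_gsub(1)[OF ok x]] E by (rule subset_trans)
    show "{\<zero>\<^bsub>?E\<^esub>} \<subseteq> boundary_image \<Gamma> K x"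
      using gsubD(4)[OF boundary_gsub(1)[OF ok x]] by (rule insert_subsetI) simp
  qed
  finally show ?thesis .
qed

text \<open>The delicate clause is purity, since the boundary in \<Gamma> involves more vertices and
  edges than the one in \<Gamma>_{\<le>z}. Edges whose upper end is not below \<open>z\<close> carry
  zero modules, so sections over the subgraph extend by zero, and sections over \<Gamma> restrict,
  without changing the germ at \<open>x\<close>.\<close>

lemma min_pure_of_below:
  assumes z: "z \<in> verts \<Gamma>" and K: "canonical_below \<Gamma> z K"
  shows "min_pure z K"
proof -
  let ?G = "graph_below \<Gamma> z"
  interpret B: moment ?G by (rule below_moment[OF z])
  have G: "graph_sheaf \<Gamma> K" and can: "canonical_sheaf ?G z K"
    and zv: "\<And>y. y \<in> verts \<Gamma> \<Longrightarrow> \<not> vle \<Gamma> y z \<Longrightarrow> zero_gmodule (vmod K y)"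
    and ze: "\<And>L. L \<in> edges \<Gamma> \<Longrightarrow> L \<notin> edges ?G \<Longrightarrow> zero_gmodule (emod K L)"
    using K by (auto simp: canonical_below_def)
  have BG: "graph_sheaf ?G K" and ne: "gmod_iso d (vmod K z) (sym_alg d) \<noteq> {}"
    using can by (auto simp: canonical_sheaf_def)
  have Bq: "quotient_map d (dir \<Gamma> L) (vmod K (up L)) (emod K L) (res K (up L) L)" if L: "L \<in> edges ?G" for L
  proof -
    have "L \<in> down_edges ?G (up L)" "up L \<in> verts ?G"
      using B.down_edges_iff below_e[OF z L] L below_edges[OF z] e_ends(1)[of L] by auto
    thus ?thesis using can by (simp add: canonical_sheaf_def)
  qed
  have pc: "projective_cover d (vmod K x) (boundary_module ?G K x) (bmap ?G K x)"
    if "x \<in> verts \<Gamma>" "vle \<Gamma> x z" "x \<noteq> z" for x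
    using can that unfolding canonical_sheaf_def bmap_def[abs_def] by simp
  have gr: "graded_module d (vmod K x)" if "x \<in> verts \<Gamma>" for x using graph_sheafD(1)[OF G that] .
  have ge: "graded_module d (emod K L)" if "L \<in> edges \<Gamma>" for L using graph_sheafD(2)[OF G that] .
  have gu: "ghom d (vmod K (up L)) (emod K L) (res K (up L) L)" if L: "L \<in> edges \<Gamma>" for L
    by (rule ghomI[OF gr[OF e_ends(1)[OF L]] ge[OF L] graph_sheafD(3)[OF G L]])
  have gl: "ghom d (vmod K (lo L)) (emod K L) (res K (lo L) L)" if L: "L \<in> edges \<Gamma>" for L
    by (rule ghomI[OF gr[OF e_ends(2)[OF L]] ge[OF L] graph_sheafD(4)[OF G L]])
  have ok: "above_ok K x" for x by (rule graph_sheaf_above_ok[OF G])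
  have Bok: "B.above_ok K x" for x by (rule B.graph_sheaf_above_ok[OF BG])
  have free: "free_gmodule d (vmod K x)" if x: "x \<in> verts \<Gamma>" for x
  proof (cases "vle \<Gamma> x z")
    case True
    show ?thesis
    proof (cases "x = z")
      case True
      obtain \<phi> where "\<phi> \<in> gmod_iso d (vmod K z) (sym_alg d)" using ne by blast
      thus ?thesis using free_of_iso[OF gr[OF z]] True by blast
    next
      case False
      thus ?thesis using pc[OF x True] by (simp add: projective_cover_def)
    qed
  next
    case False
    thus ?thesis using free_zero[OF gr[OF x] zv[OF x]] by simp
  qed
  have quot: "quotient_map d (dir \<Gamma> L) (vmod K (up L)) (emod K L) (res K (up L) L)" if L: "L \<in> edges \<Gamma>" for L
  proof (cases "L \<in> edges ?G")
    case False
    hence "\<not> vle \<Gamma> (up L) z" using below_edges[OF z] L by simp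
    thus ?thesis
      using zero_quotient[OF graph_sheafD(3)[OF G L] zv[OF e_ends(1)[OF L]] ze[OF L False]
          gr[OF e_ends(1)[OF L]] ge[OF L]] dir_sub[OF L] tdual_carrier by blast
  qed (rule Bq)
  have edge_zero: "zero_gmodule (emod K L)" if "L \<in> edges \<Gamma>" "\<not> vle \<Gamma> (up L) z" for L
    using ze[OF that(1)] that(2) below_edges[OF z] by simp
  have Bup: "L \<in> up_edges ?G x \<longleftrightarrow> L \<in> up_edges \<Gamma> x \<and> vle \<Gamma> (up L) z" for L x
    using below_up_edges[OF z, of x] below_edges[OF z] up_edges_iff[of L x] by auto
  have upE: "up L \<in> verts_above \<Gamma> x" "L \<in> edges \<Gamma>" "lo L = x" if "L \<in> up_edges \<Gamma> x" for L x
    using that up_above_lo[of L] by (auto simp: up_edges_iff)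
  have ea: "up L \<in> verts_above \<Gamma> x" "lo L \<in> verts_above \<Gamma> x" "L \<in> edges \<Gamma>" if "L \<in> edges_above \<Gamma> x" for L x
    using that by (auto simp: edges_above_iff)
  have Bea: "L \<in> edges_above ?G x \<longleftrightarrow> L \<in> edges_above \<Gamma> x \<and> vle \<Gamma> (up L) z" if x: "x \<in> verts \<Gamma>" for L x
  proof -
    have "L \<in> edges_above ?G x \<longleftrightarrow> L \<in> edges ?G \<and> up L \<in> verts_above ?G x \<and> lo L \<in> verts_above ?G x"
      using B.edges_above_iff[of L x] below_e[OF z, of L] by auto
    thus ?thesis
      using edges_above_iff[of L x] below_edges[OF z, of L] e_ends[of L] vtrans[of "lo L" "up L" z] z
      by (auto simp: below_verts_above)
  qed
  have bnd: "bmap \<Gamma> K x ` carrier (vmod K x) = boundary_image \<Gamma> K x" if x: "x \<in> verts \<Gamma>" for x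
  proof (cases "vle \<Gamma> x z \<and> x \<noteq> z")
    case False
    \<comment> \<open>If \<open>x\<close> is \<open>z\<close> or not below \<open>z\<close>, every
      edge going up from \<open>x\<close> leaves \<Gamma>_{\<le>z}.\<close>
    have "zero_gmodule (emod K L)" if L: "L \<in> up_edges \<Gamma> x" for L
    proof (rule edge_zero[OF upE(2)[OF L]])
      show "\<not> vle \<Gamma> (up L) z"
        using upE[OF L] e_ends[OF upE(2)[OF L]] vtrans[of x "up L" z] vanti[of "up L" z] x z False
        by (auto simp: verts_above_iff)
    qed
    thus ?thesis by (rule germ_zero[OF G _ x])
  next
    case True
    have Bim: "bmap ?G K x ` carrier (vmod K x) = B.germ K x ` B.glued K x"
      using pc[OF x] True B.boundary_image_eq[OF Bok, of x]
      by (simp add: projective_cover_def boundary_module_def)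
    have bl: "bmap ?G K x m L = res K x L m" if "L \<in> up_edges ?G x" for m L using that by (simp add: bmap_def)
    have gl': "B.germ K x s L = res K (up L) L (s (up L))" if L: "L \<in> up_edges ?G x" for s L
    proof -
      have "L \<in> edges ?G" using L B.up_edges_iff by blast
      thus ?thesis using L below_e(1)[OF z] by (simp add: B.germ_def)
    qed
    \<comment> \<open>Only the edges of the subgraph have to be compared: on the others both sides
      lie in a zero module.\<close>
    have match: "germ K x s = bmap \<Gamma> K x m"
      if s: "s \<in> glued K x" and m: "m \<in> carrier (vmod K x)" and
        eq: "\<And>L. L \<in> up_edges ?G x \<Longrightarrow> res K (up L) L (s (up L)) = res K x L m" for s m
      unfolding germ_def bmap_def
    proof (rule restrict_ext)
      fix L assume L: "L \<in> up_edges \<Gamma> x"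
      show "res K (up L) L (s (up L)) = res K x L m"
      proof (cases "vle \<Gamma> (up L) z")
        case False
        note zL = zero_gmoduleD[OF edge_zero[OF upE(2)[OF L] False]]
        have "s (up L) \<in> carrier (vmod K (up L))" using s upE(1)[OF L] by (auto simp: glued_def)
        thus ?thesis
          using zL[OF ghom.closed[OF gu[OF upE(2)[OF L]]]] zL[OF ghom.closed[OF gl[OF upE(2)[OF L]]]] m upE(3)[OF L]
          by simp
      qed (use eq L Bup in simp)
    qed
    show ?thesis unfolding boundary_image_eq[OF ok]
    proof (intro subset_antisym subsetI)
      fix u assume "u \<in> bmap \<Gamma> K x ` carrier (vmod K x)"
      then obtain m where m: "m \<in> carrier (vmod K x)" "u = bmap \<Gamma> K x m" by blast
      obtain s' where s': "s' \<in> B.glued K x" "bmap ?G K x m = B.germ K x s'"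
        using Bim m(1) by blast
      \<comment> \<open>Extension by zero. An edge whose upper end lies below \<open>z\<close> has
        its lower end there too; all other edges have zero modules, so the gluing condition
        persists.\<close>
      define s where "s = (\<lambda>y\<in>verts_above \<Gamma> x. if vle \<Gamma> y z then s' y else \<zero>\<^bsub>vmod K y\<^esub>)"
      have sc: "s y \<in> carrier (vmod K y)" if y: "y \<in> verts_above \<Gamma> x" for y
      proof -
        interpret gmod d "vmod K y" using gr[of y] y by (simp add: gmod_def verts_above_iff)
        have "s' y \<in> carrier (vmod K y)" if "vle \<Gamma> y z"
          using s'(1) y that by (auto simp: B.glued_def below_verts_above)
        thus ?thesis using y by (simp add: s_def)
      qed
      have "s \<in> glued K x" unfolding glued_def
      proof (intro CollectI conjI ballI)
        show "s \<in> (\<Pi>\<^sub>E y\<in>verts_above \<Gamma> x. carrier (vmod K y))" using sc by (simp add: PiE_iff s_def)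
        fix L assume L: "L \<in> edges_above \<Gamma> x"
        note e = ea[OF L]
        show "res K (lo L) L (s (lo L)) = res K (up L) L (s (up L))"
        proof (cases "vle \<Gamma> (up L) z")
          case True
          hence BL: "L \<in> edges_above ?G x" using Bea[OF x] L by simp
          have "vle \<Gamma> (lo L) z" using vtrans[of "lo L" "up L" z] e_ends[OF e(3)] True z by blast
          moreover have "L \<in> edges ?G" using below_edges[OF z] e(3) True by simp
          moreover have "res K (B.lo L) L (s' (B.lo L)) = res K (B.up L) L (s' (B.up L))"
            using s'(1) BL unfolding B.glued_def by blast
          ultimately show ?thesis
            using below_e[OF z, of L] True e by (simp add: s_def)
        next
          case False
          note zL = zero_gmoduleD[OF edge_zero[OF e(3) False]]
          show ?thesis
            using zL[OF ghom.closed[OF gu[OF e(3)] sc[OF e(1)]]] zL[OF ghom.closed[OF gl[OF e(3)] sc[OF e(2)]]]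
            by simp
        qed
      qed
      moreover have "germ K x s = bmap \<Gamma> K x m"
      proof (rule match[OF \<open>s \<in> glued K x\<close> m(1)])
        fix L assume L: "L \<in> up_edges ?G x"
        have "res K (up L) L (s' (up L)) = res K x L m"
          using fun_cong[OF s'(2), of L] bl[OF L] gl'[OF L] by simp
        thus "res K (up L) L (s (up L)) = res K x L m"
          using L Bup upE(1)[of L x] by (simp add: s_def)
      qed
      ultimately show "u \<in> germ K x ` glued K x" using m(2) by (metis imageI)
    next
      fix u assume "u \<in> germ K x ` glued K x"
      then obtain s where s: "s \<in> glued K x" "u = germ K x s" by blast
      \<comment> \<open>In the other direction a section over \<Gamma> is simply restricted to the
        subgraph.\<close>
      define s' where "s' = restrict s (verts_above ?G x)"
      have "s' \<in> B.glued K x" unfolding B.glued_def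
      proof (intro CollectI conjI ballI)
        show "s' \<in> (\<Pi>\<^sub>E y\<in>verts_above ?G x. carrier (vmod K y))"
          using s(1) by (auto simp: s'_def glued_def below_verts_above)
        fix L assume L: "L \<in> edges_above ?G x"
        hence "L \<in> edges ?G" "e_up ?G L \<in> verts_above ?G x" "e_lo ?G L \<in> verts_above ?G x"
          using B.edges_above_iff by auto
        moreover have "L \<in> edges_above \<Gamma> x" using L Bea[OF x] by simp
        ultimately show "res K (e_lo ?G L) L (s' (e_lo ?G L)) = res K (e_up ?G L) L (s' (e_up ?G L))"
          using s(1) below_e[OF z, of L] by (simp add: s'_def glued_def)
      qed
      then obtain m where m: "m \<in> carrier (vmod K x)" "B.germ K x s' = bmap ?G K x m"
        using Bim by blast
      have "germ K x s = bmap \<Gamma> K x m"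
      proof (rule match[OF s(1) m(1)])
        fix L assume L: "L \<in> up_edges ?G x"
        have "res K (up L) L (s' (up L)) = res K x L m"
          using fun_cong[OF m(2), of L] bl[OF L] gl'[OF L] by simp
        thus "res K (up L) L (s (up L)) = res K x L m"
          using L Bup upE(1)[of L x] by (simp add: s'_def below_verts_above)
      qed
      thus "u \<in> bmap \<Gamma> K x ` carrier (vmod K x)" using s(2) m(1) by blast
    qed
  qed
  have ker: "m \<in> mod_span (tdual d) (vmod K x)"
    if x: "x \<in> verts \<Gamma> - {z}" and m: "m \<in> carrier (vmod K x)"
      and r: "\<forall>L\<in>up_edges \<Gamma> x. res K x L m = \<zero>\<^bsub>emod K L\<^esub>" for x m
  proof (cases "vle \<Gamma> x z")
    case True
    have xB: "x \<in> verts ?G" using x True by simp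
    have "bmap ?G K x m = \<zero>\<^bsub>boundary_module ?G K x\<^esub>"
      unfolding bmap_def boundary_module_def sub_gmodule_simps dsum_gmodule_simps
      by (rule restrict_ext) (use r Bup in blast)
    moreover have "graded_module d (boundary_module ?G K x)"
      using B.boundary_graded[OF Bok xB] by simp
    ultimately show ?thesis using projective_coverD[OF pc _ m] x True by auto
  next
    case False
    have xV: "x \<in> verts \<Gamma>" using x by blast
    interpret gmod d "vmod K x" using gr[OF xV] by (simp add: gmod_def)
    show ?thesis using zero_gmoduleD[OF zv[OF xV False] m] mod_span_zero by simp
  qed
  show ?thesis
    unfolding min_pure_def using z G ne free bnd quot ker zv by blast
qed

text \<open>Descending induction. If the summand vanishes above \<open>x\<close>, its elements at
  \<open>x\<close> correspond to elements of \<open>M\<close> that die in the boundary; by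
  minimality these lie in the maximal ideal times the stalk, and so do their projections back to the
  summand. Nakayama's lemma makes the summand vanish at \<open>x\<close>.\<close>

lemma summand_zero:
  assumes top: "\<And>y. y \<in> verts \<Gamma> \<Longrightarrow> vle \<Gamma> y x0" and M: "min_pure x0 M"
    and J: "finite J" and S: "\<And>j. j \<in> J \<Longrightarrow> graph_sheaf \<Gamma> (S j)"
    and f: "\<And>x. x \<in> verts \<Gamma> \<Longrightarrow> f x \<in> gmod_iso d (vmod M x) (vmod (dsum_gsheaf J S) x)"
    and g: "\<And>L. L \<in> edges \<Gamma> \<Longrightarrow> g L \<in> gmod_iso d (emod M L) (emod (dsum_gsheaf J S) L)"
    and comm: "\<And>x L m. x \<in> verts \<Gamma> \<Longrightarrow> L \<in> edges \<Gamma> \<Longrightarrow> x \<in> ends \<Gamma> L \<Longrightarrow> m \<in> carrier (vmod M x) \<Longrightarrow>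
       g L (res M x L m) = res (dsum_gsheaf J S) x L (f x m)"
    and b: "b \<in> J" and z: "zero_gmodule (vmod (S b) x0)"
  shows "zero_gsheaf \<Gamma> (S b)"
proof -
  have GM: "graph_sheaf \<Gamma> M"
    and quot: "\<And>L. L \<in> edges \<Gamma> \<Longrightarrow> quotient_map d (dir \<Gamma> L) (vmod M (up L)) (emod M L) (res M (up L) L)"
    and ker: "\<And>x m. x \<in> verts \<Gamma> \<Longrightarrow> x \<noteq> x0 \<Longrightarrow> m \<in> carrier (vmod M x) \<Longrightarrow>
        \<forall>L\<in>up_edges \<Gamma> x. res M x L m = \<zero>\<^bsub>emod M L\<^esub> \<Longrightarrow> m \<in> mod_span (tdual d) (vmod M x)"
    using M by (auto simp: min_pure_def)
  have Vf: "gfam d J (\<lambda>j. vmod (S j) x)" if "x \<in> verts \<Gamma>" for x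
    by (rule gfam_const[OF J]) (use graph_sheafD(1)[OF S] that in blast)
  have Ef: "gfam d J (\<lambda>j. emod (S j) L)" if "L \<in> edges \<Gamma>" for L
    by (rule gfam_const[OF J]) (use graph_sheafD(2)[OF S] that in blast)
  \<comment> \<open>For \<open>M\<close> the restriction from the upper end is surjective, hence it
    is so for every summand; a summand that vanishes at \<open>up L\<close> vanishes on
    \<open>L\<close>.\<close>
  have edge_zero: "zero_gmodule (emod (S b) L)" if L: "L \<in> edges \<Gamma>" and zu: "zero_gmodule (vmod (S b) (up L))" for L
  proof -
    note e = e_ends[OF L]
    interpret V: gfam d J "\<lambda>j. vmod (S j) (up L)" by (rule Vf[OF e(1)])
    interpret E: gfam d J "\<lambda>j. emod (S j) L" by (rule Ef[OF L])
    interpret r: ghom d "vmod (S b) (up L)" "emod (S b) L" "res (S b) (up L) L"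
      by (rule ghomI[OF V.gmod[OF b] E.gmod[OF b] graph_sheafD(3)[OF S[OF b] L]])
    show ?thesis
    proof (rule r.N.zero_gmoduleI)
      fix u assume u: "u \<in> carrier (emod (S b) L)"
      have "dinj J (\<lambda>j. emod (S j) L) b u \<in> carrier (emod (dsum_gsheaf J S) L)"
        using gmod_homD(1)[OF E.dinj_hom[OF b] u] by (simp only: dsum_gsheaf_simps)
      then obtain w where w: "w \<in> carrier (emod M L)" "g L w = dinj J (\<lambda>j. emod (S j) L) b u"
        using gmod_iso_surjD[OF g[OF L]] by blast
      have "carrier (emod M L) = res M (up L) L ` carrier (vmod M (up L))"
        using quot[OF L] by (simp add: quotient_map_def)
      then obtain m where m: "m \<in> carrier (vmod M (up L))" "w = res M (up L) L m" using w(1) by blast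
      have "dinj J (\<lambda>j. emod (S j) L) b u = res (dsum_gsheaf J S) (up L) L (f (up L) m)"
        using comm[OF e(1) L _ m(1)] e(5) w(2) m(2) by simp
      hence "u = res (S b) (up L) L (f (up L) m b)"
        using b by (simp add: dinj_def fun_eq_iff restrict_def split: if_splits)
      moreover have "f (up L) m b \<in> carrier (vmod (S b) (up L))"
        using gmod_homD(1)[OF gmod_isoD(1)[OF f[OF e(1)]] m(1)] b by auto
      ultimately show "u = \<zero>\<^bsub>emod (S b) L\<^esub>" using zero_gmoduleD[OF zu] r.zero by metis
    qed
  qed
  have "\<forall>y\<in>I. zero_gmodule (vmod (S b) y)" if "\<And>x. x \<in> I \<Longrightarrow> x \<in> verts \<Gamma> \<and> verts_above \<Gamma> x \<subseteq> I" for I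
  proof (rule upper_induct[of I])
    show "x \<in> verts \<Gamma> \<and> verts_above \<Gamma> x \<subseteq> I" if "x \<in> I" for x using that \<open>\<And>x. x \<in> I \<Longrightarrow> _\<close> by blast
    show "\<forall>y\<in>{}. zero_gmodule (vmod (S b) y)" by simp
    fix I x
    assume x: "x \<in> verts \<Gamma>" "verts_above \<Gamma> x \<subseteq> I" and IH: "\<forall>y\<in>I. zero_gmodule (vmod (S b) y)"
    have "zero_gmodule (vmod (S b) x)"
    proof (cases "x = x0")
      case False
      interpret V: gfam d J "\<lambda>j. vmod (S j) x" by (rule Vf[OF x(1)])
      interpret f: ghom d "vmod M x" V.D "f x"
        by (rule ghomI[OF graph_sheafD(1)[OF GM x(1)] V.graded_dsum(1)])
          (use gmod_isoD(1)[OF f[OF x(1)]] in simp)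
      interpret Vb: gmod d "vmod (S b) x" by (rule V.gm[OF b])
      have W: "tdual d \<subseteq> carrier (sym_alg d)" using tdual_carrier by blast
      show ?thesis
      proof (rule Vb.nakayama_zero)
        fix v assume v: "v \<in> carrier (vmod (S b) x)"
        let ?v = "dinj J (\<lambda>j. vmod (S j) x) b v"
        have vc: "?v \<in> carrier V.D" by (rule gmod_homD(1)[OF V.dinj_hom[OF b] v])
        then obtain m where m: "m \<in> carrier (vmod M x)" "f x m = ?v"
          using gmod_iso_surjD[OF f[OF x(1)], of ?v] by (auto simp only: dsum_gsheaf_simps)
        \<comment> \<open>The summand \<open>b\<close> is zero on the edge, and the other components
          of \<open>?v\<close> are zero from the outset, so the image in the sum vanishes;
          \<open>g L\<close> is injective.\<close>
        have "res M x L m = \<zero>\<^bsub>emod M L\<^esub>" if L: "L \<in> up_edges \<Gamma> x" for L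
        proof -
          have LE: "L \<in> edges \<Gamma>" "lo L = x" "up L \<in> I"
            using L up_above_lo[of L] x(2) by (auto simp: up_edges_iff)
          note e = e_ends[OF LE(1)]
          interpret E: gfam d J "\<lambda>j. emod (S j) L" by (rule Ef[OF LE(1)])
          interpret g: ghom d "emod M L" E.D "g L"
            by (rule ghomI[OF graph_sheafD(2)[OF GM LE(1)] E.graded_dsum(1)])
              (use gmod_isoD(1)[OF g[OF LE(1)]] in simp)
          have zb: "zero_gmodule (emod (S b) L)" by (rule edge_zero[OF LE(1)]) (use IH LE(3) in blast)
          have rj: "ghom d (vmod (S j) x) (emod (S j) L) (res (S j) x L)" if j: "j \<in> J" for j
            using ghomI[OF V.gmod[OF j] E.gmod[OF j]] graph_sheafD(4)[OF S[OF j] LE(1)] LE(2) by simp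
          have "g L (res M x L m) = res (dsum_gsheaf J S) x L ?v"
            using comm[OF x(1) LE(1) _ m(1)] e(5) LE(2) m(2) by simp
          also have "\<dots> = \<zero>\<^bsub>E.D\<^esub>"
            unfolding dsum_gsheaf_simps dsum_gmodule_simps
          proof (rule restrict_ext)
            fix j assume j: "j \<in> J"
            show "res (S j) x L (?v j) = \<zero>\<^bsub>emod (S j) L\<^esub>"
            proof (cases "j = b")
              case True
              show ?thesis
                using zero_gmoduleD[OF zb ghom.closed[OF rj[OF b] v]] True b by (simp add: dinj_def)
            next
              case False
              thus ?thesis using ghom.zero[OF rj[OF j]] j by (simp add: dinj_def)
            qed
          qed
          finally have "g L (res M x L m) = \<zero>\<^bsub>E.D\<^esub>" .
          moreover have "res M x L m \<in> carrier (emod M L)"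
            using gmod_homD(1)[OF graph_sheafD(4)[OF GM LE(1)]] m(1) LE(2) by simp
          moreover have "g L \<in> gmod_iso d (emod M L) E.D" using g[OF LE(1)] by simp
          ultimately show ?thesis using g.iso_inj by blast
        qed
        hence "m \<in> mod_span (tdual d) (vmod M x)" using ker[OF x(1) False m(1)] by blast
        hence "?v \<in> mod_span (tdual d) V.D" using f.mod_span_image[OF W] m(2) by metis
        hence "?v b \<in> mod_span (tdual d) (vmod (S b) x)" using V.mod_span_dsum[OF W vc] b by blast
        thus "v \<in> mod_span (tdual d) (vmod (S b) x)" using b by (simp add: dinj_def)
      qed
    qed (use z in simp)
    thus "\<forall>y\<in>insert x I. zero_gmodule (vmod (S b) y)" using IH by blast
  qed
  from this[of "verts \<Gamma>"] have "\<forall>y\<in>verts \<Gamma>. zero_gmodule (vmod (S b) y)"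
    by (auto simp: verts_above_def)
  thus ?thesis using edge_zero e_ends(1) by (simp add: zero_gsheaf_def)
qed

lemma min_pure_nonzero: "min_pure z K \<Longrightarrow> \<not> zero_gmodule (vmod K z)"
proof
  assume K: "min_pure z K" and zero: "zero_gmodule (vmod K z)"
  have gr: "graded_module d (vmod K z)" using K graph_sheafD(1) by (auto simp: min_pure_def)
  obtain \<phi> where \<phi>: "\<phi> \<in> gmod_iso d (vmod K z) (sym_alg d)" using K by (auto simp: min_pure_def)
  interpret gmod d "vmod K z" using gr by (simp add: gmod_def)
  show False
    using iso_sym_alg_generator[OF gr \<phi>] zero_gmoduleD[OF zero] hcomp_closed(1) by metis
qed

text \<open>At the top vertex the ring cannot be split, so one of the two summands vanishes there,
  and by \<open>summand_zero\<close> it vanishes everywhere.\<close>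

lemma min_pure_indecomposable:
  assumes top: "\<And>y. y \<in> verts \<Gamma> \<Longrightarrow> vle \<Gamma> y x0" and M: "min_pure x0 M"
  shows "indecomposable \<Gamma> M"
  unfolding indecomposable_def
proof (intro conjI allI impI)
  have x0: "x0 \<in> verts \<Gamma>" using M by (simp add: min_pure_def)
  show "\<not> zero_gsheaf \<Gamma> M" using min_pure_nonzero[OF M] x0 by (auto simp: zero_gsheaf_def)
  fix G H
  assume *: "graph_sheaf \<Gamma> G \<and> graph_sheaf \<Gamma> H \<and> gsheaf_iso \<Gamma> M (dsum_gsheaf UNIV (\<lambda>b. if b then G else H))"
  define S where "S = (\<lambda>b. if b then G else H)"
  have S: "graph_sheaf \<Gamma> (S b)" for b using * by (simp add: S_def)
  have "gsheaf_iso \<Gamma> M (dsum_gsheaf UNIV S)" using * by (simp only: S_def)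
  then obtain f g where
    f': "\<forall>x\<in>verts \<Gamma>. f x \<in> gmod_iso d (vmod M x) (vmod (dsum_gsheaf UNIV S) x)"
    and g': "\<forall>L\<in>edges \<Gamma>. g L \<in> gmod_iso d (emod M L) (emod (dsum_gsheaf UNIV S) L)"
    and comm': "\<forall>x\<in>verts \<Gamma>. \<forall>L\<in>edges \<Gamma>. x \<in> ends \<Gamma> L \<longrightarrow>
       (\<forall>m\<in>carrier (vmod M x). g L (res M x L m) = res (dsum_gsheaf UNIV S) x L (f x m))"
    unfolding gsheaf_iso_def by (elim exE conjE)
  note f = bspec[OF f'] and g = bspec[OF g'] and comm = comm'[rule_format]
  obtain \<phi> where \<phi>: "\<phi> \<in> gmod_iso d (vmod M x0) (sym_alg d)" using M by (auto simp: min_pure_def)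
  have gr: "graded_module d (vmod M x0)" using M graph_sheafD(1) by (auto simp: min_pure_def)
  interpret V: gfam d "UNIV :: bool set" "\<lambda>b. vmod (S b) x0"
    by (rule gfam_const) (use graph_sheafD(1)[OF S x0] in auto)
  have f0: "f x0 \<in> gmod_iso d (vmod M x0) V.D" using f[OF x0] by simp
  have "zero_gmodule (vmod (S True) x0) \<or> (\<forall>b'\<in>UNIV - {True}. zero_gmodule (vmod (S b') x0))"
    by (rule V.sym_alg_summand[OF gr \<phi> f0]) simp
  then obtain b where "zero_gmodule (vmod (S b) x0)" by blast
  note zb = this
  have "zero_gsheaf \<Gamma> (S b)"
  proof (rule summand_zero[where M = M and J = UNIV and S = S and f = f and g = g and b = b])
    show "vle \<Gamma> y x0" if "y \<in> verts \<Gamma>" for y using that by (rule top)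
    show "graph_sheaf \<Gamma> (S j)" for j by (rule S)
    show "f x \<in> gmod_iso d (vmod M x) (vmod (dsum_gsheaf UNIV S) x)" if "x \<in> verts \<Gamma>" for x
      using that by (rule f)
    show "g L \<in> gmod_iso d (emod M L) (emod (dsum_gsheaf UNIV S) L)" if "L \<in> edges \<Gamma>" for L
      using that by (rule g)
    show "g L (res M x L m) = res (dsum_gsheaf UNIV S) x L (f x m)"
      if "x \<in> verts \<Gamma>" "L \<in> edges \<Gamma>" "x \<in> ends \<Gamma> L" "m \<in> carrier (vmod M x)" for x L m
      using that by (rule comm)
  qed (use M zb in auto)
  thus "zero_gsheaf \<Gamma> G \<or> zero_gsheaf \<Gamma> H" by (cases b) (auto simp: S_def)
qed

end

section \<open>Shifts and direct sums of pure sheaves\<close>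

lemma free_shift:
  assumes "free_gmodule d M"
  shows "free_gmodule d (shift_gmodule k M)"
proof -
  have M: "graded_module d M" using assms by (simp add: free_gmodule_def)
  obtain B where B: "finite B" "B \<subseteq> carrier M" "\<forall>b\<in>B. \<exists>n. b \<in> hcomp M n"
    "\<forall>m\<in>carrier M. \<exists>!c. c \<in> B \<rightarrow>\<^sub>E carrier (sym_alg d) \<and> m = (\<Oplus>\<^bsub>M\<^esub>b\<in>B. c b \<odot>\<^bsub>M\<^esub> b)"
    using assms unfolding free_gmodule_def by blast
  have fs: "finsum (shift_gmodule k M) = (finsum M :: _ \<Rightarrow> 'b set \<Rightarrow> _)"
    by (simp add: finsum_def shift_gmodule_def fun_eq_iff)
  have "\<exists>n. b \<in> hcomp (shift_gmodule k M) n" if b: "b \<in> B" for b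
  proof -
    obtain n where "b \<in> hcomp M n" using B(3) b by blast
    thus ?thesis by (intro exI[of _ "n - k"]) simp
  qed
  thus ?thesis unfolding free_gmodule_def
    using gmod.graded_shift(1)[of d M k] M B(1,2,4)
    by (intro conjI exI[of _ B]) (simp_all add: gmod_def fs)
qed

lemma zero_shift [simp]: "zero_gmodule (shift_gmodule k M) \<longleftrightarrow> zero_gmodule M"
  by (simp add: zero_gmodule_def)

lemma dsum_gsheaf_cong:
  assumes "\<And>i. i \<in> I \<Longrightarrow> F i = G i"
  shows "dsum_gsheaf I F = dsum_gsheaf I G"
proof -
  have "dsum_gmodule I (\<lambda>i. vmod (F i) x) = dsum_gmodule I (\<lambda>i. vmod (G i) x)"
    "dsum_gmodule I (\<lambda>i. emod (F i) L) = dsum_gmodule I (\<lambda>i. emod (G i) L)" for x L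
    by (rule dsum_gmodule_cong; use assms in simp)+
  moreover have "(\<lambda>i\<in>I. res (F i) x L (m i)) = (\<lambda>i\<in>I. res (G i) x L (m i))" for x L m
    by (rule restrict_ext) (use assms in simp)
  ultimately show ?thesis by (simp add: dsum_gsheaf_def)
qed

text \<open>Appending zero summands does not change a direct sum. It is applied above a new vertex,
  where the newly added canonical sheaves vanish.\<close>

lemma dsum_extend_iso:
  assumes nm: "n \<le> (m :: nat)" and gr: "\<And>i. i < m \<Longrightarrow> graded_module d (M i)"
    and z: "\<And>i. n \<le> i \<Longrightarrow> i < m \<Longrightarrow> zero_gmodule (M i)"
  shows "(\<lambda>f. \<lambda>i\<in>{..<m}. if i < n then f i else \<zero>\<^bsub>M i\<^esub>) \<in>
    gmod_iso d (dsum_gmodule {..<n} M) (dsum_gmodule {..<m} M)"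
proof -
  interpret gfam d "{..<m}" M by (rule gfam_const) (use gr in auto)
  let ?e = "\<lambda>f. \<lambda>i\<in>{..<m}. if i < n then f i else \<zero>\<^bsub>M i\<^esub>"
  let ?N = "dsum_gmodule {..<n} M"
  have zc: "\<zero>\<^bsub>M i\<^esub> \<in> carrier (M i)" "\<zero>\<^bsub>M i\<^esub> \<oplus>\<^bsub>M i\<^esub> \<zero>\<^bsub>M i\<^esub> = \<zero>\<^bsub>M i\<^esub>"
    "\<zero>\<^bsub>M i\<^esub> \<in> hcomp (M i) k" "a \<in> carrier (sym_alg d) \<Longrightarrow> a \<odot>\<^bsub>M i\<^esub> \<zero>\<^bsub>M i\<^esub> = \<zero>\<^bsub>M i\<^esub>"
    if "i < m" for i k a
  proof -
    interpret gmod d "M i" using gr[OF that] by (simp add: gmod_def)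
    show "\<zero>\<^bsub>M i\<^esub> \<in> carrier (M i)" "\<zero>\<^bsub>M i\<^esub> \<oplus>\<^bsub>M i\<^esub> \<zero>\<^bsub>M i\<^esub> = \<zero>\<^bsub>M i\<^esub>" "\<zero>\<^bsub>M i\<^esub> \<in> hcomp (M i) k"
      "a \<in> carrier (sym_alg d) \<Longrightarrow> a \<odot>\<^bsub>M i\<^esub> \<zero>\<^bsub>M i\<^esub> = \<zero>\<^bsub>M i\<^esub>"
      by (simp_all add: hcomp_closed(2))
  qed
  have ec: "?e f \<in> carrier D" if "f \<in> carrier ?N" for f
    using that zc(1) by (simp add: PiE_iff)
  have hom: "?e \<in> gmod_hom d ?N D"
  proof (rule gmod_homI)
    show "?e (f \<oplus>\<^bsub>?N\<^esub> g) = ?e f \<oplus>\<^bsub>D\<^esub> ?e g" for f g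
      unfolding dsum_gmodule_simps by (rule restrict_ext) (simp add: zc(2))
    show "?e (a \<odot>\<^bsub>?N\<^esub> f) = a \<odot>\<^bsub>D\<^esub> ?e f" if "a \<in> carrier (sym_alg d)" for a f
      unfolding dsum_gmodule_simps by (rule restrict_ext) (simp add: zc(4)[OF _ that])
    show "?e f \<in> hcomp D k" if "f \<in> hcomp ?N k" for f k
      using that zc(3) by (simp add: PiE_iff)
  qed (rule ec)
  have "bij_betw ?e (carrier ?N) (carrier D)"
  proof (rule bij_betw_byWitness[where f' = "\<lambda>f. restrict f {..<n}"])
    show "\<forall>f\<in>carrier ?N. restrict (?e f) {..<n} = f"
    proof
      fix f assume f: "f \<in> carrier ?N"
      have "restrict (?e f) {..<n} = restrict f {..<n}"
        by (rule restrict_ext) (use nm in auto)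
      also have "\<dots> = f" using f by (simp add: PiE_restrict)
      finally show "restrict (?e f) {..<n} = f" .
    qed
    show "\<forall>f\<in>carrier D. ?e (restrict f {..<n}) = f"
    proof
      fix f assume f: "f \<in> carrier D"
      have "?e (restrict f {..<n}) = restrict f {..<m}"
      proof (rule restrict_ext)
        fix i assume i: "i \<in> {..<m}"
        show "(if i < n then restrict f {..<n} i else \<zero>\<^bsub>M i\<^esub>) = f i"
        proof (cases "i < n")
          case False
          thus ?thesis using zero_gmoduleD[OF z[of i], of "f i"] f i by (simp add: PiE_iff)
        qed simp
      qed
      also have "\<dots> = f" using f by (simp add: PiE_restrict)
      finally show "?e (restrict f {..<n}) = f" .
    qed
    show "?e ` carrier ?N \<subseteq> carrier D" using ec by blast
    show "(\<lambda>f. restrict f {..<n}) ` carrier D \<subseteq> carrier ?N"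
    proof (rule image_subsetI)
      fix f assume "f \<in> carrier D"
      thus "restrict f {..<n} \<in> carrier ?N" using nm by (simp add: PiE_iff)
    qed
  qed
  thus ?thesis using hom by (simp add: gmod_iso_def)
qed

context moment
begin

lemma pure_sheafD:
  assumes "pure_sheaf \<Gamma> F"
  shows "graph_sheaf \<Gamma> F" "x \<in> verts \<Gamma> \<Longrightarrow> free_gmodule d (vmod F x)"
    "x \<in> verts \<Gamma> \<Longrightarrow> bmap \<Gamma> F x ` carrier (vmod F x) = boundary_image \<Gamma> F x"
    "L \<in> edges \<Gamma> \<Longrightarrow> quotient_map d (dir \<Gamma> L) (vmod F (up L)) (emod F L) (res F (up L) L)"
proof -
  show "graph_sheaf \<Gamma> F" using assms by (simp add: pure_sheaf_def)
  note iff = pure_sheaf_iff[OF this]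
  show "x \<in> verts \<Gamma> \<Longrightarrow> free_gmodule d (vmod F x)"
    "x \<in> verts \<Gamma> \<Longrightarrow> bmap \<Gamma> F x ` carrier (vmod F x) = boundary_image \<Gamma> F x"
    "L \<in> edges \<Gamma> \<Longrightarrow> quotient_map d (dir \<Gamma> L) (vmod F (up L)) (emod F L) (res F (up L) L)"
    using assms unfolding iff by blast+
qed

lemma shift_graph_sheaf:
  assumes F: "graph_sheaf \<Gamma> F"
  shows "graph_sheaf \<Gamma> (shift_gsheaf k F)"
proof (rule graph_sheafI; unfold shift_gsheaf_simps)
  show "graded_module d (shift_gmodule k (vmod F x))" if "x \<in> verts \<Gamma>" for x
    using gmod.graded_shift(1) graph_sheafD(1)[OF F that] by (simp add: gmod_def)
  fix L assume L: "L \<in> edges \<Gamma>"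
  show "graded_module d (shift_gmodule k (emod F L))"
    using gmod.graded_shift(1) graph_sheafD(2)[OF F L] by (simp add: gmod_def)
  show "v \<odot>\<^bsub>shift_gmodule k (emod F L)\<^esub> m = \<zero>\<^bsub>shift_gmodule k (emod F L)\<^esub>"
    if "v \<in> dir \<Gamma> L" "m \<in> carrier (shift_gmodule k (emod F L))" for v m
    using F L that by (simp add: graph_sheaf_def)
qed (use graph_sheafD(3,4)[OF F] gmod_hom_shift in blast)+

lemma shift_pure:
  assumes "pure_sheaf \<Gamma> F"
  shows "pure_sheaf \<Gamma> (shift_gsheaf k F)"
proof -
  note F = pure_sheafD[OF assms]
  have "bmap \<Gamma> (shift_gsheaf k F) x = bmap \<Gamma> F x" for x
    by (simp add: bmap_def fun_eq_iff)
  moreover have "boundary_image \<Gamma> (shift_gsheaf k F) x = boundary_image \<Gamma> F x" for x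
    by (simp add: boundary_image_def sheaf_sections_def)
  ultimately show ?thesis
    unfolding pure_sheaf_iff[OF shift_graph_sheaf[OF F(1)]] shift_gsheaf_simps shift_gmodule_simps
    using F(3) free_shift[OF F(2)] quotient_map_shift[OF F(4)] by simp
qed

lemma dsum_graph_sheaf:
  assumes I: "finite I" and F: "\<And>i. i \<in> I \<Longrightarrow> graph_sheaf \<Gamma> (F i)"
  shows "graph_sheaf \<Gamma> (dsum_gsheaf I F)"
proof (rule graph_sheafI)
  show "graded_module d (vmod (dsum_gsheaf I F) x)" if "x \<in> verts \<Gamma>" for x
    using gfam.graded_dsum(1)[OF gfam_const[OF I, of d "\<lambda>i. vmod (F i) x"]] graph_sheafD(1)[OF F that] by simp
  fix L assume L: "L \<in> edges \<Gamma>"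
  show "graded_module d (emod (dsum_gsheaf I F) L)"
    using gfam.graded_dsum(1)[OF gfam_const[OF I, of d "\<lambda>i. emod (F i) L"]] graph_sheafD(2)[OF F L] by simp
  have r: "res (dsum_gsheaf I F) y L = (\<lambda>m. \<lambda>i\<in>I. res (F i) y L (m i))" for y
    by (simp add: fun_eq_iff)
  show "res (dsum_gsheaf I F) (up L) L \<in> gmod_hom d (vmod (dsum_gsheaf I F) (up L)) (emod (dsum_gsheaf I F) L)"
    "res (dsum_gsheaf I F) (lo L) L \<in> gmod_hom d (vmod (dsum_gsheaf I F) (lo L)) (emod (dsum_gsheaf I F) L)"
    unfolding r dsum_gsheaf_simps(1,2)
    by (rule gmod_hom_dsum, rule graph_sheafD(3)[OF F L], assumption)
      (rule gmod_hom_dsum, rule graph_sheafD(4)[OF F L], assumption)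
  show "v \<odot>\<^bsub>emod (dsum_gsheaf I F) L\<^esub> m = \<zero>\<^bsub>emod (dsum_gsheaf I F) L\<^esub>"
    if v: "v \<in> dir \<Gamma> L" and m: "m \<in> carrier (emod (dsum_gsheaf I F) L)" for v m
    unfolding dsum_gsheaf_simps dsum_gmodule_simps
    by (rule restrict_ext) (use F L v m in \<open>auto simp: graph_sheaf_def PiE_iff\<close>)
qed

lemma bmap_hom:
  assumes F: "graph_sheaf \<Gamma> F"
  shows "bmap \<Gamma> F x \<in> gmod_hom d (vmod F x) (dsum_gmodule (up_edges \<Gamma> x) (emod F))"
proof -
  have r: "res F x L \<in> gmod_hom d (vmod F x) (emod F L)" if "L \<in> up_edges \<Gamma> x" for L
    using graph_sheafD(4)[OF F, of L] that by (auto simp: up_edges_iff)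
  show ?thesis
  proof (rule gmod_homI)
    show "bmap \<Gamma> F x (m \<oplus>\<^bsub>vmod F x\<^esub> n) = bmap \<Gamma> F x m \<oplus>\<^bsub>dsum_gmodule (up_edges \<Gamma> x) (emod F)\<^esub> bmap \<Gamma> F x n"
      if "m \<in> carrier (vmod F x)" "n \<in> carrier (vmod F x)" for m n
      unfolding dsum_gmodule_simps bmap_def
      by (rule restrict_ext) (simp add: gmod_homD(2)[OF r that])
    show "bmap \<Gamma> F x (a \<odot>\<^bsub>vmod F x\<^esub> m) = a \<odot>\<^bsub>dsum_gmodule (up_edges \<Gamma> x) (emod F)\<^esub> bmap \<Gamma> F x m"
      if "a \<in> carrier (sym_alg d)" "m \<in> carrier (vmod F x)" for a m
      unfolding dsum_gmodule_simps bmap_def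
      by (rule restrict_ext) (simp add: gmod_homD(3)[OF r _ that(2)] that(1))
  qed (simp_all add: bmap_def gmod_homD(1)[OF r] gmod_homD(4)[OF r])
qed

text \<open>Gluing conditions and germs are computed summand by summand; the proof exchanges the
  vertex index with the summand index in both directions.\<close>

lemma dsum_boundary:
  assumes I: "finite I" and F: "\<And>i. i \<in> I \<Longrightarrow> pure_sheaf \<Gamma> (F i)" and x: "x \<in> verts \<Gamma>"
  shows "bmap \<Gamma> (dsum_gsheaf I F) x ` carrier (vmod (dsum_gsheaf I F) x) = boundary_image \<Gamma> (dsum_gsheaf I F) x"
proof -
  let ?S = "dsum_gsheaf I F"
  note Fg = pure_sheafD(1)[OF F]
  have S: "graph_sheaf \<Gamma> ?S" by (rule dsum_graph_sheaf[OF I Fg])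
  have im: "bmap \<Gamma> (F i) x ` carrier (vmod (F i) x) = germ (F i) x ` glued (F i) x" if "i \<in> I" for i
    using pure_sheafD(3)[OF F[OF that] x] boundary_image_eq[OF graph_sheaf_above_ok[OF Fg[OF that]], of x] by simp
  have glS: "(\<lambda>y\<in>verts_above \<Gamma> x. \<lambda>i\<in>I. s i y) \<in> glued ?S x" if s: "\<And>i. i \<in> I \<Longrightarrow> s i \<in> glued (F i) x" for s
    unfolding glued_def
  proof (intro CollectI conjI ballI)
    show "(\<lambda>y\<in>verts_above \<Gamma> x. \<lambda>i\<in>I. s i y) \<in> (\<Pi>\<^sub>E y\<in>verts_above \<Gamma> x. carrier (vmod ?S y))"
      using s by (auto simp: glued_def PiE_iff)
    fix L assume L: "L \<in> edges_above \<Gamma> x"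
    have eq: "res (F i) (lo L) L (s i (lo L)) = res (F i) (up L) L (s i (up L))" if "i \<in> I" for i
      using s[OF that] L by (simp add: glued_def)
    show "res ?S (lo L) L ((\<lambda>y\<in>verts_above \<Gamma> x. \<lambda>i\<in>I. s i y) (lo L)) =
      res ?S (up L) L ((\<lambda>y\<in>verts_above \<Gamma> x. \<lambda>i\<in>I. s i y) (up L))"
      unfolding dsum_gsheaf_simps by (rule restrict_ext) (use L eq in \<open>simp add: edges_above_iff\<close>)
  qed
  have match: "bmap \<Gamma> ?S x m = germ ?S x t"
    if "\<And>i L. i \<in> I \<Longrightarrow> L \<in> up_edges \<Gamma> x \<Longrightarrow> res (F i) x L (m i) = res (F i) (up L) L (t (up L) i)" for m t
    unfolding bmap_def germ_def dsum_gsheaf_simps by (intro restrict_ext) (rule that)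
  have upa: "up L \<in> verts_above \<Gamma> x" if "L \<in> up_edges \<Gamma> x" for L
    using that up_above_lo[of L] by (auto simp: up_edges_iff)
  show ?thesis unfolding boundary_image_eq[OF graph_sheaf_above_ok[OF S]]
  proof (intro subset_antisym subsetI)
    fix u assume "u \<in> bmap \<Gamma> ?S x ` carrier (vmod ?S x)"
    then obtain m where m: "m \<in> carrier (vmod ?S x)" "u = bmap \<Gamma> ?S x m" by blast
    have "\<forall>i\<in>I. \<exists>s. s \<in> glued (F i) x \<and> bmap \<Gamma> (F i) x (m i) = germ (F i) x s"
    proof
      fix i assume i: "i \<in> I"
      have "m i \<in> carrier (vmod (F i) x)" using m(1) i by (simp add: PiE_iff)
      hence "bmap \<Gamma> (F i) x (m i) \<in> germ (F i) x ` glued (F i) x" using im[OF i] by blast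
      thus "\<exists>s. s \<in> glued (F i) x \<and> bmap \<Gamma> (F i) x (m i) = germ (F i) x s" by blast
    qed
    from bchoice[OF this] obtain s where s: "\<forall>i\<in>I. s i \<in> glued (F i) x \<and> bmap \<Gamma> (F i) x (m i) = germ (F i) x (s i)" ..
    have "bmap \<Gamma> ?S x m = germ ?S x (\<lambda>y\<in>verts_above \<Gamma> x. \<lambda>i\<in>I. s i y)"
    proof (rule match)
      fix i L assume i: "i \<in> I" and L: "L \<in> up_edges \<Gamma> x"
      have "bmap \<Gamma> (F i) x (m i) L = germ (F i) x (s i) L" using s i by simp
      thus "res (F i) x L (m i) = res (F i) (up L) L ((\<lambda>y\<in>verts_above \<Gamma> x. \<lambda>i\<in>I. s i y) (up L) i)"
        using L upa[OF L] i by (simp add: bmap_def germ_def)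
    qed
    moreover have "(\<lambda>y\<in>verts_above \<Gamma> x. \<lambda>i\<in>I. s i y) \<in> glued ?S x" by (rule glS) (use s in blast)
    ultimately show "u \<in> germ ?S x ` glued ?S x" unfolding m(2) by simp
  next
    fix u assume "u \<in> germ ?S x ` glued ?S x"
    then obtain t where t: "t \<in> glued ?S x" "u = germ ?S x t" by blast
    have "\<forall>i\<in>I. \<exists>m. m \<in> carrier (vmod (F i) x) \<and> bmap \<Gamma> (F i) x m = germ (F i) x (\<lambda>y\<in>verts_above \<Gamma> x. t y i)"
    proof
      fix i assume i: "i \<in> I"
      have "(\<lambda>y\<in>verts_above \<Gamma> x. t y i) \<in> glued (F i) x" unfolding glued_def
      proof (intro CollectI conjI ballI)
        show "(\<lambda>y\<in>verts_above \<Gamma> x. t y i) \<in> (\<Pi>\<^sub>E y\<in>verts_above \<Gamma> x. carrier (vmod (F i) y))"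
          using t(1) i by (auto simp: glued_def PiE_iff)
        fix L assume L: "L \<in> edges_above \<Gamma> x"
        have "res ?S (lo L) L (t (lo L)) i = res ?S (up L) L (t (up L)) i"
          using t(1) L unfolding glued_def by simp
        thus "res (F i) (lo L) L ((\<lambda>y\<in>verts_above \<Gamma> x. t y i) (lo L)) =
          res (F i) (up L) L ((\<lambda>y\<in>verts_above \<Gamma> x. t y i) (up L))"
          using L i by (simp add: edges_above_iff)
      qed
      hence "germ (F i) x (\<lambda>y\<in>verts_above \<Gamma> x. t y i) \<in> bmap \<Gamma> (F i) x ` carrier (vmod (F i) x)"
        using im[OF i] by blast
      then obtain m where "germ (F i) x (\<lambda>y\<in>verts_above \<Gamma> x. t y i) = bmap \<Gamma> (F i) x m" "m \<in> carrier (vmod (F i) x)"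
        by (rule imageE)
      thus "\<exists>m. m \<in> carrier (vmod (F i) x) \<and> bmap \<Gamma> (F i) x m = germ (F i) x (\<lambda>y\<in>verts_above \<Gamma> x. t y i)"
        by (intro exI[of _ m]) simp
    qed
    from bchoice[OF this] obtain m where m: "\<forall>i\<in>I. m i \<in> carrier (vmod (F i) x) \<and>
      bmap \<Gamma> (F i) x (m i) = germ (F i) x (\<lambda>y\<in>verts_above \<Gamma> x. t y i)" ..
    have "bmap \<Gamma> ?S x (restrict m I) = germ ?S x t"
    proof (rule match)
      fix i L assume i: "i \<in> I" and L: "L \<in> up_edges \<Gamma> x"
      have "bmap \<Gamma> (F i) x (m i) L = germ (F i) x (\<lambda>y\<in>verts_above \<Gamma> x. t y i) L" using m i by simp
      thus "res (F i) x L (restrict m I i) = res (F i) (up L) L (t (up L) i)"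
        using L upa[OF L] i by (simp add: bmap_def germ_def)
    qed
    moreover have "restrict m I \<in> carrier (vmod ?S x)" using m by simp
    ultimately show "u \<in> bmap \<Gamma> ?S x ` carrier (vmod ?S x)" unfolding t(2) by (metis imageI)
  qed
qed

lemma dsum_quotient:
  assumes I: "finite I" and F: "\<And>i. i \<in> I \<Longrightarrow> pure_sheaf \<Gamma> (F i)" and L: "L \<in> edges \<Gamma>"
  shows "quotient_map d (dir \<Gamma> L) (vmod (dsum_gsheaf I F) (up L)) (emod (dsum_gsheaf I F) L)
    (res (dsum_gsheaf I F) (up L) L)"
proof -
  have r: "res (dsum_gsheaf I F) (up L) L = (\<lambda>m. \<lambda>i\<in>I. res (F i) (up L) L (m i))"
    by (simp add: fun_eq_iff)
  show ?thesis unfolding r dsum_gsheaf_simps(1,2)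
  proof (rule quotient_map_dsum[OF I])
    show "graded_module d (vmod (F i) (up L))" if "i \<in> I" for i
      using graph_sheafD(1)[OF pure_sheafD(1)[OF F[OF that]] e_ends(1)[OF L]] .
    show "dir \<Gamma> L \<subseteq> carrier (sym_alg d)" using dir_sub[OF L] tdual_carrier by blast
  qed (rule pure_sheafD(4)[OF F L])
qed

text \<open>Isomorphism of the restrictions of two sheaves to an upper set of vertices and the edges below them.\<close>

definition piso :: "'v set \<Rightarrow> ('v, 'e, 'm, 'l) gsheaf \<Rightarrow> ('v, 'e, 'm2, 'l2) gsheaf \<Rightarrow>
    ('v \<Rightarrow> 'm \<Rightarrow> 'm2) \<Rightarrow> ('e \<Rightarrow> 'l \<Rightarrow> 'l2) \<Rightarrow> bool" where
  "piso I N S f g \<longleftrightarrow> (\<forall>x\<in>I. f x \<in> gmod_iso d (vmod N x) (vmod S x)) \<and>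
     (\<forall>L\<in>edges \<Gamma>. up L \<in> I \<longrightarrow> g L \<in> gmod_iso d (emod N L) (emod S L) \<and>
        (\<forall>m\<in>carrier (vmod N (up L)). g L (res N (up L) L m) = res S (up L) L (f (up L) m)) \<and>
        (lo L \<in> I \<longrightarrow> (\<forall>m\<in>carrier (vmod N (lo L)). g L (res N (lo L) L m) = res S (lo L) L (f (lo L) m))))"

lemma pisoD:
  assumes "piso I N S f g"
  shows "x \<in> I \<Longrightarrow> f x \<in> gmod_iso d (vmod N x) (vmod S x)"
    "L \<in> edges \<Gamma> \<Longrightarrow> up L \<in> I \<Longrightarrow> g L \<in> gmod_iso d (emod N L) (emod S L)"
    "L \<in> edges \<Gamma> \<Longrightarrow> up L \<in> I \<Longrightarrow> m \<in> carrier (vmod N (up L)) \<Longrightarrow>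
       g L (res N (up L) L m) = res S (up L) L (f (up L) m)"
    "L \<in> edges \<Gamma> \<Longrightarrow> up L \<in> I \<Longrightarrow> lo L \<in> I \<Longrightarrow> m \<in> carrier (vmod N (lo L)) \<Longrightarrow>
       g L (res N (lo L) L m) = res S (lo L) L (f (lo L) m)"
  using assms by (auto simp: piso_def)

text \<open>Compatible families above \<open>x\<close> are transported by the vertex isomorphisms;
  the second part transports them back through chosen preimages.\<close>

lemma piso_boundary:
  assumes p: "piso I N S f g" and I: "verts_above \<Gamma> x \<subseteq> I" and N: "graph_sheaf \<Gamma> N" and S: "graph_sheaf \<Gamma> S"
  shows "u \<in> boundary_image \<Gamma> N x \<Longrightarrow> (\<lambda>L\<in>up_edges \<Gamma> x. g L (u L)) \<in> boundary_image \<Gamma> S x"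
    "w \<in> boundary_image \<Gamma> S x \<Longrightarrow> \<exists>u\<in>boundary_image \<Gamma> N x. w = (\<lambda>L\<in>up_edges \<Gamma> x. g L (u L))"
proof -
  note bN = boundary_image_eq[OF graph_sheaf_above_ok[OF N], of x]
    and bS = boundary_image_eq[OF graph_sheaf_above_ok[OF S], of x]
  have upa: "up L \<in> verts_above \<Gamma> x" "L \<in> edges \<Gamma>" "up L \<in> I" if "L \<in> up_edges \<Gamma> x" for L
    using that up_above_lo[of L] I by (auto simp: up_edges_iff)
  have ea: "up L \<in> verts_above \<Gamma> x" "lo L \<in> verts_above \<Gamma> x" "L \<in> edges \<Gamma>" "up L \<in> I" "lo L \<in> I"
    if "L \<in> edges_above \<Gamma> x" for L using that I by (auto simp: edges_above_iff)
  have germ_eq: "(\<lambda>L\<in>up_edges \<Gamma> x. g L (germ N x s L)) = germ S x (\<lambda>y\<in>verts_above \<Gamma> x. f y (s y))"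
    if sc: "\<And>y. y \<in> verts_above \<Gamma> x \<Longrightarrow> s y \<in> carrier (vmod N y)" for s
    unfolding germ_def
    by (rule restrict_ext) (use upa sc pisoD(3)[OF p] in simp)
  {
    assume "u \<in> boundary_image \<Gamma> N x"
    then obtain s where s: "s \<in> glued N x" "u = germ N x s" unfolding bN by blast
    have sc: "s y \<in> carrier (vmod N y)" if "y \<in> verts_above \<Gamma> x" for y
      using s(1) that by (auto simp: glued_def)
    have "(\<lambda>y\<in>verts_above \<Gamma> x. f y (s y)) \<in> glued S x" unfolding glued_def
    proof (intro CollectI conjI ballI)
      show "(\<lambda>y\<in>verts_above \<Gamma> x. f y (s y)) \<in> (\<Pi>\<^sub>E y\<in>verts_above \<Gamma> x. carrier (vmod S y))"
        using gmod_homD(1)[OF gmod_isoD(1)[OF pisoD(1)[OF p]]] sc I by (simp add: subset_iff)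
      fix L assume L: "L \<in> edges_above \<Gamma> x"
      note e = ea[OF L]
      have "res N (lo L) L (s (lo L)) = res N (up L) L (s (up L))" using s(1) L by (simp add: glued_def)
      thus "res S (lo L) L ((\<lambda>y\<in>verts_above \<Gamma> x. f y (s y)) (lo L)) =
        res S (up L) L ((\<lambda>y\<in>verts_above \<Gamma> x. f y (s y)) (up L))"
        using pisoD(3)[OF p e(3,4) sc[OF e(1)]] pisoD(4)[OF p e(3,4,5) sc[OF e(2)]] e(1,2) by simp
    qed
    moreover have "(\<lambda>L\<in>up_edges \<Gamma> x. g L (u L)) = germ S x (\<lambda>y\<in>verts_above \<Gamma> x. f y (s y))"
      unfolding s(2) by (rule germ_eq) (rule sc)
    ultimately show "(\<lambda>L\<in>up_edges \<Gamma> x. g L (u L)) \<in> boundary_image \<Gamma> S x"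
      unfolding bS by - (rule image_eqI)
  next
    assume "w \<in> boundary_image \<Gamma> S x"
    then obtain t where t: "t \<in> glued S x" "w = germ S x t" unfolding bS by blast
    have tc: "t y \<in> carrier (vmod S y)" if "y \<in> verts_above \<Gamma> x" for y
      using t(1) that by (auto simp: glued_def)
    have "\<forall>y\<in>verts_above \<Gamma> x. \<exists>a. a \<in> carrier (vmod N y) \<and> f y a = t y"
    proof
      fix y assume y: "y \<in> verts_above \<Gamma> x"
      show "\<exists>a. a \<in> carrier (vmod N y) \<and> f y a = t y"
        using gmod_iso_surjD[OF pisoD(1)[OF p subsetD[OF I y]] tc[OF y]] by blast
    qed
    from bchoice[OF this] obtain s where s: "\<forall>y\<in>verts_above \<Gamma> x. s y \<in> carrier (vmod N y) \<and> f y (s y) = t y" ..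
    let ?s = "restrict s (verts_above \<Gamma> x)"
    have sc: "?s y \<in> carrier (vmod N y)" "f y (?s y) = t y" if "y \<in> verts_above \<Gamma> x" for y
      using s that by simp_all
    have ft: "(\<lambda>y\<in>verts_above \<Gamma> x. f y (?s y)) = t"
    proof -
      have "(\<lambda>y\<in>verts_above \<Gamma> x. f y (?s y)) = restrict t (verts_above \<Gamma> x)"
        by (rule restrict_ext) (rule sc(2))
      also have "\<dots> = t"
        by (rule PiE_restrict[of t _ "\<lambda>y. carrier (vmod S y)"]) (use t(1) in \<open>simp add: glued_def\<close>)
      finally show ?thesis .
    qed
    have "?s \<in> glued N x" unfolding glued_def
    proof (intro CollectI conjI ballI)
      show "?s \<in> (\<Pi>\<^sub>E y\<in>verts_above \<Gamma> x. carrier (vmod N y))" using s by simp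
      fix L assume L: "L \<in> edges_above \<Gamma> x"
      note e = ea[OF L]
      have "res S (lo L) L (t (lo L)) = res S (up L) L (t (up L))" using t(1) L by (simp add: glued_def)
      \<comment> \<open>The gluing condition holds after \<open>g L\<close>; injectivity of
        \<open>g L\<close> then carries it back from \<open>S\<close> to \<open>N\<close>.\<close>
      hence "g L (res N (lo L) L (?s (lo L))) = g L (res N (up L) L (?s (up L)))"
        using pisoD(3)[OF p e(3,4) sc(1)[OF e(1)]] pisoD(4)[OF p e(3,4,5) sc(1)[OF e(2)]]
          sc(2)[OF e(1)] sc(2)[OF e(2)] by simp
      thus "res N (lo L) L (?s (lo L)) = res N (up L) L (?s (up L))"
        by (rule inj_onD[OF bij_betw_imp_inj_on[OF gmod_isoD(2)[OF pisoD(2)[OF p e(3,4)]]]])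
          (use gmod_homD(1)[OF graph_sheafD(4)[OF N e(3)] sc(1)[OF e(2)]]
            gmod_homD(1)[OF graph_sheafD(3)[OF N e(3)] sc(1)[OF e(1)]] in auto)
    qed
    moreover have "(\<lambda>L\<in>up_edges \<Gamma> x. g L (germ N x ?s L)) = germ S x (\<lambda>y\<in>verts_above \<Gamma> x. f y (?s y))"
      by (rule germ_eq) (rule sc(1))
    hence "w = (\<lambda>L\<in>up_edges \<Gamma> x. g L (germ N x ?s L))" unfolding ft t(2) by (rule sym)
    ultimately show "\<exists>u\<in>boundary_image \<Gamma> N x. w = (\<lambda>L\<in>up_edges \<Gamma> x. g L (u L))"
      unfolding bN by blast
  }
qed

end

section \<open>Decomposition of pure sheaves\<close>

context moment
begin

text \<open>The isomorphism at \<open>x\<close> is the inverse of a map \<open>\<Phi>\<close> from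
  the enlarged sum to the stalk of \<open>N\<close>: on the old summands it lifts their boundary
  maps through that of \<open>N\<close>, and on each new summand it hits one minimal generator of
  the kernel. It is onto by Nakayama, its kernel lies in the maximal ideal times the source, and
  freeness of the stalk of \<open>N\<close> then makes it bijective.\<close>

lemma structure_step:
  fixes F :: "nat \<Rightarrow> ('v, 'e, 'm, 'l) gsheaf" and N :: "('v, 'e, 'n, 'k) gsheaf" and Kx :: "('v, 'e, 'm, 'l) gsheaf"
  assumes IV: "I \<subseteq> verts \<Gamma>" and I: "\<And>y. y \<in> I \<Longrightarrow> verts_above \<Gamma> y \<subseteq> I"
    and x: "x \<in> verts \<Gamma>" "x \<notin> I" "verts_above \<Gamma> x \<subseteq> I"
    and N: "pure_sheaf \<Gamma> N" and K: "min_pure x Kx"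
    and F: "\<And>i. i < n \<Longrightarrow> pure_sheaf \<Gamma> (F i)"
    and Fker: "\<And>i m. i < n \<Longrightarrow> m \<in> carrier (vmod (F i) x) \<Longrightarrow>
       \<forall>L\<in>up_edges \<Gamma> x. res (F i) x L m = \<zero>\<^bsub>emod (F i) L\<^esub> \<Longrightarrow> m \<in> mod_span (tdual d) (vmod (F i) x)"
    and p: "piso I N (dsum_gsheaf {..<n} F) f g"
  shows "\<exists>m ks f' g'. n \<le> m \<and>
    piso (insert x I) N (dsum_gsheaf {..<m} (\<lambda>i. if i < n then F i else shift_gsheaf (ks i) Kx)) f' g'"
proof -
  let ?A = "sym_alg d"
  have W: "tdual d \<subseteq> carrier ?A" using tdual_carrier by blast
  have Kp: "pure_sheaf \<Gamma> Kx" by (rule min_pure_pure[OF K])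
  obtain \<phi> where \<phi>: "\<phi> \<in> gmod_iso d (vmod Kx x) ?A" using K by (auto simp: min_pure_def)
  have Kgr: "graded_module d (vmod Kx x)" by (rule graph_sheafD(1)[OF pure_sheafD(1)[OF Kp] x(1)])
  note Ng = pure_sheafD(1)[OF N]
  have Nx: "graded_module d (vmod N x)" by (rule graph_sheafD(1)[OF Ng x(1)])
  interpret Nx: gmod d "vmod N x" using Nx by (simp add: gmod_def)
  have upa: "up L \<in> verts_above \<Gamma> x" "L \<in> edges \<Gamma>" "up L \<in> I" "lo L = x" if "L \<in> up_edges \<Gamma> x" for L
    using that up_above_lo[of L] x(3) by (auto simp: up_edges_iff)
  \<comment> \<open>A vertex of the upper set \<open>I\<close> lying below \<open>x\<close> would
    force \<open>x\<close> into \<open>I\<close>. Hence the new summands vanish on \<open>I\<close>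
    and cannot disturb the isomorphism given there.\<close>
  have notle: "\<not> vle \<Gamma> y x" if "y \<in> I" for y
    using I[OF that] x that IV by (auto simp: verts_above_iff)
  have Kz: "zero_gmodule (vmod Kx y)" if "y \<in> I" for y
    using K notle[OF that] that IV by (auto simp: min_pure_def)
  have Kze: "zero_gmodule (emod Kx L)" if "L \<in> edges \<Gamma>" "up L \<in> I" for L
    by (rule quotient_zero[OF pure_sheafD(4)[OF Kp that(1)] Kz[OF that(2)]])
      (use graph_sheafD(1,2)[OF pure_sheafD(1)[OF Kp]] e_ends(1) that(1) in auto)

  \<comment> \<open>Comparison of the boundaries of \<open>N\<close> and of the old sum at
    \<open>x\<close>\<close>
  define S where "S = dsum_gsheaf {..<n} F"
  have Sg: "graph_sheaf \<Gamma> S" unfolding S_def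
    by (rule dsum_graph_sheaf) (use pure_sheafD(1)[OF F] in auto)
  have SB: "bmap \<Gamma> S x ` carrier (vmod S x) = boundary_image \<Gamma> S x"
    unfolding S_def by (rule dsum_boundary[OF _ _ x(1)]) (use F in auto)
  note p = p[folded S_def]
  let ?ES = "dsum_gmodule (up_edges \<Gamma> x) (emod S)"
  have ESg: "graded_module d ?ES" by (rule boundary_gsub(2)[OF graph_sheaf_above_ok[OF Sg] x(1)])
  \<comment> \<open>The boundary map of \<open>N\<close> at \<open>x\<close>, read in the edge
    modules of \<open>S\<close>. Purity of both sheaves and \<open>piso_boundary\<close> make its
    image the same as that of \<open>bmap \<Gamma> S x\<close>.\<close>
  define h where "h m = (\<lambda>L\<in>up_edges \<Gamma> x. g L (bmap \<Gamma> N x m L))" for m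
  have h: "h \<in> gmod_hom d (vmod N x) ?ES"
    unfolding h_def[abs_def]
    by (rule gmod_hom_comp[OF bmap_hom[OF Ng] gmod_hom_dsum]) (rule gmod_isoD(1)[OF pisoD(2)[OF p upa(2,3)]])
  have hL: "h m L = g L (res N x L m)" if "L \<in> up_edges \<Gamma> x" for m L
    using that by (simp add: h_def bmap_def)
  interpret h: ghom d "vmod N x" ?ES h by (rule ghomI[OF Nx ESg h])
  have hS: "h m \<in> boundary_image \<Gamma> S x" if m: "m \<in> carrier (vmod N x)" for m
  proof -
    have "bmap \<Gamma> N x m \<in> boundary_image \<Gamma> N x" using pure_sheafD(3)[OF N x(1)] m by blast
    thus ?thesis unfolding h_def by (rule piso_boundary(1)[OF p x(3) Ng Sg])
  qed
  have Sh: "\<exists>m\<in>carrier (vmod N x). h m = w" if w: "w \<in> boundary_image \<Gamma> S x" for w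
  proof -
    obtain u where u: "u \<in> boundary_image \<Gamma> N x" "w = (\<lambda>L\<in>up_edges \<Gamma> x. g L (u L))"
      using piso_boundary(2)[OF p x(3) Ng Sg w] by blast
    obtain m where "m \<in> carrier (vmod N x)" "u = bmap \<Gamma> N x m"
      using u(1) pure_sheafD(3)[OF N x(1)] by blast
    thus ?thesis using u(2) by (intro bexI[of _ m]) (simp add: h_def)
  qed

  \<comment> \<open>Lifting the old summands into the stalk of \<open>N\<close>\<close>
  interpret V: gfam d "{..<n}" "\<lambda>i. vmod (F i) x"
    by (rule gfam_const) (use graph_sheafD(1)[OF pure_sheafD(1)[OF F] x(1)] in auto)
  have VS: "vmod S x = V.D" by (simp add: S_def)
  have bS: "bmap \<Gamma> S x \<in> gmod_hom d V.D ?ES" using bmap_hom[OF Sg, of x] by (simp only: VS)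
  interpret bS: ghom d V.D ?ES "bmap \<Gamma> S x" by (rule ghomI[OF V.graded_dsum(1) ESg bS])

  have "\<forall>i\<in>{..<n}. \<exists>s. s \<in> gmod_hom d (vmod (F i) x) (vmod N x) \<and>
     (\<forall>m\<in>carrier (vmod (F i) x). h (s m) = bmap \<Gamma> S x (dinj {..<n} (\<lambda>i. vmod (F i) x) i m))"
  proof
    fix i assume i: "i \<in> {..<n}"
    have c: "dinj {..<n} (\<lambda>i. vmod (F i) x) i m \<in> carrier V.D" if "m \<in> carrier (vmod (F i) x)" for m
      by (rule gmod_homD(1)[OF V.dinj_hom[OF i] that])
    have "\<exists>s\<in>gmod_hom d (vmod (F i) x) (vmod N x).
      \<forall>m\<in>carrier (vmod (F i) x). h (s m) = bmap \<Gamma> S x (dinj {..<n} (\<lambda>i. vmod (F i) x) i m)"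
    proof (rule free_lift[OF _ Nx ESg h gmod_hom_comp[OF V.dinj_hom[OF i] bS]])
      show "free_gmodule d (vmod (F i) x)" using pure_sheafD(2)[OF F x(1)] i by simp
      fix m assume "m \<in> carrier (vmod (F i) x)"
      hence "bmap \<Gamma> S x (dinj {..<n} (\<lambda>i. vmod (F i) x) i m) \<in> boundary_image \<Gamma> S x"
        using c VS by (metis SB imageI)
      thus "\<exists>k\<in>carrier (vmod N x). h k = bmap \<Gamma> S x (dinj {..<n} (\<lambda>i. vmod (F i) x) i m)" by (rule Sh)
    qed
    thus "\<exists>s. s \<in> gmod_hom d (vmod (F i) x) (vmod N x) \<and>
     (\<forall>m\<in>carrier (vmod (F i) x). h (s m) = bmap \<Gamma> S x (dinj {..<n} (\<lambda>i. vmod (F i) x) i m))"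
      by (simp only: Bex_def)
  qed
  from bchoice[OF this] obtain s where s: "\<forall>i\<in>{..<n}. s i \<in> gmod_hom d (vmod (F i) x) (vmod N x) \<and>
     (\<forall>m\<in>carrier (vmod (F i) x). h (s i m) = bmap \<Gamma> S x (dinj {..<n} (\<lambda>i. vmod (F i) x) i m))" ..
  have sh: "s i \<in> gmod_hom d (vmod (F i) x) (vmod N x)" if "i < n" for i using s that by simp

  \<comment> \<open>New summands from minimal generators of the kernel of \<open>h\<close>\<close>
  obtain T where T: "finite T" "T \<subseteq> {m \<in> carrier (vmod N x). h m = \<zero>\<^bsub>?ES\<^esub>}" "\<forall>t\<in>T. \<exists>k. t \<in> hcomp (vmod N x) k"
    and cover: "\<forall>m\<in>{m \<in> carrier (vmod N x). h m = \<zero>\<^bsub>?ES\<^esub>}. \<exists>s\<in>mgen d (vmod N x) T.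
      \<exists>w\<in>mod_span (tdual d) (vmod N x). m = s \<oplus>\<^bsub>vmod N x\<^esub> w"
    and rel: "\<forall>c\<in>T \<rightarrow> carrier ?A. (\<Oplus>\<^bsub>vmod N x\<^esub>t\<in>T. c t \<odot>\<^bsub>vmod N x\<^esub> t) \<in> mod_span (tdual d) (vmod N x) \<longrightarrow>
       (\<forall>t\<in>T. Poly_Mapping.lookup (c t) 0 = 0)"
    using Nx.minimal_cover[OF h.kernel] by (elim exE conjE)
  \<comment> \<open>One new index per generator: \<open>{..<n}\<close> numbers the old summands and
    \<open>{n..<m}\<close> the elements of \<open>T\<close>.\<close>
  define m where "m = n + card T"
  let ?J = "{n..<m}"
  have "card ?J = card T" by (simp add: m_def)
  then obtain e where e: "bij_betw e ?J T"
    using finite_same_card_bij[of ?J T] T(1) by auto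
  have eT: "e i \<in> T" if "i \<in> ?J" for i using e that by (auto simp: bij_betw_def)
  obtain k where k: "\<forall>t\<in>T. t \<in> hcomp (vmod N x) (k t)" using bchoice[OF T(3)] ..
  have Tc: "t \<in> carrier (vmod N x)" if "t \<in> T" for t using T(2) that by blast
  \<comment> \<open>The shift by \<open>- k\<close> puts the generator of the stalk of
    \<open>Kx\<close> at \<open>x\<close> into the degree of the element of \<open>T\<close> that it
    is sent to.\<close>
  define F' where "F' = (\<lambda>i. if i < n then F i else shift_gsheaf (- k (e i)) Kx)"
  have F': "pure_sheaf \<Gamma> (F' i)" if "i < m" for i
    using F shift_pure[OF Kp] by (simp add: F'_def)
  note F'g = pure_sheafD(1)[OF F']
  define S' where "S' = dsum_gsheaf {..<m} F'"
  have nm: "n \<le> m" by (simp add: m_def)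
  have SF': "S = dsum_gsheaf {..<n} F'"
    unfolding S_def by (rule dsum_gsheaf_cong) (simp add: F'_def)
  have S'g: "graph_sheaf \<Gamma> S'" unfolding S'_def by (rule dsum_graph_sheaf) (use F'g in auto)

  interpret V': gfam d "{..<m}" "\<lambda>i. vmod (F' i) x"
    by (rule gfam_const) (use graph_sheafD(1)[OF F'g x(1)] in auto)
  have VS': "vmod S' x = V'.D" by (simp add: S'_def)
  \<comment> \<open>\<open>\<phi>\<close> identifies the stalk of \<open>Kx\<close> at
    \<open>x\<close> with the ring, so on a new summand its value serves as the coefficient of the
    generator \<open>e i\<close>.\<close>
  define \<sigma> where "\<sigma> i = (if i < n then s i else (\<lambda>a. \<phi> a \<odot>\<^bsub>vmod N x\<^esub> e i))" for i
  have \<sigma>: "\<sigma> i \<in> gmod_hom d (vmod (F' i) x) (vmod N x)" if i: "i \<in> {..<m}" for i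
  proof (cases "i < n")
    case True
    thus ?thesis using sh by (simp add: \<sigma>_def F'_def)
  next
    case False
    hence iJ: "i \<in> ?J" using i by simp
    have "(\<lambda>a. \<phi> a \<odot>\<^bsub>vmod N x\<^esub> e i) \<in> gmod_hom d (shift_gmodule (- k (e i)) (vmod Kx x)) (vmod N x)"
      by (rule gmod_hom_comp[OF gmod_hom_shift[OF gmod_isoD(1)[OF \<phi>]] Nx.smult_hom])
        (use k eT[OF iJ] in blast)
    thus ?thesis using False by (simp add: \<sigma>_def F'_def)
  qed
  define \<Phi> where "\<Phi> q = (\<Oplus>\<^bsub>vmod N x\<^esub>i\<in>{..<m}. \<sigma> i (q i))" for q
  have \<Phi>: "\<Phi> \<in> gmod_hom d V'.D (vmod N x)" unfolding \<Phi>_def[abs_def] by (rule V'.sum_hom[OF Nx \<sigma>])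
  interpret \<Phi>: ghom d V'.D "vmod N x" \<Phi> by (rule ghomI[OF V'.graded_dsum(1) Nx \<Phi>])
  have qm: "q i \<in> carrier (vmod (F' i) x)" if "q \<in> carrier V'.D" "i < m" for q i
    using that by (simp add: PiE_iff)
  have qF: "q i \<in> carrier (vmod (F i) x)" if "q \<in> carrier V'.D" "i < n" for q i
    using qm[OF that(1), of i] that(2) nm by (simp add: F'_def)
  have qK: "q i \<in> carrier (vmod Kx x)" if "q \<in> carrier V'.D" "i \<in> ?J" for q i
    using qm[OF that(1), of i] that(2) by (simp add: F'_def)
  have \<sigma>c: "\<sigma> i (q i) \<in> carrier (vmod N x)" if "q \<in> carrier V'.D" "i \<in> {..<m}" for q i
    using gmod_homD(1)[OF \<sigma>[OF that(2)] qm[OF that(1)]] that(2) by simp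
  define \<Phi>1 where "\<Phi>1 q = (\<Oplus>\<^bsub>vmod N x\<^esub>i\<in>{..<n}. s i (q i))" for q
  define \<Phi>2 where "\<Phi>2 q = (\<Oplus>\<^bsub>vmod N x\<^esub>i\<in>?J. \<phi> (q i) \<odot>\<^bsub>vmod N x\<^esub> e i)" for q
  have \<Phi>1c: "\<Phi>1 q \<in> carrier (vmod N x)" if "q \<in> carrier V'.D" for q
    unfolding \<Phi>1_def
  proof (rule Nx.M.finsum_closed, rule funcsetI)
    fix i assume "i \<in> {..<n}"
    thus "s i (q i) \<in> carrier (vmod N x)" using gmod_homD(1)[OF sh qF[OF that]] by simp
  qed
  have \<phi>c: "\<phi> (q i) \<in> carrier ?A" if "q \<in> carrier V'.D" "i \<in> ?J" for q i
    by (rule gmod_homD(1)[OF gmod_isoD(1)[OF \<phi>] qK[OF that]])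
  have ec: "e i \<in> carrier (vmod N x)" if "i \<in> ?J" for i using Tc eT[OF that] by blast
  have \<Phi>2c: "\<Phi>2 q \<in> carrier (vmod N x)" if "q \<in> carrier V'.D" for q
    unfolding \<Phi>2_def
    by (rule Nx.M.finsum_closed, rule funcsetI) (rule Nx.smult_closed[OF \<phi>c[OF that] ec])
  have split: "\<Phi> q = \<Phi>1 q \<oplus>\<^bsub>vmod N x\<^esub> \<Phi>2 q" if q: "q \<in> carrier V'.D" for q
  proof -
    have "{..<m} = {..<n} \<union> ?J" using nm by auto
    hence "\<Phi> q = (\<Oplus>\<^bsub>vmod N x\<^esub>i\<in>{..<n} \<union> ?J. \<sigma> i (q i))" by (simp add: \<Phi>_def)
    also have "\<dots> = (\<Oplus>\<^bsub>vmod N x\<^esub>i\<in>{..<n}. \<sigma> i (q i)) \<oplus>\<^bsub>vmod N x\<^esub> (\<Oplus>\<^bsub>vmod N x\<^esub>i\<in>?J. \<sigma> i (q i))"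
      by (rule Nx.M.finsum_Un_disjoint) (use \<sigma>c[OF q] nm in auto)
    also have "(\<Oplus>\<^bsub>vmod N x\<^esub>i\<in>{..<n}. \<sigma> i (q i)) = \<Phi>1 q"
      unfolding \<Phi>1_def
    proof (rule Nx.M.finsum_cong')
      show "(\<lambda>i. s i (q i)) \<in> {..<n} \<rightarrow> carrier (vmod N x)"
        by (rule funcsetI) (use gmod_homD(1)[OF sh qF[OF q]] in simp)
    qed (auto simp: \<sigma>_def)
    also have "(\<Oplus>\<^bsub>vmod N x\<^esub>i\<in>?J. \<sigma> i (q i)) = \<Phi>2 q"
      unfolding \<Phi>2_def
    proof (rule Nx.M.finsum_cong')
      show "(\<lambda>i. \<phi> (q i) \<odot>\<^bsub>vmod N x\<^esub> e i) \<in> ?J \<rightarrow> carrier (vmod N x)"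
        by (rule funcsetI) (rule Nx.smult_closed[OF \<phi>c[OF q] ec])
    qed (auto simp: \<sigma>_def)
    finally show ?thesis .
  qed
  have h1: "h (\<Phi>1 q) = bmap \<Gamma> S x (restrict q {..<n})" if q: "q \<in> carrier V'.D" for q
  proof -
    let ?r = "restrict q {..<n}"
    have r: "?r \<in> carrier V.D" using qF[OF q] by simp
    have dc: "dinj {..<n} (\<lambda>i. vmod (F i) x) i (?r i) \<in> carrier V.D" if "i \<in> {..<n}" for i
      by (rule gmod_homD(1)[OF V.dinj_hom[OF that]]) (use qF[OF q] that in simp)
    have "h (\<Phi>1 q) = (\<Oplus>\<^bsub>?ES\<^esub>i\<in>{..<n}. h (s i (q i)))"
      unfolding \<Phi>1_def by (rule h.finsum, rule funcsetI) (use gmod_homD(1)[OF sh qF[OF q]] in simp)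
    also have "\<dots> = (\<Oplus>\<^bsub>?ES\<^esub>i\<in>{..<n}. bmap \<Gamma> S x (dinj {..<n} (\<lambda>i. vmod (F i) x) i (?r i)))"
    proof (rule h.N.M.finsum_cong')
      show "(\<lambda>i. bmap \<Gamma> S x (dinj {..<n} (\<lambda>i. vmod (F i) x) i (?r i))) \<in> {..<n} \<rightarrow> carrier ?ES"
        by (rule funcsetI) (rule bS.closed[OF dc])
    qed (use s qF[OF q] in auto)
    also have "\<dots> = bmap \<Gamma> S x (\<Oplus>\<^bsub>V.D\<^esub>i\<in>{..<n}. dinj {..<n} (\<lambda>i. vmod (F i) x) i (?r i))"
      by (rule bS.finsum[symmetric], rule funcsetI) (rule dc)
    also have "\<dots> = bmap \<Gamma> S x ?r" by (simp only: V.dinj_sum[OF r, symmetric])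
    finally show ?thesis .
  qed
  have h2: "h (\<Phi>2 q) = \<zero>\<^bsub>?ES\<^esub>" if q: "q \<in> carrier V'.D" for q
  proof -
    have "h (\<Phi>2 q) = (\<Oplus>\<^bsub>?ES\<^esub>i\<in>?J. h (\<phi> (q i) \<odot>\<^bsub>vmod N x\<^esub> e i))"
      unfolding \<Phi>2_def by (rule h.finsum, rule funcsetI) (rule Nx.smult_closed[OF \<phi>c[OF q] ec])
    also have "\<dots> = \<zero>\<^bsub>?ES\<^esub>"
    proof (rule h.N.M.add.finprod_one_eqI)
      fix i assume i: "i \<in> ?J"
      have "h (e i) = \<zero>\<^bsub>?ES\<^esub>" using T(2) eT[OF i] by blast
      thus "h (\<phi> (q i) \<odot>\<^bsub>vmod N x\<^esub> e i) = \<zero>\<^bsub>?ES\<^esub>"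
        using h.smult[OF \<phi>c[OF q i] ec[OF i]] h.N.smult_r_null[OF \<phi>c[OF q i]] by simp
    qed
    finally show ?thesis .
  qed
  \<comment> \<open>New summands go to the kernel of \<open>h\<close>, so the boundary of
    \<open>\<Phi> q\<close> depends only on the old components. This gives both the kernel estimate
    and, at the end, compatibility with the edges going up from \<open>x\<close>.\<close>
  have h\<Phi>: "h (\<Phi> q) = bmap \<Gamma> S x (restrict q {..<n})" if q: "q \<in> carrier V'.D" for q
  proof -
    have "bmap \<Gamma> S x (restrict q {..<n}) \<in> carrier ?ES"
      by (rule bS.closed) (use qF[OF q] in simp)
    thus ?thesis
      by (simp only: split[OF q] h.add[OF \<Phi>1c[OF q] \<Phi>2c[OF q]] h1[OF q] h2[OF q] h.N.M.r_zero)
  qed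
  have lin: "\<Phi>2 q = (\<Oplus>\<^bsub>vmod N x\<^esub>t\<in>T. c t \<odot>\<^bsub>vmod N x\<^esub> t)"
    if c: "c \<in> T \<rightarrow> carrier ?A" and eq: "\<And>i. i \<in> ?J \<Longrightarrow> \<phi> (q i) = c (e i)" for q c
  proof -
    have cc: "c t \<odot>\<^bsub>vmod N x\<^esub> t \<in> carrier (vmod N x)" if "t \<in> T" for t
      using Nx.smult_closed c Tc that by (auto simp: Pi_iff)
    have "(\<Oplus>\<^bsub>vmod N x\<^esub>t\<in>e ` ?J. c t \<odot>\<^bsub>vmod N x\<^esub> t) = (\<Oplus>\<^bsub>vmod N x\<^esub>i\<in>?J. c (e i) \<odot>\<^bsub>vmod N x\<^esub> e i)"
      by (rule Nx.M.finsum_reindex) (use cc e in \<open>auto simp: bij_betw_def\<close>)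
    also have "\<dots> = \<Phi>2 q" unfolding \<Phi>2_def
    proof (rule Nx.M.finsum_cong')
      show "(\<lambda>i. \<phi> (q i) \<odot>\<^bsub>vmod N x\<^esub> e i) \<in> ?J \<rightarrow> carrier (vmod N x)"
        by (rule funcsetI) (use cc eT eq in simp)
    qed (use eq in auto)
    finally show ?thesis using e by (simp add: bij_betw_def)
  qed

  \<comment> \<open>Surjectivity of \<open>\<Phi>\<close>\<close>
  have surj: "\<Phi> ` carrier V'.D = carrier (vmod N x)"
  proof (rule Nx.nakayama)
    show "gsub d (vmod N x) (\<Phi> ` carrier V'.D)" by (rule \<Phi>.image_gsub) (rule \<Phi>.M.gsub_carrier)
    fix a assume a: "a \<in> carrier (vmod N x)"
    have "h a \<in> bmap \<Gamma> S x ` carrier V.D" using hS[OF a] by (simp only: SB[symmetric] VS)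
    then obtain r where r': "h a = bmap \<Gamma> S x r" "r \<in> carrier V.D" by (rule imageE)
    note r = r'(2) r'(1)[symmetric]
    \<comment> \<open>An element with old components only and with the same boundary as
      \<open>a\<close>; subtracting its image leaves an element of the kernel of
      \<open>h\<close>.\<close>
    define q0 where "q0 = (\<lambda>i\<in>{..<m}. if i < n then r i else \<zero>\<^bsub>vmod (F' i) x\<^esub>)"
    have q0: "q0 \<in> carrier V'.D"
      unfolding dsum_gmodule_simps q0_def restrict_PiE_iff
    proof
      fix i assume i: "i \<in> {..<m}"
      show "(if i < n then r i else \<zero>\<^bsub>vmod (F' i) x\<^esub>) \<in> carrier (vmod (F' i) x)"
        using V'.mc(1)[OF i] r(1) by (cases "i < n") (simp_all add: PiE_iff F'_def)
    qed
    have "restrict q0 {..<n} = restrict r {..<n}"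
      by (rule restrict_ext) (use nm in \<open>simp add: q0_def\<close>)
    also have "\<dots> = r" using r(1) by (simp add: PiE_restrict)
    finally have hq0: "h (\<Phi> q0) = h a" using h\<Phi>[OF q0] r(2) by simp
    have \<Phi>q0: "\<Phi> q0 \<in> carrier (vmod N x)" by (rule \<Phi>.closed[OF q0])
    have "h (a \<ominus>\<^bsub>vmod N x\<^esub> \<Phi> q0) = \<zero>\<^bsub>?ES\<^esub>"
      using h.diff[OF a \<Phi>q0] hq0 h.N.M.diff_zero_iff[OF h.closed[OF a] h.closed[OF a]] by simp
    hence "a \<ominus>\<^bsub>vmod N x\<^esub> \<Phi> q0 \<in> {m \<in> carrier (vmod N x). h m = \<zero>\<^bsub>?ES\<^esub>}"
      using Nx.M.diff_closed[OF a \<Phi>q0] by blast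
    then obtain t w where tw: "t \<in> mgen d (vmod N x) T" "w \<in> mod_span (tdual d) (vmod N x)"
      "a \<ominus>\<^bsub>vmod N x\<^esub> \<Phi> q0 = t \<oplus>\<^bsub>vmod N x\<^esub> w" using cover by blast
    have TN: "T \<subseteq> carrier (vmod N x)" using Tc by blast
    obtain c where c: "c \<in> T \<rightarrow> carrier ?A" "t = (\<Oplus>\<^bsub>vmod N x\<^esub>t\<in>T. c t \<odot>\<^bsub>vmod N x\<^esub> t)"
      using tw(1) mgen_lincomb[OF Nx.module_axioms T(1) TN] by blast
    have "\<forall>i\<in>?J. \<exists>b. b \<in> carrier (vmod Kx x) \<and> \<phi> b = c (e i)"
    proof
      fix i assume "i \<in> ?J"
      hence "c (e i) \<in> carrier ?A" using c(1) eT by blast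
      thus "\<exists>b. b \<in> carrier (vmod Kx x) \<and> \<phi> b = c (e i)" using gmod_iso_surjD[OF \<phi>] by blast
    qed
    from bchoice[OF this] obtain b where b: "\<forall>i\<in>?J. b i \<in> carrier (vmod Kx x) \<and> \<phi> (b i) = c (e i)" ..
    \<comment> \<open>An element with new components only, chosen through \<open>\<phi>\<close> to
      reproduce the combination \<open>t\<close> of the kernel generators.\<close>
    define q1 where "q1 = (\<lambda>i\<in>{..<m}. if i < n then \<zero>\<^bsub>vmod (F' i) x\<^esub> else b i)"
    have q1: "q1 \<in> carrier V'.D"
      unfolding dsum_gmodule_simps q1_def restrict_PiE_iff
    proof
      fix i assume i: "i \<in> {..<m}"
      show "(if i < n then \<zero>\<^bsub>vmod (F' i) x\<^esub> else b i) \<in> carrier (vmod (F' i) x)"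
        using V'.mc(1)[OF i] b i by (cases "i < n") (simp_all add: F'_def)
    qed
    have "\<Phi>2 q1 = t" unfolding c(2) by (rule lin[OF c(1)]) (use b nm in \<open>auto simp: q1_def\<close>)
    moreover have "\<Phi>1 q1 = \<zero>\<^bsub>vmod N x\<^esub>"
      unfolding \<Phi>1_def
    proof (rule Nx.M.add.finprod_one_eqI)
      fix i assume i: "i \<in> {..<n}"
      have "q1 i = \<zero>\<^bsub>vmod (F i) x\<^esub>" using i nm by (simp add: q1_def F'_def)
      thus "s i (q1 i) = \<zero>\<^bsub>vmod N x\<^esub>"
        using ghom.zero[OF ghomI[OF V.gmod[OF i] Nx sh]] i by simp
    qed
    ultimately have \<Phi>q1: "\<Phi> q1 = t" using split[OF q1] \<Phi>2c[OF q1] by simp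
    have tc: "t \<in> carrier (vmod N x)" using \<Phi>.closed[OF q1] \<Phi>q1 by simp
    have wc: "w \<in> carrier (vmod N x)" using gsubD(3)[OF Nx.max_gsub tw(2)] .
    have "a = \<Phi> q0 \<oplus>\<^bsub>vmod N x\<^esub> (t \<oplus>\<^bsub>vmod N x\<^esub> w)"
      using Nx.M.add_diff_self[OF \<Phi>q0 a] tw(3) by simp
    also have "\<dots> = (\<Phi> q0 \<oplus>\<^bsub>vmod N x\<^esub> t) \<oplus>\<^bsub>vmod N x\<^esub> w" using Nx.M.a_assoc[OF \<Phi>q0 tc wc] by simp
    also have "\<Phi> q0 \<oplus>\<^bsub>vmod N x\<^esub> t = \<Phi> (q0 \<oplus>\<^bsub>V'.D\<^esub> q1)" using \<Phi>.add[OF q0 q1] \<Phi>q1 by simp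
    finally have "a = \<Phi> (q0 \<oplus>\<^bsub>V'.D\<^esub> q1) \<oplus>\<^bsub>vmod N x\<^esub> w" .
    moreover have "\<Phi> (q0 \<oplus>\<^bsub>V'.D\<^esub> q1) \<in> \<Phi> ` carrier V'.D"
      by (rule imageI) (rule V'.D.M.a_closed[OF q0 q1])
    ultimately show "\<exists>c\<in>\<Phi> ` carrier V'.D. \<exists>w\<in>mod_span (tdual d) (vmod N x). a = c \<oplus>\<^bsub>vmod N x\<^esub> w"
      using tw(2) by blast
  qed

  \<comment> \<open>The kernel of \<open>\<Phi>\<close> lies in the maximal ideal times the
    source\<close>
  have ker: "q \<in> mod_span (tdual d) V'.D" if q: "q \<in> carrier V'.D" and z: "\<Phi> q = \<zero>\<^bsub>vmod N x\<^esub>" for q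
  proof -
    have b0: "bmap \<Gamma> S x (restrict q {..<n}) = \<zero>\<^bsub>?ES\<^esub>" using h\<Phi>[OF q] z h.zero by simp
    \<comment> \<open>The old components of a kernel element have zero boundary, summand by summand,
      so minimality of the old summands at \<open>x\<close> applies.\<close>
    have qi: "q i \<in> mod_span (tdual d) (vmod (F i) x)" if i: "i < n" for i
    proof (rule Fker[OF i qF[OF q i]], rule ballI)
      fix L assume L: "L \<in> up_edges \<Gamma> x"
      have "bmap \<Gamma> S x (restrict q {..<n}) L i = \<zero>\<^bsub>?ES\<^esub> L i" using b0 by simp
      thus "res (F i) x L (q i) = \<zero>\<^bsub>emod (F i) L\<^esub>" using L i by (simp add: bmap_def S_def)
    qed
    have "\<Phi>1 q \<in> mod_span (tdual d) (vmod N x)"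
      unfolding \<Phi>1_def
    proof (rule Nx.M.finsum_mem, rule funcsetI)
      fix i assume i: "i \<in> {..<n}"
      show "s i (q i) \<in> mod_span (tdual d) (vmod N x)"
        by (rule ghom.mod_span_image[OF ghomI[OF V.gmod[OF i] Nx sh] W qi]) (use i in auto)
    qed (use gsubD(2,4,5)[OF Nx.max_gsub] in auto)
    moreover have "\<Phi>2 q = \<ominus>\<^bsub>vmod N x\<^esub> \<Phi>1 q"
      using split[OF q] z Nx.M.minus_equality[of "\<Phi>2 q" "\<Phi>1 q"] \<Phi>1c[OF q] \<Phi>2c[OF q] Nx.M.a_comm[OF \<Phi>1c[OF q] \<Phi>2c[OF q]]
      by simp
    ultimately have m2: "\<Phi>2 q \<in> mod_span (tdual d) (vmod N x)" using gsubD(6)[OF Nx.max_gsub] by simp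
    \<comment> \<open>The new part is the negative of the old part and hence also in the maximal
      ideal times the stalk; minimality of \<open>T\<close> then removes the constant terms of its
      coefficients.\<close>
    let ?c = "\<lambda>t. \<phi> (q (the_inv_into ?J e t))"
    have ce: "?c (e i) = \<phi> (q i)" if "i \<in> ?J" for i
      using the_inv_into_f_f[OF bij_betw_imp_inj_on[OF e] that] by simp
    have cT: "?c \<in> T \<rightarrow> carrier ?A"
    proof (rule funcsetI)
      fix t assume "t \<in> T"
      then obtain i where i: "i \<in> ?J" "t = e i" using e by (auto simp: bij_betw_def)
      show "?c t \<in> carrier ?A" unfolding i(2) ce[OF i(1)] by (rule \<phi>c[OF q i(1)])
    qed
    have "\<Phi>2 q = (\<Oplus>\<^bsub>vmod N x\<^esub>t\<in>T. ?c t \<odot>\<^bsub>vmod N x\<^esub> t)" by (rule lin[OF cT]) (rule ce[symmetric])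
    hence "\<forall>t\<in>T. Poly_Mapping.lookup (?c t) 0 = 0" using bspec[OF rel cT] m2 by simp
    hence c0: "Poly_Mapping.lookup (\<phi> (q i)) 0 = 0" if "i \<in> ?J" for i using ce[OF that] eT[OF that] by metis
    have qi': "q i \<in> mod_span (tdual d) (vmod Kx x)" if i: "i \<in> ?J" for i
    proof -
      interpret A: gmod d ?A using graded_sym_alg by (simp add: gmod_def)
      have "\<phi> (q i) \<in> mod_span (tdual d) ?A" using A.smult_max[OF \<phi>c[OF q i] c0[OF i], of 1] by simp
      moreover interpret phi: ghom d "vmod Kx x" ?A \<phi> by (rule ghomI[OF Kgr graded_sym_alg gmod_isoD(1)[OF \<phi>]])
      obtain y where y: "y \<in> mod_span (tdual d) (vmod Kx x)" "\<phi> y = \<phi> (q i)"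
        using phi.mod_span_surj[OF W bij_betw_imp_surj_on[OF gmod_isoD(2)[OF \<phi>]] calculation] by blast
      have "y = q i"
        by (rule inj_onD[OF bij_betw_imp_inj_on[OF gmod_isoD(2)[OF \<phi>]] y(2)])
          (use gsubD(3)[OF phi.M.max_gsub y(1)] qK[OF q i] in auto)
      thus ?thesis using y(1) by simp
    qed
    have "q i \<in> mod_span (tdual d) (vmod (F' i) x)" if "i \<in> {..<m}" for i
      using qi[of i] qi'[of i] that by (cases "i < n") (auto simp: F'_def)
    thus ?thesis using V'.mod_span_dsum[OF W q] by blast
  qed
  have \<Phi>iso: "\<Phi> \<in> gmod_iso d V'.D (vmod N x)"
    by (rule surj_free_inj[OF V'.graded_dsum(1) pure_sheafD(2)[OF N x(1)] \<Phi> surj ker])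

  \<comment> \<open>Extension of the isomorphism to \<open>x\<close> and to the edges descending
    from it\<close>
  define \<Psi> where "\<Psi> = inv_into (carrier V'.D) \<Phi>"
  have \<Psi>: "\<Psi> \<in> gmod_iso d (vmod N x) (vmod S' x)"
    unfolding \<Psi>_def VS' by (rule gmod_iso_inv[OF V'.graded_dsum(1) Nx \<Phi>iso])
  have \<Phi>\<Psi>: "\<Phi> (\<Psi> a) = a" "\<Psi> a \<in> carrier V'.D" if "a \<in> carrier (vmod N x)" for a
    using bij_betw_inv_into_right[OF gmod_isoD(2)[OF \<Phi>iso] that] gmod_homD(1)[OF gmod_isoD(1)[OF \<Psi>] that] VS'
    by (simp_all add: \<Psi>_def)

  define ev where "ev y = (\<lambda>f. \<lambda>i\<in>{..<m}. if i < n then f i else \<zero>\<^bsub>vmod (F' i) y\<^esub>)" for y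
  define ee where "ee L = (\<lambda>f. \<lambda>i\<in>{..<m}. if i < n then f i else \<zero>\<^bsub>emod (F' i) L\<^esub>)" for L
  \<comment> \<open>Over \<open>I\<close> the old isomorphism is kept and its values are padded by
    zeros in the new summands, all of which vanish there.\<close>
  have ev: "ev y \<in> gmod_iso d (vmod S y) (vmod S' y)" if y: "y \<in> I" for y
    unfolding SF' S'_def dsum_gsheaf_simps ev_def
  proof (rule dsum_extend_iso[OF nm])
    show "graded_module d (vmod (F' i) y)" if "i < m" for i
      using graph_sheafD(1)[OF F'g[OF that]] y IV by blast
    show "zero_gmodule (vmod (F' i) y)" if "n \<le> i" for i using that Kz[OF y] by (simp add: F'_def)
  qed
  have ee: "ee L \<in> gmod_iso d (emod S L) (emod S' L)" if L: "L \<in> edges \<Gamma>" "up L \<in> I" for L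
    unfolding SF' S'_def dsum_gsheaf_simps ee_def
  proof (rule dsum_extend_iso[OF nm])
    show "graded_module d (emod (F' i) L)" if "i < m" for i
      using graph_sheafD(2)[OF F'g[OF that] L(1)] .
    show "zero_gmodule (emod (F' i) L)" if "n \<le> i" for i using that Kze[OF L] by (simp add: F'_def)
  qed
  have eres: "ee L (res S y L a) = res S' y L (ev y a)"
    if L: "L \<in> edges \<Gamma>" and y: "y = up L \<or> y = lo L" for y L a
    unfolding SF' S'_def dsum_gsheaf_simps ee_def ev_def
  proof (rule restrict_ext)
    fix i assume i: "i \<in> {..<m}"
    have yV: "y \<in> verts \<Gamma>" using y e_ends(1,2)[OF L] by blast
    have r: "res (F' i) y L \<in> gmod_hom d (vmod (F' i) y) (emod (F' i) L)"
      using y graph_sheafD(3,4)[OF F'g L] i by auto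
    have "ghom d (vmod (F' i) y) (emod (F' i) L) (res (F' i) y L)"
      by (rule ghomI[OF graph_sheafD(1)[OF F'g yV] graph_sheafD(2)[OF F'g L] r]) (use i in auto)
    from ghom.zero[OF this]
    show "(if i < n then (\<lambda>i\<in>{..<n}. res (F' i) y L (a i)) i else \<zero>\<^bsub>emod (F' i) L\<^esub>) =
      res (F' i) y L ((\<lambda>i\<in>{..<m}. if i < n then a i else \<zero>\<^bsub>vmod (F' i) y\<^esub>) i)"
      using i by simp
  qed
  \<comment> \<open>On an edge descending from \<open>x\<close> both sheaves are the quotient of
    their stalk at \<open>x\<close>, so \<open>\<Psi>\<close> induces the isomorphism on the
    edge.\<close>
  have "\<forall>L\<in>{L \<in> edges \<Gamma>. up L = x}. \<exists>\<gamma>. \<gamma> \<in> gmod_iso d (emod N L) (emod S' L) \<and>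
      (\<forall>a\<in>carrier (vmod N x). \<gamma> (res N x L a) = res S' x L (\<Psi> a))"
  proof
    fix L assume "L \<in> {L \<in> edges \<Gamma>. up L = x}"
    hence L: "L \<in> edges \<Gamma>" "up L = x" by auto
    have q: "quotient_map d (dir \<Gamma> L) (vmod N x) (emod N L) (res N x L)"
      using pure_sheafD(4)[OF N L(1)] L(2) by simp
    have "quotient_map d (dir \<Gamma> L) (vmod S' (up L)) (emod S' L) (res S' (up L) L)"
      unfolding S'_def by (rule dsum_quotient[OF _ _ L(1)]) (use F' in auto)
    hence q': "quotient_map d (dir \<Gamma> L) (vmod S' x) (emod S' L) (res S' x L)" using L(2) by simp
    have "dir \<Gamma> L \<subseteq> carrier ?A" using dir_sub[OF L(1)] W by blast
    from quotient_iso[OF Nx graph_sheafD(2)[OF Ng L(1)] graph_sheafD(1)[OF S'g x(1)] graph_sheafD(2)[OF S'g L(1)]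
        this q q' \<Psi>]
    show "\<exists>\<gamma>. \<gamma> \<in> gmod_iso d (emod N L) (emod S' L) \<and>
      (\<forall>a\<in>carrier (vmod N x). \<gamma> (res N x L a) = res S' x L (\<Psi> a))" by blast
  qed
  from bchoice[OF this] obtain \<gamma> where \<gamma>: "\<forall>L\<in>{L \<in> edges \<Gamma>. up L = x}. \<gamma> L \<in> gmod_iso d (emod N L) (emod S' L) \<and>
      (\<forall>a\<in>carrier (vmod N x). \<gamma> L (res N x L a) = res S' x L (\<Psi> a))" ..
  define f' where "f' y = (if y = x then \<Psi> else (\<lambda>a. ev y (f y a)))" for y
  define g' where "g' L = (if up L = x then \<gamma> L else (\<lambda>u. ee L (g L u)))" for L
  have "piso (insert x I) N S' f' g'"
    unfolding piso_def
  proof (intro conjI ballI impI)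
    fix y assume "y \<in> insert x I"
    thus "f' y \<in> gmod_iso d (vmod N y) (vmod S' y)"
      using \<Psi> gmod_iso_comp[OF pisoD(1)[OF p] ev, of y] x(2) by (auto simp: f'_def)
  next
    fix L assume L: "L \<in> edges \<Gamma>" "up L \<in> insert x I"
    show "g' L \<in> gmod_iso d (emod N L) (emod S' L)"
    proof (cases "up L = x")
      case True
      thus ?thesis using \<gamma> L(1) by (simp add: g'_def)
    next
      case False
      hence u: "up L \<in> I" using L(2) by blast
      show ?thesis using gmod_iso_comp[OF pisoD(2)[OF p L(1) u] ee[OF L(1) u]] False by (simp add: g'_def)
    qed
    show "g' L (res N (up L) L a) = res S' (up L) L (f' (up L) a)" if a: "a \<in> carrier (vmod N (up L))" for a
    proof (cases "up L = x")
      case True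
      thus ?thesis using \<gamma> L(1) a by (simp add: g'_def f'_def)
    next
      case False
      hence u: "up L \<in> I" using L(2) by blast
      show ?thesis using pisoD(3)[OF p L(1) u a] eres[OF L(1)] False by (simp add: g'_def f'_def)
    qed
    show "g' L (res N (lo L) L a) = res S' (lo L) L (f' (lo L) a)"
      if lI: "lo L \<in> insert x I" and a: "a \<in> carrier (vmod N (lo L))" for a
    proof -
      \<comment> \<open>As \<open>I\<close> is upper and misses \<open>x\<close>, an edge whose
        lower end lies in \<open>insert x I\<close> does not descend from \<open>x\<close>.\<close>
      have ux: "up L \<noteq> x"
        using lI up_above_lo[OF L(1)] I[of "lo L"] x(2) e_ends(3)[OF L(1)] by auto
      hence u: "up L \<in> I" using L(2) by blast
      show ?thesis
      proof (cases "lo L = x")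
        case False
        hence l: "lo L \<in> I" using lI by blast
        show ?thesis using pisoD(4)[OF p L(1) u l a] eres[OF L(1)] False ux by (simp add: g'_def f'_def)
      next
        case True
        hence LU: "L \<in> up_edges \<Gamma> x" using L(1) by (simp add: up_edges_iff)
        have ax: "a \<in> carrier (vmod N x)" using a True by simp
        \<comment> \<open>On an edge going up from \<open>x\<close>, compatibility is the identity
          for \<open>h\<close> after \<open>\<Phi>\<close>, applied to \<open>\<Psi> a\<close>; the
          new summands contribute nothing because they are zero on this edge.\<close>
        have "g L (res N x L a) = h (\<Phi> (\<Psi> a)) L" using hL[OF LU] \<Phi>\<Psi>(1)[OF ax] by simp
        also have "\<dots> = res S x L (restrict (\<Psi> a) {..<n})"
          using h\<Phi>[OF \<Phi>\<Psi>(2)[OF ax]] LU by (simp add: bmap_def)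
        finally have "g' L (res N x L a) = ee L (res S x L (restrict (\<Psi> a) {..<n}))"
          using ux by (simp add: g'_def)
        also have "\<dots> = res S' x L (\<Psi> a)"
          unfolding SF' S'_def dsum_gsheaf_simps ee_def
        proof (rule restrict_ext)
          fix i assume i: "i \<in> {..<m}"
          show "(if i < n then (\<lambda>i\<in>{..<n}. res (F' i) x L (restrict (\<Psi> a) {..<n} i)) i else \<zero>\<^bsub>emod (F' i) L\<^esub>) =
            res (F' i) x L (\<Psi> a i)"
          proof (cases "i < n")
            case False
            have "res (F' i) x L \<in> gmod_hom d (vmod (F' i) x) (emod (F' i) L)"
              using graph_sheafD(4)[OF F'g L(1), of i] True i by simp
            moreover have "\<Psi> a i \<in> carrier (vmod (F' i) x)" using \<Phi>\<Psi>(2)[OF ax] i by (simp add: PiE_iff)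
            ultimately have "res (F' i) x L (\<Psi> a i) \<in> carrier (emod (F' i) L)" by (rule gmod_homD(1))
            moreover have "zero_gmodule (emod (F' i) L)" using Kze[OF L(1) u] False by (simp add: F'_def)
            ultimately show ?thesis using False zero_gmoduleD by fastforce
          qed simp
        qed
        finally show ?thesis using True by (simp add: f'_def)
      qed
    qed
  qed
  thus ?thesis using nm unfolding S'_def F'_def
    by (intro exI[of _ m] exI[of _ "\<lambda>i. - k (e i)"] exI[of _ f'] exI[of _ g'] conjI)
qed

end

context moment
begin

section \<open>Isomorphism of sheaves as an equivalence relation\<close>

lemma piso_gsheaf_iso: "gsheaf_iso \<Gamma> N S \<longleftrightarrow> (\<exists>f g. piso (verts \<Gamma>) N S f g)"
proof
  assume "gsheaf_iso \<Gamma> N S"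
  then obtain f g where f: "\<forall>x\<in>verts \<Gamma>. f x \<in> gmod_iso d (vmod N x) (vmod S x)"
    and g: "\<forall>L\<in>edges \<Gamma>. g L \<in> gmod_iso d (emod N L) (emod S L)"
    and c: "\<forall>x\<in>verts \<Gamma>. \<forall>L\<in>edges \<Gamma>. x \<in> ends \<Gamma> L \<longrightarrow>
        (\<forall>m\<in>carrier (vmod N x). g L (res N x L m) = res S x L (f x m))"
    unfolding gsheaf_iso_def by (elim exE conjE)
  have "piso (verts \<Gamma>) N S f g"
    unfolding piso_def
  proof (intro conjI ballI impI)
    fix L assume L: "L \<in> edges \<Gamma>"
    note e = e_ends[OF L]
    show "g L (res N (up L) L m) = res S (up L) L (f (up L) m)" if "m \<in> carrier (vmod N (up L))" for m
      using c[rule_format, OF e(1) L _ that] e(5) by simp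
    show "g L (res N (lo L) L m) = res S (lo L) L (f (lo L) m)" if "m \<in> carrier (vmod N (lo L))" for m
      using c[rule_format, OF e(2) L _ that] e(5) by simp
  qed (use f g in auto)
  thus "\<exists>f g. piso (verts \<Gamma>) N S f g" by blast
next
  assume "\<exists>f g. piso (verts \<Gamma>) N S f g"
  then obtain f g where p: "piso (verts \<Gamma>) N S f g" by blast
  have "g L (res N x L m) = res S x L (f x m)"
    if "x \<in> verts \<Gamma>" "L \<in> edges \<Gamma>" "x \<in> ends \<Gamma> L" "m \<in> carrier (vmod N x)" for x L m
  proof -
    have "x = up L \<or> x = lo L" using that(3) e_ends(5)[OF that(2)] by simp
    thus ?thesis
      using pisoD(3)[OF p that(2) e_ends(1)[OF that(2)]] pisoD(4)[OF p that(2) e_ends(1,2)[OF that(2)]] that(4)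
      by auto
  qed
  thus "gsheaf_iso \<Gamma> N S"
    unfolding gsheaf_iso_def using pisoD(1)[OF p] pisoD(2)[OF p _ e_ends(1)]
    by (intro exI[of _ f] exI[of _ g] conjI ballI impI) simp_all
qed

lemma gsheaf_iso_sym:
  assumes N: "graph_sheaf \<Gamma> N" and S: "graph_sheaf \<Gamma> S" and iso: "gsheaf_iso \<Gamma> N S"
  shows "gsheaf_iso \<Gamma> S N"
proof -
  obtain f g where p: "piso (verts \<Gamma>) N S f g" using iso by (auto simp: piso_gsheaf_iso)
  let ?f = "\<lambda>x. inv_into (carrier (vmod N x)) (f x)" and ?g = "\<lambda>L. inv_into (carrier (emod N L)) (g L)"
  have f: "?f x \<in> gmod_iso d (vmod S x) (vmod N x)" if "x \<in> verts \<Gamma>" for x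
    by (rule gmod_iso_inv[OF graph_sheafD(1)[OF N that] graph_sheafD(1)[OF S that] pisoD(1)[OF p that]])
  have g: "?g L \<in> gmod_iso d (emod S L) (emod N L)" if "L \<in> edges \<Gamma>" for L
    by (rule gmod_iso_inv[OF graph_sheafD(2)[OF N that] graph_sheafD(2)[OF S that] pisoD(2)[OF p that e_ends(1)[OF that]]])
  have c: "?g L (res S x L m) = res N x L (?f x m)"
    if x: "x \<in> verts \<Gamma>" and L: "L \<in> edges \<Gamma>" and m: "m \<in> carrier (vmod S x)"
      and r: "res N x L \<in> gmod_hom d (vmod N x) (emod N L)"
      and eq: "\<And>m. m \<in> carrier (vmod N x) \<Longrightarrow> g L (res N x L m) = res S x L (f x m)" for x L m
  proof -
    have fm: "?f x m \<in> carrier (vmod N x)" by (rule gmod_homD(1)[OF gmod_isoD(1)[OF f[OF x]] m])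
    have ff: "f x (?f x m) = m" by (rule bij_betw_inv_into_right[OF gmod_isoD(2)[OF pisoD(1)[OF p x]] m])
    have "?g L (g L (res N x L (?f x m))) = res N x L (?f x m)"
      by (rule bij_betw_inv_into_left[OF gmod_isoD(2)[OF pisoD(2)[OF p L e_ends(1)[OF L]]] gmod_homD(1)[OF r fm]])
    thus ?thesis using eq[OF fm] ff by simp
  qed
  have "piso (verts \<Gamma>) S N ?f ?g"
    unfolding piso_def
  proof (intro conjI ballI impI)
    fix L assume L: "L \<in> edges \<Gamma>"
    note e = e_ends[OF L]
    show "?g L (res S (up L) L m) = res N (up L) L (?f (up L) m)" if "m \<in> carrier (vmod S (up L))" for m
      by (rule c[OF e(1) L that graph_sheafD(3)[OF N L] pisoD(3)[OF p L e(1)]])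
    show "?g L (res S (lo L) L m) = res N (lo L) L (?f (lo L) m)" if "m \<in> carrier (vmod S (lo L))" for m
      by (rule c[OF e(2) L that graph_sheafD(4)[OF N L] pisoD(4)[OF p L e(1,2)]])
  qed (use f g in auto)
  thus ?thesis by (auto simp: piso_gsheaf_iso)
qed

lemma gsheaf_iso_trans:
  assumes NS: "gsheaf_iso \<Gamma> N S" and SR: "gsheaf_iso \<Gamma> S R"
  shows "gsheaf_iso \<Gamma> N R"
proof -
  obtain f g where p: "piso (verts \<Gamma>) N S f g" using NS by (auto simp: piso_gsheaf_iso)
  obtain f' g' where p': "piso (verts \<Gamma>) S R f' g'" using SR by (auto simp: piso_gsheaf_iso)
  have fc: "f x m \<in> carrier (vmod S x)" if "x \<in> verts \<Gamma>" "m \<in> carrier (vmod N x)" for x m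
    by (rule gmod_homD(1)[OF gmod_isoD(1)[OF pisoD(1)[OF p that(1)]] that(2)])
  have "piso (verts \<Gamma>) N R (\<lambda>x m. f' x (f x m)) (\<lambda>L u. g' L (g L u))"
    unfolding piso_def
  proof (intro conjI ballI impI)
    show "(\<lambda>m. f' x (f x m)) \<in> gmod_iso d (vmod N x) (vmod R x)" if "x \<in> verts \<Gamma>" for x
      by (rule gmod_iso_comp[OF pisoD(1)[OF p that] pisoD(1)[OF p' that]])
    fix L assume L: "L \<in> edges \<Gamma>"
    note e = e_ends[OF L]
    show "(\<lambda>u. g' L (g L u)) \<in> gmod_iso d (emod N L) (emod R L)"
      by (rule gmod_iso_comp[OF pisoD(2)[OF p L e(1)] pisoD(2)[OF p' L e(1)]])
    show "g' L (g L (res N (up L) L m)) = res R (up L) L (f' (up L) (f (up L) m))"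
      if "m \<in> carrier (vmod N (up L))" for m
      using pisoD(3)[OF p L e(1) that] pisoD(3)[OF p' L e(1) fc[OF e(1) that]] by simp
    show "g' L (g L (res N (lo L) L m)) = res R (lo L) L (f' (lo L) (f (lo L) m))"
      if "m \<in> carrier (vmod N (lo L))" for m
      using pisoD(4)[OF p L e(1,2) that] pisoD(4)[OF p' L e(1,2) fc[OF e(2) that]] by simp
  qed
  thus ?thesis by (auto simp: piso_gsheaf_iso)
qed

text \<open>\<open>structure_step\<close> is iterated along \<open>upper_induct\<close>, starting
  from the empty sum over the empty set of vertices. The family \<open>K\<close> is arbitrary apart
  from \<open>min_pure\<close>, so the result applies to any choice of the canonical
  sheaves.\<close>

theorem pure_structure:
  fixes K :: "'v \<Rightarrow> ('v, 'e, 'm, 'l) gsheaf" and N :: "('v, 'e, 'n, 'k) gsheaf"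
  assumes K: "\<And>x. x \<in> verts \<Gamma> \<Longrightarrow> min_pure x (K x)" and N: "pure_sheaf \<Gamma> N"
  shows "\<exists>(n :: nat) xs ks. (\<forall>i<n. xs i \<in> verts \<Gamma>) \<and>
    gsheaf_iso \<Gamma> N (dsum_gsheaf {..<n} (\<lambda>i. shift_gsheaf (ks i) (K (xs i))))"
proof -
  \<comment> \<open>The invariant keeps every \<open>xs i\<close> inside \<open>I\<close>. Thus a
    new vertex differs from the top vertices of all earlier summands, and their minimality at it is
    available from \<open>min_pure\<close>.\<close>
  let ?Q = "\<lambda>I. \<exists>(n :: nat) xs ks f g. (\<forall>i<n. xs i \<in> I) \<and>
    piso I N (dsum_gsheaf {..<n} (\<lambda>i. shift_gsheaf (ks i) (K (xs i)))) f g"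
  have "?Q (verts \<Gamma>)"
  proof (rule upper_induct[of "verts \<Gamma>"])
    show "x \<in> verts \<Gamma> \<and> verts_above \<Gamma> x \<subseteq> verts \<Gamma>" if "x \<in> verts \<Gamma>" for x
      using that by (auto simp: verts_above_def)
    have "piso {} N (dsum_gsheaf {..<0 :: nat} (\<lambda>i. shift_gsheaf (undefined i) (K (undefined i)))) undefined undefined"
      by (simp add: piso_def)
    thus "?Q {}" by (intro exI[of _ "0 :: nat"] exI conjI) auto
  next
    fix I x
    assume I: "I \<subseteq> verts \<Gamma>" "\<And>y. y \<in> I \<Longrightarrow> verts_above \<Gamma> y \<subseteq> I"
      and x: "x \<in> verts \<Gamma>" "x \<notin> I" "verts_above \<Gamma> x \<subseteq> I" and "?Q I"
    then obtain n :: nat and xs ks f g where xs: "\<forall>i<n. xs i \<in> I"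
      and p: "piso I N (dsum_gsheaf {..<n} (\<lambda>i. shift_gsheaf (ks i) (K (xs i)))) f g" by (elim exE conjE)
    let ?F = "\<lambda>i. shift_gsheaf (ks i) (K (xs i))"
    have xsV: "xs i \<in> verts \<Gamma>" "xs i \<noteq> x" if "i < n" for i using xs that I(1) x(2) by auto
    have F: "pure_sheaf \<Gamma> (?F i)" if "i < n" for i
      by (rule shift_pure[OF min_pure_pure[OF K[OF xsV(1)[OF that]]]])
    have Fker: "m \<in> mod_span (tdual d) (vmod (?F i) x)"
      if "i < n" "m \<in> carrier (vmod (?F i) x)" "\<forall>L\<in>up_edges \<Gamma> x. res (?F i) x L m = \<zero>\<^bsub>emod (?F i) L\<^esub>" for i m
      using K[OF xsV(1)[OF that(1)]] xsV[OF that(1)] that(2,3) x(1) by (simp add: min_pure_def)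
    have "\<exists>m ks' f' g'. n \<le> m \<and>
      piso (insert x I) N (dsum_gsheaf {..<m} (\<lambda>i. if i < n then ?F i else shift_gsheaf (ks' i) (K x))) f' g'"
      by (rule structure_step[where F = ?F, OF I x N K[OF x(1)] F Fker p])
    then obtain m ks' f' g' where
      p': "piso (insert x I) N (dsum_gsheaf {..<m} (\<lambda>i. if i < n then ?F i else shift_gsheaf (ks' i) (K x))) f' g'"
      by (elim exE conjE)
    let ?xs = "\<lambda>i. if i < n then xs i else x" and ?ks = "\<lambda>i. if i < n then ks i else ks' i"
    have "(\<lambda>i. if i < n then ?F i else shift_gsheaf (ks' i) (K x)) = (\<lambda>i. shift_gsheaf (?ks i) (K (?xs i)))"
      by (simp add: fun_eq_iff)
    moreover have "\<forall>i<m. ?xs i \<in> insert x I" using xs by simp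
    ultimately show "?Q (insert x I)"
      using p' by (intro exI[of _ m] exI[of _ ?xs] exI[of _ ?ks] exI[of _ f'] exI[of _ g'] conjI) simp_all
  qed
  then obtain n :: nat and xs ks f g where "\<forall>i<n. xs i \<in> verts \<Gamma>"
    "piso (verts \<Gamma>) N (dsum_gsheaf {..<n} (\<lambda>i. shift_gsheaf (ks i) (K (xs i)))) f g" by (elim exE conjE)
  thus ?thesis
    unfolding piso_gsheaf_iso by (intro exI[of _ n] exI[of _ xs] exI[of _ ks] exI[of _ f] exI[of _ g] conjI)
qed

text \<open>Splitting by an idempotent into image and kernel. Both stay within the carrier type of
  \<open>M\<close>, as the definition of \<open>indecomposable\<close> demands of its
  summands.\<close>

lemma split_module:
  assumes M: "graded_module d M" and e: "e \<in> gmod_hom d M M"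
    and idem: "\<And>m. m \<in> carrier M \<Longrightarrow> e (e m) = e m"
  defines "G \<equiv> sub_gmodule (e ` carrier M) M" and "H \<equiv> sub_gmodule {m \<in> carrier M. e m = \<zero>\<^bsub>M\<^esub>} M"
  shows "graded_module d G" "graded_module d H"
    "(\<lambda>m b. if b then e m else m \<ominus>\<^bsub>M\<^esub> e m) \<in> gmod_iso d M (dsum_gmodule UNIV (\<lambda>b. if b then G else H))"
proof -
  interpret e: ghom d M M e by (rule ghomI[OF M M e])
  note ge = e.image_gsub[OF e.M.gsub_carrier] and gk = e.kernel
  show gG: "graded_module d G" unfolding G_def by (rule e.M.gsub_graded(1)[OF ge])
  show gH: "graded_module d H" unfolding H_def by (rule e.M.gsub_graded(1)[OF gk])
  let ?\<alpha> = "\<lambda>m b. if b then e m else m \<ominus>\<^bsub>M\<^esub> e m"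
  let ?D = "dsum_gmodule UNIV (\<lambda>b. if b then G else H)"
  have k: "m \<ominus>\<^bsub>M\<^esub> e m \<in> {m \<in> carrier M. e m = \<zero>\<^bsub>M\<^esub>}" if m: "m \<in> carrier M" for m
  proof -
    have em: "e m \<in> carrier M" by (rule e.closed[OF m])
    have "e (m \<ominus>\<^bsub>M\<^esub> e m) = \<zero>\<^bsub>M\<^esub>"
      using e.diff[OF m em] idem[OF m] e.M.M.diff_zero_iff[OF em em] by simp
    thus ?thesis using e.M.M.diff_closed[OF m em] by simp
  qed
  have \<alpha>c: "?\<alpha> m \<in> carrier ?D" if m: "m \<in> carrier M" for m
    using k[OF m] m by (auto simp: G_def H_def PiE_iff)
  have hom: "?\<alpha> \<in> gmod_hom d M ?D"
  proof (rule gmod_homI[OF \<alpha>c])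
    show "?\<alpha> (x \<oplus>\<^bsub>M\<^esub> y) = ?\<alpha> x \<oplus>\<^bsub>?D\<^esub> ?\<alpha> y" if x: "x \<in> carrier M" and y: "y \<in> carrier M" for x y
      using e.add[OF x y] e.M.M.diff_add_diff[OF x y e.closed[OF x] e.closed[OF y]]
      by (auto simp: fun_eq_iff G_def H_def)
    show "?\<alpha> (a \<odot>\<^bsub>M\<^esub> x) = a \<odot>\<^bsub>?D\<^esub> ?\<alpha> x" if a: "a \<in> carrier (sym_alg d)" and x: "x \<in> carrier M" for a x
    proof -
      have "a \<odot>\<^bsub>M\<^esub> x \<ominus>\<^bsub>M\<^esub> a \<odot>\<^bsub>M\<^esub> e x = a \<odot>\<^bsub>M\<^esub> (x \<ominus>\<^bsub>M\<^esub> e x)"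
        using a x e.closed[OF x] by (simp add: a_minus_def e.M.smult_r_distr e.M.smult_r_minus)
      thus ?thesis using e.smult[OF a x] by (auto simp: fun_eq_iff G_def H_def)
    qed
    show "?\<alpha> x \<in> hcomp ?D n" if x: "x \<in> hcomp M n" for x n
    proof -
      have xc: "x \<in> carrier M" using x by (rule e.M.hcomp_closed)
      have "x \<ominus>\<^bsub>M\<^esub> e x \<in> hcomp M n"
        unfolding a_minus_def by (intro e.M.hcomp_closed(3,4) x e.hcomp)
      thus ?thesis using e.hcomp[OF x] k[OF xc] xc by (auto simp: G_def H_def PiE_iff)
    qed
  qed
  have "bij_betw ?\<alpha> (carrier M) (carrier ?D)"
  proof (rule bij_betw_byWitness[where f' = "\<lambda>t. t True \<oplus>\<^bsub>M\<^esub> t False"])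
    show "\<forall>m\<in>carrier M. ?\<alpha> m True \<oplus>\<^bsub>M\<^esub> ?\<alpha> m False = m"
      using e.M.M.add_diff_self e.closed by simp
    show "\<forall>t\<in>carrier ?D. ?\<alpha> (t True \<oplus>\<^bsub>M\<^esub> t False) = t"
    proof
      fix t assume t: "t \<in> carrier ?D"
      have "t True \<in> carrier G" "t False \<in> carrier H"
        using t PiE_mem[of t UNIV "\<lambda>b. carrier (if b then G else H)" True]
          PiE_mem[of t UNIV "\<lambda>b. carrier (if b then G else H)" False] by simp_all
      then obtain u where u: "u \<in> carrier M" "t True = e u" and tF: "t False \<in> carrier M" "e (t False) = \<zero>\<^bsub>M\<^esub>"
        by (auto simp: G_def H_def)
      have tT: "t True \<in> carrier M" "e (t True) = t True" using u e.closed idem by auto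
      have "e (t True \<oplus>\<^bsub>M\<^esub> t False) = t True" using e.add[OF tT(1) tF(1)] tT tF by simp
      moreover have "(t True \<oplus>\<^bsub>M\<^esub> t False) \<ominus>\<^bsub>M\<^esub> t True = t False"
        using e.M.M.diff_add_self[OF tF(1) tT(1)] e.M.M.a_comm[OF tF(1) tT(1)] by simp
      ultimately show "?\<alpha> (t True \<oplus>\<^bsub>M\<^esub> t False) = t" by (simp add: fun_eq_iff)
    qed
    show "?\<alpha> ` carrier M \<subseteq> carrier ?D" using \<alpha>c by blast
    show "(\<lambda>t. t True \<oplus>\<^bsub>M\<^esub> t False) ` carrier ?D \<subseteq> carrier M"
    proof (rule image_subsetI)
      fix t assume t: "t \<in> carrier ?D"
      have "t True \<in> carrier G" "t False \<in> carrier H"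
        using t PiE_mem[of t UNIV "\<lambda>b. carrier (if b then G else H)" True]
          PiE_mem[of t UNIV "\<lambda>b. carrier (if b then G else H)" False] by simp_all
      hence "t True \<in> e ` carrier M" and tF: "t False \<in> carrier M" by (simp_all add: G_def H_def)
      hence "t True \<in> carrier M" by (elim imageE) (simp add: e.closed)
      thus "t True \<oplus>\<^bsub>M\<^esub> t False \<in> carrier M" using tF by (rule e.M.M.add.m_closed)
    qed
  qed
  thus "?\<alpha> \<in> gmod_iso d M ?D" using hom by (simp add: gmod_iso_def)
qed

text \<open>Image and kernel of an idempotent endomorphism are sheaves whose sum is
  \<open>N\<close>, so one of them vanishes and the endomorphism is zero or the identity on all
  stalks.\<close>

lemma indecomposable_idempotent:
  fixes N :: "('v, 'e, 'n, 'k) gsheaf"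
  assumes N: "graph_sheaf \<Gamma> N" and ind: "indecomposable \<Gamma> N"
    and e: "\<And>x. x \<in> verts \<Gamma> \<Longrightarrow> e x \<in> gmod_hom d (vmod N x) (vmod N x)"
    and e2: "\<And>x m. x \<in> verts \<Gamma> \<Longrightarrow> m \<in> carrier (vmod N x) \<Longrightarrow> e x (e x m) = e x m"
    and \<epsilon>: "\<And>L. L \<in> edges \<Gamma> \<Longrightarrow> \<epsilon> L \<in> gmod_hom d (emod N L) (emod N L)"
    and \<epsilon>2: "\<And>L m. L \<in> edges \<Gamma> \<Longrightarrow> m \<in> carrier (emod N L) \<Longrightarrow> \<epsilon> L (\<epsilon> L m) = \<epsilon> L m"
    and comm: "\<And>x L m. L \<in> edges \<Gamma> \<Longrightarrow> x = up L \<or> x = lo L \<Longrightarrow> m \<in> carrier (vmod N x) \<Longrightarrow>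
       \<epsilon> L (res N x L m) = res N x L (e x m)"
  shows "(\<forall>x\<in>verts \<Gamma>. \<forall>m\<in>carrier (vmod N x). e x m = \<zero>\<^bsub>vmod N x\<^esub>) \<or>
    (\<forall>x\<in>verts \<Gamma>. \<forall>m\<in>carrier (vmod N x). e x m = m)"
proof -
  define G :: "('v, 'e, 'n, 'k) gsheaf" where
    "G = \<lparr>vmod = (\<lambda>x. sub_gmodule (e x ` carrier (vmod N x)) (vmod N x)),
          emod = (\<lambda>L. sub_gmodule (\<epsilon> L ` carrier (emod N L)) (emod N L)), res = res N\<rparr>"
  define H :: "('v, 'e, 'n, 'k) gsheaf" where
    "H = \<lparr>vmod = (\<lambda>x. sub_gmodule {m \<in> carrier (vmod N x). e x m = \<zero>\<^bsub>vmod N x\<^esub>} (vmod N x)),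
          emod = (\<lambda>L. sub_gmodule {m \<in> carrier (emod N L). \<epsilon> L m = \<zero>\<^bsub>emod N L\<^esub>} (emod N L)), res = res N\<rparr>"
  have gv: "graded_module d (vmod N x)" if "x \<in> verts \<Gamma>" for x by (rule graph_sheafD(1)[OF N that])
  have gL: "graded_module d (emod N L)" if "L \<in> edges \<Gamma>" for L by (rule graph_sheafD(2)[OF N that])
  have he: "ghom d (vmod N x) (vmod N x) (e x)" if "x \<in> verts \<Gamma>" for x
    by (rule ghomI[OF gv[OF that] gv[OF that] e[OF that]])
  have h\<epsilon>: "ghom d (emod N L) (emod N L) (\<epsilon> L)" if "L \<in> edges \<Gamma>" for L
    by (rule ghomI[OF gL[OF that] gL[OF that] \<epsilon>[OF that]])
  have re: "ghom d (vmod N x) (emod N L) (res N x L)" if L: "L \<in> edges \<Gamma>" and x: "x = up L \<or> x = lo L" for x L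
    using x ghomI[OF gv[OF e_ends(1)[OF L]] gL[OF L] graph_sheafD(3)[OF N L]]
      ghomI[OF gv[OF e_ends(2)[OF L]] gL[OF L] graph_sheafD(4)[OF N L]] by blast
  have xV: "x \<in> verts \<Gamma>" if "L \<in> edges \<Gamma>" "x = up L \<or> x = lo L" for x L
    using e_ends(1,2)[OF that(1)] that(2) by blast
  have rG: "res G x L \<in> gmod_hom d (vmod G x) (emod G L)" and rH: "res H x L \<in> gmod_hom d (vmod H x) (emod H L)"
    if L: "L \<in> edges \<Gamma>" and x: "x = up L \<or> x = lo L" for x L
  proof -
    interpret r: ghom d "vmod N x" "emod N L" "res N x L" by (rule re[OF L x])
    interpret ex: ghom d "vmod N x" "vmod N x" "e x" by (rule he[OF xV[OF L x]])
    have inG: "res N x L a \<in> \<epsilon> L ` carrier (emod N L)" if "a \<in> e x ` carrier (vmod N x)" for a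
    proof -
      from that obtain m where m: "m \<in> carrier (vmod N x)" "a = e x m" by blast
      show ?thesis using comm[OF L x m(1)] r.closed[OF m(1)] m(2) by (metis imageI)
    qed
    show "res G x L \<in> gmod_hom d (vmod G x) (emod G L)"
    proof (rule gmod_homI; simp only: G_def gsheaf.simps sub_gmodule_simps)
      fix a b assume a: "a \<in> e x ` carrier (vmod N x)"
      show "res N x L a \<in> \<epsilon> L ` carrier (emod N L)" by (rule inG[OF a])
      have ac: "a \<in> carrier (vmod N x)" using a ex.closed by blast
      show "res N x L (a \<oplus>\<^bsub>vmod N x\<^esub> b) = res N x L a \<oplus>\<^bsub>emod N L\<^esub> res N x L b"
        if "b \<in> e x ` carrier (vmod N x)"
        using r.add[OF ac, of b] that ex.closed by blast
      show "res N x L (c \<odot>\<^bsub>vmod N x\<^esub> a) = c \<odot>\<^bsub>emod N L\<^esub> res N x L a" if "c \<in> carrier (sym_alg d)" for c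
        by (rule r.smult[OF that ac])
    next
      fix n a assume "a \<in> hcomp (vmod N x) n \<inter> e x ` carrier (vmod N x)"
      thus "res N x L a \<in> hcomp (emod N L) n \<inter> \<epsilon> L ` carrier (emod N L)" using inG r.hcomp by blast
    qed
    have inH: "\<epsilon> L (res N x L a) = \<zero>\<^bsub>emod N L\<^esub>" if "a \<in> carrier (vmod N x)" "e x a = \<zero>\<^bsub>vmod N x\<^esub>" for a
      using comm[OF L x that(1)] that(2) r.zero by simp
    show "res H x L \<in> gmod_hom d (vmod H x) (emod H L)"
      by (rule gmod_homI; simp add: H_def inH r.closed r.add r.smult r.hcomp)
  qed
  have zero_sub: "v \<odot>\<^bsub>emod N L\<^esub> m = \<zero>\<^bsub>emod N L\<^esub>" if "L \<in> edges \<Gamma>" "v \<in> dir \<Gamma> L" "m \<in> carrier (emod N L)" for L v m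
    using N that by (simp add: graph_sheaf_def)
  have G: "graph_sheaf \<Gamma> G"
  proof (rule graph_sheafI)
    show "graded_module d (vmod G x)" if "x \<in> verts \<Gamma>" for x
      unfolding G_def using split_module(1)[OF gv[OF that] e[OF that] e2[OF that]] by simp
    fix L assume L: "L \<in> edges \<Gamma>"
    show "graded_module d (emod G L)"
      unfolding G_def using split_module(1)[OF gL[OF L] \<epsilon>[OF L] \<epsilon>2[OF L]] by simp
    show "v \<odot>\<^bsub>emod G L\<^esub> m = \<zero>\<^bsub>emod G L\<^esub>" if "v \<in> dir \<Gamma> L" "m \<in> carrier (emod G L)" for v m
    proof -
      have "m \<in> carrier (emod N L)" using that(2) ghom.closed[OF h\<epsilon>[OF L]] by (auto simp: G_def)
      thus ?thesis using zero_sub[OF L that(1)] by (simp add: G_def)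
    qed
    show "res G (up L) L \<in> gmod_hom d (vmod G (up L)) (emod G L)"
      "res G (lo L) L \<in> gmod_hom d (vmod G (lo L)) (emod G L)" by (rule rG[OF L]; simp)+
  qed
  have H: "graph_sheaf \<Gamma> H"
  proof (rule graph_sheafI)
    show "graded_module d (vmod H x)" if "x \<in> verts \<Gamma>" for x
      unfolding H_def using split_module(2)[OF gv[OF that] e[OF that] e2[OF that]] by simp
    fix L assume L: "L \<in> edges \<Gamma>"
    show "graded_module d (emod H L)"
      unfolding H_def using split_module(2)[OF gL[OF L] \<epsilon>[OF L] \<epsilon>2[OF L]] by simp
    show "v \<odot>\<^bsub>emod H L\<^esub> m = \<zero>\<^bsub>emod H L\<^esub>" if "v \<in> dir \<Gamma> L" "m \<in> carrier (emod H L)" for v m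
      using zero_sub[OF L that(1)] that(2) by (simp add: H_def)
    show "res H (up L) L \<in> gmod_hom d (vmod H (up L)) (emod H L)"
      "res H (lo L) L \<in> gmod_hom d (vmod H (lo L)) (emod H L)" by (rule rH[OF L]; simp)+
  qed
  let ?S = "dsum_gsheaf UNIV (\<lambda>b. if b then G else H)"
  let ?f = "\<lambda>x m b. if b then e x m else m \<ominus>\<^bsub>vmod N x\<^esub> e x m"
  let ?g = "\<lambda>L m b. if b then \<epsilon> L m else m \<ominus>\<^bsub>emod N L\<^esub> \<epsilon> L m"
  have vS: "vmod ?S x = dsum_gmodule UNIV (\<lambda>b. if b then sub_gmodule (e x ` carrier (vmod N x)) (vmod N x)
      else sub_gmodule {m \<in> carrier (vmod N x). e x m = \<zero>\<^bsub>vmod N x\<^esub>} (vmod N x))" for x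
    unfolding dsum_gsheaf_simps by (rule dsum_gmodule_cong) (simp add: G_def H_def)
  have eS: "emod ?S L = dsum_gmodule UNIV (\<lambda>b. if b then sub_gmodule (\<epsilon> L ` carrier (emod N L)) (emod N L)
      else sub_gmodule {m \<in> carrier (emod N L). \<epsilon> L m = \<zero>\<^bsub>emod N L\<^esub>} (emod N L))" for L
    unfolding dsum_gsheaf_simps by (rule dsum_gmodule_cong) (simp add: G_def H_def)
  have c: "?g L (res N x L m) = res ?S x L (?f x m)"
    if L: "L \<in> edges \<Gamma>" and x: "x = up L \<or> x = lo L" and m: "m \<in> carrier (vmod N x)" for x L m
  proof
    fix b
    have "res N x L (m \<ominus>\<^bsub>vmod N x\<^esub> e x m) = res N x L m \<ominus>\<^bsub>emod N L\<^esub> res N x L (e x m)"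
      by (rule ghom.diff[OF re[OF L x] m ghom.closed[OF he[OF xV[OF L x]] m]])
    thus "?g L (res N x L m) b = res ?S x L (?f x m) b"
      using comm[OF L x m] by (cases b) (simp_all add: G_def H_def)
  qed
  have "piso (verts \<Gamma>) N ?S ?f ?g"
    unfolding piso_def
  proof (intro conjI ballI impI)
    show "?f x \<in> gmod_iso d (vmod N x) (vmod ?S x)" if "x \<in> verts \<Gamma>" for x
      unfolding vS by (rule split_module(3)[OF gv[OF that] e[OF that] e2[OF that]])
    fix L assume L: "L \<in> edges \<Gamma>"
    show "?g L \<in> gmod_iso d (emod N L) (emod ?S L)"
      unfolding eS by (rule split_module(3)[OF gL[OF L] \<epsilon>[OF L] \<epsilon>2[OF L]])
    show "?g L (res N (up L) L m) = res ?S (up L) L (?f (up L) m)" if "m \<in> carrier (vmod N (up L))" for m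
      by (rule c[OF L _ that]) simp
    show "?g L (res N (lo L) L m) = res ?S (lo L) L (?f (lo L) m)" if "m \<in> carrier (vmod N (lo L))" for m
      by (rule c[OF L _ that]) simp
  qed
  hence "gsheaf_iso \<Gamma> N ?S" unfolding piso_gsheaf_iso by (intro exI)
  hence "zero_gsheaf \<Gamma> G \<or> zero_gsheaf \<Gamma> H"
    using ind G H unfolding indecomposable_def by blast
  thus ?thesis
  proof
    assume z: "zero_gsheaf \<Gamma> G"
    have "e x m = \<zero>\<^bsub>vmod N x\<^esub>" if "x \<in> verts \<Gamma>" "m \<in> carrier (vmod N x)" for x m
      using z that by (auto simp: zero_gsheaf_def zero_gmodule_def G_def)
    thus ?thesis by blast
  next
    assume z: "zero_gsheaf \<Gamma> H"
    have "e x m = m" if x: "x \<in> verts \<Gamma>" and m: "m \<in> carrier (vmod N x)" for x m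
    proof -
      interpret ex: ghom d "vmod N x" "vmod N x" "e x" by (rule he[OF x])
      have em: "e x m \<in> carrier (vmod N x)" by (rule ex.closed[OF m])
      have D: "m \<ominus>\<^bsub>vmod N x\<^esub> e x m \<in> carrier (vmod N x)" by (rule ex.M.M.diff_closed[OF m em])
      have "e x (m \<ominus>\<^bsub>vmod N x\<^esub> e x m) = \<zero>\<^bsub>vmod N x\<^esub>"
        using ex.diff[OF m em] e2[OF x m] ex.M.M.diff_zero_iff[OF em em] by simp
      hence "m \<ominus>\<^bsub>vmod N x\<^esub> e x m = \<zero>\<^bsub>vmod N x\<^esub>"
        using z x D by (auto simp: zero_gsheaf_def zero_gmodule_def H_def)
      thus ?thesis using ex.M.M.diff_zero_iff[OF m em] by simp
    qed
    thus ?thesis by blast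
  qed
qed

end

section \<open>Uniqueness\<close>

lemma sym_alg_hcomp_nonneg:
  assumes "p \<in> hcomp (sym_alg d) n" "p \<noteq> 0"
  shows "0 \<le> n"
proof -
  obtain m where "m \<in> Poly_Mapping.keys p" using assms(2) keys_eq_empty by blast
  hence "2 * int (\<Sum>i\<in>Poly_Mapping.keys m. Poly_Mapping.lookup m i) = n"
    using assms(1) by (simp add: sym_alg_def del: of_nat_sum)
  thus ?thesis by linarith
qed

context moment
begin

text \<open>The summands of the given decomposition live over other carrier types than
  \<open>N\<close>, so indecomposability cannot be applied to them directly. Instead the projection
  to summand \<open>i\<close> is transported to an idempotent of \<open>N\<close>: being zero is
  excluded by the nonzero stalk at \<open>w\<close>, and being the identity kills all other
  summands.\<close>

lemma indecomposable_summand: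
  fixes S :: "'i \<Rightarrow> ('v, 'e, 'm, 'l) gsheaf" and N :: "('v, 'e, 'n, 'k) gsheaf"
  assumes N: "graph_sheaf \<Gamma> N" and ind: "indecomposable \<Gamma> N" and J: "finite J"
    and S: "\<And>j. j \<in> J \<Longrightarrow> graph_sheaf \<Gamma> (S j)"
    and p: "piso (verts \<Gamma>) N (dsum_gsheaf J S) f g"
    and i: "i \<in> J" "w \<in> verts \<Gamma>" "\<not> zero_gmodule (vmod (S i) w)"
    and j: "j \<in> J" "j \<noteq> i" and x: "x \<in> verts \<Gamma>"
  shows "zero_gmodule (vmod (S j) x)"
proof -
  let ?V = "\<lambda>x i. vmod (S i) x" and ?E = "\<lambda>L i. emod (S i) L"
  have V: "gfam d J (?V x)" if "x \<in> verts \<Gamma>" for x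
    by (rule gfam_const[OF J]) (rule graph_sheafD(1)[OF S that])
  have E: "gfam d J (?E L)" if "L \<in> edges \<Gamma>" for L
    by (rule gfam_const[OF J]) (rule graph_sheafD(2)[OF S that])
  have f: "f x \<in> gmod_iso d (vmod N x) (dsum_gmodule J (?V x))" if "x \<in> verts \<Gamma>" for x
    using pisoD(1)[OF p that] by simp
  have g: "g L \<in> gmod_iso d (emod N L) (dsum_gmodule J (?E L))" if "L \<in> edges \<Gamma>" for L
    using pisoD(2)[OF p that e_ends(1)[OF that]] by simp
  note fi = gmod_iso_inv[OF graph_sheafD(1)[OF N] gfam.graded_dsum(1)[OF V] f]
    and gi = gmod_iso_inv[OF graph_sheafD(2)[OF N] gfam.graded_dsum(1)[OF E] g]
  \<comment> \<open>The projection to the summand \<open>i\<close>, conjugated by the isomorphism;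
    \<open>\<epsilon>\<close> is its counterpart on edges.\<close>
  define e where "e x m = inv_into (carrier (vmod N x)) (f x) (dinj J (?V x) i (f x m i))" for x m
  define \<epsilon> where "\<epsilon> L m = inv_into (carrier (emod N L)) (g L) (dinj J (?E L) i (g L m i))" for L m
  have fe: "f x (e x m) = dinj J (?V x) i (f x m i)"
    and ec: "e x m \<in> carrier (vmod N x)" if xx: "x \<in> verts \<Gamma>" and m: "m \<in> carrier (vmod N x)" for x m
  proof -
    have c: "dinj J (?V x) i (f x m i) \<in> carrier (dsum_gmodule J (?V x))"
      by (intro gmod_homD(1)[OF gfam.dinj_hom[OF V[OF xx] i(1)]] gmod_homD(1)[OF gfam.proj_hom[OF V[OF xx] i(1)]]
          gmod_homD(1)[OF gmod_isoD(1)[OF f[OF xx]]] m)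
    show "f x (e x m) = dinj J (?V x) i (f x m i)"
      unfolding e_def by (rule bij_betw_inv_into_right[OF gmod_isoD(2)[OF f[OF xx]] c])
    show "e x m \<in> carrier (vmod N x)"
      unfolding e_def by (rule gmod_homD(1)[OF gmod_isoD(1)[OF fi[OF xx xx xx]] c])
  qed
  have ge: "g L (\<epsilon> L m) = dinj J (?E L) i (g L m i)"
    if L: "L \<in> edges \<Gamma>" and m: "m \<in> carrier (emod N L)" for L m
  proof -
    have c: "dinj J (?E L) i (g L m i) \<in> carrier (dsum_gmodule J (?E L))"
      by (intro gmod_homD(1)[OF gfam.dinj_hom[OF E[OF L] i(1)]] gmod_homD(1)[OF gfam.proj_hom[OF E[OF L] i(1)]]
          gmod_homD(1)[OF gmod_isoD(1)[OF g[OF L]]] m)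
    show ?thesis
      unfolding \<epsilon>_def by (rule bij_betw_inv_into_right[OF gmod_isoD(2)[OF g[OF L]] c])
  qed
  have dd: "dinj J M i v i = v" for M :: "'i \<Rightarrow> (cpoly, 'z) gmodule" and v using i(1) by (simp add: dinj_def)
  have "(\<forall>x\<in>verts \<Gamma>. \<forall>m\<in>carrier (vmod N x). e x m = \<zero>\<^bsub>vmod N x\<^esub>) \<or>
    (\<forall>x\<in>verts \<Gamma>. \<forall>m\<in>carrier (vmod N x). e x m = m)"
  proof (rule indecomposable_idempotent[OF N ind, where e = e and \<epsilon> = \<epsilon>])
    show "e x \<in> gmod_hom d (vmod N x) (vmod N x)" if xx: "x \<in> verts \<Gamma>" for x
      unfolding e_def
      by (rule gmod_hom_comp[OF gmod_hom_comp[OF gmod_hom_comp[OF gmod_isoD(1)[OF f[OF xx]]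
              gfam.proj_hom[OF V[OF xx] i(1)]] gfam.dinj_hom[OF V[OF xx] i(1)]] gmod_isoD(1)[OF fi[OF xx xx xx]]])
    show "\<epsilon> L \<in> gmod_hom d (emod N L) (emod N L)" if L: "L \<in> edges \<Gamma>" for L
      unfolding \<epsilon>_def
      by (rule gmod_hom_comp[OF gmod_hom_comp[OF gmod_hom_comp[OF gmod_isoD(1)[OF g[OF L]]
              gfam.proj_hom[OF E[OF L] i(1)]] gfam.dinj_hom[OF E[OF L] i(1)]] gmod_isoD(1)[OF gi[OF L L L]]])
    show "e x (e x m) = e x m" if "x \<in> verts \<Gamma>" "m \<in> carrier (vmod N x)" for x m
      unfolding e_def[of x "e x m"] fe[OF that] dd by (simp only: e_def)
    show "\<epsilon> L (\<epsilon> L m) = \<epsilon> L m" if "L \<in> edges \<Gamma>" "m \<in> carrier (emod N L)" for L m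
      unfolding \<epsilon>_def[of L "\<epsilon> L m"] ge[OF that] dd by (simp only: \<epsilon>_def)
    show "\<epsilon> L (res N x L m) = res N x L (e x m)"
      if L: "L \<in> edges \<Gamma>" and xx: "x = up L \<or> x = lo L" and m: "m \<in> carrier (vmod N x)" for x L m
    proof -
      have xV: "x \<in> verts \<Gamma>" using xx e_ends[OF L] by blast
      have rN: "res N x L \<in> gmod_hom d (vmod N x) (emod N L)"
        using xx graph_sheafD(3,4)[OF N L] by blast
      have rS: "res (S j) x L \<in> gmod_hom d (?V x j) (?E L j)" if "j \<in> J" for j
        using xx graph_sheafD(3,4)[OF S[OF that] L] by blast
      have rz: "res (S j) x L \<zero>\<^bsub>?V x j\<^esub> = \<zero>\<^bsub>?E L j\<^esub>" if "j \<in> J" for j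
        by (rule ghom.zero[OF ghomI[OF graph_sheafD(1)[OF S[OF that] xV] graph_sheafD(2)[OF S[OF that] L] rS[OF that]]])
      have c: "g L (res N x L m) = (\<lambda>j\<in>J. res (S j) x L (f x m j))" if "m \<in> carrier (vmod N x)" for m
        using xx pisoD(3)[OF p L e_ends(1)[OF L]] pisoD(4)[OF p L e_ends(1,2)[OF L]] that by auto
      have "g L (res N x L (e x m)) = dinj J (?E L) i (g L (res N x L m) i)"
        unfolding c[OF ec[OF xV m]] c[OF m] fe[OF xV m]
        by (rule ext) (use i(1) rz in \<open>auto simp: dinj_def\<close>)
      hence "\<epsilon> L (res N x L m) = inv_into (carrier (emod N L)) (g L) (g L (res N x L (e x m)))"
        by (simp add: \<epsilon>_def)
      thus ?thesis
        using bij_betw_inv_into_left[OF gmod_isoD(2)[OF g[OF L]] gmod_homD(1)[OF rN ec[OF xV m]]] by simp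
    qed
  qed
  thus ?thesis
  proof
    assume z: "\<forall>x\<in>verts \<Gamma>. \<forall>m\<in>carrier (vmod N x). e x m = \<zero>\<^bsub>vmod N x\<^esub>"
    have "v = \<zero>\<^bsub>?V w i\<^esub>" if v: "v \<in> carrier (?V w i)" for v
    proof -
      interpret F: ghom d "vmod N w" "dsum_gmodule J (?V w)" "f w"
        by (rule ghomI[OF graph_sheafD(1)[OF N i(2)] gfam.graded_dsum(1)[OF V[OF i(2)]] gmod_isoD(1)[OF f[OF i(2)]]])
      obtain m where m: "m \<in> carrier (vmod N w)" "f w m = dinj J (?V w) i v"
        using gmod_iso_surjD[OF f[OF i(2)] gmod_homD(1)[OF gfam.dinj_hom[OF V[OF i(2)] i(1)] v]] by blast
      have "dinj J (?V w) i v = f w \<zero>\<^bsub>vmod N w\<^esub>"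
        using fe[OF i(2) m(1)] z i(2) m by (simp add: dd)
      hence "dinj J (?V w) i v i = \<zero>\<^bsub>?V w i\<^esub>" using F.zero i(1) by simp
      thus ?thesis by (simp add: dd)
    qed
    hence "zero_gmodule (?V w i)" by (rule gmod.zero_gmoduleI[OF gfam.gm[OF V[OF i(2)] i(1)]])
    thus ?thesis using i(3) by contradiction
  next
    assume id: "\<forall>x\<in>verts \<Gamma>. \<forall>m\<in>carrier (vmod N x). e x m = m"
    show ?thesis
    proof (rule gmod.zero_gmoduleI[OF gfam.gm[OF V[OF x] j(1)]])
      fix v assume v: "v \<in> carrier (?V x j)"
      obtain m where m: "m \<in> carrier (vmod N x)" "f x m = dinj J (?V x) j v"
        using gmod_iso_surjD[OF f[OF x] gmod_homD(1)[OF gfam.dinj_hom[OF V[OF x] j(1)] v]] by blast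
      have "dinj J (?V x) j v j = dinj J (?V x) i (f x m i) j"
        using fe[OF x m(1)] id x m by simp
      thus "v = \<zero>\<^bsub>?V x j\<^esub>" using j by (simp add: dinj_def)
    qed
  qed
qed

text \<open>In the decomposition of \<open>N\<close> only one summand survives; it is nonzero at the
  top vertex, which fixes its support, and the degrees of the generators fix its shift. The one-term
  sum is kept in the conclusion because it serves only as a common reference for comparing two
  sheaves.\<close>

lemma pure_unique:
  fixes K :: "'v \<Rightarrow> ('v, 'e, 'm, 'l) gsheaf" and N :: "('v, 'e, 'n, 'k) gsheaf"
  assumes x0: "x0 \<in> verts \<Gamma>" and top: "\<And>y. y \<in> verts \<Gamma> \<Longrightarrow> vle \<Gamma> y x0"
    and K: "\<And>x. x \<in> verts \<Gamma> \<Longrightarrow> min_pure x (K x)"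
    and N: "pure_sheaf \<Gamma> N" and ind: "indecomposable \<Gamma> N" and ne: "gmod_iso d (vmod N x0) (sym_alg d) \<noteq> {}"
  shows "gsheaf_iso \<Gamma> N (dsum_gsheaf {..<1::nat} (\<lambda>i. shift_gsheaf 0 (K x0)))"
proof -
  note Ng = pure_sheafD(1)[OF N]
  have "\<exists>(n :: nat) xs ks. (\<forall>i<n. xs i \<in> verts \<Gamma>) \<and>
    gsheaf_iso \<Gamma> N (dsum_gsheaf {..<n} (\<lambda>i. shift_gsheaf (ks i) (K (xs i))))"
    by (rule pure_structure[OF K N])
  then obtain n :: nat and xs ks where xs: "\<forall>i<n. xs i \<in> verts \<Gamma>"
    and iso: "gsheaf_iso \<Gamma> N (dsum_gsheaf {..<n} (\<lambda>i. shift_gsheaf (ks i) (K (xs i))))"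
    by (elim exE conjE)
  define S where "S i = shift_gsheaf (ks i) (K (xs i))" for i
  have KG: "graph_sheaf \<Gamma> (K x)" if "x \<in> verts \<Gamma>" for x using K[OF that] by (simp add: min_pure_def)
  have S: "graph_sheaf \<Gamma> (S i)" if "i \<in> {..<n}" for i
    unfolding S_def by (rule shift_graph_sheaf[OF KG]) (use xs that in simp)
  obtain f g where p: "piso (verts \<Gamma>) N (dsum_gsheaf {..<n} S) f g"
    using iso unfolding S_def[symmetric] piso_gsheaf_iso by (elim exE)
  obtain \<psi> where \<psi>: "\<psi> \<in> gmod_iso d (vmod N x0) (sym_alg d)" using ne by blast
  have N0: "graded_module d (vmod N x0)" by (rule graph_sheafD(1)[OF Ng x0])
  obtain e where e: "e \<in> hcomp (vmod N x0) 0" "e \<noteq> \<zero>\<^bsub>vmod N x0\<^esub>"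
    using iso_sym_alg_generator[OF N0 \<psi>] by metis
  interpret V: gfam d "{..<n}" "\<lambda>i. vmod (S i) x0"
    by (rule gfam_const) (use graph_sheafD(1)[OF S x0] in auto)
  have f0: "f x0 \<in> gmod_iso d (vmod N x0) V.D" using pisoD(1)[OF p x0] by simp
  interpret F: ghom d "vmod N x0" V.D "f x0" by (rule ghomI[OF N0 V.graded_dsum(1) gmod_isoD(1)[OF f0]])
  have ec: "e \<in> carrier (vmod N x0)" using e(1) by (rule F.M.hcomp_closed)
  have fe: "f x0 e \<in> hcomp V.D 0" "f x0 e \<in> carrier V.D" by (rule F.hcomp[OF e(1)], rule F.closed[OF ec])
  have "\<exists>i<n. f x0 e i \<noteq> \<zero>\<^bsub>vmod (S i) x0\<^esub>"
  proof (rule ccontr)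
    assume "\<not> (\<exists>i<n. f x0 e i \<noteq> \<zero>\<^bsub>vmod (S i) x0\<^esub>)"
    hence "f x0 e = \<zero>\<^bsub>V.D\<^esub>" using fe(2) by (intro ext) (auto simp: PiE_iff extensional_def)
    thus False using F.iso_inj[OF f0 ec] e(2) by simp
  qed
  then obtain i where i: "i < n" "f x0 e i \<noteq> \<zero>\<^bsub>vmod (S i) x0\<^esub>" by blast
  have ci: "f x0 e i \<in> carrier (vmod (S i) x0)" using fe(2) i(1) by auto
  have nz: "\<not> zero_gmodule (vmod (S i) x0)"
  proof
    assume "zero_gmodule (vmod (S i) x0)"
    from zero_gmoduleD[OF this ci] show False using i(2) by contradiction
  qed
  \<comment> \<open>A canonical sheaf vanishes at vertices not below its own top vertex, so a
    summand that is nonzero at \<open>x0\<close> has top vertex \<open>x0\<close>.\<close>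
  hence "vle \<Gamma> x0 (xs i)" using K[of "xs i"] xs i(1) x0 by (auto simp: S_def min_pure_def)
  hence xi: "xs i = x0" using vanti[OF x0 _ _ top] xs i(1) by auto
  have "j = i" if j: "j < n" for j
  proof (rule ccontr)
    assume "j \<noteq> i"
    hence "zero_gmodule (vmod (S j) (xs j))"
      using indecomposable_summand[OF Ng ind _ S p, of i x0 j "xs j"] i(1) j x0 nz xs by simp
    thus False using min_pure_nonzero[OF K[of "xs j"]] xs j by (simp add: S_def)
  qed
  from this[of 0] i(1) this[of "n - 1"] have i0: "i = 0" and n1: "n = 1" by auto
  let ?K = "vmod (K x0) x0"
  have Si: "vmod (S i) x0 = shift_gmodule (ks i) ?K" by (simp add: S_def xi)
  have K0: "graded_module d ?K" by (rule graph_sheafD(1)[OF KG[OF x0] x0])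
  obtain \<phi> where \<phi>: "\<phi> \<in> gmod_iso d ?K (sym_alg d)" using K[OF x0] by (auto simp: min_pure_def)
  interpret P: ghom d ?K "sym_alg d" \<phi> by (rule ghomI[OF K0 graded_sym_alg gmod_isoD(1)[OF \<phi>]])
  interpret Q: ghom d "vmod N x0" "sym_alg d" \<psi> by (rule ghomI[OF N0 graded_sym_alg gmod_isoD(1)[OF \<psi>]])
  have z: "\<zero>\<^bsub>sym_alg d\<^esub> = 0" by (simp add: sym_alg_def)
  \<comment> \<open>The generator of the stalk of \<open>N\<close>, of degree 0, yields a nonzero
    element of degree \<open>ks i\<close> in a copy of the ring, whose degrees are
    nonnegative.\<close>
  have "0 \<le> ks i"
  proof (rule sym_alg_hcomp_nonneg)
    have "f x0 e i \<in> hcomp (vmod (S i) x0) 0" using fe(1) i(1) by (auto simp: PiE_iff)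
    hence "f x0 e i \<in> hcomp ?K (ks i)" by (simp add: Si)
    thus "\<phi> (f x0 e i) \<in> hcomp (sym_alg d) (ks i)" by (rule P.hcomp)
    show "\<phi> (f x0 e i) \<noteq> 0" using P.iso_inj[OF \<phi>, of "f x0 e i"] ci i(2) by (auto simp: Si z)
  qed
  moreover obtain u where u: "u \<in> hcomp ?K 0" "u \<noteq> \<zero>\<^bsub>?K\<^esub>"
    using iso_sym_alg_generator[OF K0 \<phi>] by metis
  \<comment> \<open>The converse comparison: the generator of the stalk of \<open>K x0\<close> has
    degree \<open>- ks i\<close> in the shifted sheaf and pulls back to a nonzero element of the
    stalk of \<open>N\<close>.\<close>
  have "0 \<le> - ks i"
  proof (rule sym_alg_hcomp_nonneg)
    have "u \<in> hcomp (vmod (S i) x0) (- ks i)" using u(1) by (simp add: Si)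
    hence D: "dinj {..<n} (\<lambda>i. vmod (S i) x0) i u \<in> hcomp V.D (- ks i)"
      using gmod_homD(4)[OF V.dinj_hom[of i]] i(1) by simp
    let ?m = "inv_into (carrier (vmod N x0)) (f x0) (dinj {..<n} (\<lambda>i. vmod (S i) x0) i u)"
    have m: "?m \<in> hcomp (vmod N x0) (- ks i)"
      by (rule gmod_homD(4)[OF gmod_isoD(1)[OF gmod_iso_inv[OF N0 V.graded_dsum(1) f0]] D])
    thus "\<psi> ?m \<in> hcomp (sym_alg d) (- ks i)" by (rule Q.hcomp)
    have mc: "?m \<in> carrier (vmod N x0)" using m by (rule F.M.hcomp_closed)
    have fm: "f x0 ?m = dinj {..<n} (\<lambda>i. vmod (S i) x0) i u"
      by (rule bij_betw_inv_into_right[OF gmod_isoD(2)[OF f0] F.N.hcomp_closed(1)[OF D]])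
    show "\<psi> ?m \<noteq> 0"
    proof
      assume "\<psi> ?m = 0"
      hence "?m = \<zero>\<^bsub>vmod N x0\<^esub>" using Q.iso_inj[OF \<psi> mc] z by simp
      hence "dinj {..<n} (\<lambda>i. vmod (S i) x0) i u i = \<zero>\<^bsub>V.D\<^esub> i" using fm F.zero by simp
      thus False using u(2) i(1) by (simp add: dinj_def Si)
    qed
  qed
  ultimately have "ks i = 0" by linarith
  hence "dsum_gsheaf {..<n} (\<lambda>i. shift_gsheaf (ks i) (K (xs i))) = dsum_gsheaf {..<1::nat} (\<lambda>i. shift_gsheaf 0 (K x0))"
    unfolding n1 by (intro dsum_gsheaf_cong) (use i0 xi in simp)
  thus ?thesis using iso by simp
qed

end

section \<open>The moment graph of a variety\<close>

lemma peval_one [simp]: "peval z 1 = 1"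
  by (simp add: peval_def)

lemma topspace_zariski:
  assumes "algebraic_variety X"
  shows "topspace (zariski X) = pts X"
proof -
  let ?B = "{{x \<in> cdom c. peval (cmap c x) p \<noteq> 0} | c p. c \<in> charts X}"
  have B: "topspace (zariski X) = \<Union>?B" by (simp only: zariski_def topology_generated_by_topspace)
  have X: "pts X = (\<Union>c\<in>charts X. cdom c)" using assms by (simp add: algebraic_variety_def)
  \<comment> \<open>The constant polynomial 1 exhibits the whole chart domain as a basic open
    set.\<close>
  have chart: "cdom c \<in> ?B" if "c \<in> charts X" for c
    using that by (intro CollectI exI[of _ c] exI[of _ 1]) simp
  have "pts X \<subseteq> topspace (zariski X)" unfolding B X by (intro UN_least Union_upper chart)
  moreover have "\<Union>?B \<subseteq> pts X"
  proof (rule Union_least)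
    fix A assume "A \<in> ?B"
    then obtain c where "c \<in> charts X" "A \<subseteq> cdom c" by auto
    thus "A \<subseteq> pts X" using X by auto
  qed
  ultimately show ?thesis using B by simp
qed

lemma irreducible_in_finite_cover:
  assumes "irreducible_in \<tau> Z" "finite \<F>" "\<And>C. C \<in> \<F> \<Longrightarrow> closedin \<tau> C" "Z \<subseteq> \<Union>\<F>"
  shows "\<exists>C\<in>\<F>. Z \<subseteq> C"
  using assms(2-4)
proof (induction \<F> rule: finite_induct)
  case empty
  thus ?case using assms(1) by (auto simp: irreducible_in_def)
next
  case (insert C \<F>)
  have "closedin \<tau> (\<Union>\<F>)" by (rule closedin_Union) (use insert in auto)
  moreover have "closedin \<tau> C" "Z \<subseteq> C \<union> \<Union>\<F>" using insert by auto
  ultimately have "Z \<subseteq> C \<or> Z \<subseteq> \<Union>\<F>" using assms(1) unfolding irreducible_in_def by blast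
  thus ?case
  proof
    assume "Z \<subseteq> \<Union>\<F>"
    hence "\<exists>C\<in>\<F>. Z \<subseteq> C" using insert.IH insert.prems(1) by simp
    thus ?thesis by simp
  qed simp
qed

lemma stratum_of_eq:
  assumes "partition_on A (strata X)" "S \<in> strata X" "x \<in> S"
  shows "stratum_of X x = S"
  unfolding stratum_of_def
  by (rule the_equality) (use assms disjointD[OF partition_onD2[OF assms(1)]] in auto)

text \<open>\<open>U\<close> is an open neighbourhood of a point in the closure of
  \<open>S'\<close>, so it meets \<open>S'\<close>; and \<open>S'\<close> is contained in the
  closure of \<open>S\<close>, hence in \<open>F\<close>.\<close>

lemma locally_closed_closures_meet:
  assumes "openin \<tau> U" "closedin \<tau> F" "S = U \<inter> F" "S \<noteq> {}"
    and "S \<subseteq> \<tau> closure_of S'" "S' \<subseteq> \<tau> closure_of S"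
  shows "S \<inter> S' \<noteq> {}"
proof -
  obtain s where "s \<in> S" using assms(4) by blast
  hence "s \<in> U" "s \<in> \<tau> closure_of S'" using assms(3,5) by auto
  then obtain y where y: "y \<in> S'" "y \<in> U" using assms(1) by (auto simp: in_closure_of)
  have "\<tau> closure_of S \<subseteq> F" by (rule closure_of_minimal) (use assms(2,3) in auto)
  thus ?thesis using y assms(3,6) by blast
qed

lemma moment_varietyD:
  assumes "moment_variety X"
  shows "topspace (zariski X) = pts X" "partition_on (pts X) (strata X)" "finite (strata X)"
    "irreducible_in (zariski X) (pts X)" "finite (one_dim_orbits X)"
    "S \<in> strata X \<Longrightarrow> \<exists>U F. openin (zariski X) U \<and> closedin (zariski X) F \<and> S = U \<inter> F"
    "S \<in> strata X \<Longrightarrow> \<exists>!x. x \<in> S \<inter> fixed_points X"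
    "S \<in> strata X \<Longrightarrow> x \<in> S \<Longrightarrow> stratum_of X x = S"
    "x \<in> fixed_points X \<Longrightarrow> stratum_of X x \<in> strata X \<and> x \<in> stratum_of X x \<and> stratum_of X x \<subseteq> pts X"
proof -
  have W: "whitney_affine_stratification X" using assms by (simp add: moment_variety_def)
  show "topspace (zariski X) = pts X"
    by (rule topspace_zariski) (use assms in \<open>simp add: moment_variety_def\<close>)
  show part: "partition_on (pts X) (strata X)" using W by (simp add: whitney_affine_stratification_def)
  show "finite (strata X)" using W by (simp add: whitney_affine_stratification_def)
  show "irreducible_in (zariski X) (pts X)" "finite (one_dim_orbits X)"
    using assms by (simp_all add: moment_variety_def)
  show "\<exists>U F. openin (zariski X) U \<and> closedin (zariski X) F \<and> S = U \<inter> F" if "S \<in> strata X"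
    using W that by (simp add: whitney_affine_stratification_def affine_space_stratum_def)
  show "\<exists>!x. x \<in> S \<inter> fixed_points X" if "S \<in> strata X"
    using assms that by (simp add: moment_variety_def)
  show so: "stratum_of X x = S" if "S \<in> strata X" "x \<in> S" for S x
    by (rule stratum_of_eq[OF part that])
  show "stratum_of X x \<in> strata X \<and> x \<in> stratum_of X x \<and> stratum_of X x \<subseteq> pts X" if "x \<in> fixed_points X"
  proof -
    have "x \<in> \<Union>(strata X)" using that partition_onD1[OF part] by (simp add: fixed_points_def)
    then obtain S where "S \<in> strata X" "x \<in> S" by blast
    thus ?thesis using so partition_onD1[OF part] by auto
  qed
qed

lemma moment_graph_simps [simp]:
  "grank (moment_graph X) = trank X" "verts (moment_graph X) = fixed_points X"
  "edges (moment_graph X) = one_dim_orbits X" "ends (moment_graph X) = limit_points X"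
  "vle (moment_graph X) x y \<longleftrightarrow> stratum_of X x \<subseteq> zariski X closure_of (stratum_of X y)"
  by (simp_all add: moment_graph_def)

lemma moment_moment_graph:
  assumes X: "moment_variety X"
  shows "moment (moment_graph X)"
proof
  note D = moment_varietyD[OF X]
  \<comment> \<open>A stratum contains only one fixed point, so vertices inject into the finite set
    of strata. The same injectivity turns equality of strata into equality of vertices for
    antisymmetry.\<close>
  have inj: "inj_on (stratum_of X) (fixed_points X)"
  proof (rule inj_onI)
    fix x y assume xy: "x \<in> fixed_points X" "y \<in> fixed_points X" "stratum_of X x = stratum_of X y"
    thus "x = y" using D(7)[of "stratum_of X x"] D(9)[of x] D(9)[of y] by auto
  qed
  have "stratum_of X ` fixed_points X \<subseteq> strata X" using D(9) by blast
  thus "finite (verts (moment_graph X))" using inj_on_finite[OF inj _ D(3)] by simp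
  show "finite (edges (moment_graph X))" using D(5) by simp
  show "vle (moment_graph X) x x" if "x \<in> verts (moment_graph X)" for x
    using that D(9)[of x] D(1) by (simp add: closure_of_subset)
  show "vle (moment_graph X) x z" if "vle (moment_graph X) x y" "vle (moment_graph X) y z" for x y z
  proof -
    have "zariski X closure_of stratum_of X y \<subseteq> zariski X closure_of stratum_of X z"
      by (rule closure_of_minimal) (use that in auto)
    thus ?thesis using that by auto
  qed
  show "x = y" if xy: "x \<in> verts (moment_graph X)" "y \<in> verts (moment_graph X)"
    "vle (moment_graph X) x y" "vle (moment_graph X) y x" for x y
  proof -
    let ?S = "stratum_of X x" and ?S' = "stratum_of X y"
    have S: "?S \<in> strata X" "x \<in> ?S" "?S' \<in> strata X" using xy D(9) by auto
    obtain U F where "openin (zariski X) U" "closedin (zariski X) F" "?S = U \<inter> F"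
      using D(6)[OF S(1)] by blast
    hence "?S \<inter> ?S' \<noteq> {}" by (rule locally_closed_closures_meet) (use S xy in auto)
    then obtain s where "s \<in> ?S" "s \<in> ?S'" by blast
    hence "?S = ?S'" using D(8)[OF S(1), of s] D(8)[OF S(3), of s] by (simp only:)
    thus ?thesis using inj xy by (auto dest: inj_onD)
  qed
  show "\<exists>x y. is_end (moment_graph X) L x y" if L: "L \<in> edges (moment_graph X)" for L
  proof -
    have "\<exists>x\<in>fixed_points X. \<exists>y\<in>fixed_points X. \<exists>S\<in>strata X. \<exists>S'\<in>strata X.
        x \<noteq> y \<and> limit_points X L = {x, y} \<and> L \<subseteq> S \<and> x \<in> S \<and>
        y \<in> S' \<and> S' \<subseteq> zariski X closure_of S"
      using X L unfolding moment_variety_def by simp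
    then obtain x y S S' where "x \<in> fixed_points X" "y \<in> fixed_points X" "S \<in> strata X" "S' \<in> strata X"
      "x \<noteq> y" "limit_points X L = {x, y}" "x \<in> S" "y \<in> S'" "S' \<subseteq> zariski X closure_of S" by blast
    hence "is_end (moment_graph X) L x y" using D(8) by (simp add: is_end_def)
    thus ?thesis by blast
  qed
  show "dir (moment_graph X) L \<subseteq> tdual (grank (moment_graph X))" for L
    by (auto simp: moment_graph_def)
qed

text \<open>The fixed point of the dense stratum lies above every vertex, so a maximal vertex has to
  coincide with it.\<close>

lemma moment_graph_top:
  assumes X: "moment_variety X" and max: "maximal_vertex (moment_graph X) x0" and y: "y \<in> fixed_points X"
  shows "vle (moment_graph X) y x0"
proof -
  note D = moment_varietyD[OF X]
  have sub: "S \<subseteq> pts X" if "S \<in> strata X" for S using that partition_onD1[OF D(2)] by auto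
  have "pts X \<subseteq> \<Union>((closure_of) (zariski X) ` strata X)"
    using closure_of_subset[of _ "zariski X"] sub unfolding D(1) by (subst partition_onD1[OF D(2)]) blast
  hence "\<exists>C\<in>(closure_of) (zariski X) ` strata X. pts X \<subseteq> C"
    by (intro irreducible_in_finite_cover[OF D(4)]) (use D(3) in auto)
  then obtain S where S: "S \<in> strata X" "pts X \<subseteq> zariski X closure_of S" by blast
  obtain z where z: "z \<in> S" "z \<in> fixed_points X" using D(7)[OF S(1)] by blast
  have zS: "stratum_of X z = S" by (rule D(8)[OF S(1) z(1)])
  have top: "vle (moment_graph X) x z" if "x \<in> fixed_points X" for x
    using D(9)[OF that] S(2) by (auto simp: zS)
  hence "z = x0" using max z(2) by (simp add: maximal_vertex_def)
  thus ?thesis using top[OF y] by simp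
qed

context moment
begin

lemma graph_below_top:
  assumes top: "\<And>y. y \<in> verts \<Gamma> \<Longrightarrow> vle \<Gamma> y x0"
  shows "graph_below \<Gamma> x0 = \<Gamma>"
proof -
  have "{y \<in> verts \<Gamma>. vle \<Gamma> y x0} = verts \<Gamma>" using top by blast
  moreover have "{L \<in> edges \<Gamma>. ends \<Gamma> L \<subseteq> verts \<Gamma>} = edges \<Gamma>" using e_ends by fastforce
  ultimately show ?thesis by (simp add: graph_below_def)
qed

text \<open>The canonical sheaf of the whole graph is the case of the top vertex, so everything
  proved for \<open>canonical_below\<close> applies to it.\<close>

lemma canonical_below_top:
  assumes top: "\<And>y. y \<in> verts \<Gamma> \<Longrightarrow> vle \<Gamma> y x0"
  shows "canonical_below \<Gamma> x0 M = canonical_sheaf \<Gamma> x0 M"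
proof -
  have "graph_below \<Gamma> x0 = \<Gamma>" by (rule graph_below_top[OF top])
  thus ?thesis unfolding canonical_below_def by (auto simp: canonical_sheaf_def simp del: below_simps)
qed

text \<open>\<open>M\<close> and \<open>N\<close> have unrelated carrier types. Both are compared
  with the same constructed sheaf over \<open>nat \<Rightarrow> cpoly\<close>, and the isomorphism
  is obtained by composition.\<close>

lemma pure_indecomposable_iso:
  fixes M :: "('v, 'e, 'm, 'l) gsheaf" and N :: "('v, 'e, 'n, 'k) gsheaf"
  assumes x0: "x0 \<in> verts \<Gamma>" and top: "\<And>y. y \<in> verts \<Gamma> \<Longrightarrow> vle \<Gamma> y x0"
    and M: "pure_sheaf \<Gamma> M" "indecomposable \<Gamma> M" "gmod_iso d (vmod M x0) (sym_alg d) \<noteq> {}"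
    and N: "pure_sheaf \<Gamma> N" "indecomposable \<Gamma> N" "gmod_iso d (vmod N x0) (sym_alg d) \<noteq> {}"
  shows "gsheaf_iso \<Gamma> N M"
proof -
  have "\<forall>x\<in>verts \<Gamma>. \<exists>K :: ('v, 'e, nat \<Rightarrow> cpoly, (nat \<Rightarrow> cpoly) set) gsheaf. min_pure x K"
  proof
    fix x assume x: "x \<in> verts \<Gamma>"
    obtain K :: "('v, 'e, nat \<Rightarrow> cpoly, (nat \<Rightarrow> cpoly) set) gsheaf" where "canonical_below \<Gamma> x K"
      using canonical_below_exists[OF x] by (elim exE)
    from min_pure_of_below[OF x this]
    show "\<exists>K :: ('v, 'e, nat \<Rightarrow> cpoly, (nat \<Rightarrow> cpoly) set) gsheaf. min_pure x K" by (rule exI)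
  qed
  from bchoice[OF this] obtain K :: "'v \<Rightarrow> ('v, 'e, nat \<Rightarrow> cpoly, (nat \<Rightarrow> cpoly) set) gsheaf"
    where K: "\<forall>x\<in>verts \<Gamma>. min_pure x (K x)" by (elim exE)
  let ?S = "dsum_gsheaf {..<1::nat} (\<lambda>i. shift_gsheaf 0 (K x0))"
  have NS: "gsheaf_iso \<Gamma> N ?S" by (rule pure_unique[OF x0 top bspec[OF K] N])
  have MS: "gsheaf_iso \<Gamma> M ?S" by (rule pure_unique[OF x0 top bspec[OF K] M])
  have "graph_sheaf \<Gamma> (K x0)" using bspec[OF K x0] by (simp add: min_pure_def)
  hence "graph_sheaf \<Gamma> ?S" by (intro dsum_graph_sheaf shift_graph_sheaf) simp_all
  from gsheaf_iso_sym[OF pure_sheafD(1)[OF M(1)] this MS] show ?thesis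
    by (rule gsheaf_iso_trans[OF NS])
qed

end

text \<open>Existence is asserted over the concrete carrier types of the construction. The other
  claims range over canonical and pure sheaves with arbitrary carrier types, so that they do not
  depend on the copies, quotients and covers chosen.\<close>

theorem theorem1p4:
  fixes X :: "'x tvariety" and x0 :: 'x and \<Gamma> :: "('x, 'x set) mgraph"
  assumes "moment_variety X"
    and "\<Gamma> = moment_graph X"
    and "maximal_vertex \<Gamma> x0"
  shows
    "(\<exists>M :: ('x, 'x set, nat \<Rightarrow> cpoly, (nat \<Rightarrow> cpoly) set) gsheaf. canonical_sheaf \<Gamma> x0 M) \<and>
     (\<forall>x\<in>verts \<Gamma>. \<exists>K :: ('x, 'x set, nat \<Rightarrow> cpoly, (nat \<Rightarrow> cpoly) set) gsheaf.
        canonical_below \<Gamma> x K) \<and>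
     (\<forall>M :: ('x, 'x set, 'm, 'l) gsheaf. canonical_sheaf \<Gamma> x0 M \<longrightarrow>
        pure_sheaf \<Gamma> M \<and> indecomposable \<Gamma> M \<and>
        gmod_iso (grank \<Gamma>) (vmod M x0) (sym_alg (grank \<Gamma>)) \<noteq> {} \<and>
        (\<forall>N :: ('x, 'x set, 'n, 'k) gsheaf.
           pure_sheaf \<Gamma> N \<and> indecomposable \<Gamma> N \<and>
           gmod_iso (grank \<Gamma>) (vmod N x0) (sym_alg (grank \<Gamma>)) \<noteq> {} \<longrightarrow>
           gsheaf_iso \<Gamma> N M)) \<and>
     (\<forall>(K :: 'x \<Rightarrow> ('x, 'x set, 'm, 'l) gsheaf) (N :: ('x, 'x set, 'n, 'k) gsheaf).
        (\<forall>x\<in>verts \<Gamma>. canonical_below \<Gamma> x (K x)) \<and> pure_sheaf \<Gamma> N \<longrightarrow>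
        (\<exists>(n :: nat) (xs :: nat \<Rightarrow> 'x) (ks :: nat \<Rightarrow> int).
           (\<forall>i<n. xs i \<in> verts \<Gamma>) \<and>
           gsheaf_iso \<Gamma> N (dsum_gsheaf {..<n} (\<lambda>i. shift_gsheaf (ks i) (K (xs i))))))"
proof (intro conjI allI ballI impI)
  have X: "moment_variety X" and \<Gamma>: "\<Gamma> = moment_graph X" and mx: "maximal_vertex \<Gamma> x0" by fact+
  interpret moment \<Gamma> unfolding \<Gamma> by (rule moment_moment_graph[OF X])
  have x0: "x0 \<in> verts \<Gamma>" using mx by (simp add: maximal_vertex_def)
  have top: "vle \<Gamma> y x0" if "y \<in> verts \<Gamma>" for y
    using moment_graph_top[OF X] mx that by (simp add: \<Gamma> del: moment_graph_simps(5))
  show below: "\<exists>K :: ('x, 'x set, nat \<Rightarrow> cpoly, (nat \<Rightarrow> cpoly) set) gsheaf. canonical_below \<Gamma> x K"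
    if "x \<in> verts \<Gamma>" for x by (rule canonical_below_exists[OF that])
  show "\<exists>M :: ('x, 'x set, nat \<Rightarrow> cpoly, (nat \<Rightarrow> cpoly) set) gsheaf. canonical_sheaf \<Gamma> x0 M"
    using below[OF x0] by (simp only: canonical_below_top[OF top])
  {
    fix M :: "('x, 'x set, 'm, 'l) gsheaf" assume M: "canonical_sheaf \<Gamma> x0 M"
    hence m: "min_pure x0 M" by (intro min_pure_of_below[OF x0]) (simp only: canonical_below_top[OF top])
    show p: "pure_sheaf \<Gamma> M" by (rule min_pure_pure[OF m])
    show i: "indecomposable \<Gamma> M" by (rule min_pure_indecomposable[OF top m])
    show ne: "gmod_iso (grank \<Gamma>) (vmod M x0) (sym_alg (grank \<Gamma>)) \<noteq> {}" using m by (simp add: min_pure_def)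
    fix N :: "('x, 'x set, 'n, 'k) gsheaf"
    assume N: "pure_sheaf \<Gamma> N \<and> indecomposable \<Gamma> N \<and>
      gmod_iso (grank \<Gamma>) (vmod N x0) (sym_alg (grank \<Gamma>)) \<noteq> {}"
    show "gsheaf_iso \<Gamma> N M"
      by (rule pure_indecomposable_iso[OF x0 top p i ne conjunct1[OF N]
            conjunct1[OF conjunct2[OF N]] conjunct2[OF conjunct2[OF N]]])
  }
  fix K :: "'x \<Rightarrow> ('x, 'x set, 'm, 'l) gsheaf" and N :: "('x, 'x set, 'n, 'k) gsheaf"
  assume KN: "(\<forall>x\<in>verts \<Gamma>. canonical_below \<Gamma> x (K x)) \<and> pure_sheaf \<Gamma> N"
  have "min_pure x (K x)" if "x \<in> verts \<Gamma>" for x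
    using min_pure_of_below[OF that] KN that by blast
  thus "\<exists>(n :: nat) (xs :: nat \<Rightarrow> 'x) (ks :: nat \<Rightarrow> int). (\<forall>i<n. xs i \<in> verts \<Gamma>) \<and>
      gsheaf_iso \<Gamma> N (dsum_gsheaf {..<n} (\<lambda>i. shift_gsheaf (ks i) (K (xs i))))"
    by (rule pure_structure[OF _ conjunct2[OF KN]])
qed

end
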